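(* Let $\Gamma$ be a Lie group and $X$ a manifold equipped with a smooth $\Gamma$-action. A short exact sequence of $\Gamma$-groups $1 \rightarrow A \xrightarrow{\alpha} B \xrightarrow{\beta} C \rightarrow 1$, where $\alpha(A)$ is central in $B$, induces an exact sequence of pointed sets $$0\rightarrow H^0_\Gamma(X,A)\xrightarrow{\alpha^0}\mathrm{TC}^0_\Gamma(X,B)\xrightarrow{\beta^0}\mathrm{TC}^0_\Gamma(X,C)\xrightarrow{\Delta^0}H^1_\Gamma(X,A)\xrightarrow{\alpha^1}\mathrm{TC}^1_\Gamma(X,B)\xrightarrow{\beta^1}\mathrm{TC}^1_\Gamma(X,C)\xrightarrow{\Delta^1}H^2_\Gamma(X,A),$$ where the connecting maps $\Delta^0$ and $\Delta^1$ are defined by $$\Delta^0([\mu]):=[(\delta_1\eta)^{-1}(\delta_0\eta)],\qquad \Delta^1([\phi]):=[(\delta_1\psi)^{-1}(\delta_2\psi)(\delta_0\psi)],$$ for any $\eta\in K^0_\Gamma(X,B)$ and $\psi\in K^1_\Gamma(X,B)$ satisfying $\beta^0(\eta)=\mu$ and $\beta^1(\psi)=\phi$.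
   Context: **$\Gamma$-groups.** A (smooth) $\Gamma$-group $(G,\theta)$ is a Lie group $G$ with a smooth action $\theta:\Gamma\rightarrow \mathrm{Aut}(G)$ by group automorphisms; write $\gamma g:=\theta_\gamma(g)$. A homomorphism of $\Gamma$-groups is a homomorphism $\varphi$ of Lie groups with $\varphi(\gamma g)=\gamma\varphi(g)$. A short exact sequence of $\Gamma$-groups is a short exact sequence whose maps are homomorphisms of $\Gamma$-groups. The action is often omitted from the notation. **Cochains.** Let $X^p:=\Gamma^p\times X$, with face maps $d_i:X^p\rightarrow X^{p-1}$ given by $d_0(\gamma_1,\ldots,\gamma_p,x)=(\gamma_2,\ldots,\gamma_p,x)$, $d_i(\gamma_1,\ldots,\gamma_p,x)=(\gamma_1,\ldots,\gamma_i\gamma_{i+1},\ldots,\gamma_p,x)$ for $1\le i\le p-1$, $d_p(\gamma_1,\ldots,\gamma_p,x)=(\gamma_1,\ldots,\gamma_{p-1},\gamma_p x)$. For $x^p=(\gamma_1,\ldots,\gamma_p,x)\in X^p$, $p\ge1$, set $\theta_0^{x^p}:=\theta_{\gamma_1}$ and $\theta_i^{x^p}:=\mathrm{id}_G$ for $1\le i\le p$. Let $\mathcal U=\{U_a\}_{a\in I}$ be an open cover of $X$ (not required to be invariant). For $a^p=(a_0,\ldots,a_p)\in I^{p+1}$ put $d_i(a^p):=(a_0,\ldots,\hat a_i,\ldots,a_p)$ ($a_i$ removed), and let $U_{a^p}\subseteq X^p$ be the set of $(\gamma_1,\ldots,\gamma_p,x)$ such that $\gamma_{i+1}\cdots\gamma_p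 x\in U_{a_i}$ for $0\le i\le p$ (for $i=p$: $x\in U_{a_p}$). The group of $p$-cochains is $K^p_\Gamma(\mathcal U,X,(G,\theta)):=\prod_{a^p\in I^{p+1}}C^\infty(U_{a^p},G)$ with pointwise multiplication. The twisted pullbacks $\delta_i:K^p_\Gamma\rightarrow K^{p+1}_\Gamma$, $0\le i\le p+1$, are $(\delta_i\phi)_{a^{p+1}}(x^{p+1}):=\theta_i^{x^{p+1}}\big(\phi_{d_i(a^{p+1})}(d_i(x^{p+1}))\big)$. **Cohomology.** If $G$ is abelian, the coboundary is $\delta:=\sum_{0\le i\le p+1}(-1)^i\delta_i$ (additive notation for pointwise multiplication); $H^p_\Gamma(\mathcal U,X,(G,\theta))$ is the cohomology of $(K^\bullet_\Gamma(\mathcal U,X,(G,\theta)),\delta)$, and $H^p_\Gamma(X,(G,\theta)):=\varinjlim H^p_\Gamma(\mathcal U,X,(G,\theta))$ over refinements of $\mathcal U$. **Degree 0 and 1 for non-abelian coefficients.** For any $\Gamma$-group, $\mathrm{TC}^0_\Gamma(\mathcal U,X,(G,\theta)):=\{\mu\in K^0_\Gamma(\mathcal U,X,(G,\theta)) : (\delta_1\mu)^{-1}(\delta_0\mu)=1\}$ and $\mathrm{TC}^1_\Gamma(\mathcal U,X,(G,\theta)):=\{\phi\in K^1_\Gamma(\mathcal U,X,(G,\theta)) : (\delta_1\phi)^{-1}(\delta_2\phi)(\delta_0\phi)=1\}/\sim$, where $\phi^1\sim\phi^2$ iff there is $\mu\in K^0_\Gamma(\mathcal U,X,(G,\theta))$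 with $(\delta_1\mu)\phi^1=\phi^2(\delta_0\mu)$. These are pointed sets, pointed by the (class of the) constant cochain $1$. $\mathrm{TC}^p_\Gamma(X,\cdot)$ denotes the direct limit over refinements of $\mathcal U$, and $K^p_\Gamma(X,\cdot)$ denotes cochains over open covers, where a cochain may be replaced by its restriction to a refinement of the cover. **Induced maps.** $\alpha^p,\beta^p$ are induced by post-composing cochains with $\alpha,\beta$ (when $A$ is abelian, $\mathrm{TC}^p_\Gamma(X,A)$ is identified with $H^p_\Gamma(X,A)$, $p=0,1$). The bracketed expressions defining $\Delta^0,\Delta^1$ take values in $\ker\beta=\alpha(A)\cong A$. A sequence of pointed sets is exact if at each term the image of the incoming map equals the preimage of the base point under the outgoing map.
   Formalization: Δ^1 is defined only on classes [φ] having a lift ψ over some cover, and everywhere if all lift after refinement; exactness at TC^1(X,C) is for this map. Lifts can fail: X a point, Γ=SO(3), trivial actions on Z/2→SU(2)→SO(3), where H^2=0 and no total Δ^1 is exact. *)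

theory Defs
  imports
    "HOL-Analysis.Analysis"
    "HOL-Algebra.Bij"
    "HOL-Algebra.Group_Action"
    "HOL-Algebra.FiniteProduct"
begin

section \<open>Smooth manifolds and Lie groups\<close>

text \<open>
  Euclidean n-space is \<^const>\<open>Euclidean_space\<close> n, i.e. the functions nat => real that vanish from n
  on. The dimension is thus a natural number, so that the products of p copies of \<open>\<Gamma>\<close> with X make
  sense for variable p, and dimension 0 (discrete groups) is included.

  \<open>Ck n k S f\<close>, for S open in n-space: all iterated partial derivatives of f of order at most k
  exist and are continuous on S.
\<close>

primrec Ck :: "nat \<Rightarrow> nat \<Rightarrow> (nat \<Rightarrow> real) set \<Rightarrow> ((nat \<Rightarrow> real) \<Rightarrow> real) \<Rightarrow> bool" where
  "Ck n 0 S f \<longleftrightarrow> continuous_on S f"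
| "Ck n (Suc k) S f \<longleftrightarrow> continuous_on S f \<and>
     (\<exists>D. \<forall>i<n. (\<forall>x\<in>S. ((\<lambda>t. f (x(i := t))) has_real_derivative D i x) (at (x i))) \<and>
                 Ck n k S (D i))"

definition smooth_Rn ::
    "nat \<Rightarrow> nat \<Rightarrow> (nat \<Rightarrow> real) set \<Rightarrow> ((nat \<Rightarrow> real) \<Rightarrow> nat \<Rightarrow> real) \<Rightarrow> bool" where
  "smooth_Rn n m S f \<longleftrightarrow> (\<forall>j<m. \<forall>k. Ck n k S (\<lambda>x. f x j))"

type_synonym 'a chart = "'a set \<times> ('a \<Rightarrow> nat \<Rightarrow> real)"

record 'a manifold =
  mtop :: "'a topology"
  mdim :: nat
  atlas :: "'a chart set"

text \<open>The atlas need not be maximal. Manifolds are Hausdorff and second countable.\<close>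

definition smooth_manifold :: "'a manifold \<Rightarrow> bool" where
  "smooth_manifold M \<longleftrightarrow>
     Hausdorff_space (mtop M) \<and> second_countable (mtop M) \<and>
     (\<Union>(U,\<phi>)\<in>atlas M. U) = topspace (mtop M) \<and>
     (\<forall>(U,\<phi>)\<in>atlas M. openin (mtop M) U \<and>
        (\<exists>V. openin (Euclidean_space (mdim M)) V \<and>
             homeomorphic_map (subtopology (mtop M) U)
                (subtopology (Euclidean_space (mdim M)) V) \<phi>)) \<and>
     (\<forall>(U,\<phi>)\<in>atlas M. \<forall>(V,\<psi>)\<in>atlas M.
        smooth_Rn (mdim M) (mdim M) (\<phi> ` (U \<inter> V)) (\<psi> \<circ> inv_into U \<phi>))"

text \<open>\<open>smooth_on M W N f\<close>: f is a smooth map to N from the open subset W of M.\<close>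

definition smooth_on :: "'a manifold \<Rightarrow> 'a set \<Rightarrow> 'b manifold \<Rightarrow> ('a \<Rightarrow> 'b) \<Rightarrow> bool" where
  "smooth_on M W N f \<longleftrightarrow>
     continuous_map (subtopology (mtop M) W) (mtop N) f \<and>
     (\<forall>(U,\<phi>)\<in>atlas M. \<forall>(V,\<psi>)\<in>atlas N.
        smooth_Rn (mdim M) (mdim N) (\<phi> ` {x \<in> U \<inter> W. f x \<in> V}) (\<psi> \<circ> f \<circ> inv_into U \<phi>))"

abbreviation smooth_map :: "'a manifold \<Rightarrow> 'b manifold \<Rightarrow> ('a \<Rightarrow> 'b) \<Rightarrow> bool" where
  "smooth_map M N f \<equiv> smooth_on M (topspace (mtop M)) N f"

definition mprod :: "'a manifold \<Rightarrow> 'b manifold \<Rightarrow> ('a \<times> 'b) manifold" where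
  "mprod M N = \<lparr>
     mtop = prod_topology (mtop M) (mtop N),
     mdim = mdim M + mdim N,
     atlas = {(U \<times> V, \<lambda>(x,y) j. if j < mdim M then \<phi> x j else \<psi> y (j - mdim M)) | U \<phi> V \<psi>.
                (U,\<phi>) \<in> atlas M \<and> (V,\<psi>) \<in> atlas N}\<rparr>"

text \<open>The p-fold power; its points are the families indexed by 1, ..., p. The coordinate number j
  is coordinate \<open>j mod k\<close> of the component \<open>j div k + 1\<close>, where k is the dimension of M.\<close>

definition mpow :: "nat \<Rightarrow> 'a manifold \<Rightarrow> (nat \<Rightarrow> 'a) manifold" where
  "mpow p M = \<lparr>
     mtop = product_topology (\<lambda>_. mtop M) {1..p},
     mdim = p * mdim M,
     atlas = {(\<Pi>\<^sub>E i\<in>{1..p}. fst (c i),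
               \<lambda>g j. if j < p * mdim M
                      then snd (c (j div mdim M + 1)) (g (j div mdim M + 1)) (j mod mdim M)
                      else 0) | c. c \<in> {1..p} \<rightarrow>\<^sub>E atlas M}\<rparr>"

record 'a lie = "'a monoid" +
  mfd :: "'a manifold"

definition lie_group :: "('a, 'z) lie_scheme \<Rightarrow> bool" where
  "lie_group G \<longleftrightarrow>
     group G \<and> smooth_manifold (mfd G) \<and> topspace (mtop (mfd G)) = carrier G \<and>
     smooth_map (mprod (mfd G) (mfd G)) (mfd G) (\<lambda>(x,y). x \<otimes>\<^bsub>G\<^esub> y) \<and>
     smooth_map (mfd G) (mfd G) (\<lambda>x. inv\<^bsub>G\<^esub> x)"


section \<open>Smooth actions and equivariant groups\<close>

record ('g, 'x) gspace =
  Grp :: "'g lie"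
  Spc :: "'x manifold"
  act :: "'g \<Rightarrow> 'x \<Rightarrow> 'x"

definition smooth_gspace :: "('g, 'x) gspace \<Rightarrow> bool" where
  "smooth_gspace S \<longleftrightarrow>
     lie_group (Grp S) \<and> smooth_manifold (Spc S) \<and>
     group_action (Grp S) (topspace (mtop (Spc S))) (act S) \<and>
     smooth_map (mprod (mfd (Grp S)) (Spc S)) (Spc S) (\<lambda>(\<gamma>,x). act S \<gamma> x)"

record ('g, 'a) ggroup = "'a lie" +
  theta :: "'g \<Rightarrow> 'a \<Rightarrow> 'a"

definition gamma_group :: "'g lie \<Rightarrow> ('g, 'a) ggroup \<Rightarrow> bool" where
  "gamma_group \<Gamma> G \<longleftrightarrow>
     lie_group G \<and> theta G \<in> hom \<Gamma> (AutoGroup G) \<and>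
     smooth_map (mprod (mfd \<Gamma>) (mfd G)) (mfd G) (\<lambda>(\<gamma>,g). theta G \<gamma> g)"

definition gamma_hom :: "'g lie \<Rightarrow> ('g, 'a) ggroup \<Rightarrow> ('g, 'b) ggroup \<Rightarrow> ('a \<Rightarrow> 'b) set" where
  "gamma_hom \<Gamma> G H =
     {f \<in> hom G H. smooth_map (mfd G) (mfd H) f \<and>
        (\<forall>\<gamma>\<in>carrier \<Gamma>. \<forall>g\<in>carrier G. f (theta G \<gamma> g) = theta H \<gamma> (f g))}"

definition gamma_short_exact :: "'g lie \<Rightarrow> ('g, 'a) ggroup \<Rightarrow> ('g, 'b) ggroup \<Rightarrow> ('g, 'c) ggroup \<Rightarrow>
    ('a \<Rightarrow> 'b) \<Rightarrow> ('b \<Rightarrow> 'c) \<Rightarrow> bool" where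
  "gamma_short_exact \<Gamma> A B C \<alpha> \<beta> \<longleftrightarrow>
     gamma_group \<Gamma> A \<and> gamma_group \<Gamma> B \<and> gamma_group \<Gamma> C \<and>
     \<alpha> \<in> gamma_hom \<Gamma> A B \<and> \<beta> \<in> gamma_hom \<Gamma> B C \<and>
     inj_on \<alpha> (carrier A) \<and> \<alpha> ` carrier A = kernel B C \<beta> \<and> \<beta> ` carrier B = carrier C"


section \<open>Cochains\<close>

type_synonym ('g, 'x) pt = "(nat \<Rightarrow> 'g) \<times> 'x"

definition Xp :: "('g, 'x) gspace \<Rightarrow> nat \<Rightarrow> ('g, 'x) pt manifold" where
  "Xp S p = mprod (mpow p (mfd (Grp S))) (Spc S)"

definition face :: "('g, 'x) gspace \<Rightarrow> nat \<Rightarrow> nat \<Rightarrow> ('g, 'x) pt \<Rightarrow> ('g, 'x) pt" where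
  "face S p i = (\<lambda>(g, x).
     if i = 0 then (\<lambda>j\<in>{1..p-1}. g (j+1), x)
     else if i < p then
       (\<lambda>j\<in>{1..p-1}. if j < i then g j
                      else if j = i then g i \<otimes>\<^bsub>Grp S\<^esub> g (i+1)
                      else g (j+1), x)
     else (\<lambda>j\<in>{1..p-1}. g j, act S (g p) x))"

definition twist :: "('g, 'a) ggroup \<Rightarrow> nat \<Rightarrow> ('g, 'x) pt \<Rightarrow> 'a \<Rightarrow> 'a" where
  "twist G i xp = (if i = 0 then theta G (fst xp 1) else id)"

text \<open>
  Open covers of X are indexed families. Every such family and the family of its members, indexed
  by itself, refine each other, so index sets contained in the type of sets of points are
  sufficient for the direct limit over all covers.
\<close>

record 'x cover =
  Idx :: "'x set set"
  Mem :: "'x set \<Rightarrow> 'x set"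

definition covers :: "('g, 'x) gspace \<Rightarrow> 'x cover set" where
  "covers S = {U. (\<forall>a\<in>Idx U. openin (mtop (Spc S)) (Mem U a)) \<and>
                  (\<Union>a\<in>Idx U. Mem U a) = topspace (mtop (Spc S))}"

abbreviation multi_idx :: "'x cover \<Rightarrow> nat \<Rightarrow> (nat \<Rightarrow> 'x set) set" where
  "multi_idx U p \<equiv> {..p} \<rightarrow>\<^sub>E Idx U"

definition idx_face :: "nat \<Rightarrow> nat \<Rightarrow> (nat \<Rightarrow> 'i) \<Rightarrow> nat \<Rightarrow> 'i" where
  "idx_face p i a = (\<lambda>j\<in>{..p-1}. if j < i then a j else a (j+1))"

text \<open>The \<open>foldr\<close> term is the point \<open>\<gamma>\<^bsub>i+1\<^esub> \<cdots> \<gamma>\<^bsub>p\<^esub> x\<close>.\<close>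

definition Uset :: "('g, 'x) gspace \<Rightarrow> 'x cover \<Rightarrow> nat \<Rightarrow> (nat \<Rightarrow> 'x set) \<Rightarrow> ('g, 'x) pt set" where
  "Uset S U p a = {(g, x) \<in> topspace (mtop (Xp S p)).
     \<forall>i\<le>p. foldr (\<lambda>j. act S (g j)) [i+1..<p+1] x \<in> Mem U (a i)}"

type_synonym ('g, 'x, 'a) cochain = "(nat \<Rightarrow> 'x set) \<Rightarrow> ('g, 'x) pt \<Rightarrow> 'a"

definition Cinf :: "'b manifold \<Rightarrow> 'b set \<Rightarrow> 'a manifold \<Rightarrow> ('b \<Rightarrow> 'a) set" where
  "Cinf M W N = {f \<in> extensional W. smooth_on M W N f}"

definition K :: "('g, 'x) gspace \<Rightarrow> nat \<Rightarrow> 'x cover \<Rightarrow> ('g, 'a) ggroup \<Rightarrow>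
    ('g, 'x, 'a) cochain monoid" where
  "K S p U G = \<lparr>
     carrier = (\<Pi>\<^sub>E a\<in>multi_idx U p. Cinf (Xp S p) (Uset S U p a) (mfd G)),
     mult = (\<lambda>\<phi> \<psi>. \<lambda>a\<in>multi_idx U p. \<lambda>xp\<in>Uset S U p a. \<phi> a xp \<otimes>\<^bsub>G\<^esub> \<psi> a xp),
     one = (\<lambda>a\<in>multi_idx U p. \<lambda>xp\<in>Uset S U p a. \<one>\<^bsub>G\<^esub>)\<rparr>"

text \<open>\<open>delta S p U G i\<close> is the twisted pullback \<open>\<delta>\<^sub>i\<close> from degree p to degree p + 1.\<close>

definition delta :: "('g, 'x) gspace \<Rightarrow> nat \<Rightarrow> 'x cover \<Rightarrow> ('g, 'a) ggroup \<Rightarrow> nat \<Rightarrow>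
    ('g, 'x, 'a) cochain \<Rightarrow> ('g, 'x, 'a) cochain" where
  "delta S p U G i \<phi> = (\<lambda>a\<in>multi_idx U (p+1). \<lambda>xp\<in>Uset S U (p+1) a.
     twist G i xp (\<phi> (idx_face (p+1) i a) (face S (p+1) i xp)))"

definition post :: "('g, 'x) gspace \<Rightarrow> nat \<Rightarrow> 'x cover \<Rightarrow> ('a \<Rightarrow> 'b) \<Rightarrow>
    ('g, 'x, 'a) cochain \<Rightarrow> ('g, 'x, 'b) cochain" where
  "post S p U f \<phi> = (\<lambda>a\<in>multi_idx U p. \<lambda>xp\<in>Uset S U p a. f (\<phi> a xp))"

definition refines :: "'x cover \<Rightarrow> 'x cover \<Rightarrow> ('x set \<Rightarrow> 'x set) \<Rightarrow> bool" where
  "refines V U r \<longleftrightarrow> (\<forall>b\<in>Idx V. r b \<in> Idx U \<and> Mem V b \<subseteq> Mem U (r b))"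

definition restr :: "('g, 'x) gspace \<Rightarrow> nat \<Rightarrow> 'x cover \<Rightarrow> ('x set \<Rightarrow> 'x set) \<Rightarrow>
    ('g, 'x, 'a) cochain \<Rightarrow> ('g, 'x, 'a) cochain" where
  "restr S p V r \<phi> = (\<lambda>b\<in>multi_idx V p. \<lambda>xp\<in>Uset S V p b. \<phi> (\<lambda>i\<in>{..p}. r (b i)) xp)"


section \<open>Cocycles and their equivalences over a fixed cover\<close>

text \<open>The alternating sum is written multiplicatively, as a product of powers.\<close>

definition cobd :: "('g, 'x) gspace \<Rightarrow> nat \<Rightarrow> 'x cover \<Rightarrow> ('g, 'a) ggroup \<Rightarrow>
    ('g, 'x, 'a) cochain \<Rightarrow> ('g, 'x, 'a) cochain" where
  "cobd S p U G \<phi> =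
     (\<Otimes>\<^bsub>K S (p+1) U G\<^esub> i\<in>{..p+1}. delta S p U G i \<phi> [^]\<^bsub>K S (p+1) U G\<^esub> ((-1)^i :: int))"

definition Hcoc :: "('g, 'x) gspace \<Rightarrow> ('g, 'a) ggroup \<Rightarrow> nat \<Rightarrow> 'x cover \<Rightarrow>
    ('g, 'x, 'a) cochain set" where
  "Hcoc S G p U = {\<phi> \<in> carrier (K S p U G). cobd S p U G \<phi> = \<one>\<^bsub>K S (p+1) U G\<^esub>}"

definition Hrel :: "('g, 'x) gspace \<Rightarrow> ('g, 'a) ggroup \<Rightarrow> nat \<Rightarrow> 'x cover \<Rightarrow>
    ('g, 'x, 'a) cochain rel" where
  "Hrel S G p U = {(\<phi>, \<phi>'). \<phi> \<in> Hcoc S G p U \<and> \<phi>' \<in> Hcoc S G p U \<and>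
     (case p of
        0 \<Rightarrow> \<phi> = \<phi>'
      | Suc q \<Rightarrow> \<exists>\<mu>\<in>carrier (K S q U G). \<phi> = \<phi>' \<otimes>\<^bsub>K S p U G\<^esub> cobd S q U G \<mu>)}"

definition ob0 :: "('g, 'x) gspace \<Rightarrow> ('g, 'a) ggroup \<Rightarrow> 'x cover \<Rightarrow>
    ('g, 'x, 'a) cochain \<Rightarrow> ('g, 'x, 'a) cochain" where
  "ob0 S G U \<mu> = inv\<^bsub>K S 1 U G\<^esub> (delta S 0 U G 1 \<mu>) \<otimes>\<^bsub>K S 1 U G\<^esub> delta S 0 U G 0 \<mu>"

definition ob1 :: "('g, 'x) gspace \<Rightarrow> ('g, 'a) ggroup \<Rightarrow> 'x cover \<Rightarrow>
    ('g, 'x, 'a) cochain \<Rightarrow> ('g, 'x, 'a) cochain" where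
  "ob1 S G U \<phi> = inv\<^bsub>K S 2 U G\<^esub> (delta S 1 U G 1 \<phi>) \<otimes>\<^bsub>K S 2 U G\<^esub> delta S 1 U G 2 \<phi>
                   \<otimes>\<^bsub>K S 2 U G\<^esub> delta S 1 U G 0 \<phi>"

definition TC0coc :: "('g, 'x) gspace \<Rightarrow> ('g, 'a) ggroup \<Rightarrow> 'x cover \<Rightarrow>
    ('g, 'x, 'a) cochain set" where
  "TC0coc S G U = {\<mu> \<in> carrier (K S 0 U G). ob0 S G U \<mu> = \<one>\<^bsub>K S 1 U G\<^esub>}"

definition TC1coc :: "('g, 'x) gspace \<Rightarrow> ('g, 'a) ggroup \<Rightarrow> 'x cover \<Rightarrow>
    ('g, 'x, 'a) cochain set" where
  "TC1coc S G U = {\<phi> \<in> carrier (K S 1 U G). ob1 S G U \<phi> = \<one>\<^bsub>K S 2 U G\<^esub>}"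

definition TC1rel :: "('g, 'x) gspace \<Rightarrow> ('g, 'a) ggroup \<Rightarrow> 'x cover \<Rightarrow>
    ('g, 'x, 'a) cochain rel" where
  "TC1rel S G U = {(\<phi>, \<phi>'). \<phi> \<in> TC1coc S G U \<and> \<phi>' \<in> TC1coc S G U \<and>
     (\<exists>\<mu>\<in>carrier (K S 0 U G).
        delta S 0 U G 1 \<mu> \<otimes>\<^bsub>K S 1 U G\<^esub> \<phi> = \<phi>' \<otimes>\<^bsub>K S 1 U G\<^esub> delta S 0 U G 0 \<mu>)}"


section \<open>Direct limits over refinements\<close>

text \<open>
  The direct limit of the quotients \<open>Z U / R U\<close> over the covers U: two cocycles on two covers are
  identified iff their restrictions to some common refinement are equivalent there.
\<close>

definition lim_rel :: "('g, 'x) gspace \<Rightarrow> nat \<Rightarrow> ('x cover \<Rightarrow> ('g, 'x, 'a) cochain set) \<Rightarrow>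
    ('x cover \<Rightarrow> ('g, 'x, 'a) cochain rel) \<Rightarrow> ('x cover \<times> ('g, 'x, 'a) cochain) rel" where
  "lim_rel S p Z R = {((U, \<phi>), (V, \<psi>)).
     U \<in> covers S \<and> V \<in> covers S \<and> \<phi> \<in> Z U \<and> \<psi> \<in> Z V \<and>
     (\<exists>W\<in>covers S. \<exists>r s. refines W U r \<and> refines W V s \<and>
        (restr S p W r \<phi>, restr S p W s \<psi>) \<in> R W)}"

type_synonym ('g, 'x, 'a) cls = "('x cover \<times> ('g, 'x, 'a) cochain) set"

definition H :: "('g, 'x) gspace \<Rightarrow> ('g, 'a) ggroup \<Rightarrow> nat \<Rightarrow> ('g, 'x, 'a) cls set" where
  "H S G p = (SIGMA U:covers S. Hcoc S G p U) // lim_rel S p (Hcoc S G p) (Hrel S G p)"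

definition Hcls :: "('g, 'x) gspace \<Rightarrow> ('g, 'a) ggroup \<Rightarrow> nat \<Rightarrow> 'x cover \<Rightarrow>
    ('g, 'x, 'a) cochain \<Rightarrow> ('g, 'x, 'a) cls" where
  "Hcls S G p U \<phi> = lim_rel S p (Hcoc S G p) (Hrel S G p) `` {(U, \<phi>)}"

definition TC0 :: "('g, 'x) gspace \<Rightarrow> ('g, 'a) ggroup \<Rightarrow> ('g, 'x, 'a) cls set" where
  "TC0 S G = (SIGMA U:covers S. TC0coc S G U) // lim_rel S 0 (TC0coc S G) (\<lambda>_. Id)"

definition TC0cls :: "('g, 'x) gspace \<Rightarrow> ('g, 'a) ggroup \<Rightarrow> 'x cover \<Rightarrow>
    ('g, 'x, 'a) cochain \<Rightarrow> ('g, 'x, 'a) cls" where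
  "TC0cls S G U \<mu> = lim_rel S 0 (TC0coc S G) (\<lambda>_. Id) `` {(U, \<mu>)}"

definition TC1 :: "('g, 'x) gspace \<Rightarrow> ('g, 'a) ggroup \<Rightarrow> ('g, 'x, 'a) cls set" where
  "TC1 S G = (SIGMA U:covers S. TC1coc S G U) // lim_rel S 1 (TC1coc S G) (TC1rel S G)"

definition TC1cls :: "('g, 'x) gspace \<Rightarrow> ('g, 'a) ggroup \<Rightarrow> 'x cover \<Rightarrow>
    ('g, 'x, 'a) cochain \<Rightarrow> ('g, 'x, 'a) cls" where
  "TC1cls S G U \<phi> = lim_rel S 1 (TC1coc S G) (TC1rel S G) `` {(U, \<phi>)}"

text \<open>The base points are the classes of the constant cochain 1, taken over the cover {X}.\<close>

definition triv_cover :: "('g, 'x) gspace \<Rightarrow> 'x cover" where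
  "triv_cover S = \<lparr>Idx = {topspace (mtop (Spc S))}, Mem = (\<lambda>a. a)\<rparr>"

definition Hpt :: "('g, 'x) gspace \<Rightarrow> ('g, 'a) ggroup \<Rightarrow> nat \<Rightarrow> ('g, 'x, 'a) cls" where
  "Hpt S G p = Hcls S G p (triv_cover S) \<one>\<^bsub>K S p (triv_cover S) G\<^esub>"

definition TC0pt :: "('g, 'x) gspace \<Rightarrow> ('g, 'a) ggroup \<Rightarrow> ('g, 'x, 'a) cls" where
  "TC0pt S G = TC0cls S G (triv_cover S) \<one>\<^bsub>K S 0 (triv_cover S) G\<^esub>"

definition TC1pt :: "('g, 'x) gspace \<Rightarrow> ('g, 'a) ggroup \<Rightarrow> ('g, 'x, 'a) cls" where
  "TC1pt S G = TC1cls S G (triv_cover S) \<one>\<^bsub>K S 1 (triv_cover S) G\<^esub>"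


section \<open>The maps of the sequence\<close>

text \<open>
  All maps are given by their graphs, formed from all representatives. That these graphs are
  (well-defined) maps between the stated sets is a claim, not part of the definitions.
\<close>

definition pointed_partial_map :: "'s set \<Rightarrow> 's \<Rightarrow> 't set \<Rightarrow> 't \<Rightarrow> ('s \<times> 't) set \<Rightarrow> bool" where
  "pointed_partial_map P p Q q f \<longleftrightarrow> f \<subseteq> P \<times> Q \<and> single_valued f \<and> (p, q) \<in> f"

definition pointed_map :: "'s set \<Rightarrow> 's \<Rightarrow> 't set \<Rightarrow> 't \<Rightarrow> ('s \<times> 't) set \<Rightarrow> bool" where
  "pointed_map P p Q q f \<longleftrightarrow> pointed_partial_map P p Q q f \<and> Domain f = P"

definition exact_at :: "('s \<times> 't) set \<Rightarrow> ('t \<times> 'u) set \<Rightarrow> 'u \<Rightarrow> bool" where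
  "exact_at f g u \<longleftrightarrow> Range f = g\<inverse> `` {u}"

definition alpha0 :: "('g, 'x) gspace \<Rightarrow> ('g, 'a) ggroup \<Rightarrow> ('g, 'b) ggroup \<Rightarrow> ('a \<Rightarrow> 'b) \<Rightarrow>
    (('g, 'x, 'a) cls \<times> ('g, 'x, 'b) cls) set" where
  "alpha0 S A B \<alpha> = {(Hcls S A 0 U \<mu>, TC0cls S B U (post S 0 U \<alpha> \<mu>)) | U \<mu>.
     U \<in> covers S \<and> \<mu> \<in> Hcoc S A 0 U}"

definition alpha1 :: "('g, 'x) gspace \<Rightarrow> ('g, 'a) ggroup \<Rightarrow> ('g, 'b) ggroup \<Rightarrow> ('a \<Rightarrow> 'b) \<Rightarrow>
    (('g, 'x, 'a) cls \<times> ('g, 'x, 'b) cls) set" where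
  "alpha1 S A B \<alpha> = {(Hcls S A 1 U \<phi>, TC1cls S B U (post S 1 U \<alpha> \<phi>)) | U \<phi>.
     U \<in> covers S \<and> \<phi> \<in> Hcoc S A 1 U}"

definition beta0 :: "('g, 'x) gspace \<Rightarrow> ('g, 'b) ggroup \<Rightarrow> ('g, 'c) ggroup \<Rightarrow> ('b \<Rightarrow> 'c) \<Rightarrow>
    (('g, 'x, 'b) cls \<times> ('g, 'x, 'c) cls) set" where
  "beta0 S B C \<beta> = {(TC0cls S B U \<mu>, TC0cls S C U (post S 0 U \<beta> \<mu>)) | U \<mu>.
     U \<in> covers S \<and> \<mu> \<in> TC0coc S B U}"

definition beta1 :: "('g, 'x) gspace \<Rightarrow> ('g, 'b) ggroup \<Rightarrow> ('g, 'c) ggroup \<Rightarrow> ('b \<Rightarrow> 'c) \<Rightarrow>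
    (('g, 'x, 'b) cls \<times> ('g, 'x, 'c) cls) set" where
  "beta1 S B C \<beta> = {(TC1cls S B U \<phi>, TC1cls S C U (post S 1 U \<beta> \<phi>)) | U \<phi>.
     U \<in> covers S \<and> \<phi> \<in> TC1coc S B U}"

text \<open>
  In the connecting maps, the identification of \<open>\<alpha>(A) = ker \<beta>\<close> with A is written as composition
  with the inverse of \<open>\<alpha>\<close>. A representative may live on any cover, in particular on any refinement
  on which a lift exists.

  Lifts \<open>\<eta>\<close> exist after refinement. Lifts \<open>\<psi>\<close> need not: refining a cover of X does not
  shrink the sets \<open>U\<^bsub>ab\<^esub>\<close> in the direction of \<open>\<Gamma>\<close>. For X a point and the extension
  \<open>Z/2 \<rightarrow> SU(2) \<rightarrow> SO(3)\<close> with trivial actions of \<open>\<Gamma> = SO(3)\<close>, the class of the identity of SO(3)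
  has no lift (and, as \<open>H\<^sup>2 = 0\<close>, no everywhere defined map could make the sequence exact).
  So \<open>Delta1\<close> is defined on exactly those classes to which its defining formula applies.
\<close>

definition Delta0 :: "('g, 'x) gspace \<Rightarrow> ('g, 'a) ggroup \<Rightarrow> ('g, 'b) ggroup \<Rightarrow> ('g, 'c) ggroup \<Rightarrow>
    ('a \<Rightarrow> 'b) \<Rightarrow> ('b \<Rightarrow> 'c) \<Rightarrow> (('g, 'x, 'c) cls \<times> ('g, 'x, 'a) cls) set" where
  "Delta0 S A B C \<alpha> \<beta> =
     {(TC0cls S C U \<mu>, Hcls S A 1 U (post S 1 U (inv_into (carrier A) \<alpha>) (ob0 S B U \<eta>))) | U \<mu> \<eta>.
        U \<in> covers S \<and> \<mu> \<in> TC0coc S C U \<and> \<eta> \<in> carrier (K S 0 U B) \<and> post S 0 U \<beta> \<eta> = \<mu>}"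

definition Delta1 :: "('g, 'x) gspace \<Rightarrow> ('g, 'a) ggroup \<Rightarrow> ('g, 'b) ggroup \<Rightarrow> ('g, 'c) ggroup \<Rightarrow>
    ('a \<Rightarrow> 'b) \<Rightarrow> ('b \<Rightarrow> 'c) \<Rightarrow> (('g, 'x, 'c) cls \<times> ('g, 'x, 'a) cls) set" where
  "Delta1 S A B C \<alpha> \<beta> =
     {(TC1cls S C U \<phi>, Hcls S A 2 U (post S 2 U (inv_into (carrier A) \<alpha>) (ob1 S B U \<psi>))) | U \<phi> \<psi>.
        U \<in> covers S \<and> \<phi> \<in> TC1coc S C U \<and> \<psi> \<in> carrier (K S 1 U B) \<and> post S 1 U \<beta> \<psi> = \<phi>}"

definition lifts_exist :: "('g, 'x) gspace \<Rightarrow> ('g, 'b) ggroup \<Rightarrow> ('g, 'c) ggroup \<Rightarrow> ('b \<Rightarrow> 'c) \<Rightarrow>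
    bool" where
  "lifts_exist S B C \<beta> \<longleftrightarrow>
     (\<forall>U\<in>covers S. \<forall>\<phi>\<in>TC1coc S C U. \<exists>V\<in>covers S. \<exists>r. refines V U r \<and>
        (\<exists>\<psi>\<in>carrier (K S 1 V B). post S 1 V \<beta> \<psi> = restr S 1 V r \<phi>))"

end

theory Submission
  imports Defs
begin

text \<open>
  Exactness is a diagram chase in groups of cochains. Post-composition with \<open>\<alpha>\<close> and \<open>\<beta>\<close> gives
  homomorphisms \<open>K\<^sup>p(A) \<rightarrow> K\<^sup>p(B) \<rightarrow> K\<^sup>p(C)\<close> over each cover; the first is injective and its image is
  the kernel of the second (\<open>corestrict\<close>). Degree 0 cochains with values in C lift to B after refining
  the cover (\<open>local_lift\<close>). Degree 1 cochains need not lift, which is why \<open>\<Delta>\<^sup>1\<close> is a partial map;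
  none of the exactness statements requires such a lift to be constructed.

  The non-abelian coboundaries \<open>ob0 \<eta> = (\<delta>\<^sub>1\<eta>)\<^sup>-\<^sup>1(\<delta>\<^sub>0\<eta>)\<close> and \<open>ob1 \<psi> = (\<delta>\<^sub>1\<psi>)\<^sup>-\<^sup>1(\<delta>\<^sub>2\<psi>)(\<delta>\<^sub>0\<psi>)\<close> are not homomorphisms, but
  they are multiplicative when one of the factors is central (\<open>ob0_mult_central\<close>, \<open>ob1_mult_central\<close>), and
  the gauge action \<open>(\<delta>\<^sub>1\<eta>)\<psi>(\<delta>\<^sub>0\<eta>)\<^sup>-\<^sup>1\<close>, whose orbits are the elements of \<open>TC\<^sup>1\<close>, only conjugates
  \<open>ob1 \<psi>\<close> (\<open>val_ob1_gauge\<close>). If \<open>\<eta>\<close> or \<open>\<psi>\<close> lifts a cocycle of C, its coboundary has values in the central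
  subgroup \<open>\<alpha>(A)\<close> and is a cocycle there (\<open>ob0_cocycle\<close>, \<open>ob1_cocycle\<close>). Another lift differs by a
  cochain of A, hence changes it by a coboundary; a gauge transformation in C lifts to one in B
  after refinement, and does not change it at all. So the connecting maps are well defined, and each
  exactness statement says that a lift can be corrected by a cochain of A or by a gauge transformation.

  Two facts on Lie groups carry the smoothness. \<open>\<beta>\<close> has smooth local sections
  (\<open>surjective_hom_local_section\<close>), and a smooth map into B with values in \<open>\<alpha>(A)\<close> is smooth as a map
  into A (\<open>injective_hom_lift_smooth\<close>). Both follow from a normal form (\<open>smooth_normal_form\<close>): near some
  point, in suitable coordinates of the source, a smooth map depends only on coordinates that occur
  among its components. It is found by exchanging coordinates for components one at a time
  (\<open>solve_coordinate\<close>), until all derivatives in the remaining directions vanish. For an injective map no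
  direction can remain. For a surjective homomorphism every component must have been exchanged,
  because by Baire's theorem the images of open sets contain open sets
  (\<open>hom_image_compact_interior\<close>). Translations then carry the statement from one point to all.

  Finally, the classes in the direct limits are handled by two abstract locales. \<open>limsys\<close> is a system of
  sets of cocycles with an equivalence relation, for which the restriction along a refinement does
  not depend on the refinement map up to equivalence; \<open>limmap\<close> is a map between the limits of two such
  systems given by a relation between cocycles.
\<close>

section \<open>Differential calculus in coordinates\<close>

abbreviation "openE n \<equiv> openin (Euclidean_space n)"

abbreviation EE :: "nat \<Rightarrow> (nat \<Rightarrow> real) set" where
  "EE n \<equiv> topspace (Euclidean_space n)"

definition cube :: "nat \<Rightarrow> (nat \<Rightarrow> real) \<Rightarrow> real \<Rightarrow> (nat \<Rightarrow> real) set" where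
  "cube n z d = {x \<in> EE n. \<forall>l<n. \<bar>x l - z l\<bar> < d}"

lemma EE_iff: "x \<in> EE n \<longleftrightarrow> (\<forall>i\<ge>n. x i = 0)"
  by (simp add: topspace_Euclidean_space)

lemma EE_upd: "x \<in> EE n \<Longrightarrow> i < n \<Longrightarrow> x(i := t) \<in> EE n"
  by (auto simp: EE_iff)

lemma EE_eqI: "x \<in> EE n \<Longrightarrow> y \<in> EE n \<Longrightarrow> (\<And>i. i < n \<Longrightarrow> x i = y i) \<Longrightarrow> x = y"
  by (metis EE_iff ext not_le)

lemma cube_sub: "cube n z d \<subseteq> EE n"
  by (auto simp: cube_def)

lemma cube_mono: "d \<le> e \<Longrightarrow> cube n z d \<subseteq> cube n z e"
  by (force simp: cube_def)

lemma cube_self: "z \<in> EE n \<Longrightarrow> 0 < d \<Longrightarrow> z \<in> cube n z d"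
  by (simp add: cube_def)

lemma openin_E: "openE n S \<longleftrightarrow> (\<exists>T. open T \<and> S = T \<inter> EE n)"
  by (simp add: Euclidean_space_def openin_subtopology euclidean_product_topology)

lemma openin_E_sub: "openE n S \<Longrightarrow> x \<in> S \<Longrightarrow> x \<in> EE n"
  using openin_subset by (rule subsetD)

lemma open_box_aux: "open {x :: nat \<Rightarrow> real. \<forall>l<n. \<bar>x l - z l\<bar> < d}"
proof -
  have "{x :: nat \<Rightarrow> real. \<forall>l<n. \<bar>x l - z l\<bar> < d} = (\<Inter>l\<in>{..<n}. {x. \<bar>x l - z l\<bar> < d})"
    by auto
  moreover have "open {x :: nat \<Rightarrow> real. \<bar>x l - z l\<bar> < d}" for l
    by (intro open_Collect_less continuous_intros continuous_on_product_coordinates)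
  ultimately show ?thesis
    by (simp add: open_INT)
qed

lemma open_cube: "openE n (cube n z d)"
  unfolding openin_E cube_def using open_box_aux[of n z d] by blast

lemma open_contains_box:
  fixes z :: "nat \<Rightarrow> real"
  assumes "open T" "z \<in> T" "z \<in> EE n"
  shows "\<exists>d>0. cube n z d \<subseteq> T"
proof -
  have "openin (product_topology (\<lambda>i. euclidean) UNIV) T"
    using assms(1) by (simp add: euclidean_product_topology)
  then obtain X where X: "z \<in> (\<Pi>\<^sub>E i\<in>UNIV. X i)" "\<And>i. open (X i)" "(\<Pi>\<^sub>E i\<in>UNIV. X i) \<subseteq> T"
    using product_topology_open_contains_basis[of "\<lambda>i. euclidean" UNIV T z] assms(2) by auto
  have "\<exists>e>0. \<forall>t. \<bar>t - z l\<bar> < e \<longrightarrow> t \<in> X l" if "l < n" for l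
    using X(1) X(2)[of l] open_real by (metis PiE_E UNIV_I)
  then obtain e where e: "\<And>l. l < n \<Longrightarrow> e l > 0" "\<And>l t. l < n \<Longrightarrow> \<bar>t - z l\<bar> < e l \<Longrightarrow> t \<in> X l"
    by metis
  define d where "d = Min (insert 1 (e ` {..<n}))"
  have "d > 0" unfolding d_def using e(1) by auto
  moreover have "cube n z d \<subseteq> T"
  proof
    fix x assume x: "x \<in> cube n z d"
    have "x i \<in> X i" for i
    proof (cases "i < n")
      case True
      have "d \<le> e i" unfolding d_def using True by auto
      then show ?thesis using x True e(2)[of i "x i"] by (force simp: cube_def)
    next
      case False
      then have "x i = z i" using x assms(3) by (simp add: cube_def EE_iff)
      then show ?thesis using X(1) by auto
    qed
    then show "x \<in> T" using X(3) by auto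
  qed
  ultimately show ?thesis by blast
qed

lemma openin_E_iff:
  "openE n S \<longleftrightarrow> S \<subseteq> EE n \<and> (\<forall>z\<in>S. \<exists>d>0. cube n z d \<subseteq> S)"
proof safe
  fix z assume "openE n S" "z \<in> S"
  then obtain T where T: "open T" "S = T \<inter> EE n" by (auto simp: openin_E)
  then obtain d where "d>0" "cube n z d \<subseteq> T" using \<open>z\<in>S\<close> open_contains_box by blast
  then show "\<exists>d>0. cube n z d \<subseteq> S" using T cube_sub by blast
next
  assume S: "S \<subseteq> EE n" "\<forall>z\<in>S. \<exists>d>0. cube n z d \<subseteq> S"
  show "openE n S"
  proof (subst openin_subopen, rule ballI)
    fix z assume "z \<in> S"
    then obtain d where "d>0" "cube n z d \<subseteq> S" using S by blast
    then show "\<exists>T. openE n T \<and> z \<in> T \<and> T \<subseteq> S"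
      using open_cube[of n z d] cube_self[of z n d] S(1) \<open>z\<in>S\<close> by (intro exI[of _ "cube n z d"]) auto
  qed
qed (use openin_subset in auto)

lemma eventually_at_E:
  assumes "S \<subseteq> EE n" "z \<in> S"
  shows "eventually P (at z within S) \<longleftrightarrow> (\<exists>d>0. \<forall>x\<in>S. x \<noteq> z \<and> x \<in> cube n z d \<longrightarrow> P x)"
proof
  assume "eventually P (at z within S)"
  then obtain T where T: "open T" "z \<in> T" "\<forall>x\<in>T. x \<noteq> z \<longrightarrow> x \<in> S \<longrightarrow> P x"
    by (auto simp: eventually_at_topological)
  then obtain d where "d>0" "cube n z d \<subseteq> T" using open_contains_box assms by blast
  then show "\<exists>d>0. \<forall>x\<in>S. x \<noteq> z \<and> x \<in> cube n z d \<longrightarrow> P x" using T by blast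
next
  assume "\<exists>d>0. \<forall>x\<in>S. x \<noteq> z \<and> x \<in> cube n z d \<longrightarrow> P x"
  then obtain d where d: "d>0" "\<forall>x\<in>S. x \<noteq> z \<and> x \<in> cube n z d \<longrightarrow> P x" by blast
  obtain T where T: "open T" "cube n z d = T \<inter> EE n" using open_cube openin_E by metis
  then have "z \<in> T" using cube_self d(1) assms by blast
  then show "eventually P (at z within S)"
    unfolding eventually_at_topological using d T assms by blast
qed

lemma continuous_on_E:
  fixes f :: "(nat \<Rightarrow> real) \<Rightarrow> real"
  assumes "S \<subseteq> EE n"
  shows "continuous_on S f \<longleftrightarrow> (\<forall>z\<in>S. \<forall>e>0. \<exists>d>0. \<forall>x\<in>S. x \<in> cube n z d \<longrightarrow> \<bar>f x - f z\<bar> < e)"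
proof -
  have "(f \<longlongrightarrow> f z) (at z within S) \<longleftrightarrow> (\<forall>e>0. \<exists>d>0. \<forall>x\<in>S. x \<in> cube n z d \<longrightarrow> \<bar>f x - f z\<bar> < e)"
    if "z \<in> S" for z
  proof -
    have "(x \<noteq> z \<and> x \<in> cube n z d \<longrightarrow> \<bar>f x - f z\<bar> < e) \<longleftrightarrow> (x \<in> cube n z d \<longrightarrow> \<bar>f x - f z\<bar> < e)"
      if "e > 0" for x d e using that by auto
    then show ?thesis
      unfolding tendsto_iff eventually_at_E[OF assms that] dist_real_def by (simp cong: imp_cong)
  qed
  then show ?thesis unfolding continuous_on_def by blast
qed

lemma openin_E_line:
  assumes "openE n S" "x \<in> S" "i < n"
  shows "\<exists>d>0. \<forall>t. \<bar>t - x i\<bar> < d \<longrightarrow> x(i := t) \<in> S"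
proof -
  obtain d where d: "d>0" "cube n x d \<subseteq> S" using assms openin_E_iff by blast
  have "x \<in> EE n" using assms openin_subset by blast
  then have "\<bar>t - x i\<bar> < d \<Longrightarrow> x(i := t) \<in> cube n x d" for t
    using EE_upd[of x n i t] assms(3) d by (auto simp: cube_def)
  then show ?thesis using d by blast
qed

lemma continuous_on_to_E:
  fixes g :: "(nat \<Rightarrow> real) \<Rightarrow> nat \<Rightarrow> real"
  assumes "g ` S \<subseteq> EE m" "\<And>j. j < m \<Longrightarrow> continuous_on S (\<lambda>x. g x j)"
  shows "continuous_on S g"
proof (rule continuous_on_coordinatewise_then_product)
  fix j
  show "continuous_on S (\<lambda>x. g x j)"
  proof (cases "j < m")
    case False
    then have "g x j = 0" if "x \<in> S" for x using assms(1) that by (auto simp: EE_iff)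
    then show ?thesis using continuous_on_cong[of S S "\<lambda>x. g x j" "\<lambda>x. 0"] by simp
  qed (use assms in auto)
qed

definition pd :: "nat \<Rightarrow> ((nat \<Rightarrow> real) \<Rightarrow> real) \<Rightarrow> (nat \<Rightarrow> real) \<Rightarrow> real" where
  "pd i f x = deriv (\<lambda>t. f (x(i := t))) (x i)"

declare Ck.simps(2) [simp del]

lemma Ck_SucI:
  assumes "continuous_on S f"
    "\<And>i x. i<n \<Longrightarrow> x\<in>S \<Longrightarrow> ((\<lambda>t. f (x(i := t))) has_real_derivative D i x) (at (x i))"
    "\<And>i. i<n \<Longrightarrow> Ck n k S (D i)"
  shows "Ck n (Suc k) S f"
proof -
  have "\<forall>i<n. (\<forall>x\<in>S. ((\<lambda>t. f (x(i := t))) has_real_derivative D i x) (at (x i))) \<and> Ck n k S (D i)"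
    using assms(2,3) by simp
  with assms(1) show ?thesis unfolding Ck.simps(2) by (rule conjI[OF _ exI[of _ D]])
qed

lemma Ck_SucE:
  assumes "Ck n (Suc k) S f"
  obtains D where "continuous_on S f"
    "\<And>i x. i<n \<Longrightarrow> x\<in>S \<Longrightarrow> ((\<lambda>t. f (x(i := t))) has_real_derivative D i x) (at (x i))"
    "\<And>i. i<n \<Longrightarrow> Ck n k S (D i)"
  using assms unfolding Ck.simps(2) by blast

lemma Ck_continuous: "Ck n k S f \<Longrightarrow> continuous_on S f"
  by (cases k) (auto simp: Ck.simps(2))

lemma Ck_subset: "Ck n k S f \<Longrightarrow> T \<subseteq> S \<Longrightarrow> Ck n k T f"
proof (induction k arbitrary: f)
  case 0 then show ?case by (auto intro: continuous_on_subset)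
next
  case (Suc k)
  from Suc.prems(1) show ?case
  proof (rule Ck_SucE)
    fix D assume "continuous_on S f"
    "\<And>i x. i<n \<Longrightarrow> x\<in>S \<Longrightarrow> ((\<lambda>t. f (x(i := t))) has_real_derivative D i x) (at (x i))"
    "\<And>i. i<n \<Longrightarrow> Ck n k S (D i)"
    then show ?thesis using Suc.prems(2) Suc.IH
      by (intro Ck_SucI[where D=D]) (blast intro: continuous_on_subset)+
  qed
qed

lemma Ck_SucD: "Ck n (Suc k) S f \<Longrightarrow> Ck n k S f"
proof (induction k arbitrary: f)
  case 0 then show ?case using Ck_continuous by auto
next
  case (Suc k)
  from Suc.prems(1) show ?case
  proof (rule Ck_SucE)
    fix D assume "continuous_on S f"
    "\<And>i x. i<n \<Longrightarrow> x\<in>S \<Longrightarrow> ((\<lambda>t. f (x(i := t))) has_real_derivative D i x) (at (x i))"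
    "\<And>i. i<n \<Longrightarrow> Ck n (Suc k) S (D i)"
    then show ?thesis using Suc.IH by (intro Ck_SucI[where D=D]) blast+
  qed
qed

lemma deriv_cong_open:
  assumes "openE n S" "x \<in> S" "i < n" "\<And>x. x \<in> S \<Longrightarrow> f x = g x"
    "((\<lambda>t. f (x(i := t))) has_real_derivative D) (at (x i))"
  shows "((\<lambda>t. g (x(i := t))) has_real_derivative D) (at (x i))"
proof -
  obtain d where d: "d>0" "\<And>t. \<bar>t - x i\<bar> < d \<Longrightarrow> x(i := t) \<in> S"
    using openin_E_line[OF assms(1-3)] by blast
  show ?thesis
    by (rule has_field_derivative_transform_within[OF assms(5) d(1)]) (use d assms(4) in \<open>auto simp: dist_real_def\<close>)
qed

lemma Ck_cong:
  assumes S: "openE n S" and eq: "\<And>x. x \<in> S \<Longrightarrow> f x = g x" and f: "Ck n k S f"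
  shows "Ck n k S g"
proof -
  have c: "continuous_on S g" using Ck_continuous[OF f] eq by (metis continuous_on_cong)
  show ?thesis
  proof (cases k)
    case (Suc k')
    from f show ?thesis unfolding Suc
    proof (rule Ck_SucE)
      fix D assume D: "\<And>i x. i<n \<Longrightarrow> x\<in>S \<Longrightarrow> ((\<lambda>t. f (x(i := t))) has_real_derivative D i x) (at (x i))"
      "\<And>i. i<n \<Longrightarrow> Ck n k' S (D i)"
      show "Ck n (Suc k') S g"
      proof (rule Ck_SucI[where D=D])
        show "((\<lambda>t. g (x(i := t))) has_real_derivative D i x) (at (x i))" if "i < n" "x \<in> S" for i x
          by (rule deriv_cong_open[OF S that(2,1) eq D(1)[OF that]])
      qed (use c D in auto)
    qed
  qed (use c in auto)
qed

text \<open>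
  On an open set the functions D in \<^const>\<open>Ck\<close> are determined by f. With a name for them the closure
  properties below are plain inductions on the order.
\<close>

lemma Ck_Suc_pd:
  assumes S: "openE n S"
  shows "Ck n (Suc k) S f \<longleftrightarrow> continuous_on S f \<and>
     (\<forall>i<n. (\<forall>x\<in>S. ((\<lambda>t. f (x(i := t))) has_real_derivative pd i f x) (at (x i))) \<and> Ck n k S (pd i f))"
proof
  assume f: "Ck n (Suc k) S f"
  then obtain D where D: "\<And>i x. i<n \<Longrightarrow> x\<in>S \<Longrightarrow> ((\<lambda>t. f (x(i := t))) has_real_derivative D i x) (at (x i))"
     "\<And>i. i<n \<Longrightarrow> Ck n k S (D i)" by (rule Ck_SucE) blast
  have eq: "D i x = pd i f x" if "i < n" "x \<in> S" for i x
    using D(1)[OF that] by (simp add: DERIV_imp_deriv pd_def)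
  then have "Ck n k S (pd i f)" if "i < n" for i using Ck_cong[OF S eq[OF that] D(2)[OF that]] by simp
  then show "continuous_on S f \<and>
     (\<forall>i<n. (\<forall>x\<in>S. ((\<lambda>t. f (x(i := t))) has_real_derivative pd i f x) (at (x i))) \<and> Ck n k S (pd i f))"
    using Ck_continuous[OF f] D(1) eq by auto
next
  assume "continuous_on S f \<and>
     (\<forall>i<n. (\<forall>x\<in>S. ((\<lambda>t. f (x(i := t))) has_real_derivative pd i f x) (at (x i))) \<and> Ck n k S (pd i f))"
  then show "Ck n (Suc k) S f" by (intro Ck_SucI[where D="\<lambda>i. pd i f"]) auto
qed

lemma Ck_local:
  assumes S: "openE n S"
    and loc: "\<And>x. x \<in> S \<Longrightarrow> \<exists>T. openE n T \<and> x \<in> T \<and> T \<subseteq> S \<and> Ck n k T f"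
  shows "Ck n k S f"
  using loc
proof (induction k arbitrary: f)
  case 0
  have SE: "S \<subseteq> EE n" using S openin_subset by blast
  show ?case unfolding Ck.simps continuous_on_E[OF SE]
  proof (intro ballI allI impI)
    fix z and e :: real assume z: "z \<in> S" and e: "e > 0"
    obtain T where T: "openE n T" "z \<in> T" "T \<subseteq> S" "continuous_on T f"
      using 0[OF z] by auto
    then obtain d where d: "d>0" "\<forall>x\<in>T. x \<in> cube n z d \<longrightarrow> \<bar>f x - f z\<bar> < e"
      using continuous_on_E[of T n f] SE e by blast
    obtain d' where d': "d'>0" "cube n z d' \<subseteq> T" using T openin_E_iff by blast
    then show "\<exists>d>0. \<forall>x\<in>S. x \<in> cube n z d \<longrightarrow> \<bar>f x - f z\<bar> < e"
      using d cube_mono[of "min d d'" d n z] cube_mono[of "min d d'" d' n z]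
      by (intro exI[of _ "min d d'"]) auto
  qed
next
  case (Suc k)
  note loc = Suc.prems
  have "continuous_on S f"
    using Suc.IH[of f] loc Ck_SucD Ck_continuous by metis
  moreover have "((\<lambda>t. f (x(i := t))) has_real_derivative pd i f x) (at (x i))" if "i<n" "x\<in>S" for i x
    using loc[OF that(2)] that(1) Ck_Suc_pd by blast
  moreover have "Ck n k S (pd i f)" if "i < n" for i
    using Suc.IH[of "pd i f"] loc Ck_Suc_pd that by metis
  ultimately show ?case by (rule Ck_SucI)
qed

lemma Ck_const: "Ck n k S (\<lambda>x. c)"
proof (induction k arbitrary: c)
  case (Suc k)
  show ?case by (rule Ck_SucI[where D="\<lambda>i x. 0"]) (auto intro: Suc)
qed auto

lemma continuous_on_coord: "continuous_on S (\<lambda>x :: nat \<Rightarrow> real. x l)"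
  by (rule continuous_on_subset[OF continuous_on_product_coordinates]) auto

lemma Ck_coord: "Ck n k S (\<lambda>x. x l)"
proof (cases k)
  case 0
  show ?thesis using 0 by (auto intro!: continuous_on_coord)
next
  case (Suc k')
  show ?thesis unfolding Suc
  proof (rule Ck_SucI[where D="\<lambda>i x. if i = l then 1 else 0"])
    fix i x assume "i < n" "x \<in> S"
    show "((\<lambda>t. (x(i := t)) l) has_real_derivative (if i = l then 1 else 0)) (at (x i))"
    proof (cases "i = l")
      case True
      then have "(\<lambda>t. (x(i := t)) l) = (\<lambda>t. t)" by auto
      then show ?thesis using True by simp
    next
      case False
      then have "(\<lambda>t. (x(i := t)) l) = (\<lambda>t. x l)" by auto
      then show ?thesis using False by simp
    qed
  qed (auto intro: Ck_const continuous_on_coord)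
qed

lemma Ck_add:
  assumes S: "openE n S"
  shows "Ck n k S f \<Longrightarrow> Ck n k S g \<Longrightarrow> Ck n k S (\<lambda>x. f x + g x)"
proof (induction k arbitrary: f g)
  case 0 then show ?case by (auto intro: continuous_intros)
next
  case (Suc k)
  note fg = Suc.prems[unfolded Ck_Suc_pd[OF S]]
  show ?case
  proof (rule Ck_SucI[where D="\<lambda>i x. pd i f x + pd i g x"])
    show "((\<lambda>t. f (x(i := t)) + g (x(i := t))) has_real_derivative pd i f x + pd i g x) (at (x i))"
      if "i < n" "x \<in> S" for i x using fg that by (intro DERIV_add) auto
    show "continuous_on S (\<lambda>x. f x + g x)" using fg by (intro continuous_on_add) auto
    show "Ck n k S (\<lambda>x. pd i f x + pd i g x)" if "i < n" for i
      using fg that by (intro Suc.IH) auto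
  qed
qed

lemma Ck_mult:
  assumes S: "openE n S"
  shows "Ck n k S f \<Longrightarrow> Ck n k S g \<Longrightarrow> Ck n k S (\<lambda>x. f x * g x)"
proof (induction k arbitrary: f g)
  case 0 then show ?case by (auto intro: continuous_intros)
next
  case (Suc k)
  note 1 = Ck_SucD[OF Suc.prems(1)] Ck_SucD[OF Suc.prems(2)]
  note fg = Suc.prems[unfolded Ck_Suc_pd[OF S]]
  show ?case
  proof (rule Ck_SucI[where D="\<lambda>i x. pd i f x * g x + pd i g x * f x"])
    show "continuous_on S (\<lambda>x. f x * g x)" using 1 Ck_continuous by (auto intro!: continuous_intros)
    show "Ck n k S (\<lambda>x. pd i f x * g x + pd i g x * f x)" if "i < n" for i
      using fg that 1 by (intro Ck_add[OF S] Suc.IH) auto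
    fix i x assume "i < n" "x \<in> S"
    then have "((\<lambda>t. f (x(i := t))) has_real_derivative pd i f x) (at (x i))"
      "((\<lambda>t. g (x(i := t))) has_real_derivative pd i g x) (at (x i))"
      using fg by blast+
    from DERIV_mult'[OF this]
    have "((\<lambda>t. f (x(i := t)) * g (x(i := t))) has_real_derivative f x * pd i g x + pd i f x * g x) (at (x i))"
      by (simp only: fun_upd_triv)
    then show "((\<lambda>t. f (x(i := t)) * g (x(i := t))) has_real_derivative pd i f x * g x + pd i g x * f x) (at (x i))"
      by (simp only: ac_simps)
  qed
qed

lemma Ck_sum:
  assumes S: "openE n S" and "finite J" "\<And>j. j \<in> J \<Longrightarrow> Ck n k S (f j)"
  shows "Ck n k S (\<lambda>x. \<Sum>j\<in>J. f j x)"
  using assms(2,3) by (induction J rule: finite_induct) (auto intro: Ck_const Ck_add[OF S])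

lemma Ck_uminus: 
  assumes S: "openE n S" and "Ck n k S f"
  shows "Ck n k S (\<lambda>x. - f x)"
  using Ck_mult[OF S Ck_const[of n k S "-1"] assms(2)] by simp

lemma Ck_inverse:
  assumes S: "openE n S"
  shows "Ck n k S f \<Longrightarrow> (\<And>x. x \<in> S \<Longrightarrow> f x \<noteq> 0) \<Longrightarrow> Ck n k S (\<lambda>x. inverse (f x))"
proof (induction k arbitrary: f)
  case 0 then show ?case by (auto intro: continuous_intros)
next
  case (Suc k)
  note 1 = Ck_SucD[OF Suc.prems(1)]
  note fg = Suc.prems(1)[unfolded Ck_Suc_pd[OF S]]
  show ?case
  proof (rule Ck_SucI[where D="\<lambda>i x. - (pd i f x * (inverse (f x) * inverse (f x)))"])
    show "continuous_on S (\<lambda>x. inverse (f x))"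
      using 1 Ck_continuous Suc.prems(2) by (auto intro!: continuous_intros)
    show "Ck n k S (\<lambda>x. - (pd i f x * (inverse (f x) * inverse (f x))))" if "i < n" for i
      using fg that 1 Suc.prems(2) by (intro Ck_uminus[OF S] Ck_mult[OF S] Suc.IH) auto
    fix i x assume "i < n" "x \<in> S"
    then have "((\<lambda>t. f (x(i := t))) has_real_derivative pd i f x) (at (x i))"
      using fg by blast
    moreover have "f (x(i := x i)) \<noteq> 0" unfolding fun_upd_triv using Suc.prems(2)[OF \<open>x \<in> S\<close>] .
    ultimately have "((\<lambda>t. inverse (f (x(i := t)))) has_real_derivative
       - (pd i f x * inverse ((f (x(i := x i))) ^ Suc (Suc 0)))) (at (x i))"
      by (rule DERIV_inverse_fun)
    then show "((\<lambda>t. inverse (f (x(i := t)))) has_real_derivative - (pd i f x * (inverse (f x) * inverse (f x)))) (at (x i))"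
      by (simp only: fun_upd_triv power_Suc power_0 mult_1_right inverse_mult_distrib)
  qed
qed

lemma slope_step:
  assumes S: "openE n S" and f: "Ck n (Suc 0) S f"
    and z: "z \<in> S" and d: "0 < d" "cube n z d \<subseteq> S" and x: "x \<in> cube n z d" and l: "l < n"
  shows "\<exists>\<xi>. (\<forall>i. \<bar>\<xi> i - z i\<bar> \<le> \<bar>x i - z i\<bar>) \<and>
     f (\<lambda>i. if i < Suc l then x i else z i) - f (\<lambda>i. if i < l then x i else z i) = pd l f \<xi> * (x l - z l)"
proof -
  have E: "x \<in> EE n" "z \<in> EE n" using subsetD[OF cube_sub x] openin_E_sub[OF S z] .
  define y where "y = (\<lambda>i. if i < l then x i else z i)"
  have y1: "(\<lambda>i. if i < Suc l then x i else z i) = y(l := x l)" "y = y(l := z l)"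
    by (auto simp: y_def fun_eq_iff)
  have inS: "y(l := t) \<in> S" if "\<bar>t - z l\<bar> \<le> \<bar>x l - z l\<bar>" for t
  proof -
    have "y(l := t) \<in> cube n z d"
      using x E l that d(1) by (auto simp: cube_def EE_iff y_def intro: le_less_trans)
    then show ?thesis using d by blast
  qed
  define u where "u t = f (y(l := t))" for t
  have du: "(u has_real_derivative pd l f (y(l := t))) (at t)" if "\<bar>t - z l\<bar> \<le> \<bar>x l - z l\<bar>" for t
  proof -
    have "((\<lambda>s. f ((y(l := t))(l := s))) has_real_derivative pd l f (y(l := t))) (at ((y(l := t)) l))"
      using f[unfolded Ck_Suc_pd[OF S]] l inS[OF that] by blast
    then show ?thesis by (simp add: u_def[abs_def])
  qed
  have "\<exists>s. \<bar>s - z l\<bar> \<le> \<bar>x l - z l\<bar> \<and> u (x l) - u (z l) = pd l f (y(l := s)) * (x l - z l)"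
  proof (cases "x l" "z l" rule: linorder_cases)
    case less
    then obtain s where "s > x l" "s < z l" "u (z l) - u (x l) = (z l - x l) * pd l f (y(l := s))"
      using MVT2[of "x l" "z l" u "\<lambda>t. pd l f (y(l := t))"] du by auto
    then show ?thesis by (intro exI[of _ s]) (auto simp: algebra_simps)
  next
    case greater
    then obtain s where "s > z l" "s < x l" "u (x l) - u (z l) = (x l - z l) * pd l f (y(l := s))"
      using MVT2[of "z l" "x l" u "\<lambda>t. pd l f (y(l := t))"] du by auto
    then show ?thesis by (intro exI[of _ s]) (auto simp: algebra_simps)
  qed auto
  then obtain s where s: "\<bar>s - z l\<bar> \<le> \<bar>x l - z l\<bar>" "u (x l) - u (z l) = pd l f (y(l := s)) * (x l - z l)"
    by blast
  have "\<forall>i. \<bar>(y(l := s)) i - z i\<bar> \<le> \<bar>x i - z i\<bar>" using s(1) by (simp add: y_def)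
  moreover have "f (y(l := x l)) - f y = pd l f (y(l := s)) * (x l - z l)"
    using s(2) y1(2) by (simp add: u_def)
  ultimately show ?thesis unfolding y1(1) unfolding y_def[symmetric] by blast
qed

text \<open>
  The coordinates are changed from z to x one at a time, with the mean value theorem for each step.
  This writes the increment of f as a linear form in \<open>x - z\<close> whose coefficients tend to the partial
  derivatives. It replaces the total derivative, both in the chain rule and for the derivatives of
  implicitly defined functions.
\<close>

lemma slope:
  assumes S: "openE n S" and f: "Ck n (Suc 0) S f"
    and z: "z \<in> S"
  obtains d \<phi> where "0 < d" "cube n z d \<subseteq> S"
    "\<And>x. x \<in> cube n z d \<Longrightarrow> f x - f z = (\<Sum>l<n. \<phi> l x * (x l - z l))"
    "\<And>l e. l < n \<Longrightarrow> 0 < e \<Longrightarrow> \<exists>d>0. \<forall>x\<in>cube n z d. \<bar>\<phi> l x - pd l f z\<bar> < e"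
proof -
  obtain d where d: "0 < d" "cube n z d \<subseteq> S" using S z openin_E_iff by blast
  have SE: "S \<subseteq> EE n" using S openin_subset by blast
  define \<xi> where "\<xi> l x = (SOME \<xi>. (\<forall>i. \<bar>\<xi> i - z i\<bar> \<le> \<bar>x i - z i\<bar>) \<and>
     f (\<lambda>i. if i < Suc l then x i else z i) - f (\<lambda>i. if i < l then x i else z i) = pd l f \<xi> * (x l - z l))"
    for l x
  have \<xi>: "\<bar>\<xi> l x i - z i\<bar> \<le> \<bar>x i - z i\<bar>"
     "f (\<lambda>i. if i < Suc l then x i else z i) - f (\<lambda>i. if i < l then x i else z i) = pd l f (\<xi> l x) * (x l - z l)"
    if "l < n" "x \<in> cube n z d" for l x i
    using someI_ex[OF slope_step[OF S f z d that(2,1)], folded \<xi>_def] by blast+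
  have in_box: "\<xi> l x \<in> cube n z d'" if "l < n" "x \<in> cube n z d" "x \<in> cube n z d'" for l x d'
  proof -
    have "\<xi> l x i = 0" if "i \<ge> n" for i
    proof -
      have "z i = 0" "x i = 0" using that z SE \<open>x \<in> cube n z d\<close> cube_sub[of n z d] by (auto simp: EE_iff subset_iff)
      then show ?thesis using \<xi>(1)[OF \<open>l<n\<close> \<open>x \<in> cube n z d\<close>, of i] by simp
    qed
    moreover have "\<bar>\<xi> l x i - z i\<bar> < d'" if "i < n" for i
      using \<xi>(1)[OF \<open>l<n\<close> \<open>x \<in> cube n z d\<close>, of i] \<open>x \<in> cube n z d'\<close> that by (force simp: cube_def)
    ultimately show ?thesis by (simp add: cube_def EE_iff)
  qed
  show ?thesis
  proof (rule that[of d "\<lambda>l x. pd l f (\<xi> l x)", OF d])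
    fix x assume x: "x \<in> cube n z d"
    have "(\<Sum>l<k. pd l f (\<xi> l x) * (x l - z l)) = f (\<lambda>i. if i < k then x i else z i) - f z" if "k \<le> n" for k
      using that
    proof (induction k)
      case (Suc k)
      then show ?case using \<xi>(2)[of k x] x by simp
    qed simp
    moreover have "(\<lambda>i. if i < n then x i else z i) = x"
      using x z SE by (auto simp: cube_def EE_iff fun_eq_iff subset_iff)
    ultimately show "f x - f z = (\<Sum>l<n. pd l f (\<xi> l x) * (x l - z l))" by simp
  next
    fix l and e :: real assume l: "l < n" and e: "0 < e"
    have "continuous_on S (pd l f)" using f[unfolded Ck_Suc_pd[OF S]] l unfolding Ck.simps(1) by blast
    then obtain d' where d': "d'>0" "\<And>x. x\<in>S \<Longrightarrow> x \<in> cube n z d' \<Longrightarrow> \<bar>pd l f x - pd l f z\<bar> < e"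
      using e z unfolding continuous_on_E[OF SE] by blast
    have "\<bar>pd l f (\<xi> l x) - pd l f z\<bar> < e" if "x \<in> cube n z (min d d')" for x
    proof -
      have "x \<in> cube n z d" "x \<in> cube n z d'" using that by (auto simp: cube_def)
      then show ?thesis using in_box[OF l] d'(2) d(2) by blast
    qed
    then show "\<exists>d>0. \<forall>x\<in>cube n z d. \<bar>pd l f (\<xi> l x) - pd l f z\<bar> < e"
      using d(1) d'(1) by (intro exI[of _ "min d d'"]) auto
  qed
qed

lemma eventually_in_cube:
  assumes "\<And>l. l < n \<Longrightarrow> ((\<lambda>t. c t l) \<longlongrightarrow> z l) F" "\<forall>\<^sub>F t in F. c t \<in> EE n" "0 < d"
  shows "\<forall>\<^sub>F t in F. c t \<in> cube n z d"
proof -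
  have "\<forall>\<^sub>F t in F. \<forall>l\<in>{..<n}. \<bar>c t l - z l\<bar> < d"
    using assms(1,3) by (intro eventually_ball_finite) (auto simp: tendsto_iff dist_real_def)
  with assms(2) show ?thesis by eventually_elim (auto simp: cube_def)
qed

lemma slope_tendsto:
  assumes "\<And>e. 0 < e \<Longrightarrow> \<exists>d>0. \<forall>x\<in>cube n z d. \<bar>\<phi> x - p\<bar> < (e::real)"
    and "\<And>l. l < n \<Longrightarrow> ((\<lambda>t. c t l) \<longlongrightarrow> z l) F" "\<forall>\<^sub>F t in F. c t \<in> EE n"
  shows "((\<lambda>t. \<phi> (c t)) \<longlongrightarrow> p) F"
  unfolding tendsto_iff dist_real_def
proof (intro allI impI)
  fix e :: real assume "0 < e"
  then obtain d where d: "d>0" "\<forall>x\<in>cube n z d. \<bar>\<phi> x - p\<bar> < e" using assms(1) by blast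
  show "\<forall>\<^sub>F t in F. \<bar>\<phi> (c t) - p\<bar> < e"
    by (rule eventually_mono[OF eventually_in_cube[OF assms(2,3) d(1)]]) (use d in auto)
qed

lemma chain_curve:
  assumes S: "openE n S" and f: "Ck n (Suc 0) S f" and z: "c t0 \<in> S"
    and E: "\<forall>\<^sub>F t in at t0. c t \<in> EE n"
    and c: "\<And>l. l < n \<Longrightarrow> ((\<lambda>t. c t l) has_real_derivative c' l) (at t0)"
  shows "((\<lambda>t. f (c t)) has_real_derivative (\<Sum>l<n. pd l f (c t0) * c' l)) (at t0)"
proof -
  obtain \<phi> d where sl: "0 < d" "cube n (c t0) d \<subseteq> S"
    "\<And>x. x \<in> cube n (c t0) d \<Longrightarrow> f x - f (c t0) = (\<Sum>l<n. \<phi> l x * (x l - c t0 l))"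
    "\<And>l e. l < n \<Longrightarrow> 0 < e \<Longrightarrow> \<exists>d>0. \<forall>x\<in>cube n (c t0) d. \<bar>\<phi> l x - pd l f (c t0)\<bar> < e"
    by (rule slope[OF S f z], rule that)
  have cont: "((\<lambda>t. c t l) \<longlongrightarrow> c t0 l) (at t0)" if "l < n" for l
    using DERIV_isCont[OF c[OF that]] by (simp add: isCont_def)
  have "((\<lambda>t. \<Sum>l<n. \<phi> l (c t) * ((c t l - c t0 l) / (t - t0))) \<longlongrightarrow> (\<Sum>l<n. pd l f (c t0) * c' l)) (at t0)"
    using c by (intro tendsto_sum tendsto_mult slope_tendsto[OF sl(4) cont E])
      (auto simp: has_field_derivative_iff)
  moreover have "\<forall>\<^sub>F t in at t0. (\<Sum>l<n. \<phi> l (c t) * ((c t l - c t0 l) / (t - t0))) = (f (c t) - f (c t0)) / (t - t0)"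
    by (rule eventually_mono[OF eventually_in_cube[OF cont E sl(1)]]) (simp_all add: sl(3) sum_divide_distrib)
  ultimately show ?thesis
    unfolding has_field_derivative_iff by (rule Lim_transform_eventually)
qed

text \<open>
  The chain rule expresses the partial derivatives of the composite by sums of products to which the
  induction hypothesis applies.
\<close>

lemma Ck_comp:
  assumes S: "openE n S" and T: "openE m T"
    and gT: "g ` S \<subseteq> T"
  shows "(\<And>j. j < m \<Longrightarrow> Ck n k S (\<lambda>x. g x j)) \<Longrightarrow> Ck m k T f \<Longrightarrow> Ck n k S (\<lambda>x. f (g x))"
proof (induction k arbitrary: f)
  case 0
  have "g ` S \<subseteq> EE m" using gT T openin_subset by blast
  then have "continuous_on S g" using 0 by (intro continuous_on_to_E) auto
  then show ?case using 0 gT continuous_on_compose2[of T f S g] by simp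
next
  case (Suc k)
  have TE: "T \<subseteq> EE m" using T openin_subset by blast
  note g1 = Ck_SucD[OF Suc.prems(1)]
  have f1: "Ck m (Suc 0) T f" "Ck n (Suc 0) S (\<lambda>x. g x j)" if "j < m" for j
    using Suc.prems that by (induction k) (auto dest: Ck_SucD)
  have f1: "Ck m (Suc 0) T f"
    using Suc.prems(2) by (induction k) (auto dest: Ck_SucD)
  note f = Suc.prems(2)[unfolded Ck_Suc_pd[OF T]]
  have g: "((\<lambda>t. g (x(i := t)) j) has_real_derivative pd i (\<lambda>x. g x j) x) (at (x i))"
      "Ck n k S (pd i (\<lambda>x. g x j))" if "j < m" "i < n" "x \<in> S" for i j x
    using Suc.prems(1)[OF that(1), unfolded Ck_Suc_pd[OF S]] that by blast+
  show ?case
  proof (rule Ck_SucI[where D="\<lambda>i x. \<Sum>l<m. pd l f (g x) * pd i (\<lambda>x. g x l) x"])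
    show "continuous_on S (\<lambda>x. f (g x))"
      by (rule Ck_continuous[OF Suc.IH[OF g1 Ck_SucD[OF Suc.prems(2)]]])
  next
    fix i x assume ix: "i < n" "x \<in> S"
    have "((\<lambda>t. f (g (x(i := t)))) has_real_derivative (\<Sum>l<m. pd l f (g (x(i := x i))) * pd i (\<lambda>x. g x l) x)) (at (x i))"
    proof (rule chain_curve[OF T f1])
      show "g (x(i := x i)) \<in> T" using gT ix by auto
      obtain d where d: "d>0" "\<And>t. \<bar>t - x i\<bar> < d \<Longrightarrow> x(i := t) \<in> S"
        using openin_E_line[OF S ix(2,1)] by blast
      then have "\<forall>\<^sub>F t in at (x i). x(i := t) \<in> S"
        unfolding eventually_at by (auto simp: dist_real_def)
      then show "\<forall>\<^sub>F t in at (x i). g (x(i := t)) \<in> EE m"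
        by eventually_elim (use gT TE in blast)
    qed (use g ix in auto)
    then show "((\<lambda>t. f (g (x(i := t)))) has_real_derivative (\<Sum>l<m. pd l f (g x) * pd i (\<lambda>x. g x l) x)) (at (x i))"
      by simp
  next
    fix i assume i: "i < n"
    have "Ck n k S (\<lambda>x. pd l f (g x) * pd i (\<lambda>x. g x l) x)" if "l < m" for l
    proof (rule Ck_mult[OF S])
      have "Ck m k T (pd l f)" using f that by blast
      with g1 show "Ck n k S (\<lambda>x. pd l f (g x))" by (rule Suc.IH[where f="pd l f"])
      show "Ck n k S (pd i (\<lambda>x. g x l))"
        using Suc.prems(1)[OF that, unfolded Ck_Suc_pd[OF S]] i by blast
    qed
    then show "Ck n k S (\<lambda>x. \<Sum>l<m. pd l f (g x) * pd i (\<lambda>x. g x l) x)"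
      by (intro Ck_sum[OF S]) auto
  qed
qed

section \<open>Normal form of a smooth map\<close>

lemma open_preimage_E:
  assumes "openE n S" "continuous_on S g" "g ` S \<subseteq> EE m" "openE m T"
  shows "openE n {x \<in> S. g x \<in> T}"
proof -
  have top: "topspace (subtopology (Euclidean_space n) S) = S"
    using openin_subset[OF assms(1)] by auto
  have "continuous_map (subtopology (Euclidean_space n) S) (Euclidean_space m) g"
    unfolding cm_Euclidean_space_iff_continuous_on top using assms(2,3) by auto
  from openin_continuous_map_preimage[OF this assms(4)] show ?thesis
    unfolding top by (rule openin_trans_full[OF _ assms(1)])
qed

text \<open>
  The factor p only serves to treat both signs of the derivative at once.
\<close>

lemma open_upd_monotone:
  assumes Q: "openE n Q" and g: "Ck n (Suc 0) Q g" and i: "i < n"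
    and pos: "\<And>x. x \<in> Q \<Longrightarrow> pd i g x * p > 0"
    and line: "\<And>t. t1 \<le> t \<Longrightarrow> t \<le> t2 \<Longrightarrow> x(i := t) \<in> Q" and t: "t1 < t2"
  shows "g (x(i := t1)) * p < g (x(i := t2)) * p"
    and "continuous_on {t1..t2} (\<lambda>t. g (x(i := t)) * p)"
proof -
  have der: "((\<lambda>t. g (x(i := t)) * p) has_real_derivative pd i g (x(i := t)) * p) (at t)"
    if "t1 \<le> t" "t \<le> t2" for t
  proof -
    have "((\<lambda>s. g ((x(i := t))(i := s))) has_real_derivative pd i g (x(i := t))) (at ((x(i := t)) i))"
      using g[unfolded Ck_Suc_pd[OF Q]] i line[OF that] by blast
    then have "((\<lambda>s. g (x(i := s))) has_real_derivative pd i g (x(i := t))) (at t)"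
      by (simp only: fun_upd_upd fun_upd_same)
    then show ?thesis by (rule DERIV_cmult_right)
  qed
  show "g (x(i := t1)) * p < g (x(i := t2)) * p"
    by (rule DERIV_pos_imp_increasing[OF t]) (use der pos line in blast)
  show "continuous_on {t1..t2} (\<lambda>t. g (x(i := t)) * p)"
    by (rule DERIV_continuous_on, rule has_field_derivative_at_within, rule der) auto
qed

text \<open>
  Exchanging the coordinate i for the function g, where \<open>\<zeta>\<close> is the inverse of \<open>G x = x(i := g x)\<close>. On a small
  cube the derivative of g in direction i has a fixed sign. So g is strictly monotone along the
  lines in this direction: G is injective, and it is open by the intermediate value theorem.
  Differentiability of \<open>\<zeta>\<close> comes from the expansion of g. The resulting formula for its derivatives
  involves only \<open>\<zeta>\<close> itself and derivatives of g, which gives smoothness by induction.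
\<close>

lemma solve_coordinate:
  assumes Q: "openE n Q" and g: "\<And>k. Ck n k Q g" and i: "i < n"
    and y0: "y0 \<in> Q" and nz: "pd i g y0 \<noteq> 0"
  obtains Q' \<zeta> where "openE n Q'" "Q' \<noteq> {}" "\<zeta> ` Q' \<subseteq> Q"
    "\<And>k j. j < n \<Longrightarrow> Ck n k Q' (\<lambda>y. \<zeta> y j)"
    "\<And>y l. y \<in> Q' \<Longrightarrow> l \<noteq> i \<Longrightarrow> \<zeta> y l = y l"
    "\<And>y. y \<in> Q' \<Longrightarrow> g (\<zeta> y) = y i" "inj_on \<zeta> Q'"
    "\<And>O'. openE n O' \<Longrightarrow> O' \<subseteq> Q' \<Longrightarrow> openE n (\<zeta> ` O')"
proof -
  have QE: "Q \<subseteq> EE n" using Q by (rule openin_subset)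
  define p where "p = pd i g y0"
  have "continuous_on Q (pd i g)" using g[of "Suc 0", unfolded Ck_Suc_pd[OF Q]] i unfolding Ck.simps(1) by blast
  then obtain d1 where d1: "d1 > 0" "\<And>x. x\<in>Q \<Longrightarrow> x \<in> cube n y0 d1 \<Longrightarrow> \<bar>pd i g x - p\<bar> < \<bar>p\<bar>"
    using y0 nz unfolding continuous_on_E[OF QE] p_def by (meson zero_less_abs_iff)
  obtain d2 where d2: "d2 > 0" "cube n y0 d2 \<subseteq> Q" using Q y0 openin_E_iff by blast
  \<comment> \<open>on the cube of radius \<open>\<epsilon>\<close> the derivative of g in direction i has the sign of p\<close>
  define \<epsilon> where "\<epsilon> = min d1 d2"
  have eps: "\<epsilon> > 0" using d1 d2 by (simp add: \<epsilon>_def)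
  define Q0 where "Q0 = cube n y0 \<epsilon>"
  have Q0: "openE n Q0" "Q0 \<subseteq> Q" "y0 \<in> Q0" "Q0 \<subseteq> EE n"
    using open_cube cube_mono[of \<epsilon> d2 n y0] d2 cube_self[OF _ eps, of y0 n] QE y0 cube_sub unfolding Q0_def
    by (auto simp: \<epsilon>_def)
  have pos: "pd i g x * p > 0" if "x \<in> Q0" for x
  proof -
    have "\<bar>pd i g x - p\<bar> < \<bar>p\<bar>"
      using d1(2)[of x] that Q0(2) cube_mono[of \<epsilon> d1 n y0] by (auto simp: Q0_def \<epsilon>_def)
    then show ?thesis by (auto simp: zero_less_mult_iff abs_if split: if_splits)
  qed
  have p: "p \<noteq> 0" using nz by (simp add: p_def)
  have g0: "Ck n k Q0 g" for k using Ck_subset[OF g Q0(2)] .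
  have upd: "x(i := t) \<in> Q0" if "x \<in> Q0" "\<bar>t - y0 i\<bar> < \<epsilon>" for x t
    using that i by (auto simp: Q0_def cube_def EE_iff)
  have co: "\<bar>x i - y0 i\<bar> < \<epsilon>" if "x \<in> Q0" for x using that i by (auto simp: Q0_def cube_def)
  have seg: "x(i := t) \<in> Q0" if "x(i := t1) \<in> Q0" "x(i := t2) \<in> Q0" "t1 \<le> t" "t \<le> t2" for x t t1 t2
  proof -
    have "\<bar>t - y0 i\<bar> < \<epsilon>" using co[OF that(1)] co[OF that(2)] that(3,4) by auto
    from upd[OF that(1) this] show ?thesis by simp
  qed
  have mono: "g (x(i := t1)) * p < g (x(i := t2)) * p"
      "continuous_on {t1..t2} (\<lambda>t. g (x(i := t)) * p)"
    if "x(i := t1) \<in> Q0" "x(i := t2) \<in> Q0" "t1 < t2" for x t1 t2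
    using open_upd_monotone[OF Q0(1) g0 i pos seg[OF that(1,2)] that(3)] by blast+
  define G where "G x = x(i := g x)" for x
  have injG: "inj_on G Q0"
  proof (rule inj_onI, rule ccontr)
    fix x x' assume x: "x \<in> Q0" "x' \<in> Q0" "G x = G x'" "x \<noteq> x'"
    have off: "x l = x' l" if "l \<noteq> i" for l using fun_cong[OF x(3), of l] that by (simp add: G_def)
    have eq: "x' = x(i := x' i)" "x = x(i := x i)" using off by auto
    have gg: "g x = g x'" using fun_cong[OF x(3), of i] by (simp add: G_def)
    have "x i \<noteq> x' i" using off x(4) by (metis ext)
    then consider "x i < x' i" | "x' i < x i" by linarith
    then show False
    proof cases
      case 1 
      have "g (x(i := x i)) * p < g (x(i := x' i)) * p" by (rule mono(1)[OF _ _ 1]) (use x eq in simp_all)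
      then show False using gg unfolding eq(1)[symmetric] fun_upd_triv by simp
    next
      case 2
      have "g (x(i := x' i)) * p < g (x(i := x i)) * p" by (rule mono(1)[OF _ _ 2]) (use x eq in simp_all)
      then show False using gg unfolding eq(1)[symmetric] fun_upd_triv by simp
    qed
  qed
  have GE: "G x \<in> EE n" if "x \<in> Q0" for x
    unfolding G_def using Q0(4) that i EE_upd by blast
  have openG: "openE n (G ` O')" if O: "openE n O'" "O' \<subseteq> Q0" for O'
    unfolding openin_E_iff
  proof (intro conjI ballI)
    show "G ` O' \<subseteq> EE n" using GE O(2) by auto
    fix y assume "y \<in> G ` O'"
    then obtain x where x: "x \<in> O'" "y = G x" by blast
    obtain d where d: "d > 0" "cube n x d \<subseteq> O'" using O(1) x openin_E_iff by blast
    have xE: "x \<in> EE n" using x O Q0 by blast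
    define t1 t2 where "t1 = x i - d/2" and "t2 = x i + d/2"
    have tt: "t1 < x i" "x i < t2" "t1 < t2" using d by (auto simp: t1_def t2_def)
    have lineO: "x(i := t) \<in> O'" if "t1 \<le> t" "t \<le> t2" for t
    proof -
      have "x(i := t) \<in> cube n x d" using xE i d that by (auto simp: cube_def EE_iff t1_def t2_def)
      then show ?thesis using d by blast
    qed
    have lt: "g (x(i := t1)) * p < g x * p" "g x * p < g (x(i := t2)) * p"
    proof -
      have "x(i := t1) \<in> Q0" "x(i := x i) \<in> Q0" "x(i := t2) \<in> Q0"
        using tt by (intro subsetD[OF O(2) lineO]; simp)+
      then have "g (x(i := t1)) * p < g (x(i := x i)) * p" "g (x(i := x i)) * p < g (x(i := t2)) * p"
        using tt mono(1) by blast+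
      then show "g (x(i := t1)) * p < g x * p" "g x * p < g (x(i := t2)) * p" by (simp_all only: fun_upd_triv)
    qed
    define \<eta> where "\<eta> = min (g x * p - g (x(i := t1)) * p) (g (x(i := t2)) * p - g x * p)"
    have eta: "\<eta> > 0" using lt by (simp add: \<eta>_def)
    \<comment> \<open>a change of g by less than e changes \<open>g * p\<close> by less than half of the margin \<open>\<eta>\<close>\<close>
  define e where "e = \<eta> / (2 * \<bar>p\<bar>)"
    have e: "e > 0" using eta p by (simp add: e_def)
    have ep: "\<bar>a * p\<bar> < \<eta> / 2" if "\<bar>a\<bar> < e" for a
      using that p by (simp add: e_def abs_mult field_simps)
    have cg: "\<exists>\<delta>>0. \<forall>w\<in>Q0. w \<in> cube n (x(i := t)) \<delta> \<longrightarrow> \<bar>g w - g (x(i := t))\<bar> < e" if "x(i := t) \<in> Q0" for t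
      using Ck_continuous[OF g0[of 0]] that e unfolding continuous_on_E[OF Q0(4)] by blast
    have in12: "x(i := t1) \<in> Q0" "x(i := t2) \<in> Q0" using lineO tt O(2) by force+
    obtain \<delta>1 where \<delta>1: "\<delta>1 > 0" "\<And>w. w\<in>Q0 \<Longrightarrow> w \<in> cube n (x(i := t1)) \<delta>1 \<Longrightarrow> \<bar>g w - g (x(i := t1))\<bar> < e"
      using cg[OF in12(1)] by blast
    obtain \<delta>2 where \<delta>2: "\<delta>2 > 0" "\<And>w. w\<in>Q0 \<Longrightarrow> w \<in> cube n (x(i := t2)) \<delta>2 \<Longrightarrow> \<bar>g w - g (x(i := t2))\<bar> < e"
      using cg[OF in12(2)] by blast
    define \<delta> where "\<delta> = min (min \<delta>1 \<delta>2) (min d e)"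
    have \<delta>: "\<delta> > 0" "\<delta> \<le> \<delta>1" "\<delta> \<le> \<delta>2" "\<delta> \<le> d" "\<delta> \<le> e" using \<delta>1 \<delta>2 d e by (auto simp: \<delta>_def)
    have "y' \<in> G ` O'" if y': "y' \<in> cube n y \<delta>" for y'
    proof -
      have near: "\<bar>y' l - x l\<bar> < \<delta>" if "l < n" "l \<noteq> i" for l
        using y' that by (auto simp: cube_def x(2) G_def)
      have y'E: "y' \<in> EE n" using y' cube_sub by blast
      have yO: "y'(i := t) \<in> O'" if "t1 \<le> t" "t \<le> t2" for t
      proof -
        have "\<bar>t - x i\<bar> < d" using that d by (auto simp: t1_def t2_def)
        then have "y'(i := t) \<in> cube n x d" using y'E i near \<delta>(4) by (force simp: cube_def EE_iff)
        then show ?thesis using d by blast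
      qed
      have yi: "\<bar>y' i - g x\<bar> < e" using y' i \<delta>(5) by (force simp: cube_def x(2) G_def)
      have "y'(i := t1) \<in> cube n (x(i := t1)) \<delta>1" "y'(i := t2) \<in> cube n (x(i := t2)) \<delta>2"
        using near \<delta> y'E i \<delta>1(1) \<delta>2(1) by (force simp: cube_def EE_iff)+
      moreover have "y'(i := t1) \<in> Q0" "y'(i := t2) \<in> Q0" using yO tt O(2) by force+
      ultimately have "\<bar>g (y'(i := t1)) - g (x(i := t1))\<bar> < e" "\<bar>g (y'(i := t2)) - g (x(i := t2))\<bar> < e"
        using \<delta>1(2) \<delta>2(2) by blast+
      from ep[OF this(1)] ep[OF this(2)] ep[OF yi]
      have "\<bar>g (y'(i := t1)) * p - g (x(i := t1)) * p\<bar> < \<eta> / 2"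
        "\<bar>g (y'(i := t2)) * p - g (x(i := t2)) * p\<bar> < \<eta> / 2" "\<bar>y' i * p - g x * p\<bar> < \<eta> / 2"
        by (simp_all only: left_diff_distrib)
      moreover have "\<eta> \<le> g x * p - g (x(i := t1)) * p" "\<eta> \<le> g (x(i := t2)) * p - g x * p"
        by (simp_all add: \<eta>_def)
      ultimately have bd: "g (y'(i := t1)) * p \<le> y' i * p" "y' i * p \<le> g (y'(i := t2)) * p"
        by (smt (verit) field_sum_of_halves)+
      have "continuous_on {t1..t2} (\<lambda>t. g (y'(i := t)) * p)"
        by (rule mono(2)[OF _ _ tt(3)]) (use yO tt O(2) in force)+
      then obtain t where t: "t1 \<le> t" "t \<le> t2" "g (y'(i := t)) * p = y' i * p"
        using IVT'[of "\<lambda>t. g (y'(i := t)) * p" t1 "y' i * p" t2] bd tt by auto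
      then have "G (y'(i := t)) = y'" using p by (simp add: G_def)
      then show ?thesis using yO[OF t(1,2)] by (metis imageI)
    qed
    then show "\<exists>d>0. cube n y d \<subseteq> G ` O'" using \<delta>(1) by blast
  qed
  define Q' where "Q' = G ` Q0"
  define \<zeta> where "\<zeta> = inv_into Q0 G"
  have Q': "openE n Q'" unfolding Q'_def using openG Q0 by blast
  have chi: "\<zeta> y \<in> Q0" "G (\<zeta> y) = y" if "y \<in> Q'" for y
    using that inv_into_into[of y G Q0] f_inv_into_f[of y G Q0] unfolding Q'_def \<zeta>_def by blast+
  have chiG: "\<zeta> (G x) = x" if "x \<in> Q0" for x
    using that injG unfolding \<zeta>_def by (rule inv_into_f_f[rotated])
  have off: "\<zeta> y l = y l" if "y \<in> Q'" "l \<noteq> i" for y l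
    using fun_cong[OF chi(2)[OF that(1)], of l] that(2) by (simp add: G_def)
  have sol: "g (\<zeta> y) = y i" if "y \<in> Q'" for y
    using fun_cong[OF chi(2)[OF that], of i] by (simp add: G_def)
  have Q'E: "Q' \<subseteq> EE n" using Q' by (rule openin_subset)
  define h where "h y = \<zeta> y i" for y
  have hcont: "\<exists>d>0. \<forall>y\<in>cube n z d. y \<in> Q' \<and> \<bar>h y - h z\<bar> < e" if "z \<in> Q'" "e > 0" for z e
  proof -
    have "openE n (G ` (Q0 \<inter> cube n (\<zeta> z) e))"
      by (intro openG openin_Int Q0 open_cube) auto
    moreover have "z \<in> G ` (Q0 \<inter> cube n (\<zeta> z) e)"
    proof -
      have "\<zeta> z \<in> EE n" using chi(1)[OF that(1)] Q0(4) by blast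
      then show ?thesis using chi[OF that(1)] cube_self[OF _ that(2), of "\<zeta> z" n] by (metis IntI imageI)
    qed
    ultimately obtain d where d: "d > 0" "cube n z d \<subseteq> G ` (Q0 \<inter> cube n (\<zeta> z) e)" using openin_E_iff by blast
    have "y \<in> Q' \<and> \<bar>h y - h z\<bar> < e" if y: "y \<in> cube n z d" for y
    proof -
      obtain x where x: "x \<in> Q0" "x \<in> cube n (\<zeta> z) e" "y = G x" using d y by blast
      have "h y = x i" using chiG[OF x(1)] by (simp add: h_def x(3))
      then show ?thesis using x i by (auto simp: Q'_def cube_def h_def)
    qed
    then show ?thesis using d(1) by blast
  qed
  have hc: "continuous_on Q' h"
    unfolding continuous_on_E[OF Q'E] using hcont by meson
  \<comment> \<open>the derivatives of the implicit function, from differentiating \<open>g (\<zeta> y) = y i\<close>\<close>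
  define D where "D l y = (if l = i then 1 else - pd l g (\<zeta> y)) * inverse (pd i g (\<zeta> y))" for l y
  have gi: "pd i g (\<zeta> y) \<noteq> 0" if "y \<in> Q'" for y using pos[OF chi(1)[OF that]] by auto
  have hder: "((\<lambda>t. h (y(l := t))) has_real_derivative D l y) (at (y l))" if y: "y \<in> Q'" and l: "l < n" for y l
  proof -
    obtain \<phi> d where sl: "0 < d" "cube n (\<zeta> y) d \<subseteq> Q0"
      "\<And>x. x \<in> cube n (\<zeta> y) d \<Longrightarrow> g x - g (\<zeta> y) = (\<Sum>m<n. \<phi> m x * (x m - \<zeta> y m))"
      "\<And>m e. m < n \<Longrightarrow> 0 < e \<Longrightarrow> \<exists>d>0. \<forall>x\<in>cube n (\<zeta> y) d. \<bar>\<phi> m x - pd m g (\<zeta> y)\<bar> < e"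
      by (rule slope[OF Q0(1) g0 chi(1)[OF y]], rule that)
    define c where "c t = \<zeta> (y(l := t))" for t
    have yE: "\<forall>\<^sub>F t in at (y l). y(l := t) \<in> EE n" using y Q'E EE_upd l by auto
    have ylim: "((\<lambda>t. (y(l := t)) m) \<longlongrightarrow> y m) (at (y l))" for m
    proof (cases "m = l")
      case True
      then have "(\<lambda>t. (y(l := t)) m) = (\<lambda>t. t)" by auto
      then show ?thesis using True by (simp only: tendsto_ident_at)
    qed auto
    have inQ: "\<forall>\<^sub>F t in at (y l). y(l := t) \<in> Q'"
    proof -
      obtain d where "d>0" "\<And>t. \<bar>t - y l\<bar> < d \<Longrightarrow> y(l := t) \<in> Q'"
        using openin_E_line[OF Q' y l] by blast
      then show ?thesis unfolding eventually_at by (auto simp: dist_real_def)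
    qed
    have hlim: "((\<lambda>t. h (y(l := t))) \<longlongrightarrow> h y) (at (y l))"
    proof (rule slope_tendsto[where n=n and \<phi>=h and c="\<lambda>t. y(l := t)" and z=y])
      show "\<exists>d>0. \<forall>x\<in>cube n y d. \<bar>h x - h y\<bar> < e" if "e > 0" for e using hcont[OF y that] by blast
    qed (rule ylim yE)+
    have clim: "((\<lambda>t. c t m) \<longlongrightarrow> \<zeta> y m) (at (y l))" for m
    proof (cases "m = i")
      case True then show ?thesis using hlim by (simp add: c_def h_def)
    next
      case False
      have "((\<lambda>t. c t m) \<longlongrightarrow> y m) (at (y l))"
        by (rule Lim_transform_eventually[OF ylim]) (rule eventually_mono[OF inQ], simp only: c_def off[OF _ False])
      then show ?thesis using off[OF y False] by simp
    qed
    have cE: "\<forall>\<^sub>F t in at (y l). c t \<in> EE n"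
      by (rule eventually_mono[OF inQ]) (use chi Q0(4) in \<open>auto simp: c_def\<close>)
    have cbx: "\<forall>\<^sub>F t in at (y l). c t \<in> cube n (\<zeta> y) d"
      by (rule eventually_in_cube[OF clim cE sl(1)])
    have plim: "((\<lambda>t. \<phi> m (c t)) \<longlongrightarrow> pd m g (\<zeta> y)) (at (y l))" if "m < n" for m
      by (rule slope_tendsto[OF sl(4)[OF that] clim cE])
    have "((\<lambda>t. (if l = i then 1 else - \<phi> l (c t)) * inverse (\<phi> i (c t))) \<longlongrightarrow> D l y) (at (y l))"
      unfolding D_def using gi[OF y] plim i l by (auto intro!: tendsto_intros)
    moreover have ne: "\<forall>\<^sub>F t in at (y l). t \<noteq> y l" by (simp add: eventually_at_filter)
    have "\<forall>\<^sub>F t in at (y l). (if l = i then 1 else - \<phi> l (c t)) * inverse (\<phi> i (c t)) = (h (y(l := t)) - h (y(l := y l))) / (t - y l)"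
      using cbx inQ tendsto_imp_eventually_ne[OF plim[OF i] gi[OF y]] ne
    proof (eventually_elim)
      case (elim t)
      have z: "\<phi> m (c t) * (c t m - \<zeta> y m) = 0" if "m \<noteq> i" "m \<noteq> l" for m
        using off[OF elim(2) that(1)] off[OF y that(1)] that(2) by (simp add: c_def)
      have "(y(l := t)) i - y i = (\<Sum>m<n. \<phi> m (c t) * (c t m - \<zeta> y m))"
        using sl(3)[OF elim(1)] sol[OF elim(2)] sol[OF y] by (simp add: c_def)
      also have "\<dots> = (\<Sum>m\<in>{i,l}. \<phi> m (c t) * (c t m - \<zeta> y m))"
        by (rule sum.mono_neutral_right) (use z i l in auto)
      finally have eq: "(y(l := t)) i - y i = (\<Sum>m\<in>{i,l}. \<phi> m (c t) * (c t m - \<zeta> y m))" .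
      have hh: "h (y(l := t)) - h (y(l := y l)) = c t i - \<zeta> y i" by (simp add: h_def c_def)
      show ?case
      proof (cases "l = i")
        case True
        then have "t - y l = \<phi> i (c t) * (c t i - \<zeta> y i)" using eq by simp
        then show ?thesis using True elim(3,4) unfolding hh by (auto simp: field_simps)
      next
        case False
        then have "c t l - \<zeta> y l = t - y l" using off[OF elim(2) False] off[OF y False] by (simp add: c_def)
        then have "\<phi> i (c t) * (c t i - \<zeta> y i) = - \<phi> l (c t) * (t - y l)" using eq False by auto
        then show ?thesis using False elim(3,4) unfolding hh by (simp add: field_simps)
      qed
    qed
    ultimately show ?thesis
      unfolding has_field_derivative_iff by (rule Lim_transform_eventually)
  qed
  have comps: "Ck n k Q' (\<lambda>y. \<zeta> y j)" if "Ck n k Q' h" for k j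
  proof (cases "j = i")
    case True
    then show ?thesis using that by (simp add: h_def[abs_def])
  next
    case False
    show ?thesis by (rule Ck_cong[OF Q' _ Ck_coord[of n k Q' j]]) (simp add: off False)
  qed
  have hCk: "Ck n k Q' h" for k
  proof (induction k)
    case 0 then show ?case using hc by simp
  next
    case (Suc k)
    have pdC: "Ck n k Q' (\<lambda>y. pd l g (\<zeta> y))" if "l < n" for l
    proof (rule Ck_comp[where g=\<zeta> and f="pd l g", OF Q' Q0(1)])
      show "\<zeta> ` Q' \<subseteq> Q0" using chi by auto
      show "Ck n k Q0 (pd l g)" using g0[of "Suc k", unfolded Ck_Suc_pd[OF Q0(1)]] that by blast
    qed (rule comps[OF Suc.IH])
    show ?case
    proof (rule Ck_SucI[where D=D, OF hc hder])
      fix l assume l: "l < n"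
      show "Ck n k Q' (D l)" unfolding D_def
        using pdC[OF i] pdC[OF l] gi
        by (cases "l = i") (auto intro!: Ck_mult[OF Q'] Ck_inverse[OF Q'] Ck_const Ck_uminus[OF Q'])
    qed
  qed
  show ?thesis
  proof (rule that[of Q' \<zeta>, OF Q' _ _ comps[OF hCk] off sol])
    show "Q' \<noteq> {}" using Q0(3) by (auto simp: Q'_def)
    show "\<zeta> ` Q' \<subseteq> Q" using chi Q0(2) by auto
    show "inj_on \<zeta> Q'" by (rule inj_on_inverseI[where g=G]) (rule chi(2))
    fix O' assume O': "openE n O'" "O' \<subseteq> Q'"
    have "\<zeta> ` O' = {x \<in> Q0. G x \<in> O'}"
    proof safe
      fix x assume "x \<in> Q0" "G x \<in> O'"
      then show "x \<in> \<zeta> ` O'" using chiG by (metis imageI)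
    qed (use chi O' in auto)
    moreover have "openE n {x \<in> Q0. G x \<in> O'}"
    proof (rule open_preimage_E[OF Q0(1) _ _ O'(1)])
      show "continuous_on Q0 G"
      proof (rule continuous_on_to_E)
        fix j
        show "continuous_on Q0 (\<lambda>x. G x j)"
          using Ck_continuous[OF g0[of 0]] continuous_on_coord[of Q0 j] by (cases "j = i") (auto simp: G_def)
      qed (use GE in auto)
    qed (use GE in auto)
    ultimately show "openE n (\<zeta> ` O')" by simp
  qed
qed

lemma const_direction:
  assumes f: "Ck n (Suc 0) (cube n z d) f" and i: "i < n"
    and zero: "\<And>x. x \<in> cube n z d \<Longrightarrow> pd i f x = 0"
    and x: "x \<in> cube n z d" and t: "\<bar>t - z i\<bar> < d"
  shows "f (x(i := t)) = f x"
proof -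
  have inb: "x(i := s) \<in> cube n z d" if "\<bar>s - z i\<bar> < d" for s
    using x that i by (auto simp: cube_def EE_iff)
  have der: "((\<lambda>s. f (x(i := s))) has_real_derivative 0) (at s)" if "\<bar>s - z i\<bar> < d" for s
  proof -
    have "((\<lambda>r. f ((x(i := s))(i := r))) has_real_derivative pd i f (x(i := s))) (at ((x(i := s)) i))"
      using f[unfolded Ck_Suc_pd[OF open_cube]] i inb[OF that] by blast
    then show ?thesis using zero[OF inb[OF that]] by (simp only: fun_upd_upd fun_upd_same)
  qed
  have xi: "\<bar>x i - z i\<bar> < d" using x i by (auto simp: cube_def)
  have "f (x(i := t)) = f (x(i := x i))"
  proof (cases t "x i" rule: linorder_cases)
    case less
    show ?thesis
    proof (rule DERIV_isconst_end[OF less, symmetric])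
      show "continuous_on {t..x i} (\<lambda>s. f (x(i := s)))"
        by (rule DERIV_continuous_on, rule has_field_derivative_at_within, rule der) (use t xi in auto)
    qed (rule der, use t xi in auto)
  next
    case greater
    show ?thesis
    proof (rule DERIV_isconst_end[OF greater])
      show "continuous_on {x i..t} (\<lambda>s. f (x(i := s)))"
        by (rule DERIV_continuous_on, rule has_field_derivative_at_within, rule der) (use t xi in auto)
    qed (rule der, use t xi in auto)
  qed simp
  then show ?thesis by simp
qed

text \<open>
  \<open>\<Psi>\<close> is a change of coordinates after which the component \<open>j i\<close> of F is the coordinate i, for all \<open>i \<in> I\<close>.
  Openness of \<open>\<Psi>\<close> stands for continuity of the inverse.
\<close>

definition straightened ::
  "nat \<Rightarrow> nat \<Rightarrow> (nat \<Rightarrow> real) set \<Rightarrow> ((nat \<Rightarrow> real) \<Rightarrow> nat \<Rightarrow> real) \<Rightarrow>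
   (nat \<Rightarrow> real) set \<Rightarrow> ((nat \<Rightarrow> real) \<Rightarrow> nat \<Rightarrow> real) \<Rightarrow> nat set \<Rightarrow> (nat \<Rightarrow> nat) \<Rightarrow> bool" where
  "straightened n m S F Q \<Psi> I j \<longleftrightarrow>
     openE n Q \<and> Q \<noteq> {} \<and> smooth_Rn n n Q \<Psi> \<and> \<Psi> ` Q \<subseteq> S \<and> inj_on \<Psi> Q \<and>
     (\<forall>V. openE n V \<longrightarrow> V \<subseteq> Q \<longrightarrow> openE n (\<Psi> ` V)) \<and>
     I \<subseteq> {..<n} \<and> j ` I \<subseteq> {..<m} \<and> (\<forall>y\<in>Q. \<forall>i\<in>I. F (\<Psi> y) (j i) = y i)"

lemma straightenedD:
  assumes "straightened n m S F Q \<Psi> I j"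
  shows "openE n Q" "Q \<noteq> {}" "smooth_Rn n n Q \<Psi>" "\<Psi> ` Q \<subseteq> S" "inj_on \<Psi> Q"
    "\<And>V. openE n V \<Longrightarrow> V \<subseteq> Q \<Longrightarrow> openE n (\<Psi> ` V)"
    "I \<subseteq> {..<n}" "j ` I \<subseteq> {..<m}" "\<And>y i. y \<in> Q \<Longrightarrow> i \<in> I \<Longrightarrow> F (\<Psi> y) (j i) = y i"
  using assms unfolding straightened_def by simp_all

lemma smooth_RnD: "smooth_Rn n m S f \<Longrightarrow> j < m \<Longrightarrow> Ck n k S (\<lambda>x. f x j)"
  by (simp add: smooth_Rn_def)

lemma smooth_RnI: "(\<And>j k. j < m \<Longrightarrow> Ck n k S (\<lambda>x. f x j)) \<Longrightarrow> smooth_Rn n m S f"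
  by (simp add: smooth_Rn_def)

lemma smooth_Rn_subset: "smooth_Rn n m S f \<Longrightarrow> T \<subseteq> S \<Longrightarrow> smooth_Rn n m T f"
  by (rule smooth_RnI) (rule Ck_subset[OF smooth_RnD])

lemma smooth_Rn_comp:
  assumes "openE n S" "openE m T" "g ` S \<subseteq> T"
    "smooth_Rn n m S g" "smooth_Rn m l T f"
  shows "smooth_Rn n l S (\<lambda>x. f (g x))"
proof (rule smooth_RnI)
  fix j k assume "j < l"
  then show "Ck n k S (\<lambda>x. f (g x) j)"
    using Ck_comp[OF assms(1-3) smooth_RnD[OF assms(4)] smooth_RnD[OF assms(5)]] by blast
qed

text \<open>
  A component with a nonzero derivative in an unused direction is exchanged for that coordinate. The
  components exchanged before remain coordinates, since only the coordinate i changes.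
\<close>

lemma straightened_step:
  assumes st: "straightened n m S F Q \<Psi> I j" and F: "smooth_Rn n m S F"
    and S: "openE n S"
    and k: "k < m" and i: "i < n" "i \<notin> I" and y0: "y0 \<in> Q" and nz: "pd i (\<lambda>y. F (\<Psi> y) k) y0 \<noteq> 0"
  shows "\<exists>Q' \<Psi>'. straightened n m S F Q' \<Psi>' (insert i I) (j(i := k))"
proof -
  note D = straightenedD[OF st]
  note Q = D(1)
  have sm: "smooth_Rn n m Q (\<lambda>y. F (\<Psi> y))"
    by (rule smooth_Rn_comp[OF Q S D(4,3) F])
  obtain Q' \<zeta> where z: "openE n Q'" "Q' \<noteq> {}" "\<zeta> ` Q' \<subseteq> Q"
    "\<And>k j. j < n \<Longrightarrow> Ck n k Q' (\<lambda>y. \<zeta> y j)"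
    "\<And>y l. y \<in> Q' \<Longrightarrow> l \<noteq> i \<Longrightarrow> \<zeta> y l = y l"
    "\<And>y. y \<in> Q' \<Longrightarrow> F (\<Psi> (\<zeta> y)) k = y i" "inj_on \<zeta> Q'"
    "\<And>O'. openE n O' \<Longrightarrow> O' \<subseteq> Q' \<Longrightarrow> openE n (\<zeta> ` O')"
    by (rule solve_coordinate[OF Q smooth_RnD[OF sm k] i(1) y0 nz]) blast
  have "straightened n m S F Q' (\<lambda>y. \<Psi> (\<zeta> y)) (insert i I) (j(i := k))"
    unfolding straightened_def
  proof (intro conjI allI impI)
    show "smooth_Rn n n Q' (\<lambda>y. \<Psi> (\<zeta> y))"
      by (rule smooth_Rn_comp[OF z(1) Q z(3) smooth_RnI[OF z(4)] D(3)])
    show "inj_on (\<lambda>y. \<Psi> (\<zeta> y)) Q'"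
      using comp_inj_on[OF z(7) inj_on_subset[OF D(5) z(3)]] by (simp add: comp_def)
    show "(\<lambda>y. \<Psi> (\<zeta> y)) ` Q' \<subseteq> S" using subset_trans[OF image_mono[OF z(3)] D(4)] by (simp add: image_image)
    show "j(i := k) ` insert i I \<subseteq> {..<m}" using D(8) k by auto
    show "\<forall>y\<in>Q'. \<forall>l\<in>insert i I. F (\<Psi> (\<zeta> y)) ((j(i := k)) l) = y l"
    proof (intro ballI)
      fix y l assume yl: "y \<in> Q'" "l \<in> insert i I"
      show "F (\<Psi> (\<zeta> y)) ((j(i := k)) l) = y l"
      proof (cases "l = i")
        case True then show ?thesis using z(6) yl by simp
      next
        case False
        then have "F (\<Psi> (\<zeta> y)) (j l) = \<zeta> y l" using D(9)[of "\<zeta> y" l] yl z(3) by auto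
        then show ?thesis using z(5)[OF yl(1) False] False by simp
      qed
    qed
    fix V assume V: "openE n V" "V \<subseteq> Q'"
    have "openE n (\<Psi> ` (\<zeta> ` V))" 
      by (rule D(6)[OF z(8)[OF V] subset_trans[OF image_mono[OF V(2)] z(3)]])
    then show "openE n ((\<lambda>y. \<Psi> (\<zeta> y)) ` V)" by (simp add: image_image)
  qed (use D(7) z(1,2) i in auto)
  then show ?thesis by blast
qed

text \<open>
  For I of maximal size no further exchange is possible, so all derivatives in the directions outside
  I vanish and F is constant in these directions on a cube. This is the constant rank theorem at one
  unspecified point of S. That is enough for homomorphisms, which look the same at all points.
\<close>

lemma smooth_normal_form:
  assumes S: "openE n S" "S \<noteq> {}" and F: "smooth_Rn n m S F"
  obtains Q \<Psi> I j where "straightened n m S F Q \<Psi> I j"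
    "\<And>y y' k. y \<in> Q \<Longrightarrow> y' \<in> Q \<Longrightarrow> (\<And>i. i \<in> I \<Longrightarrow> y i = y' i) \<Longrightarrow> k < m \<Longrightarrow> F (\<Psi> y) k = F (\<Psi> y') k"
proof -
  define P where "P c \<longleftrightarrow> (\<exists>Q \<Psi> I j. straightened n m S F Q \<Psi> I j \<and> card I = c)" for c
  have "straightened n m S F S (\<lambda>x. x) {} (\<lambda>_. 0)"
    using S by (auto simp: straightened_def smooth_Rn_def Ck_coord)
  then have "P 0" unfolding P_def using card.empty by blast
  moreover have "c \<le> n" if "P c" for c
    using that unfolding P_def straightened_def by (metis card_lessThan card_mono finite_lessThan)
  ultimately obtain c where c: "P c" "\<And>c'. P c' \<Longrightarrow> c' \<le> c"
    using Nat.ex_has_greatest_nat[of P 0 n] by blast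
  then obtain Q \<Psi> I j where st: "straightened n m S F Q \<Psi> I j" "card I = c" unfolding P_def by blast
  note D = straightenedD[OF st(1)]
  have fin: "finite I" using D(7) finite_subset by blast
  note Q = D(1)
  have sm: "smooth_Rn n m Q (\<lambda>y. F (\<Psi> y))"
    by (rule smooth_Rn_comp[OF Q S(1) D(4,3) F])
  have zero: "pd i (\<lambda>y. F (\<Psi> y) k) y = 0" if "y \<in> Q" "k < m" "i < n" "i \<notin> I" for y k i
  proof (rule ccontr)
    assume "pd i (\<lambda>y. F (\<Psi> y) k) y \<noteq> 0"
    from straightened_step[OF st(1) F S(1) that(2-4,1) this] have "P (card (insert i I))"
      unfolding P_def by blast
    then show False using c(2) st(2) fin that(4) by fastforce
  qed
  obtain z where z: "z \<in> Q" using D(2) by blast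
  then obtain d where d: "d > 0" "cube n z d \<subseteq> Q" using Q openin_E_iff by blast
  have zE: "z \<in> EE n" using z Q by (rule openin_E_sub[rotated])
  show ?thesis
  proof (rule that[of "cube n z d" \<Psi> I j])
    show "straightened n m S F (cube n z d) \<Psi> I j"
      unfolding straightened_def
    proof (intro conjI)
      show "cube n z d \<noteq> {}" using cube_self[OF zE d(1)] by blast
      show "smooth_Rn n n (cube n z d) \<Psi>" using D(3) d(2) by (rule smooth_Rn_subset)
      show "inj_on \<Psi> (cube n z d)" using D(5) d(2) by (rule inj_on_subset)
      show "\<Psi> ` cube n z d \<subseteq> S" using image_mono[OF d(2)] D(4) by (rule subset_trans)
      show "\<forall>V. openE n V \<longrightarrow> V \<subseteq> cube n z d \<longrightarrow> openE n (\<Psi> ` V)"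
        using D(6) subset_trans[OF _ d(2)] by simp
      show "\<forall>y\<in>cube n z d. \<forall>i\<in>I. F (\<Psi> y) (j i) = y i" using D(9) subsetD[OF d(2)] by simp
    qed (use D(7,8) open_cube in auto)
  next
    fix y y' k assume y: "y \<in> cube n z d" "y' \<in> cube n z d" "\<And>i. i \<in> I \<Longrightarrow> y i = y' i" and k: "k < m"
    define f where "f y = F (\<Psi> y) k" for y
    have f: "Ck n (Suc 0) (cube n z d) f" unfolding f_def by (rule Ck_subset[OF smooth_RnD[OF sm k] d(2)])
    \<comment> \<open>change one coordinate at a time\<close>
    have "f (\<lambda>i. if i < l then y' i else y i) = f y \<and> (\<lambda>i. if i < l then y' i else y i) \<in> cube n z d" if "l \<le> n" for l
      using that
    proof (induction l)
      case 0 then show ?case using y by simp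
    next
      case (Suc l)
      define w where "w = (\<lambda>i. if i < l then y' i else y i)"
      have eq: "(\<lambda>i. if i < Suc l then y' i else y i) = w(l := y' l)" by (auto simp: w_def fun_eq_iff)
      have IH: "f w = f y" "w \<in> cube n z d" using Suc by (auto simp: w_def)
      have near: "\<bar>y' l - z l\<bar> < d" using y(2) Suc.prems by (auto simp: cube_def)
      have "f (w(l := y' l)) = f w"
      proof (cases "l \<in> I")
        case True
        then have "w l = y' l" using y(3) by (simp add: w_def)
        then have "w(l := y' l) = w" by auto
        then show ?thesis by simp
      next
        case False
        show ?thesis
          by (rule const_direction[OF f _ _ IH(2) near]) (use zero[of _ k l] k d(2) False Suc.prems in \<open>auto simp: f_def[abs_def]\<close>)
      qed
      moreover have "w(l := y' l) \<in> cube n z d" using IH(2) near Suc.prems by (auto simp: cube_def EE_iff)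
      ultimately show ?case unfolding eq using IH by simp
    qed
    from this[of n] have "f (\<lambda>i. if i < n then y' i else y i) = f y" by simp
    moreover have "(\<lambda>i. if i < n then y' i else y i) = y'"
      using y(1,2) by (auto simp: cube_def EE_iff fun_eq_iff)
    ultimately show "F (\<Psi> y) k = F (\<Psi> y') k" by (simp add: f_def)
  qed
qed

section \<open>Smooth maps between manifolds\<close>

declare One_nat_def [simp del]

lemma smooth_Rn_cong:
  assumes "openE n S" "\<And>x j. x \<in> S \<Longrightarrow> j < m \<Longrightarrow> f x j = g x j" "smooth_Rn n m S f"
  shows "smooth_Rn n m S g"
proof (rule smooth_RnI)
  fix j k assume j: "j < m"
  show "Ck n k S (\<lambda>x. g x j)"
    by (rule Ck_cong[OF assms(1) assms(2)[OF _ j] smooth_RnD[OF assms(3) j]])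
qed

lemma smooth_Rn_local:
  assumes "openE n S"
    "\<And>x. x \<in> S \<Longrightarrow> \<exists>T. openE n T \<and> x \<in> T \<and> T \<subseteq> S \<and> smooth_Rn n m T f"
  shows "smooth_Rn n m S f"
proof (rule smooth_RnI)
  fix j k assume j: "j < m"
  show "Ck n k S (\<lambda>x. f x j)"
  proof (rule Ck_local[OF assms(1)])
    fix x assume "x \<in> S"
    then obtain T where "openE n T" "x \<in> T" "T \<subseteq> S" "smooth_Rn n m T f"
      using assms(2) by blast
    then show "\<exists>T. openE n T \<and> x \<in> T \<and> T \<subseteq> S \<and> Ck n k T (\<lambda>x. f x j)"
      using smooth_RnD[OF _ j] by blast
  qed
qed

text \<open>
  The local charts and the smoothness of the transition functions are separated: a map into a product
  is smooth as soon as its components are, which rests on the charts alone, whereas smoothness of the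
  projections rests on the transition functions.
\<close>

definition charted :: "'a manifold \<Rightarrow> bool" where
  "charted M \<longleftrightarrow> (\<Union>(U,\<phi>)\<in>atlas M. U) = topspace (mtop M) \<and>
     (\<forall>(U,\<phi>)\<in>atlas M. openin (mtop M) U \<and>
        (\<exists>V. openE (mdim M) V \<and>
             homeomorphic_map (subtopology (mtop M) U)
                (subtopology (Euclidean_space (mdim M)) V) \<phi>))"

definition compat :: "'a manifold \<Rightarrow> bool" where
  "compat M \<longleftrightarrow> (\<forall>(U,\<phi>)\<in>atlas M. \<forall>(V,\<psi>)\<in>atlas M.
        smooth_Rn (mdim M) (mdim M) (\<phi> ` (U \<inter> V)) (\<psi> \<circ> inv_into U \<phi>))"

lemma smooth_manifoldD:
  assumes "smooth_manifold M"
  shows "charted M" "compat M" "Hausdorff_space (mtop M)" "second_countable (mtop M)"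
  using assms by (auto simp: smooth_manifold_def charted_def compat_def)

lemma continuous_map_from_open:
  assumes "openin X W"
  shows "continuous_map (subtopology X W) Y f \<longleftrightarrow>
    f ` W \<subseteq> topspace Y \<and> (\<forall>T. openin Y T \<longrightarrow> openin X {x \<in> W. f x \<in> T})"
proof -
  have top: "topspace (subtopology X W) = W" using openin_subset[OF assms] by auto
  show ?thesis
    unfolding continuous_map_def top openin_open_subtopology[OF assms] by auto
qed

lemma continuous_map_into_E:
  "continuous_map X (Euclidean_space n) f \<longleftrightarrow>
    f ` topspace X \<subseteq> EE n \<and> (\<forall>i<n. continuous_map X euclideanreal (\<lambda>x. f x i))"
proof -
  have "continuous_map X (Euclidean_space n) f \<longleftrightarrow>
      continuous_map X (Euclidean_space n) (\<lambda>x i. if i < n then f x i else 0)"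
    if im: "f ` topspace X \<subseteq> EE n"
  proof -
    have eq: "f x = (\<lambda>i. if i < n then f x i else 0)" if "x \<in> topspace X" for x
    proof -
      have "f x \<in> EE n" using that im by blast
      then show ?thesis by (auto simp: EE_iff fun_eq_iff)
    qed
    show ?thesis
    proof
      show "continuous_map X (Euclidean_space n) (\<lambda>x i. if i < n then f x i else 0)"
        if "continuous_map X (Euclidean_space n) f" using that eq by (rule continuous_map_eq)
      show "continuous_map X (Euclidean_space n) f"
        if "continuous_map X (Euclidean_space n) (\<lambda>x i. if i < n then f x i else 0)"
        using that eq[symmetric] by (rule continuous_map_eq)
    qed
  qed
  moreover have "continuous_map X (Euclidean_space n) f \<Longrightarrow> f ` topspace X \<subseteq> EE n"
    by (rule continuous_map_image_subset_topspace)
  ultimately show ?thesis unfolding continuous_map_componentwise_Euclidean_space by blast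
qed

lemma chartD:
  assumes M: "charted M" and c: "(U, \<phi>) \<in> atlas M"
  shows "openin (mtop M) U" "openE (mdim M) (\<phi> ` U)" "inj_on \<phi> U"
    "homeomorphic_map (subtopology (mtop M) U) (subtopology (Euclidean_space (mdim M)) (\<phi> ` U)) \<phi>"
proof -
  obtain V where V: "openin (mtop M) U" "openE (mdim M) V"
    "homeomorphic_map (subtopology (mtop M) U) (subtopology (Euclidean_space (mdim M)) V) \<phi>"
    using assms unfolding charted_def by blast
  have top: "topspace (subtopology (mtop M) U) = U"
      "topspace (subtopology (Euclidean_space (mdim M)) V) = V"
    using openin_subset[OF V(1)] openin_subset[OF V(2)] by auto
  have im: "\<phi> ` U = V" using homeomorphic_imp_surjective_map[OF V(3)] unfolding top .
  show "openin (mtop M) U" "openE (mdim M) (\<phi> ` U)"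
    "homeomorphic_map (subtopology (mtop M) U) (subtopology (Euclidean_space (mdim M)) (\<phi> ` U)) \<phi>"
    using V im by auto
  show "inj_on \<phi> U" using homeomorphic_imp_injective_map[OF V(3)] unfolding top .
qed

lemma chart_into_E: "charted M \<Longrightarrow> (U, \<phi>) \<in> atlas M \<Longrightarrow> x \<in> U \<Longrightarrow> \<phi> x \<in> EE (mdim M)"
  using openin_subset[OF chartD(2)] by blast

lemma chart_inv: "charted M \<Longrightarrow> (U, \<phi>) \<in> atlas M \<Longrightarrow> x \<in> U \<Longrightarrow> inv_into U \<phi> (\<phi> x) = x"
  by (rule inv_into_f_f[OF chartD(3)])

lemma chart_open_image:
  assumes M: "charted M" and c: "(U, \<phi>) \<in> atlas M" and W: "openin (mtop M) W" "W \<subseteq> U"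
  shows "openE (mdim M) (\<phi> ` W)"
proof -
  note h = chartD[OF M c]
  have "openin (subtopology (mtop M) U) W" using W by (simp add: openin_open_subtopology[OF h(1)])
  moreover have "W \<subseteq> topspace (subtopology (mtop M) U)" using W openin_subset by auto
  ultimately have "openin (subtopology (Euclidean_space (mdim M)) (\<phi> ` U)) (\<phi> ` W)"
    using homeomorphic_map_openness_eq[OF h(4)] by blast
  then show ?thesis by (simp add: openin_open_subtopology[OF h(2)])
qed

lemma chart_open_preimage:
  assumes M: "charted M" and c: "(U, \<phi>) \<in> atlas M" and T: "openE (mdim M) T"
  shows "openin (mtop M) {x \<in> U. \<phi> x \<in> T}"
proof -
  note h = chartD[OF M c]
  have "continuous_map (subtopology (mtop M) U) (Euclidean_space (mdim M)) \<phi>"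
    using homeomorphic_imp_continuous_map[OF h(4)] by (simp add: continuous_map_in_subtopology)
  then show ?thesis using T unfolding continuous_map_from_open[OF h(1)] by blast
qed

lemma chart_coord_continuous:
  assumes M: "charted M" and c: "(U, \<phi>) \<in> atlas M"
  shows "continuous_map (subtopology (mtop M) U) euclideanreal (\<lambda>x. \<phi> x j)"
proof (cases "j < mdim M")
  case True
  have "continuous_map (subtopology (mtop M) U) (Euclidean_space (mdim M)) \<phi>"
    using homeomorphic_imp_continuous_map[OF chartD(4)[OF assms]] by (simp add: continuous_map_in_subtopology)
  then show ?thesis using True unfolding continuous_map_into_E by blast
next
  case False
  have "\<phi> x j = 0" if "x \<in> topspace (subtopology (mtop M) U)" for x
    using chart_into_E[OF assms, of x] that False by (simp add: EE_iff)
  then show ?thesis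
    by (intro continuous_map_eq[where f="\<lambda>x. 0" and g="\<lambda>x. \<phi> x j" and X="subtopology (mtop M) U"]) simp_all
qed

lemma chart_inv_continuous:
  assumes M: "charted M" and c: "(U, \<phi>) \<in> atlas M"
  shows "continuous_map (subtopology (Euclidean_space (mdim M)) (\<phi> ` U)) (mtop M) (inv_into U \<phi>)"
  unfolding continuous_map_from_open[OF chartD(2)[OF assms]]
proof (intro conjI allI impI)
  show "inv_into U \<phi> ` \<phi> ` U \<subseteq> topspace (mtop M)"
    using openin_subset[OF chartD(1)[OF assms]] chart_inv[OF assms] by auto
  fix T assume T: "openin (mtop M) T"
  have "{p \<in> \<phi> ` U. inv_into U \<phi> p \<in> T} = \<phi> ` (U \<inter> T)" using chart_inv[OF assms] by auto
  then show "openE (mdim M) {p \<in> \<phi> ` U. inv_into U \<phi> p \<in> T}"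
    using chart_open_image[OF assms openin_Int[OF chartD(1)[OF assms] T]] by simp
qed

lemma chart_cover: "charted M \<Longrightarrow> x \<in> topspace (mtop M) \<Longrightarrow> \<exists>U \<phi>. (U, \<phi>) \<in> atlas M \<and> x \<in> U"
  unfolding charted_def by blast

lemma charted_sub: "charted M \<Longrightarrow> (U, \<phi>) \<in> atlas M \<Longrightarrow> U \<subseteq> topspace (mtop M)"
  by (rule openin_subset[OF chartD(1)])

lemma smooth_on_cont: 
  assumes "smooth_on M W N f" "openin (mtop M) W"
  shows "f ` W \<subseteq> topspace (mtop N)" "openin (mtop N) T \<Longrightarrow> openin (mtop M) {x \<in> W. f x \<in> T}"
  using assms(1) unfolding smooth_on_def continuous_map_from_open[OF assms(2)] by blast+

lemma smooth_on_rep: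
  "smooth_on M W N f \<Longrightarrow> (U, \<phi>) \<in> atlas M \<Longrightarrow> (V, \<psi>) \<in> atlas N \<Longrightarrow>
   smooth_Rn (mdim M) (mdim N) (\<phi> ` {x \<in> U \<inter> W. f x \<in> V}) (\<lambda>p. \<psi> (f (inv_into U \<phi> p)))"
  by (force simp: smooth_on_def comp_def)

lemma smooth_onI:
  assumes W: "openin (mtop M) W"
    and "\<And>x. x \<in> W \<Longrightarrow> f x \<in> topspace (mtop N)"
    and "\<And>T. openin (mtop N) T \<Longrightarrow> openin (mtop M) {x \<in> W. f x \<in> T}"
    and "\<And>U \<phi> V \<psi>. (U, \<phi>) \<in> atlas M \<Longrightarrow> (V, \<psi>) \<in> atlas N \<Longrightarrow>
      smooth_Rn (mdim M) (mdim N) (\<phi> ` {x \<in> U \<inter> W. f x \<in> V}) (\<lambda>p. \<psi> (f (inv_into U \<phi> p)))"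
  shows "smooth_on M W N f"
  unfolding smooth_on_def continuous_map_from_open[OF W] comp_def
  using assms(2-) by auto

lemma rep_domain_open:
  assumes M: "charted M" "(U, \<phi>) \<in> atlas M" and W: "openin (mtop M) {x \<in> W. f x \<in> V}"
  shows "openE (mdim M) (\<phi> ` {x \<in> U \<inter> W. f x \<in> V})"
proof -
  have "{x \<in> U \<inter> W. f x \<in> V} = U \<inter> {x \<in> W. f x \<in> V}" by auto
  then show ?thesis using chart_open_image[OF M openin_Int[OF chartD(1)[OF M] W]] by auto
qed

lemma smooth_on_cong:
  assumes f: "smooth_on M W N f" and M: "charted M" and W: "openin (mtop M) W" and N: "charted N"
    and eq: "\<And>x. x \<in> W \<Longrightarrow> f x = g x"
  shows "smooth_on M W N g"
proof (rule smooth_onI[OF W])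
  have s: "{x \<in> W. f x \<in> T} = {x \<in> W. g x \<in> T}" for T using eq by auto
  show "\<And>T. openin (mtop N) T \<Longrightarrow> openin (mtop M) {x \<in> W. g x \<in> T}"
    using smooth_on_cont(2)[OF f W] s by simp
  show "\<And>x. x \<in> W \<Longrightarrow> g x \<in> topspace (mtop N)" using smooth_on_cont(1)[OF f W] eq by force
  fix U \<phi> V \<psi> assume c: "(U, \<phi>) \<in> atlas M" "(V, \<psi>) \<in> atlas N"
  have s': "{x \<in> U \<inter> W. f x \<in> V} = {x \<in> U \<inter> W. g x \<in> V}" using eq by auto
  have "smooth_Rn (mdim M) (mdim N) (\<phi> ` {x \<in> U \<inter> W. f x \<in> V}) (\<lambda>p. \<psi> (g (inv_into U \<phi> p)))"
  proof (rule smooth_Rn_cong[OF _ _ smooth_on_rep[OF f c]])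
    show "openE (mdim M) (\<phi> ` {x \<in> U \<inter> W. f x \<in> V})"
      by (rule rep_domain_open[OF M c(1) smooth_on_cont(2)[OF f W chartD(1)[OF N c(2)]]])
  qed (use chart_inv[OF M c(1)] eq in auto)
  then show "smooth_Rn (mdim M) (mdim N) (\<phi> ` {x \<in> U \<inter> W. g x \<in> V}) (\<lambda>p. \<psi> (g (inv_into U \<phi> p)))"
    unfolding s' .
qed

lemma smooth_on_subset:
  assumes f: "smooth_on M W N f" and W: "openin (mtop M) W" "openin (mtop M) W'" "W' \<subseteq> W"
  shows "smooth_on M W' N f"
proof (rule smooth_onI[OF W(2)])
  show "\<And>x. x \<in> W' \<Longrightarrow> f x \<in> topspace (mtop N)" using smooth_on_cont(1)[OF f W(1)] W(3) by auto
  fix T assume "openin (mtop N) T"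
  moreover have "{x \<in> W'. f x \<in> T} = W' \<inter> {x \<in> W. f x \<in> T}" using W by auto
  ultimately show "openin (mtop M) {x \<in> W'. f x \<in> T}"
    using smooth_on_cont(2)[OF f W(1)] W(2) by auto
next
  fix U \<phi> V \<psi> assume c: "(U, \<phi>) \<in> atlas M" "(V, \<psi>) \<in> atlas N"
  show "smooth_Rn (mdim M) (mdim N) (\<phi> ` {x \<in> U \<inter> W'. f x \<in> V}) (\<lambda>p. \<psi> (f (inv_into U \<phi> p)))"
    by (rule smooth_Rn_subset[OF smooth_on_rep[OF f c]]) (use W in auto)
qed

lemma smooth_on_local:
  assumes M: "charted M" and N: "charted N" and W: "openin (mtop M) W"
    and loc: "\<And>w. w \<in> W \<Longrightarrow> \<exists>W'. openin (mtop M) W' \<and> w \<in> W' \<and> W' \<subseteq> W \<and> smooth_on M W' N f"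
  shows "smooth_on M W N f"
proof (rule smooth_onI[OF W])
  show "\<And>x. x \<in> W \<Longrightarrow> f x \<in> topspace (mtop N)" using loc smooth_on_cont(1) by blast
  show op: "openin (mtop M) {x \<in> W. f x \<in> T}" if T: "openin (mtop N) T" for T
  proof (subst openin_subopen, intro ballI)
    fix w assume "w \<in> {x \<in> W. f x \<in> T}"
    then obtain W' where W': "openin (mtop M) W'" "w \<in> W'" "W' \<subseteq> W" "smooth_on M W' N f" "f w \<in> T"
      using loc by blast
    then show "\<exists>Ta. openin (mtop M) Ta \<and> w \<in> Ta \<and> Ta \<subseteq> {x \<in> W. f x \<in> T}"
      using smooth_on_cont(2)[OF W'(4,1) T] by (intro exI[of _ "{x \<in> W'. f x \<in> T}"]) auto
  qed
  fix U \<phi> V \<psi> assume c: "(U, \<phi>) \<in> atlas M" "(V, \<psi>) \<in> atlas N"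
  show "smooth_Rn (mdim M) (mdim N) (\<phi> ` {x \<in> U \<inter> W. f x \<in> V}) (\<lambda>p. \<psi> (f (inv_into U \<phi> p)))"
  proof (rule smooth_Rn_local[OF rep_domain_open[OF M c(1) op[OF chartD(1)[OF N c(2)]]]])
    fix p assume "p \<in> \<phi> ` {x \<in> U \<inter> W. f x \<in> V}"
    then obtain x where x: "x \<in> U" "x \<in> W" "f x \<in> V" "p = \<phi> x" by blast
    then obtain W' where W': "openin (mtop M) W'" "x \<in> W'" "W' \<subseteq> W" "smooth_on M W' N f"
      using loc by blast
    show "\<exists>T. openE (mdim M) T \<and> p \<in> T \<and> T \<subseteq> \<phi> ` {x \<in> U \<inter> W. f x \<in> V} \<and>
       smooth_Rn (mdim M) (mdim N) T (\<lambda>p. \<psi> (f (inv_into U \<phi> p)))"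
    proof (intro exI conjI)
      show "openE (mdim M) (\<phi> ` {x \<in> U \<inter> W'. f x \<in> V})"
        by (rule rep_domain_open[OF M c(1) smooth_on_cont(2)[OF W'(4,1) chartD(1)[OF N c(2)]]])
      show "smooth_Rn (mdim M) (mdim N) (\<phi> ` {x \<in> U \<inter> W'. f x \<in> V}) (\<lambda>p. \<psi> (f (inv_into U \<phi> p)))"
        by (rule smooth_on_rep[OF W'(4) c])
    qed (use x W' in auto)
  qed
qed

text \<open>
  The image of a chart domain of M need not lie in one chart of N, so the representatives are
  composed through a chart of N around each point separately.
\<close>

lemma smooth_on_comp:
  assumes M: "charted M" and N: "charted N" and P: "charted P"
    and W: "openin (mtop M) W" and T: "openin (mtop N) T"
    and f: "smooth_on M W N f" and g: "smooth_on N T P g" and im: "f ` W \<subseteq> T"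
  shows "smooth_on M W P (\<lambda>x. g (f x))"
proof (rule smooth_onI[OF W])
  show "\<And>x. x \<in> W \<Longrightarrow> g (f x) \<in> topspace (mtop P)" using smooth_on_cont(1)[OF g T] im by blast
  show op: "openin (mtop M) {x \<in> W. g (f x) \<in> O'}" if O': "openin (mtop P) O'" for O'
  proof -
    have "{x \<in> W. g (f x) \<in> O'} = {x \<in> W. f x \<in> {y \<in> T. g y \<in> O'}}" using im by auto
    then show ?thesis using smooth_on_cont(2)[OF f W smooth_on_cont(2)[OF g T O']] by simp
  qed
  fix U \<phi> V \<psi> assume c: "(U, \<phi>) \<in> atlas M" "(V, \<psi>) \<in> atlas P"
  show "smooth_Rn (mdim M) (mdim P) (\<phi> ` {x \<in> U \<inter> W. g (f x) \<in> V}) (\<lambda>p. \<psi> (g (f (inv_into U \<phi> p))))"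
  proof (rule smooth_Rn_local[OF rep_domain_open[OF M c(1) op[OF chartD(1)[OF P c(2)]]]])
    fix p assume "p \<in> \<phi> ` {x \<in> U \<inter> W. g (f x) \<in> V}"
    then obtain x where x: "x \<in> U" "x \<in> W" "g (f x) \<in> V" "p = \<phi> x" by blast
    then have "f x \<in> topspace (mtop N)" using smooth_on_cont(1)[OF f W] by blast
    then obtain V' \<kappa> where k: "(V', \<kappa>) \<in> atlas N" "f x \<in> V'" using chart_cover[OF N] by blast
    define Y where "Y = {y \<in> V' \<inter> T. g y \<in> V}"
    define Z where "Z = {x \<in> U \<inter> W. f x \<in> Y}"
    have Yop: "openin (mtop N) Y"
    proof -
      have "Y = V' \<inter> {y \<in> T. g y \<in> V}" by (auto simp: Y_def)
      then show ?thesis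
        using chartD(1)[OF N k(1)] smooth_on_cont(2)[OF g T chartD(1)[OF P c(2)]] by auto
    qed
    have Zop: "openE (mdim M) (\<phi> ` Z)"
      unfolding Z_def by (rule rep_domain_open[OF M c(1) smooth_on_cont(2)[OF f W Yop]])
    have kY: "openE (mdim N) (\<kappa> ` Y)"
      by (rule chart_open_image[OF N k(1) Yop]) (auto simp: Y_def)
    have 1: "smooth_Rn (mdim M) (mdim N) (\<phi> ` Z) (\<lambda>p. \<kappa> (f (inv_into U \<phi> p)))"
      by (rule smooth_Rn_subset[OF smooth_on_rep[OF f c(1) k(1)]]) (auto simp: Z_def Y_def)
    have 2: "smooth_Rn (mdim N) (mdim P) (\<kappa> ` Y) (\<lambda>q. \<psi> (g (inv_into V' \<kappa> q)))"
      by (rule smooth_Rn_subset[OF smooth_on_rep[OF g k(1) c(2)]]) (auto simp: Y_def)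
    have im': "(\<lambda>p. \<kappa> (f (inv_into U \<phi> p))) ` \<phi> ` Z \<subseteq> \<kappa> ` Y"
      using chart_inv[OF M c(1)] by (auto simp: Z_def)
    have "smooth_Rn (mdim M) (mdim P) (\<phi> ` Z) (\<lambda>p. \<psi> (g (f (inv_into U \<phi> p))))"
    proof (rule smooth_Rn_cong[OF Zop _ smooth_Rn_comp[OF Zop kY im' 1 2]])
      fix q j assume "q \<in> \<phi> ` Z"
      then obtain z where z: "z \<in> Z" "q = \<phi> z" by blast
      then have "inv_into V' \<kappa> (\<kappa> (f z)) = f z" "inv_into U \<phi> q = z"
        using chart_inv[OF N k(1)] chart_inv[OF M c(1)] by (auto simp: Z_def Y_def)
      then show "\<psi> (g (inv_into V' \<kappa> (\<kappa> (f (inv_into U \<phi> q))))) j = \<psi> (g (f (inv_into U \<phi> q))) j" by simp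
    qed
    then show "\<exists>T. openE (mdim M) T \<and> p \<in> T \<and> T \<subseteq> \<phi> ` {x \<in> U \<inter> W. g (f x) \<in> V} \<and>
       smooth_Rn (mdim M) (mdim P) T (\<lambda>p. \<psi> (g (f (inv_into U \<phi> p))))"
      using Zop x k im by (intro exI[of _ "\<phi> ` Z"]) (auto simp: Z_def Y_def)
  qed
qed

lemma smooth_on_const:
  assumes "openin (mtop M) W" "c \<in> topspace (mtop N)"
  shows "smooth_on M W N (\<lambda>_. c)"
proof (rule smooth_onI[OF assms(1)])
  show "openin (mtop M) {x \<in> W. c \<in> T}" for T using assms(1) by (cases "c \<in> T") auto
qed (use assms in \<open>auto simp: smooth_Rn_def intro: Ck_const\<close>)

lemma smooth_on_id:
  assumes "compat M" "openin (mtop M) W"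
  shows "smooth_on M W M (\<lambda>x. x)"
proof (rule smooth_onI[OF assms(2)])
  fix U \<phi> V \<psi> assume c: "(U, \<phi>) \<in> atlas M" "(V, \<psi>) \<in> atlas M"
  have "smooth_Rn (mdim M) (mdim M) (\<phi> ` (U \<inter> V)) (\<lambda>p. \<psi> (inv_into U \<phi> p))"
    using assms(1) c by (force simp: compat_def comp_def)
  then show "smooth_Rn (mdim M) (mdim M) (\<phi> ` {x \<in> U \<inter> W. x \<in> V}) (\<lambda>p. \<psi> (inv_into U \<phi> p))"
    by (rule smooth_Rn_subset) auto
next
  fix T assume "openin (mtop M) T"
  then show "openin (mtop M) {x \<in> W. x \<in> T}" using openin_Int[OF assms(2)] by (simp add: Int_def)
qed (use openin_subset[OF assms(2)] in auto)

lemma mprod_simps [simp]: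
  "mtop (mprod M N) = prod_topology (mtop M) (mtop N)" "mdim (mprod M N) = mdim M + mdim N"
  by (simp_all add: mprod_def)

lemma atlas_mprod:
  "c \<in> atlas (mprod M N) \<longleftrightarrow> (\<exists>U \<phi> V \<psi>. c = (U \<times> V, \<lambda>(x,y) j. if j < mdim M then \<phi> x j else \<psi> y (j - mdim M)) \<and>
     (U, \<phi>) \<in> atlas M \<and> (V, \<psi>) \<in> atlas N)"
  by (auto simp: mprod_def)

lemma mpow_simps [simp]:
  "mtop (mpow p M) = product_topology (\<lambda>_. mtop M) {1..p}" "mdim (mpow p M) = p * mdim M"
  by (simp_all add: mpow_def)

lemma atlas_mpow:
  "C \<in> atlas (mpow p M) \<longleftrightarrow> (\<exists>c. C = (\<Pi>\<^sub>E i\<in>{1..p}. fst (c i),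
               \<lambda>g j. if j < p * mdim M
                      then snd (c (j div mdim M + 1)) (g (j div mdim M + 1)) (j mod mdim M)
                      else 0) \<and> c \<in> {1..p} \<rightarrow>\<^sub>E atlas M)"
  by (auto simp: mpow_def)

lemma smooth_on_pair:
  assumes M: "charted M" and N: "charted N" "charted P" and W: "openin (mtop M) W"
    and f: "smooth_on M W N f" and g: "smooth_on M W P g"
  shows "smooth_on M W (mprod N P) (\<lambda>x. (f x, g x))"
proof -
  have cont: "continuous_map (subtopology (mtop M) W) (prod_topology (mtop N) (mtop P)) (\<lambda>x. (f x, g x))"
    using f g unfolding smooth_on_def continuous_map_pairwise by (simp add: comp_def)
  have cont': "(\<lambda>x. (f x, g x)) ` W \<subseteq> topspace (prod_topology (mtop N) (mtop P))"
     "openin (prod_topology (mtop N) (mtop P)) T \<Longrightarrow> openin (mtop M) {x \<in> W. (f x, g x) \<in> T}" for T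
    using cont unfolding continuous_map_from_open[OF W] by blast+
  show ?thesis
  proof (rule smooth_onI[OF W])
    fix U \<phi> V \<psi> assume c: "(U, \<phi>) \<in> atlas M" "(V, \<psi>) \<in> atlas (mprod N P)"
    then obtain V1 \<psi>1 V2 \<psi>2 where v: "V = V1 \<times> V2"
      "\<psi> = (\<lambda>(x,y) j. if j < mdim N then \<psi>1 x j else \<psi>2 y (j - mdim N))"
      "(V1, \<psi>1) \<in> atlas N" "(V2, \<psi>2) \<in> atlas P" unfolding atlas_mprod by auto
    note 1 = smooth_on_rep[OF f c(1) v(3)] smooth_on_rep[OF g c(1) v(4)]
    show "smooth_Rn (mdim M) (mdim (mprod N P)) (\<phi> ` {x \<in> U \<inter> W. (f x, g x) \<in> V})
        (\<lambda>p. \<psi> (f (inv_into U \<phi> p), g (inv_into U \<phi> p)))"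
    proof (rule smooth_RnI)
      fix j k assume j: "j < mdim (mprod N P)"
      show "Ck (mdim M) k (\<phi> ` {x \<in> U \<inter> W. (f x, g x) \<in> V}) (\<lambda>p. \<psi> (f (inv_into U \<phi> p), g (inv_into U \<phi> p)) j)"
      proof (cases "j < mdim N")
        case True
        have "Ck (mdim M) k (\<phi> ` {x \<in> U \<inter> W. (f x, g x) \<in> V}) (\<lambda>p. \<psi>1 (f (inv_into U \<phi> p)) j)"
          by (rule Ck_subset[OF smooth_RnD[OF 1(1) True]]) (auto simp: v(1))
        then show ?thesis using True by (simp add: v(2))
      next
        case False
        then have "j - mdim N < mdim P" using j by auto
        then have "Ck (mdim M) k (\<phi> ` {x \<in> U \<inter> W. (f x, g x) \<in> V}) (\<lambda>p. \<psi>2 (g (inv_into U \<phi> p)) (j - mdim N))"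
          by (rule Ck_subset[OF smooth_RnD[OF 1(2)]]) (auto simp: v(1))
        then show ?thesis using False by (simp add: v(2))
      qed
    qed
  qed (use cont' in auto)
qed

lemma charted_chartI:
  assumes "openin X U" "openE n Z"
    "continuous_map (subtopology X U) (Euclidean_space n) F" "F ` U \<subseteq> Z"
    "continuous_map (subtopology (Euclidean_space n) Z) X G" "G ` Z \<subseteq> U"
    "\<And>x. x \<in> U \<Longrightarrow> G (F x) = x" "\<And>z. z \<in> Z \<Longrightarrow> F (G z) = z"
  shows "openin X U \<and> (\<exists>V. openE n V \<and>
       homeomorphic_map (subtopology X U) (subtopology (Euclidean_space n) V) F)"
proof -
  have "homeomorphic_maps (subtopology X U) (subtopology (Euclidean_space n) Z) F G"
    unfolding homeomorphic_maps_def continuous_map_in_subtopology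
    using assms openin_subset[OF assms(1)] openin_subset[OF assms(2)] by auto
  then show ?thesis using assms(1,2) homeomorphic_maps_imp_map by blast
qed

definition init_coords :: "nat \<Rightarrow> (nat \<Rightarrow> real) \<Rightarrow> nat \<Rightarrow> real" where "init_coords m z = (\<lambda>i. if i < m then z i else 0)"
definition tail_coords :: "nat \<Rightarrow> (nat \<Rightarrow> real) \<Rightarrow> nat \<Rightarrow> real" where "tail_coords m z = (\<lambda>i. z (i + m))"

lemma E_coord_continuous: "continuous_map (subtopology (Euclidean_space n) Z) euclideanreal (\<lambda>z. z i)"
proof (rule continuous_map_from_subtopology)
  show "continuous_map (Euclidean_space n) euclideanreal (\<lambda>z. z i)"
    unfolding continuous_map_Euclidean_space_iff by (rule continuous_on_coord)
qed

lemma continuous_map_E_reindex: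
  assumes "\<And>i z. i < m \<Longrightarrow> f z i = z (h i)" "f ` (EE n \<inter> Z) \<subseteq> EE m"
  shows "continuous_map (subtopology (Euclidean_space n) Z) (Euclidean_space m) f"
  unfolding continuous_map_into_E using assms E_coord_continuous by auto

lemma charted_mprod:
  assumes M: "charted M" and N: "charted N"
  shows "charted (mprod M N)"
  unfolding charted_def
proof (intro conjI ballI)
  show "(\<Union>(U, \<phi>)\<in>atlas (mprod M N). U) = topspace (mtop (mprod M N))"
  proof safe
    fix U \<phi> a b assume "(U, \<phi>) \<in> atlas (mprod M N)" "(a, b) \<in> U"
    then show "(a, b) \<in> topspace (mtop (mprod M N))"
      using charted_sub[OF M] charted_sub[OF N] unfolding atlas_mprod by (auto dest!: subsetD)
  next
    fix a b assume "(a, b) \<in> topspace (mtop (mprod M N))"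
    then obtain U \<phi> V \<psi> where "(U, \<phi>) \<in> atlas M" "a \<in> U" "(V, \<psi>) \<in> atlas N" "b \<in> V"
      using chart_cover[OF M, of a] chart_cover[OF N, of b] by auto
    then show "(a, b) \<in> (\<Union>(U, \<phi>)\<in>atlas (mprod M N). U)"
      by (intro UN_I[of "(U \<times> V, \<lambda>(x,y) j. if j < mdim M then \<phi> x j else \<psi> y (j - mdim M))"])
        (auto simp: atlas_mprod)
  qed
  fix c assume "c \<in> atlas (mprod M N)"
  then obtain U \<phi> V \<psi> where c: "c = (U \<times> V, \<lambda>(x,y) j. if j < mdim M then \<phi> x j else \<psi> y (j - mdim M))"
     "(U, \<phi>) \<in> atlas M" "(V, \<psi>) \<in> atlas N" unfolding atlas_mprod by blast
  let ?m = "mdim M" and ?n = "mdim N"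
  define F where "F = (\<lambda>(x,y) j. if j < ?m then \<phi> x j else \<psi> y (j - ?m))"
  define Z where "Z = {z \<in> EE (?m + ?n). init_coords ?m z \<in> \<phi> ` U} \<inter> {z \<in> EE (?m + ?n). tail_coords ?m z \<in> \<psi> ` V}"
  define G where "G z = (inv_into U \<phi> (init_coords ?m z), inv_into V \<psi> (tail_coords ?m z))" for z
  have takF: "init_coords ?m (F (x, y)) = \<phi> x" and drpF: "tail_coords ?m (F (x, y)) = \<psi> y" if "x \<in> U" "y \<in> V" for x y
    using chart_into_E[OF M c(2) that(1)] by (auto simp: init_coords_def tail_coords_def F_def EE_iff fun_eq_iff)
  have FE: "F (x, y) \<in> EE (?m + ?n)" if "x \<in> U" "y \<in> V" for x y
    using chart_into_E[OF N c(3) that(2)] by (auto simp: F_def EE_iff)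
  have ct: "continuous_map (subtopology (Euclidean_space (?m + ?n)) Y) (Euclidean_space ?m) (init_coords ?m)" for Y
    by (rule continuous_map_E_reindex[where h="\<lambda>i. i"]) (auto simp: init_coords_def EE_iff)
  have cd: "continuous_map (subtopology (Euclidean_space (?m + ?n)) Y) (Euclidean_space ?n) (tail_coords ?m)" for Y
    by (rule continuous_map_E_reindex[where h="\<lambda>i. i + ?m"]) (auto simp: tail_coords_def EE_iff)
  have Zop: "openin (Euclidean_space (?m + ?n)) Z"
    unfolding Z_def
    using openin_continuous_map_preimage[OF ct[of "EE (?m + ?n)"] chartD(2)[OF M c(2)]]
      openin_continuous_map_preimage[OF cd[of "EE (?m + ?n)"] chartD(2)[OF N c(3)]]
    by (intro openin_Int) (auto simp: subtopology_topspace)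
  have "openin (prod_topology (mtop M) (mtop N)) (U \<times> V) \<and> (\<exists>Z. openin (Euclidean_space (?m + ?n)) Z \<and>
       homeomorphic_map (subtopology (prod_topology (mtop M) (mtop N)) (U \<times> V)) (subtopology (Euclidean_space (?m + ?n)) Z) F)"
  proof (rule charted_chartI[OF _ Zop])
    show op: "openin (prod_topology (mtop M) (mtop N)) (U \<times> V)"
      using chartD(1)[OF M c(2)] chartD(1)[OF N c(3)] by (simp add: openin_prod_Times_iff)
    show "continuous_map (subtopology (prod_topology (mtop M) (mtop N)) (U \<times> V)) (Euclidean_space (?m + ?n)) F"
      unfolding continuous_map_into_E
    proof (intro conjI allI impI)
      show "F ` topspace (subtopology (prod_topology (mtop M) (mtop N)) (U \<times> V)) \<subseteq> EE (?m + ?n)"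
        using FE by auto
      fix j
      have 1: "continuous_map (subtopology (prod_topology (mtop M) (mtop N)) (U \<times> V)) (subtopology (mtop M) U) fst"
        "continuous_map (subtopology (prod_topology (mtop M) (mtop N)) (U \<times> V)) (subtopology (mtop N) V) snd"
        using continuous_map_fst[of "subtopology (mtop M) U" "subtopology (mtop N) V"]
          continuous_map_snd[of "subtopology (mtop M) U" "subtopology (mtop N) V"]
        by (simp_all add: subtopology_Times)
      show "continuous_map (subtopology (prod_topology (mtop M) (mtop N)) (U \<times> V)) euclideanreal (\<lambda>x. F x j)"
        using continuous_map_compose[OF 1(1) chart_coord_continuous[OF M c(2), of j]]
          continuous_map_compose[OF 1(2) chart_coord_continuous[OF N c(3), of "j - ?m"]]
        by (cases "j < ?m") (auto simp: F_def comp_def case_prod_beta)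
    qed
    show "F ` (U \<times> V) \<subseteq> Z" using FE takF drpF by (auto simp: Z_def)
    show "G ` Z \<subseteq> U \<times> V" by (auto simp: G_def Z_def inv_into_into)
    show "G (F x) = x" if "x \<in> U \<times> V" for x
      using that takF drpF chart_inv[OF M c(2)] chart_inv[OF N c(3)] by (auto simp: G_def)
    show "F (G z) = z" if "z \<in> Z" for z
    proof -
      have "\<phi> (inv_into U \<phi> (init_coords ?m z)) = init_coords ?m z" "\<psi> (inv_into V \<psi> (tail_coords ?m z)) = tail_coords ?m z"
        using that by (auto simp: Z_def f_inv_into_f)
      then show ?thesis by (auto simp: F_def G_def init_coords_def tail_coords_def fun_eq_iff)
    qed
    have "continuous_map (subtopology (Euclidean_space (?m + ?n)) Z) (mtop M) (inv_into U \<phi> \<circ> init_coords ?m)"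
    proof (rule continuous_map_compose[OF _ chart_inv_continuous[OF M c(2)]])
      show "continuous_map (subtopology (Euclidean_space (?m + ?n)) Z) (subtopology (Euclidean_space ?m) (\<phi> ` U)) (init_coords ?m)"
        unfolding continuous_map_in_subtopology using ct by (auto simp: Z_def)
    qed
    moreover have "continuous_map (subtopology (Euclidean_space (?m + ?n)) Z) (mtop N) (inv_into V \<psi> \<circ> tail_coords ?m)"
    proof (rule continuous_map_compose[OF _ chart_inv_continuous[OF N c(3)]])
      show "continuous_map (subtopology (Euclidean_space (?m + ?n)) Z) (subtopology (Euclidean_space ?n) (\<psi> ` V)) (tail_coords ?m)"
        unfolding continuous_map_in_subtopology using cd by (auto simp: Z_def)
    qed
    ultimately show "continuous_map (subtopology (Euclidean_space (?m + ?n)) Z) (prod_topology (mtop M) (mtop N)) G"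
      unfolding continuous_map_pairwise by (simp add: G_def comp_def)
  qed
  then show "case c of (U, \<phi>) \<Rightarrow> openin (mtop (mprod M N)) U \<and>
       (\<exists>V. openin (Euclidean_space (mdim (mprod M N))) V \<and>
           homeomorphic_map (subtopology (mtop (mprod M N)) U)
             (subtopology (Euclidean_space (mdim (mprod M N))) V) \<phi>)"
    by (simp add: c(1) F_def)
qed

lemma smooth_on_fst:
  assumes M: "charted M" "compat M" and N: "charted N" and W: "openin (mtop (mprod M N)) W"
  shows "smooth_on (mprod M N) W M fst"
proof (rule smooth_onI[OF W])
  show "fst x \<in> topspace (mtop M)" if "x \<in> W" for x using openin_subset[OF W] that by auto
  show op: "openin (mtop (mprod M N)) {x \<in> W. fst x \<in> T}" if "openin (mtop M) T" for T
  proof -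
    have "{x \<in> W. fst x \<in> T} = W \<inter> (T \<times> topspace (mtop N))" using openin_subset[OF W] by auto
    then show ?thesis using W that by (auto simp: openin_prod_Times_iff)
  qed
  fix U \<phi> V \<psi> assume c: "(U, \<phi>) \<in> atlas (mprod M N)" "(V, \<psi>) \<in> atlas M"
  then obtain U1 \<phi>1 U2 \<phi>2 where u: "U = U1 \<times> U2"
      "\<phi> = (\<lambda>(x,y) j. if j < mdim M then \<phi>1 x j else \<phi>2 y (j - mdim M))"
      "(U1, \<phi>1) \<in> atlas M" "(U2, \<phi>2) \<in> atlas N" unfolding atlas_mprod by auto
  have tk: "init_coords (mdim M) (\<phi> x) = \<phi>1 (fst x)" if "x \<in> U" for x
    using chart_into_E[OF M(1) u(3), of "fst x"] that by (auto simp: init_coords_def u EE_iff fun_eq_iff)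
  have op': "openin (Euclidean_space (mdim (mprod M N))) (\<phi> ` {x \<in> U \<inter> W. fst x \<in> V})"
    by (rule rep_domain_open[OF charted_mprod[OF M(1) N] c(1) op[OF chartD(1)[OF M(1) c(2)]]])
  have 1: "smooth_Rn (mdim M) (mdim M) (\<phi>1 ` (U1 \<inter> V)) (\<lambda>p. \<psi> (inv_into U1 \<phi>1 p))"
    using M(2) u(3) c(2) by (force simp: compat_def comp_def)
  show "smooth_Rn (mdim (mprod M N)) (mdim M) (\<phi> ` {x \<in> U \<inter> W. fst x \<in> V}) (\<lambda>p. \<psi> (fst (inv_into U \<phi> p)))"
  proof (rule smooth_Rn_cong[OF op' _ smooth_Rn_comp[OF op' chart_open_image[OF M(1) u(3) openin_Int[OF chartD(1)[OF M(1) u(3)] chartD(1)[OF M(1) c(2)]]] _ _ 1]])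
    show "init_coords (mdim M) ` \<phi> ` {x \<in> U \<inter> W. fst x \<in> V} \<subseteq> \<phi>1 ` (U1 \<inter> V)"
      using tk u(1) by auto
    show "smooth_Rn (mdim (mprod M N)) (mdim M) (\<phi> ` {x \<in> U \<inter> W. fst x \<in> V}) (init_coords (mdim M))"
      by (rule smooth_RnI) (simp add: init_coords_def Ck_coord)
    fix p j assume "p \<in> \<phi> ` {x \<in> U \<inter> W. fst x \<in> V}"
    then obtain x where x: "x \<in> U" "p = \<phi> x" by blast
    then have "fst x \<in> U1" using u(1) by auto
    then show "\<psi> (inv_into U1 \<phi>1 (init_coords (mdim M) p)) j = \<psi> (fst (inv_into U \<phi> p)) j"
      using x tk chart_inv[OF charted_mprod[OF M(1) N] c(1)] chart_inv[OF M(1) u(3)] by simp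
  qed auto
qed

lemma smooth_on_snd:
  assumes M: "charted M" and N: "charted N" "compat N" and W: "openin (mtop (mprod M N)) W"
  shows "smooth_on (mprod M N) W N snd"
proof (rule smooth_onI[OF W])
  show "snd x \<in> topspace (mtop N)" if "x \<in> W" for x using openin_subset[OF W] that by auto
  show op: "openin (mtop (mprod M N)) {x \<in> W. snd x \<in> T}" if "openin (mtop N) T" for T
  proof -
    have "{x \<in> W. snd x \<in> T} = W \<inter> (topspace (mtop M) \<times> T)" using openin_subset[OF W] by auto
    then show ?thesis using W that by (auto simp: openin_prod_Times_iff)
  qed
  fix U \<phi> V \<psi> assume c: "(U, \<phi>) \<in> atlas (mprod M N)" "(V, \<psi>) \<in> atlas N"
  then obtain U1 \<phi>1 U2 \<phi>2 where u: "U = U1 \<times> U2"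
      "\<phi> = (\<lambda>(x,y) j. if j < mdim M then \<phi>1 x j else \<phi>2 y (j - mdim M))"
      "(U1, \<phi>1) \<in> atlas M" "(U2, \<phi>2) \<in> atlas N" unfolding atlas_mprod by auto
  have dr: "tail_coords (mdim M) (\<phi> x) = \<phi>2 (snd x)" if "x \<in> U" for x
    using that by (auto simp: tail_coords_def u fun_eq_iff)
  have op': "openin (Euclidean_space (mdim (mprod M N))) (\<phi> ` {x \<in> U \<inter> W. snd x \<in> V})"
    by (rule rep_domain_open[OF charted_mprod[OF M N(1)] c(1) op[OF chartD(1)[OF N(1) c(2)]]])
  have 1: "smooth_Rn (mdim N) (mdim N) (\<phi>2 ` (U2 \<inter> V)) (\<lambda>p. \<psi> (inv_into U2 \<phi>2 p))"
    using N(2) u(4) c(2) by (force simp: compat_def comp_def)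
  show "smooth_Rn (mdim (mprod M N)) (mdim N) (\<phi> ` {x \<in> U \<inter> W. snd x \<in> V}) (\<lambda>p. \<psi> (snd (inv_into U \<phi> p)))"
  proof (rule smooth_Rn_cong[OF op' _ smooth_Rn_comp[OF op' chart_open_image[OF N(1) u(4) openin_Int[OF chartD(1)[OF N(1) u(4)] chartD(1)[OF N(1) c(2)]]] _ _ 1]])
    show "tail_coords (mdim M) ` \<phi> ` {x \<in> U \<inter> W. snd x \<in> V} \<subseteq> \<phi>2 ` (U2 \<inter> V)"
      using dr u(1) by auto
    show "smooth_Rn (mdim (mprod M N)) (mdim N) (\<phi> ` {x \<in> U \<inter> W. snd x \<in> V}) (tail_coords (mdim M))"
      by (rule smooth_RnI) (simp add: tail_coords_def Ck_coord)
    fix p j assume "p \<in> \<phi> ` {x \<in> U \<inter> W. snd x \<in> V}"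
    then obtain x where x: "x \<in> U" "p = \<phi> x" by blast
    then have "snd x \<in> U2" using u(1) by auto
    then show "\<psi> (inv_into U2 \<phi>2 (tail_coords (mdim M) p)) j = \<psi> (snd (inv_into U \<phi> p)) j"
      using x dr chart_inv[OF charted_mprod[OF M N(1)] c(1)] chart_inv[OF N(1) u(4)] by simp
  qed auto
qed

text \<open>
  The i-th of consecutive blocks of length d: the coordinates of component i of a point of a power.
\<close>

definition coord_block :: "nat \<Rightarrow> nat \<Rightarrow> (nat \<Rightarrow> real) \<Rightarrow> nat \<Rightarrow> real" where
  "coord_block d i z = (\<lambda>j. if j < d then z ((i - 1) * d + j) else 0)"

lemma mpow_index:
  fixes j :: nat
  assumes "j < p * d"
  shows "j div d + 1 \<in> {1..p}" "j mod d < d"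
proof -
  have "0 < d" using assms by (intro Nat.gr0I) simp
  then show "j mod d < d" by simp
  show "j div d + 1 \<in> {1..p}" using less_mult_imp_div_less[OF assms] by simp
qed

lemma coord_block_index: 
  fixes i :: nat
  shows "i \<in> {1..p} \<Longrightarrow> j < d \<Longrightarrow> (i - 1) * d + j < p * d \<and> ((i - 1) * d + j) div d + 1 = i \<and> ((i - 1) * d + j) mod d = j"
proof -
  assume i: "i \<in> {1..p}" and j: "j < d"
  obtain i' where i': "i = Suc i'" using i by (cases i) auto
  have "i' * d + j < i' * d + d" using j by simp
  also have "\<dots> = i * d" by (simp add: i')
  also have "\<dots> \<le> p * d" using i by (intro mult_le_mono1) simp
  finally show ?thesis using j by (simp add: i' One_nat_def)
qed

lemma mpow_chart_block:
  assumes M: "charted M" and c: "c \<in> {1..p} \<rightarrow>\<^sub>E atlas M" and i: "i \<in> {1..p}" and g: "g i \<in> fst (c i)"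
  shows "coord_block (mdim M) i (\<lambda>j. if j < p * mdim M
            then snd (c (j div mdim M + 1)) (g (j div mdim M + 1)) (j mod mdim M) else 0) = snd (c i) (g i)"
proof
  fix j
  have "(fst (c i), snd (c i)) \<in> atlas M" using c i by auto
  from chart_into_E[OF M this g] coord_block_index[OF i, of j "mdim M"]
  show "coord_block (mdim M) i (\<lambda>j. if j < p * mdim M
            then snd (c (j div mdim M + 1)) (g (j div mdim M + 1)) (j mod mdim M) else 0) j = snd (c i) (g i) j"
    by (auto simp: coord_block_def EE_iff)
qed

lemma charted_mpow:
  assumes M: "charted M"
  shows "charted (mpow p M)"
  unfolding charted_def
proof (intro conjI ballI)
  let ?d = "mdim M" and ?X = "product_topology (\<lambda>_. mtop M) {1..p}"
  show "(\<Union>(U, \<phi>)\<in>atlas (mpow p M). U) = topspace (mtop (mpow p M))"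
  proof safe
    fix U \<phi> g assume "(U, \<phi>) \<in> atlas (mpow p M)" "g \<in> U"
    then obtain c where c: "U = (\<Pi>\<^sub>E i\<in>{1..p}. fst (c i))" "c \<in> {1..p} \<rightarrow>\<^sub>E atlas M" "g \<in> U"
      unfolding atlas_mpow by auto
    have "fst (c i) \<subseteq> topspace (mtop M)" if "i \<in> {1..p}" for i
      using charted_sub[OF M, of "fst (c i)" "snd (c i)"] PiE_mem[OF c(2) that] by simp
    then have "g i \<in> topspace (mtop M)" if "i \<in> {1..p}" for i using c that by blast
    then show "g \<in> topspace (mtop (mpow p M))" using c by (simp add: PiE_iff)
  next
    fix g assume g: "g \<in> topspace (mtop (mpow p M))"
    have "\<exists>C. C \<in> atlas M \<and> g i \<in> fst C" if "i \<in> {1..p}" for i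
      using chart_cover[OF M, of "g i"] g that by (force simp: PiE_iff)
    then obtain C where C: "\<And>i. i \<in> {1..p} \<Longrightarrow> C i \<in> atlas M \<and> g i \<in> fst (C i)" by metis
    define c where "c = (\<lambda>i\<in>{1..p}. C i)"
    have "(\<Pi>\<^sub>E i\<in>{1..p}. fst (c i), \<lambda>g j. if j < p * mdim M
                      then snd (c (j div mdim M + 1)) (g (j div mdim M + 1)) (j mod mdim M)
                      else 0) \<in> atlas (mpow p M)"
      unfolding atlas_mpow using C by (intro exI[of _ c]) (auto simp: c_def)
    moreover have "g \<in> (\<Pi>\<^sub>E i\<in>{1..p}. fst (c i))" using g C by (auto simp: c_def PiE_iff)
    ultimately show "g \<in> (\<Union>(U, \<phi>)\<in>atlas (mpow p M). U)" by blast
  qed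
  fix C assume "C \<in> atlas (mpow p M)"
  then obtain c where c: "C = (\<Pi>\<^sub>E i\<in>{1..p}. fst (c i), \<lambda>g j. if j < p * ?d
                      then snd (c (j div ?d + 1)) (g (j div ?d + 1)) (j mod ?d) else 0)" 
      "c \<in> {1..p} \<rightarrow>\<^sub>E atlas M" unfolding atlas_mpow by blast
  define F where "F = (\<lambda>(g::nat \<Rightarrow> 'a) j. if j < p * ?d
                      then snd (c (j div ?d + 1)) (g (j div ?d + 1)) (j mod ?d) else 0)"
  define U where "U = (\<Pi>\<^sub>E i\<in>{1..p}. fst (c i))"
  have ci: "(fst (c i), snd (c i)) \<in> atlas M" if "i \<in> {1..p}" for i using c(2) that by auto
  define Z where "Z = {z \<in> EE (p * ?d). \<forall>i\<in>{1..p}. coord_block ?d i z \<in> snd (c i) ` fst (c i)}"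
  define G where "G z = (\<lambda>i\<in>{1..p}. inv_into (fst (c i)) (snd (c i)) (coord_block ?d i z))" for z
  have cb: "continuous_map (subtopology (Euclidean_space (p * ?d)) Y) (Euclidean_space ?d) (coord_block ?d i)" for Y i
    by (rule continuous_map_E_reindex[where h="\<lambda>j. (i - 1) * ?d + j"]) (auto simp: coord_block_def EE_iff)
  have blkF: "coord_block ?d i (F g) = snd (c i) (g i)" if "g \<in> U" "i \<in> {1..p}" for g i
    unfolding F_def by (rule mpow_chart_block[OF M c(2) that(2)]) (use that in \<open>auto simp: U_def\<close>)
  have Zop: "openin (Euclidean_space (p * ?d)) Z"
  proof -
    have "openin (Euclidean_space (p * ?d)) {z \<in> EE (p * ?d). coord_block ?d i z \<in> snd (c i) ` fst (c i)}" if "i \<in> {1..p}" for i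
      using openin_continuous_map_preimage[OF cb[of "EE (p * ?d)"] chartD(2)[OF M ci[OF that]]]
      by (simp add: subtopology_topspace)
    then have "openin (Euclidean_space (p * ?d)) (EE (p * ?d) \<inter> (\<Inter>i\<in>{1..p}. {z \<in> EE (p * ?d). coord_block ?d i z \<in> snd (c i) ` fst (c i)}))"
      by (intro openin_Int_Inter) auto
    moreover have "Z = EE (p * ?d) \<inter> (\<Inter>i\<in>{1..p}. {z \<in> EE (p * ?d). coord_block ?d i z \<in> snd (c i) ` fst (c i)})"
      by (auto simp: Z_def)
    ultimately show ?thesis by simp
  qed
  have "openin ?X U \<and> (\<exists>Z. openin (Euclidean_space (p * ?d)) Z \<and>
       homeomorphic_map (subtopology ?X U) (subtopology (Euclidean_space (p * ?d)) Z) F)"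
  proof (rule charted_chartI[OF _ Zop])
    show op: "openin ?X U"
      unfolding U_def using chartD(1)[OF M ci] by (simp add: openin_PiE)
    have top: "topspace (subtopology ?X U) = U" using openin_subset[OF op] by auto
    show "continuous_map (subtopology ?X U) (Euclidean_space (p * ?d)) F"
      unfolding continuous_map_into_E
    proof (intro conjI allI impI)
      show "F ` topspace (subtopology ?X U) \<subseteq> EE (p * ?d)" by (auto simp: F_def EE_iff)
      fix j assume j: "j < p * ?d"
      define i where "i = j div ?d + 1"
      have i: "i \<in> {1..p}" using mpow_index[OF j] by (simp add: i_def)
      have "continuous_map (subtopology ?X U) (subtopology (mtop M) (fst (c i))) (\<lambda>g. g i)"
        unfolding continuous_map_in_subtopology
        using i by (auto simp: top U_def intro!: continuous_map_from_subtopology continuous_map_product_projection)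
      from continuous_map_compose[OF this chart_coord_continuous[OF M ci[OF i], of "j mod ?d"]]
      show "continuous_map (subtopology ?X U) euclideanreal (\<lambda>g. F g j)"
        using j by (simp add: F_def i_def comp_def)
    qed
    show "F ` U \<subseteq> Z"
    proof safe
      fix g assume g: "g \<in> U"
      then have "coord_block ?d i (F g) \<in> snd (c i) ` fst (c i)" if "i \<in> {1..p}" for i
        using blkF[OF g that] that by (auto simp: U_def)
      then show "F g \<in> Z" by (auto simp: Z_def F_def EE_iff)
    qed
    show GZ: "G ` Z \<subseteq> U" by (auto simp: G_def Z_def U_def intro!: inv_into_into)
    show "G (F g) = g" if "g \<in> U" for g
    proof
      fix i show "G (F g) i = g i"
      proof (cases "i \<in> {1..p}")
        case True
        then have "g i \<in> fst (c i)" using that unfolding U_def by (rule PiE_mem[rotated])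
        then show ?thesis using True blkF[OF that True] chart_inv[OF M ci[OF True]] by (simp add: G_def)
      next
        case False
        have "g i = undefined" using PiE_arb[OF that[unfolded U_def] False] .
        then show ?thesis using False by (auto simp: G_def)
      qed
    qed
    show "F (G z) = z" if z: "z \<in> Z" for z
    proof
      fix j show "F (G z) j = z j"
      proof (cases "j < p * ?d")
        case True
        note i = mpow_index[OF True]
        have "snd (c (j div ?d + 1)) (G z (j div ?d + 1)) = coord_block ?d (j div ?d + 1) z"
          using z i by (auto simp: Z_def G_def f_inv_into_f)
        then show ?thesis using True i by (simp add: F_def coord_block_def)
      next
        case False
        then show ?thesis using z by (auto simp: F_def Z_def EE_iff)
      qed
    qed
    show "continuous_map (subtopology (Euclidean_space (p * ?d)) Z) ?X G"
      unfolding continuous_map_componentwise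
    proof (intro conjI ballI)
      show "G ` topspace (subtopology (Euclidean_space (p * ?d)) Z) \<subseteq> extensional {1..p}" by (auto simp: G_def)
      fix i assume i: "i \<in> {1..p}"
      have "continuous_map (subtopology (Euclidean_space (p * ?d)) Z) (mtop M) (inv_into (fst (c i)) (snd (c i)) \<circ> coord_block ?d i)"
      proof (rule continuous_map_compose[OF _ chart_inv_continuous[OF M ci[OF i]]])
        show "continuous_map (subtopology (Euclidean_space (p * ?d)) Z) (subtopology (Euclidean_space ?d) (snd (c i) ` fst (c i))) (coord_block ?d i)"
          unfolding continuous_map_in_subtopology using cb i by (auto simp: Z_def)
      qed
      then show "continuous_map (subtopology (Euclidean_space (p * ?d)) Z) (mtop M) (\<lambda>z. G z i)"
        using i by (simp add: G_def comp_def)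
    qed
  qed
  then show "case C of (U, \<phi>) \<Rightarrow> openin (mtop (mpow p M)) U \<and>
       (\<exists>V. openin (Euclidean_space (mdim (mpow p M))) V \<and>
           homeomorphic_map (subtopology (mtop (mpow p M)) U)
             (subtopology (Euclidean_space (mdim (mpow p M))) V) \<phi>)"
    by (simp add: c(1) F_def U_def)
qed

lemma smooth_on_mpow_proj:
  assumes M: "charted M" "compat M" and i: "i \<in> {1..p}" and W: "openin (mtop (mpow p M)) W"
  shows "smooth_on (mpow p M) W M (\<lambda>g. g i)"
proof (rule smooth_onI[OF W])
  have cp: "continuous_map (subtopology (mtop (mpow p M)) W) (mtop M) (\<lambda>g. g i)"
    using i by (auto intro!: continuous_map_from_subtopology continuous_map_product_projection)
  show "g i \<in> topspace (mtop M)" if "g \<in> W" for g using openin_subset[OF W] that i by (auto simp: PiE_iff)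
  show op: "openin (mtop (mpow p M)) {x \<in> W. x i \<in> T}" if "openin (mtop M) T" for T
    using cp that unfolding continuous_map_from_open[OF W] by blast
  fix U \<phi> V \<psi> assume C: "(U, \<phi>) \<in> atlas (mpow p M)" "(V, \<psi>) \<in> atlas M"
  then obtain c where c: "U = (\<Pi>\<^sub>E i\<in>{1..p}. fst (c i))" "\<phi> = (\<lambda>g j. if j < p * mdim M
                      then snd (c (j div mdim M + 1)) (g (j div mdim M + 1)) (j mod mdim M) else 0)" 
      "c \<in> {1..p} \<rightarrow>\<^sub>E atlas M" unfolding atlas_mpow by auto
  have ci: "(fst (c i), snd (c i)) \<in> atlas M" using c(3) i by auto
  have bl: "coord_block (mdim M) i (\<phi> g) = snd (c i) (g i)" if "g \<in> U" for g
    unfolding c(2) by (rule mpow_chart_block[OF M(1) c(3) i]) (use that i in \<open>auto simp: c(1)\<close>)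
  have op': "openin (Euclidean_space (mdim (mpow p M))) (\<phi> ` {x \<in> U \<inter> W. x i \<in> V})"
    by (rule rep_domain_open[OF charted_mpow[OF M(1)] C(1) op[OF chartD(1)[OF M(1) C(2)]]])
  have 1: "smooth_Rn (mdim M) (mdim M) (snd (c i) ` (fst (c i) \<inter> V)) (\<lambda>p. \<psi> (inv_into (fst (c i)) (snd (c i)) p))"
    using M(2) ci C(2) by (force simp: compat_def comp_def)
  show "smooth_Rn (mdim (mpow p M)) (mdim M) (\<phi> ` {x \<in> U \<inter> W. x i \<in> V}) (\<lambda>p. \<psi> (inv_into U \<phi> p i))"
  proof (rule smooth_Rn_cong[OF op' _ smooth_Rn_comp[OF op' chart_open_image[OF M(1) ci openin_Int[OF chartD(1)[OF M(1) ci] chartD(1)[OF M(1) C(2)]]] _ _ 1]])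
    show "coord_block (mdim M) i ` \<phi> ` {x \<in> U \<inter> W. x i \<in> V} \<subseteq> snd (c i) ` (fst (c i) \<inter> V)"
    proof safe
      fix x assume x: "x \<in> U" "x i \<in> V"
      then have "x i \<in> fst (c i)" using c(1) i by auto
      then show "coord_block (mdim M) i (\<phi> x) \<in> snd (c i) ` (fst (c i) \<inter> V)" using bl[OF x(1)] x(2) by auto
    qed
    show "smooth_Rn (mdim (mpow p M)) (mdim M) (\<phi> ` {x \<in> U \<inter> W. x i \<in> V}) (coord_block (mdim M) i)"
      by (rule smooth_RnI) (simp add: coord_block_def Ck_coord)
    fix q j assume "q \<in> \<phi> ` {x \<in> U \<inter> W. x i \<in> V}"
    then obtain x where x: "x \<in> U" "q = \<phi> x" by blast
    then have "x i \<in> fst (c i)" using c(1) i by auto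
    then show "\<psi> (inv_into (fst (c i)) (snd (c i)) (coord_block (mdim M) i q)) j = \<psi> (inv_into U \<phi> q i) j"
      using x bl chart_inv[OF charted_mpow[OF M(1)] C(1)] chart_inv[OF M(1) ci] by simp
  qed auto
qed

lemma smooth_on_mpow_tuple:
  assumes M: "charted M" and N: "charted N" and W: "openin (mtop M) W"
    and f: "\<And>i. i \<in> {1..p} \<Longrightarrow> smooth_on M W N (\<lambda>x. f x i)" and ext: "\<And>x. x \<in> W \<Longrightarrow> f x \<in> extensional {1..p}"
  shows "smooth_on M W (mpow p N) f"
proof -
  have "continuous_map (subtopology (mtop M) W) (product_topology (\<lambda>_. mtop N) {1..p}) f"
    unfolding continuous_map_componentwise using f ext by (auto simp: smooth_on_def)
  then have cont: "f ` W \<subseteq> topspace (mtop (mpow p N))"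
      "\<And>T. openin (mtop (mpow p N)) T \<Longrightarrow> openin (mtop M) {x \<in> W. f x \<in> T}"
    unfolding continuous_map_from_open[OF W] by auto
  show ?thesis
  proof (rule smooth_onI[OF W])
    fix U \<phi> V \<psi> assume C: "(U, \<phi>) \<in> atlas M" "(V, \<psi>) \<in> atlas (mpow p N)"
    then obtain c where c: "V = (\<Pi>\<^sub>E i\<in>{1..p}. fst (c i))" "\<psi> = (\<lambda>g j. if j < p * mdim N
                      then snd (c (j div mdim N + 1)) (g (j div mdim N + 1)) (j mod mdim N) else 0)" 
      "c \<in> {1..p} \<rightarrow>\<^sub>E atlas N" unfolding atlas_mpow by auto
    show "smooth_Rn (mdim M) (mdim (mpow p N)) (\<phi> ` {x \<in> U \<inter> W. f x \<in> V}) (\<lambda>q. \<psi> (f (inv_into U \<phi> q)))"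
    proof (rule smooth_RnI)
      fix j k assume "j < mdim (mpow p N)"
      then have j: "j < p * mdim N" by simp
      define i where "i = j div mdim N + 1"
      have i: "i \<in> {1..p}" "j mod mdim N < mdim N" using mpow_index[OF j] by (auto simp: i_def)
      have ci: "(fst (c i), snd (c i)) \<in> atlas N" using c(3) i by auto
      have "Ck (mdim M) k (\<phi> ` {x \<in> U \<inter> W. f x \<in> V}) (\<lambda>q. snd (c i) (f (inv_into U \<phi> q) i) (j mod mdim N))"
        by (rule Ck_subset[OF smooth_RnD[OF smooth_on_rep[OF f[OF i(1)] C(1) ci] i(2)]]) (use c(1) i in auto)
      then show "Ck (mdim M) k (\<phi> ` {x \<in> U \<inter> W. f x \<in> V}) (\<lambda>q. \<psi> (f (inv_into U \<phi> q)) j)"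
        using j by (simp add: c(2) i_def)
    qed
  qed (use cont in auto)
qed

subsection \<open>Euclidean space as a manifold\<close>

text \<open>
  With Euclidean space as a manifold the charts are themselves smooth maps, and \<open>smooth_on_comp\<close> covers
  compositions with them.
\<close>

definition Eucl :: "nat \<Rightarrow> (nat \<Rightarrow> real) manifold" where
  "Eucl n = \<lparr>mtop = Euclidean_space n, mdim = n, atlas = {(EE n, \<lambda>x. x)}\<rparr>"

lemma Eucl_simps [simp]: "mtop (Eucl n) = Euclidean_space n" "mdim (Eucl n) = n" "atlas (Eucl n) = {(EE n, \<lambda>x. x)}"
  by (simp_all add: Eucl_def)

lemma charted_Eucl: "charted (Eucl n)"
  unfolding charted_def
  using homeomorphic_map_id[of "Euclidean_space n" "Euclidean_space n", unfolded id_def]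
  by (auto simp: subtopology_topspace intro!: exI[of _ "EE n"])

lemma smooth_on_Eucl:
  assumes "openE n W" "smooth_Rn n m W f" "f ` W \<subseteq> EE m"
  shows "smooth_on (Eucl n) W (Eucl m) f"
proof (rule smooth_onI)
  have c: "continuous_on W f"
    using assms(2) by (intro continuous_on_to_E[OF assms(3)]) (auto dest: smooth_RnD[where k=0])
  show "openin (mtop (Eucl n)) {x \<in> W. f x \<in> T}" if "openin (mtop (Eucl m)) T" for T
    using open_preimage_E[OF assms(1) c assms(3)] that by simp
  fix U \<phi> V \<psi> assume "(U, \<phi>) \<in> atlas (Eucl n)" "(V, \<psi>) \<in> atlas (Eucl m)"
  then have *: "U = EE n" "\<phi> = (\<lambda>x. x)" "V = EE m" "\<psi> = (\<lambda>x. x)" by auto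
  have s: "\<phi> ` {x \<in> U \<inter> W. f x \<in> V} = W" using assms(3) openin_subset[OF assms(1)] by (auto simp: *)
  have "smooth_Rn n m W (\<lambda>p. \<psi> (f (inv_into U \<phi> p)))"
    by (rule smooth_Rn_cong[OF assms(1) _ assms(2)])
      (use openin_E_sub[OF assms(1)] in \<open>simp add: * inv_into_ident\<close>)
  then show "smooth_Rn (mdim (Eucl n)) (mdim (Eucl m)) (\<phi> ` {x \<in> U \<inter> W. f x \<in> V}) (\<lambda>p. \<psi> (f (inv_into U \<phi> p)))"
    unfolding s by simp
qed (use assms in auto)

lemma smooth_on_chart:
  assumes M: "charted M" "compat M" and c: "(U, \<phi>) \<in> atlas M"
  shows "smooth_on M U (Eucl (mdim M)) \<phi>"
proof (rule smooth_onI[OF chartD(1)[OF M(1) c]])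
  show "openin (mtop M) {x \<in> U. \<phi> x \<in> T}" if "openin (mtop (Eucl (mdim M))) T" for T
    using chart_open_preimage[OF M(1) c] that by simp
  show "\<phi> x \<in> topspace (mtop (Eucl (mdim M)))" if "x \<in> U" for x using chart_into_E[OF M(1) c that] by simp
  fix U' \<phi>' V \<psi> assume c': "(U', \<phi>') \<in> atlas M" "(V, \<psi>) \<in> atlas (Eucl (mdim M))"
  have "smooth_Rn (mdim M) (mdim M) (\<phi>' ` (U' \<inter> U)) (\<lambda>p. \<phi> (inv_into U' \<phi>' p))"
    using M(2) c c' by (force simp: compat_def comp_def)
  then have "smooth_Rn (mdim M) (mdim M) (\<phi>' ` {x \<in> U' \<inter> U. \<phi> x \<in> V}) (\<lambda>p. \<phi> (inv_into U' \<phi>' p))"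
    by (rule smooth_Rn_subset) auto
  then show "smooth_Rn (mdim M) (mdim (Eucl (mdim M))) (\<phi>' ` {x \<in> U' \<inter> U. \<phi> x \<in> V}) (\<lambda>p. \<psi> (\<phi> (inv_into U' \<phi>' p)))"
    using c'(2) by simp
qed

lemma smooth_on_chart_inv:
  assumes M: "charted M" "compat M" and c: "(U, \<phi>) \<in> atlas M"
  shows "smooth_on (Eucl (mdim M)) (\<phi> ` U) M (inv_into U \<phi>)"
proof -
  have W: "openin (mtop (Eucl (mdim M))) (\<phi> ` U)" using chartD(2)[OF M(1) c] by simp
  have cont: "inv_into U \<phi> ` \<phi> ` U \<subseteq> topspace (mtop M)"
      "\<And>T. openin (mtop M) T \<Longrightarrow> openE (mdim M) {x \<in> \<phi> ` U. inv_into U \<phi> x \<in> T}"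
    using chart_inv_continuous[OF M(1) c] unfolding continuous_map_from_open[OF chartD(2)[OF M(1) c]] by blast+
  show ?thesis
  proof (rule smooth_onI[OF W])
    fix U' \<phi>' V \<psi> assume c': "(U', \<phi>') \<in> atlas (Eucl (mdim M))" "(V, \<psi>) \<in> atlas M"
    then have *: "U' = EE (mdim M)" "\<phi>' = (\<lambda>x. x)" by auto
    have 1: "smooth_Rn (mdim M) (mdim M) (\<phi> ` (U \<inter> V)) (\<lambda>p. \<psi> (inv_into U \<phi> p))"
      using M(2) c c'(2) by (force simp: compat_def comp_def)
    have s: "\<phi>' ` {x \<in> U' \<inter> \<phi> ` U. inv_into U \<phi> x \<in> V} = \<phi> ` (U \<inter> V)"
      using chart_into_E[OF M(1) c] chart_inv[OF M(1) c] by (auto simp: *)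
    have "smooth_Rn (mdim M) (mdim M) (\<phi> ` (U \<inter> V)) (\<lambda>p. \<psi> (inv_into U \<phi> (inv_into U' \<phi>' p)))"
    proof (rule smooth_Rn_cong[OF _ _ 1])
      show "openE (mdim M) (\<phi> ` (U \<inter> V))"
        using chartD(1)[OF M(1) c] chartD(1)[OF M(1) c'(2)] by (intro chart_open_image[OF M(1) c] openin_Int) auto
    qed (use chart_into_E[OF M(1) c] in \<open>auto simp: * inv_into_ident\<close>)
    then show "smooth_Rn (mdim (Eucl (mdim M))) (mdim M) (\<phi>' ` {x \<in> U' \<inter> \<phi> ` U. inv_into U \<phi> x \<in> V})
        (\<lambda>p. \<psi> (inv_into U \<phi> (inv_into U' \<phi>' p)))" unfolding s by simp
  qed (use cont in auto)
qed

section \<open>Homomorphisms of Lie groups\<close>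

lemma charted_compact_nbhd:
  assumes M: "charted M" and O: "openin (mtop M) P" "x \<in> P"
  obtains Kc P' where "compactin (mtop M) Kc" "openin (mtop M) P'" "x \<in> P'" "P' \<subseteq> Kc" "Kc \<subseteq> P"
proof -
  let ?n = "mdim M"
  have "x \<in> topspace (mtop M)" using O openin_subset by blast
  then obtain U \<phi> where c: "(U, \<phi>) \<in> atlas M" "x \<in> U" using chart_cover[OF M] by blast
  define z where "z = \<phi> x"
  have op: "openE ?n (\<phi> ` (U \<inter> P))"
    using chartD(1)[OF M c(1)] O(1) by (intro chart_open_image[OF M c(1)] openin_Int) auto
  have zin: "z \<in> \<phi> ` (U \<inter> P)" using c(2) O(2) by (simp add: z_def)
  have zE: "z \<in> EE ?n" by (rule openin_E_sub[OF op zin])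
  obtain d where d: "d > 0" "cube ?n z d \<subseteq> \<phi> ` (U \<inter> P)" using op zin openin_E_iff by blast
  define S where "S l = (if l < ?n then {z l - d/2 .. z l + d/2} else {0})" for l
  define B where "B = (\<Pi>\<^sub>E l\<in>UNIV. S l)"
  have "compactin (powertop_real UNIV) B"
    unfolding B_def compactin_PiE by (auto simp: S_def)
  moreover have "B \<subseteq> {x. \<forall>i\<ge>?n. x i = 0}"
  proof safe
    fix y i assume "y \<in> B" "?n \<le> i"
    then have "y i \<in> S i" by (auto simp: B_def)
    then show "y i = 0" using \<open>?n \<le> i\<close> by (simp add: S_def)
  qed
  ultimately have cB: "compactin (Euclidean_space ?n) B"
    by (simp add: Euclidean_space_def compactin_subtopology)
  have Bd: "B \<subseteq> cube ?n z d"
  proof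
    fix y assume y: "y \<in> B"
    then have "y \<in> EE ?n" using \<open>B \<subseteq> {x. \<forall>i\<ge>?n. x i = 0}\<close> by (auto simp: EE_iff)
    moreover have "\<bar>y l - z l\<bar> < d" if "l < ?n" for l
    proof -
      have "y l \<in> S l" using y by (auto simp: B_def)
      then show ?thesis using that d(1) by (auto simp: S_def abs_less_iff)
    qed
    ultimately show "y \<in> cube ?n z d" by (simp add: cube_def)
  qed
  have bB: "cube ?n z (d/2) \<subseteq> B"
  proof
    fix y assume y: "y \<in> cube ?n z (d/2)"
    have "y l \<in> S l" for l
    proof (cases "l < ?n")
      case True
      then have "\<bar>y l - z l\<bar> < d/2" using y by (simp add: cube_def)
      then show ?thesis unfolding S_def if_P[OF True] atLeastAtMost_iff abs_less_iff by linarith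
    next
      case False
      then show ?thesis using y by (simp add: cube_def S_def EE_iff)
    qed
    then show "y \<in> B" by (auto simp: B_def)
  qed
  have "compactin (subtopology (Euclidean_space ?n) (\<phi> ` U)) B"
    using cB Bd d(2) by (auto simp: compactin_subtopology)
  then have Kc: "compactin (mtop M) (inv_into U \<phi> ` B)"
    by (rule image_compactin[OF _ chart_inv_continuous[OF M c(1)]])
  have inv: "inv_into U \<phi> y \<in> U \<inter> P \<and> \<phi> (inv_into U \<phi> y) = y" if "y \<in> cube ?n z d" for y
    using d(2) that chart_inv[OF M c(1)] by auto
  show ?thesis
  proof (rule that[OF Kc, of "{x \<in> U. \<phi> x \<in> cube ?n z (d/2)}"])
    show "openin (mtop M) {x \<in> U. \<phi> x \<in> cube ?n z (d/2)}" by (rule chart_open_preimage[OF M c(1) open_cube])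
    show "x \<in> {x \<in> U. \<phi> x \<in> cube ?n z (d/2)}" using c(2) cube_self[OF zE, of "d/2"] d(1) by (simp add: z_def)
    show "{x \<in> U. \<phi> x \<in> cube ?n z (d/2)} \<subseteq> inv_into U \<phi> ` B"
    proof
      fix y assume "y \<in> {x \<in> U. \<phi> x \<in> cube ?n z (d/2)}"
      then have "\<phi> y \<in> B" "inv_into U \<phi> (\<phi> y) = y" using bB chart_inv[OF M c(1)] by auto
      then show "y \<in> inv_into U \<phi> ` B" by (metis imageI)
    qed
    show "inv_into U \<phi> ` B \<subseteq> P" using Bd inv by blast
  qed
qed

lemma charted_locally_compact: "charted M \<Longrightarrow> locally_compact_space (mtop M)"
  unfolding locally_compact_space_def
proof safe
  fix x assume M: "charted M" and x: "x \<in> topspace (mtop M)"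
  obtain Kc P' where "compactin (mtop M) Kc" "openin (mtop M) P'" "x \<in> P'" "P' \<subseteq> Kc" "Kc \<subseteq> topspace (mtop M)"
    by (rule charted_compact_nbhd[OF M openin_topspace x])
  then show "\<exists>U Kc. openin (mtop M) U \<and> compactin (mtop M) Kc \<and> x \<in> U \<and> U \<subseteq> Kc" by blast
qed

lemma lie_groupD:
  assumes "lie_group G"
  shows "group G" "smooth_manifold (mfd G)" "charted (mfd G)" "compat (mfd G)"
    "topspace (mtop (mfd G)) = carrier G"
    "smooth_map (mprod (mfd G) (mfd G)) (mfd G) (\<lambda>(x,y). x \<otimes>\<^bsub>G\<^esub> y)"
    "smooth_map (mfd G) (mfd G) (\<lambda>x. inv\<^bsub>G\<^esub> x)"
  using assms smooth_manifoldD by (auto simp: lie_group_def)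

lemma smooth_on_compose2:
  assumes M: "charted M" and N: "charted N1" "charted N2" "charted P" and W: "openin (mtop M) W"
    and f: "smooth_on M W N1 f" and g: "smooth_on M W N2 g"
    and h: "smooth_map (mprod N1 N2) P (\<lambda>(x,y). h x y)"
  shows "smooth_on M W P (\<lambda>x. h (f x) (g x))"
proof -
  have "smooth_on M W P (\<lambda>x. (\<lambda>(x,y). h x y) (f x, g x))"
    by (rule smooth_on_comp[OF M charted_mprod[OF N(1,2)] N(3) W openin_topspace
          smooth_on_pair[OF M N(1,2) W f g] h])
      (use smooth_on_cont(1)[OF f W] smooth_on_cont(1)[OF g W] in auto)
  then show ?thesis by simp
qed

lemma lie_mult_smooth:
  assumes "lie_group G" "charted M" "openin (mtop M) W"
    "smooth_on M W (mfd G) f" "smooth_on M W (mfd G) g"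
  shows "smooth_on M W (mfd G) (\<lambda>x. f x \<otimes>\<^bsub>G\<^esub> g x)"
  by (rule smooth_on_compose2[OF assms(2) lie_groupD(3,3,3)[OF assms(1)] assms(3-5) lie_groupD(6)[OF assms(1)]])

lemma smooth_on_postcomp:
  assumes M: "charted M" and N: "charted N" "charted P" and W: "openin (mtop M) W"
    and f: "smooth_on M W N f" and h: "smooth_map N P h"
  shows "smooth_on M W P (\<lambda>x. h (f x))"
  by (rule smooth_on_comp[OF M N W openin_topspace f h]) (rule smooth_on_cont(1)[OF f W])

lemma lie_inv_smooth:
  assumes "lie_group G" "charted M" "openin (mtop M) W" "smooth_on M W (mfd G) f"
  shows "smooth_on M W (mfd G) (\<lambda>x. inv\<^bsub>G\<^esub> (f x))"
  by (rule smooth_on_postcomp[OF assms(2) lie_groupD(3,3)[OF assms(1)] assms(3-4) lie_groupD(7)[OF assms(1)]])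

lemma lie_const_smooth:
  assumes "lie_group G" "openin (mtop M) W" "c \<in> carrier G"
  shows "smooth_on M W (mfd G) (\<lambda>_. c)"
  using smooth_on_const[OF assms(2), of c "mfd G"] lie_groupD(5)[OF assms(1)] assms(3) by simp

lemma lie_translate_smooth:
  assumes G: "lie_group G" and g: "g \<in> carrier G"
  shows "smooth_map (mfd G) (mfd G) (\<lambda>x. g \<otimes>\<^bsub>G\<^esub> x)"
  by (rule lie_mult_smooth[OF G lie_groupD(3)[OF G] openin_topspace
        lie_const_smooth[OF G openin_topspace g] smooth_on_id[OF lie_groupD(4)[OF G] openin_topspace]])

lemma smooth_map_continuous: "smooth_on M (topspace (mtop M)) N f \<Longrightarrow> continuous_map (mtop M) (mtop N) f"
  by (simp add: smooth_on_def subtopology_topspace)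

lemma lie_translate_open:
  assumes G: "lie_group G" and g: "g \<in> carrier G" and P: "openin (mtop (mfd G)) P"
  shows "openin (mtop (mfd G)) {x \<in> carrier G. g \<otimes>\<^bsub>G\<^esub> x \<in> P}"
  using smooth_on_cont(2)[OF lie_translate_smooth[OF G g] openin_topspace P] lie_groupD(5)[OF G] by simp

text \<open>
  Countably many translates of Kc cover G, as G is second countable. Their images are compact, hence
  closed, and cover the locally compact Hausdorff space \<open>h(G)\<close>, so by Baire's theorem one of them has
  an interior point there. Translating back moves this point into the image of Kc.
\<close>

lemma hom_image_compact_interior:
  assumes G: "lie_group G" and G': "lie_group G'" and h: "h \<in> hom G G'"
    and cont: "continuous_map (mtop (mfd G)) (mtop (mfd G')) h"
    and cl: "closedin (mtop (mfd G')) (h ` carrier G)"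
    and P: "openin (mtop (mfd G)) P" "P \<noteq> {}" "P \<subseteq> Kc" and Kc: "compactin (mtop (mfd G)) Kc"
  obtains Y where "openin (mtop (mfd G')) Y" "Y \<inter> h ` carrier G \<noteq> {}" "Y \<inter> h ` carrier G \<subseteq> h ` Kc"
proof -
  interpret G: group G using lie_groupD(1)[OF G] .
  interpret G': group G' using lie_groupD(1)[OF G'] .
  interpret h: group_hom G G' h using h by unfold_locales
  let ?TG = "mtop (mfd G)" and ?TH = "mtop (mfd G')"
  have top: "topspace ?TG = carrier G" "topspace ?TH = carrier G'" using lie_groupD(5) G G' by auto
  have KG: "Kc \<subseteq> carrier G" using compactin_subset_topspace[OF Kc] top by simp
  define L where "L a = {x \<in> carrier G. inv\<^bsub>G\<^esub> a \<otimes>\<^bsub>G\<^esub> x \<in> P}" for a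
  have Lop: "openin ?TG (L a)" if "a \<in> carrier G" for a
    unfolding L_def using lie_translate_open[OF G _ P(1)] that by simp
  obtain k0 where k0: "k0 \<in> P" using P(2) by blast
  then have k0G: "k0 \<in> carrier G" using P(3) KG by blast
  have cov: "x \<in> L (x \<otimes>\<^bsub>G\<^esub> inv\<^bsub>G\<^esub> k0)" if "x \<in> carrier G" for x
    using that k0 k0G by (simp add: L_def G.inv_mult_group G.m_assoc)
  have "Lindelof_space ?TG"
    using smooth_manifoldD(4)[OF lie_groupD(2)[OF G]] by (rule second_countable_imp_Lindelof_space)
  moreover have "\<Union>(L ` carrier G) = topspace ?TG"
  proof
    show "\<Union>(L ` carrier G) \<subseteq> topspace ?TG" by (auto simp: L_def top)
    show "topspace ?TG \<subseteq> \<Union>(L ` carrier G)" unfolding top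
    proof
      fix x assume x: "x \<in> carrier G"
      have "x \<otimes>\<^bsub>G\<^esub> inv\<^bsub>G\<^esub> k0 \<in> carrier G" using x k0G by simp
      then show "x \<in> \<Union>(L ` carrier G)" using cov[OF x] by blast
    qed
  qed
  ultimately obtain V where V: "countable V" "V \<subseteq> L ` carrier G" "\<Union>V = topspace ?TG"
    using Lop unfolding Lindelof_space_def by (metis (no_types, lifting) imageE)
  then obtain A where A: "countable A" "A \<subseteq> carrier G" "V = L ` A" by (meson countable_subset_image)
  define Z where "Z = h ` carrier G"
  define T where "T = subtopology ?TH Z"
  have ZH: "Z \<subseteq> carrier G'" by (auto simp: Z_def)
  have topT: "topspace T = Z" using ZH top by (auto simp: T_def)
  have Haus: "Hausdorff_space ?TH" using smooth_manifoldD(3)[OF lie_groupD(2)[OF G']] .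
  have lc: "locally_compact_space T"
    unfolding T_def using charted_locally_compact[OF lie_groupD(3)[OF G']] cl
    by (intro locally_compact_space_closed_subset) (auto simp: Z_def)
  have reg: "regular_space T"
    using lc Haus locally_compact_Hausdorff_imp_regular_space Hausdorff_space_subtopology T_def by blast
  define C where "C a = h ` ((\<lambda>x. a \<otimes>\<^bsub>G\<^esub> x) ` Kc)" for a
  have Ccl: "closedin T (C a)" if "a \<in> carrier G" for a
  proof -
    have "compactin ?TG ((\<lambda>x. a \<otimes>\<^bsub>G\<^esub> x) ` Kc)"
      by (rule image_compactin[OF Kc smooth_map_continuous[OF lie_translate_smooth[OF G that]]])
    from image_compactin[OF this cont] have "compactin ?TH (C a)" by (simp add: C_def)
    then have "closedin ?TH (C a)" using Haus compactin_imp_closedin by blast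
    moreover have "C a \<subseteq> Z" using KG that by (auto simp: C_def Z_def)
    ultimately show ?thesis unfolding T_def using closedin_subset_topspace by blast
  qed
  have UC: "\<Union>(C ` A) = Z"
  proof
    show "\<Union>(C ` A) \<subseteq> Z" using Ccl A(2) closedin_subset topT by blast
    show "Z \<subseteq> \<Union>(C ` A)"
    proof
      fix z assume "z \<in> Z"
      then obtain x where x: "x \<in> carrier G" "z = h x" by (auto simp: Z_def)
      then obtain a where a: "a \<in> A" "x \<in> L a" using V A top by blast
      then have "x = a \<otimes>\<^bsub>G\<^esub> (inv\<^bsub>G\<^esub> a \<otimes>\<^bsub>G\<^esub> x)" "inv\<^bsub>G\<^esub> a \<otimes>\<^bsub>G\<^esub> x \<in> Kc"
        using A(2) x(1) P(3) by (auto simp: L_def G.m_assoc[symmetric])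
      then have "z \<in> C a" unfolding C_def x(2) by blast
      then show "z \<in> \<Union>(C ` A)" using a by blast
    qed
  qed
  have "\<exists>a\<in>A. T interior_of C a \<noteq> {}"
  proof (rule ccontr)
    assume "\<not> (\<exists>a\<in>A. T interior_of C a \<noteq> {})"
    then have "T interior_of \<Union>(C ` A) = {}"
      by (intro Baire_category_alt) (use lc reg A Ccl in auto)
    then have "Z = {}" unfolding UC using interior_of_topspace[of T] topT by simp
    then show False unfolding Z_def using G.one_closed by blast
  qed
  then obtain a where a: "a \<in> A" "T interior_of C a \<noteq> {}" by blast
  then obtain Y1 where Y1: "openin ?TH Y1" "Y1 \<inter> Z \<noteq> {}" "Y1 \<inter> Z \<subseteq> C a"
  proof -
    have "openin T (T interior_of C a)" by simp
    then obtain Y1 where "openin ?TH Y1" "T interior_of C a = Y1 \<inter> Z" unfolding T_def openin_subtopology by blast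
    then show ?thesis using a(2) interior_of_subset[of T "C a"] that by metis
  qed
  have aG: "a \<in> carrier G" using a A by blast
  \<comment> \<open>Y1 meets the image of the translate by a; translating by the inverse brings it into the image of Kc itself\<close>
  define Y where "Y = {y \<in> carrier G'. h a \<otimes>\<^bsub>G'\<^esub> y \<in> Y1}"
  show ?thesis
  proof (rule that[of Y])
    show "openin ?TH Y" unfolding Y_def by (rule lie_translate_open[OF G' _ Y1(1)]) (simp add: aG)
    obtain g where g: "g \<in> carrier G" "h g \<in> Y1" using Y1(2) by (auto simp: Z_def)
    have "h (inv\<^bsub>G\<^esub> a \<otimes>\<^bsub>G\<^esub> g) \<in> Y"
      using g aG by (simp add: Y_def G'.m_assoc[symmetric])
    then show "Y \<inter> h ` carrier G \<noteq> {}" using aG g(1) by (metis G.inv_closed G.m_closed IntI empty_iff imageI)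
    show "Y \<inter> h ` carrier G \<subseteq> h ` Kc"
    proof safe
      fix g assume g: "h g \<in> Y" "g \<in> carrier G"
      then have "h a \<otimes>\<^bsub>G'\<^esub> h g \<in> Y1 \<inter> Z" using aG by (auto simp: Y_def Z_def simp flip: h.hom_mult)
      then obtain k where k: "k \<in> Kc" "h a \<otimes>\<^bsub>G'\<^esub> h g = h (a \<otimes>\<^bsub>G\<^esub> k)" using Y1(3) by (auto simp: C_def)
      then have "h g = h k" using KG aG g(2) by (auto simp: subset_iff)
      then show "h g \<in> h ` Kc" using k(1) by blast
    qed
  qed
qed

text \<open>
  The normal form of a representative in charts. The map e is the inverse of the new chart of M.
\<close>

lemma manifold_normal_form:
  assumes M: "smooth_manifold M" and N: "smooth_manifold N" and h: "smooth_map M N h"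
    and ne: "topspace (mtop M) \<noteq> {}"
  obtains Q e V \<psi> I j where
    "openE (mdim M) Q" "Q \<noteq> {}" "smooth_on (Eucl (mdim M)) Q M e" "inj_on e Q"
    "\<And>X. openE (mdim M) X \<Longrightarrow> X \<subseteq> Q \<Longrightarrow> openin (mtop M) (e ` X)"
    "(V, \<psi>) \<in> atlas N" "\<And>y. y \<in> Q \<Longrightarrow> h (e y) \<in> V" "I \<subseteq> {..<mdim M}" "j ` I \<subseteq> {..<mdim N}"
    "\<And>y i. y \<in> Q \<Longrightarrow> i \<in> I \<Longrightarrow> \<psi> (h (e y)) (j i) = y i"
    "\<forall>y\<in>Q. \<forall>y'\<in>Q. (\<forall>i\<in>I. y i = y' i) \<longrightarrow> h (e y) = h (e y')"
proof -
  note M' = smooth_manifoldD[OF M] and N' = smooth_manifoldD[OF N]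
  obtain x0 where x0: "x0 \<in> topspace (mtop M)" using ne by blast
  obtain U \<phi> where u: "(U, \<phi>) \<in> atlas M" "x0 \<in> U" using chart_cover[OF M'(1) x0] by blast
  have "h x0 \<in> topspace (mtop N)" using smooth_on_cont(1)[OF h openin_topspace] x0 by blast
  then obtain V \<psi> where v: "(V, \<psi>) \<in> atlas N" "h x0 \<in> V" using chart_cover[OF N'(1)] by blast
  define S where "S = \<phi> ` {x \<in> U \<inter> topspace (mtop M). h x \<in> V}"
  define F where "F = (\<lambda>p. \<psi> (h (inv_into U \<phi> p)))"
  have S: "openE (mdim M) S"
    unfolding S_def by (rule rep_domain_open[OF M'(1) u(1) smooth_on_cont(2)[OF h openin_topspace chartD(1)[OF N'(1) v(1)]]])
  have F: "smooth_Rn (mdim M) (mdim N) S F" unfolding S_def F_def by (rule smooth_on_rep[OF h u(1) v(1)])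
  have Sne: "S \<noteq> {}" using x0 u v by (auto simp: S_def)
  obtain Q \<Psi> I j where nf: "straightened (mdim M) (mdim N) S F Q \<Psi> I j"
    "\<forall>y\<in>Q. \<forall>y'\<in>Q. (\<forall>i\<in>I. y i = y' i) \<longrightarrow> (\<forall>k<mdim N. F (\<Psi> y) k = F (\<Psi> y') k)"
  proof (rule smooth_normal_form[OF S Sne F])
    fix Q \<Psi> I j assume a: "straightened (mdim M) (mdim N) S F Q \<Psi> I j"
      "\<And>y y' k. y \<in> Q \<Longrightarrow> y' \<in> Q \<Longrightarrow> (\<And>i. i \<in> I \<Longrightarrow> y i = y' i) \<Longrightarrow> k < mdim N \<Longrightarrow> F (\<Psi> y) k = F (\<Psi> y') k"
    show thesis by (rule that[OF a(1)]) (use a(2) in blast)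
  qed
  note D = straightenedD[OF nf(1)]
  define e where "e y = inv_into U \<phi> (\<Psi> y)" for y
  have e: "e y \<in> U" "h (e y) \<in> V" "\<phi> (e y) = \<Psi> y" if "y \<in> Q" for y
  proof -
    have "\<Psi> y \<in> S" using D(4) that by blast
    then obtain x where x: "x \<in> U" "h x \<in> V" "\<Psi> y = \<phi> x" by (auto simp: S_def)
    then have "e y = x" using chart_inv[OF M'(1) u(1)] by (simp add: e_def)
    then show "e y \<in> U" "h (e y) \<in> V" "\<phi> (e y) = \<Psi> y" using x by auto
  qed
  have SE: "\<Psi> ` Q \<subseteq> EE (mdim M)" using D(4) openin_subset[OF S] by blast
  show ?thesis
  proof (rule that[of Q e V \<psi> I j, OF D(1,2) _ _ _ v(1) e(2) D(7,8)])
    show "smooth_on (Eucl (mdim M)) Q M e"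
      unfolding e_def
    proof (rule smooth_on_comp[OF charted_Eucl charted_Eucl M'(1) _ _ smooth_on_Eucl[OF D(1,3) SE] smooth_on_chart_inv[OF M'(1,2) u(1)]])
      show "\<Psi> ` Q \<subseteq> \<phi> ` U" using D(4) by (auto simp: S_def)
    qed (use D(1) chartD(2)[OF M'(1) u(1)] in auto)
    show "inj_on e Q"
    proof (rule inj_onI)
      fix y y' assume "y \<in> Q" "y' \<in> Q" "e y = e y'"
      then have "\<Psi> y = \<Psi> y'" using e(3) by metis
      then show "y = y'" using D(5) \<open>y \<in> Q\<close> \<open>y' \<in> Q\<close> by (auto dest: inj_onD)
    qed
    show "openin (mtop M) (e ` X)" if X: "openE (mdim M) X" "X \<subseteq> Q" for X
    proof -
      have "e ` X = {x \<in> U. \<phi> x \<in> \<Psi> ` X}"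
      proof safe
        fix x y assume "x \<in> U" "\<phi> x = \<Psi> y" "y \<in> X"
        then have "x = e y" using chart_inv[OF M'(1) u(1), of x] by (simp add: e_def)
        then show "x \<in> e ` X" using \<open>y \<in> X\<close> by blast
      next
        fix y assume y: "y \<in> X"
        show "e y \<in> U" using e(1) y X by blast
        show "\<phi> (e y) \<in> \<Psi> ` X" using e(3) y X by auto
      qed
      then show ?thesis using chart_open_preimage[OF M'(1) u(1) D(6)[OF X]] by simp
    qed
    have Fe: "F (\<Psi> y) = \<psi> (h (e y))" for y by (simp add: F_def e_def)
    show "\<psi> (h (e y)) (j i) = y i" if "y \<in> Q" "i \<in> I" for y i using D(9)[OF that] Fe by simp
    show "\<forall>y\<in>Q. \<forall>y'\<in>Q. (\<forall>i\<in>I. y i = y' i) \<longrightarrow> h (e y) = h (e y')"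
    proof (intro ballI impI)
      fix y y' assume y: "y \<in> Q" "y' \<in> Q" "\<forall>i\<in>I. y i = y' i"
      have "\<psi> (h (e y)) = \<psi> (h (e y'))"
      proof (rule EE_eqI[of _ "mdim N"])
        show "\<psi> (h (e y)) \<in> EE (mdim N)" "\<psi> (h (e y')) \<in> EE (mdim N)"
          using chart_into_E[OF N'(1) v(1) e(2)] y by auto
        show "\<psi> (h (e y)) k = \<psi> (h (e y')) k" if "k < mdim N" for k
          using nf(2) y that Fe by metis
      qed
      then show "h (e y) = h (e y')"
        by (rule inj_onD[OF chartD(3)[OF N'(1) v(1)]]) (use e(2) y(1,2) in auto)
    qed
  qed
qed

text \<open>
  In the situation of the normal form, \<open>r b\<close> reads the coordinates in I off from b and takes constants for
  the others. Left inverses and sections are both of the form \<open>e \<circ> r\<close>.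
\<close>

lemma smooth_on_reindex:
  fixes j :: "nat \<Rightarrow> nat"
  assumes N: "smooth_manifold N" and c: "(V, \<psi>) \<in> atlas N" and Q: "openE m Q"
    and e: "smooth_on (Eucl m) Q M e" and M: "charted M" and I: "I \<subseteq> {..<m}" and y0: "y0 \<in> EE m"
  defines "r \<equiv> \<lambda>b i. if i \<in> I then \<psi> b (j i) else y0 i"
  shows "openin (mtop N) {b \<in> V. r b \<in> Q}" "smooth_on N {b \<in> V. r b \<in> Q} M (\<lambda>b. e (r b))"
proof -
  note N' = smooth_manifoldD[OF N]
  define q where "q z i = (if i \<in> I then z (j i) else y0 i)" for z :: "nat \<Rightarrow> real" and i
  have rq: "r b = q (\<psi> b)" for b by (auto simp: r_def q_def fun_eq_iff)
  have qE: "q ` Y \<subseteq> EE m" for Y using y0 subsetD[OF I] by (fastforce simp: q_def EE_iff)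
  have sq: "smooth_Rn (mdim N) m (EE (mdim N)) q"
  proof (rule smooth_RnI)
    fix l k show "Ck (mdim N) k (EE (mdim N)) (\<lambda>x. q x l)"
      by (cases "l \<in> I") (simp_all add: q_def Ck_coord Ck_const)
  qed
  have "smooth_on N V (Eucl m) (\<lambda>b. q (\<psi> b))"
  proof (rule smooth_on_postcomp[OF N'(1) charted_Eucl charted_Eucl chartD(1)[OF N'(1) c] smooth_on_chart[OF N'(1,2) c]])
    show "smooth_map (Eucl (mdim N)) (Eucl m) q"
      using smooth_on_Eucl[OF _ sq qE] by simp
  qed
  then have sr: "smooth_on N V (Eucl m) r" by (simp add: rq[abs_def])
  show op: "openin (mtop N) {b \<in> V. r b \<in> Q}"
    using smooth_on_cont(2)[OF sr chartD(1)[OF N'(1) c], of Q] Q by simp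
  show "smooth_on N {b \<in> V. r b \<in> Q} M (\<lambda>b. e (r b))"
    by (rule smooth_on_comp[OF N'(1) charted_Eucl M op _ smooth_on_subset[OF sr chartD(1)[OF N'(1) c] op] e])
      (use Q in auto)
qed

text \<open>
  In the normal form a coordinate outside I would be a direction in which h is constant, contrary to
  injectivity. So all coordinates of x can be read off from \<open>h x\<close>.
\<close>

lemma injective_smooth_left_inverse:
  assumes M: "smooth_manifold M" and N: "smooth_manifold N" and h: "smooth_map M N h"
    and ne: "topspace (mtop M) \<noteq> {}" and inj: "inj_on h (topspace (mtop M))"
  obtains X T l where "openin (mtop M) X" "X \<noteq> {}" "openin (mtop N) T" "smooth_on N T M l"
    "\<And>x. x \<in> X \<Longrightarrow> h x \<in> T \<and> l (h x) = x"
proof -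
  let ?m = "mdim M"
  obtain Q e V \<psi> I j where nf:
    "openE ?m Q" "Q \<noteq> {}" "smooth_on (Eucl ?m) Q M e" "inj_on e Q"
    "\<And>X. openE ?m X \<Longrightarrow> X \<subseteq> Q \<Longrightarrow> openin (mtop M) (e ` X)"
    "(V, \<psi>) \<in> atlas N" "\<And>y. y \<in> Q \<Longrightarrow> h (e y) \<in> V" "I \<subseteq> {..<?m}" "j ` I \<subseteq> {..<mdim N}"
    "\<And>y i. y \<in> Q \<Longrightarrow> i \<in> I \<Longrightarrow> \<psi> (h (e y)) (j i) = y i"
    "\<forall>y\<in>Q. \<forall>y'\<in>Q. (\<forall>i\<in>I. y i = y' i) \<longrightarrow> h (e y) = h (e y')"
    by (rule manifold_normal_form[OF M N h ne], rule that)
  have eM: "e y \<in> topspace (mtop M)" if "y \<in> Q" for y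
    using smooth_on_cont(1)[OF nf(3)] nf(1) that by auto
  have I: "I = {..<?m}"
  proof (rule ccontr)
    assume "I \<noteq> {..<?m}"
    then obtain i where i: "i < ?m" "i \<notin> I" using nf(8) by blast
    obtain y where y: "y \<in> Q" using nf(2) by blast
    obtain d where d: "d > 0" "\<And>t. \<bar>t - y i\<bar> < d \<Longrightarrow> y(i := t) \<in> Q"
      using openin_E_line[OF nf(1) y i(1)] by blast
    define y' where "y' = y(i := y i + d/2)"
    have y': "y' \<in> Q" unfolding y'_def using d(1) by (intro d(2)) simp
    have "\<forall>l\<in>I. y l = y' l" using i by (auto simp: y'_def)
    then have "h (e y) = h (e y')" using nf(11) y y' by blast
    then have "e y = e y'" using inj eM y y' by (auto dest: inj_onD)
    then have "y = y'" using nf(4) y y' by (auto dest: inj_onD)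
    then have "y i = y' i" by simp
    then show False using d(1) by (simp add: y'_def)
  qed
  have z: "(\<lambda>_. 0) \<in> EE ?m" by (simp add: EE_iff)
  define r where "r b i = (if i \<in> I then \<psi> b (j i) else 0)" for b i
  note re = smooth_on_reindex[OF N nf(6) nf(1) nf(3) smooth_manifoldD(1)[OF M] nf(8) z, where j=j]
  show ?thesis
  proof (rule that[of "e ` Q" "{b \<in> V. r b \<in> Q}" "\<lambda>b. e (r b)"])
    show "openin (mtop N) {b \<in> V. r b \<in> Q}" "smooth_on N {b \<in> V. r b \<in> Q} M (\<lambda>b. e (r b))"
      using re by (simp_all add: r_def[abs_def])
  next
    fix x assume "x \<in> e ` Q"
    then obtain y where y: "y \<in> Q" "x = e y" by blast
    have "r (h x) = y"
      by (rule EE_eqI[of _ ?m]) (use y nf(10)[OF y(1)] I openin_E_sub[OF nf(1) y(1)] in \<open>auto simp: r_def EE_iff\<close>)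
    then show "h x \<in> {b \<in> V. r b \<in> Q} \<and> e (r (h x)) = x" using y nf(7) by auto
  next
    show "openin (mtop M) (e ` Q)" by (rule nf(5)[OF nf(1) order_refl])
    show "e ` Q \<noteq> {}" using nf(2) by simp
  qed
qed

text \<open>
  In the normal form a component of h that is not of the form \<open>j i\<close> would be a function of the others on
  the image, contrary to the assumption that the image of an open set contains an open set. So all
  components can be prescribed.
\<close>

lemma fat_image_smooth_section:
  assumes M: "smooth_manifold M" and N: "smooth_manifold N" and h: "smooth_map M N h"
    and ne: "topspace (mtop M) \<noteq> {}"
    and fat: "\<And>P. openin (mtop M) P \<Longrightarrow> P \<noteq> {} \<Longrightarrow> \<exists>Y. openin (mtop N) Y \<and> Y \<noteq> {} \<and> Y \<subseteq> h ` P"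
  obtains T s where "openin (mtop N) T" "T \<noteq> {}" "smooth_on N T M s" "\<And>b. b \<in> T \<Longrightarrow> h (s b) = b"
proof -
  let ?m = "mdim M" and ?n = "mdim N"
  note N' = smooth_manifoldD[OF N]
  obtain Q e V \<psi> I j where nf:
    "openE ?m Q" "Q \<noteq> {}" "smooth_on (Eucl ?m) Q M e" "inj_on e Q"
    "\<And>X. openE ?m X \<Longrightarrow> X \<subseteq> Q \<Longrightarrow> openin (mtop M) (e ` X)"
    "(V, \<psi>) \<in> atlas N" "\<And>y. y \<in> Q \<Longrightarrow> h (e y) \<in> V" "I \<subseteq> {..<?m}" "j ` I \<subseteq> {..<?n}"
    "\<And>y i. y \<in> Q \<Longrightarrow> i \<in> I \<Longrightarrow> \<psi> (h (e y)) (j i) = y i"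
    "\<forall>y\<in>Q. \<forall>y'\<in>Q. (\<forall>i\<in>I. y i = y' i) \<longrightarrow> h (e y) = h (e y')"
    by (rule manifold_normal_form[OF M N h ne], rule that)
  have J: "j ` I = {..<?n}"
  proof (rule ccontr)
    assume "j ` I \<noteq> {..<?n}"
    then obtain k where k: "k < ?n" "k \<notin> j ` I" using nf(9) by blast
    have eQ: "openin (mtop M) (e ` Q)" "e ` Q \<noteq> {}" using nf(5)[OF nf(1) order_refl] nf(2) by auto
    obtain Y where Y: "openin (mtop N) Y" "Y \<noteq> {}" "Y \<subseteq> h ` e ` Q" using fat[OF eQ] by blast
    have YV: "Y \<subseteq> V" using Y(3) nf(7) by auto
    have op: "openE ?n (\<psi> ` Y)" by (rule chart_open_image[OF N'(1) nf(6) Y(1) YV])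
    obtain y where y: "y \<in> Q" "h (e y) \<in> Y" using Y(2,3) by blast
    define z where "z = \<psi> (h (e y))"
    have z: "z \<in> \<psi> ` Y" using y by (simp add: z_def)
    obtain d where d: "d > 0" "\<And>t. \<bar>t - z k\<bar> < d \<Longrightarrow> z(k := t) \<in> \<psi> ` Y"
      using openin_E_line[OF op z k(1)] by blast
    have "z(k := z k + d/2) \<in> \<psi> ` Y" using d(1) by (intro d(2)) simp
    then obtain y' where y': "y' \<in> Q" "z(k := z k + d/2) = \<psi> (h (e y'))" using Y(3) by blast
    have "\<forall>i\<in>I. y i = y' i"
    proof
      fix i assume that: "i \<in> I"
      have "j i \<noteq> k" using k(2) that by blast
      then have "\<psi> (h (e y')) (j i) = z (j i)" by (simp flip: y'(2))
      then show "y i = y' i" using nf(10)[OF y(1) that] nf(10)[OF y'(1) that] by (simp add: z_def)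
    qed
    then have "h (e y) = h (e y')" using nf(11) y(1) y'(1) by blast
    then have "z(k := z k + d/2) = z" using y'(2) by (simp add: z_def)
    then have "(z(k := z k + d/2)) k = z k" by simp
    then show False using d(1) by simp
  qed
  obtain y0 where y0: "y0 \<in> Q" using nf(2) by blast
  have y0E: "y0 \<in> EE ?m" by (rule openin_E_sub[OF nf(1) y0])
  define r where "r b i = (if i \<in> I then \<psi> b (j i) else y0 i)" for b i
  note re = smooth_on_reindex[OF N nf(6) nf(1) nf(3) smooth_manifoldD(1)[OF M] nf(8) y0E, where j=j]
  show ?thesis
  proof (rule that[of "{b \<in> V. r b \<in> Q}" "\<lambda>b. e (r b)"])
    show "openin (mtop N) {b \<in> V. r b \<in> Q}" "smooth_on N {b \<in> V. r b \<in> Q} M (\<lambda>b. e (r b))"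
      using re by (simp_all add: r_def[abs_def])
    have "r (h (e y0)) = y0" using nf(10)[OF y0] by (auto simp: r_def fun_eq_iff)
    then show "{b \<in> V. r b \<in> Q} \<noteq> {}" using nf(7)[OF y0] y0 by force
    fix b assume b: "b \<in> {b \<in> V. r b \<in> Q}"
    have "\<psi> (h (e (r b))) = \<psi> b"
    proof (rule EE_eqI[of _ ?n])
      show "\<psi> (h (e (r b))) \<in> EE ?n" "\<psi> b \<in> EE ?n"
        using chart_into_E[OF N'(1) nf(6)] nf(7) b by auto
      fix k assume "k < ?n"
      then obtain i where i: "i \<in> I" "k = j i" using J by blast
      then show "\<psi> (h (e (r b))) k = \<psi> b k" using nf(10)[of "r b" i] b by (simp add: r_def)
    qed
    then show "h (e (r b)) = b" using chartD(3)[OF N'(1) nf(6)] nf(7) b by (auto dest: inj_onD)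
  qed
qed

text \<open>
  A section near one point exists because the images of open sets contain open sets; translation
  carries it to c.
\<close>

lemma surjective_hom_local_section:
  assumes B: "lie_group B" and C: "lie_group C" and b: "\<beta> \<in> hom B C" "smooth_map (mfd B) (mfd C) \<beta>"
    and surj: "\<beta> ` carrier B = carrier C" and c: "c \<in> carrier C"
  obtains X s where "openin (mtop (mfd C)) X" "c \<in> X" "smooth_on (mfd C) X (mfd B) s"
    "\<And>y. y \<in> X \<Longrightarrow> \<beta> (s y) = y"
proof -
  interpret B: group B using lie_groupD(1)[OF B] .
  interpret C: group C using lie_groupD(1)[OF C] .
  interpret h: group_hom B C \<beta> using b(1) by unfold_locales
  have top: "topspace (mtop (mfd B)) = carrier B" "topspace (mtop (mfd C)) = carrier C" using lie_groupD(5) B C by auto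
  have ne: "topspace (mtop (mfd B)) \<noteq> {}" using top B.one_closed by blast
  obtain T s where s: "openin (mtop (mfd C)) T" "T \<noteq> {}" "smooth_on (mfd C) T (mfd B) s" "\<And>b. b \<in> T \<Longrightarrow> \<beta> (s b) = b"
  proof (rule fat_image_smooth_section[OF lie_groupD(2)[OF B] lie_groupD(2)[OF C] b(2) ne])
    fix P assume P: "openin (mtop (mfd B)) P" "P \<noteq> {}"
    then obtain x where x: "x \<in> P" by blast
    obtain Kc P' where Kc: "compactin (mtop (mfd B)) Kc" "openin (mtop (mfd B)) P'" "x \<in> P'" "P' \<subseteq> Kc" "Kc \<subseteq> P"
      by (rule charted_compact_nbhd[OF lie_groupD(3)[OF B] P(1) x])
    have "closedin (mtop (mfd C)) (\<beta> ` carrier B)" using surj top(2) closedin_topspace by metis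
    then obtain Y where Y: "openin (mtop (mfd C)) Y" "Y \<inter> \<beta> ` carrier B \<noteq> {}" "Y \<inter> \<beta> ` carrier B \<subseteq> \<beta> ` Kc"
      by (rule hom_image_compact_interior[OF B C b(1) smooth_map_continuous[OF b(2)] _ Kc(2) _ Kc(4,1)]) (use Kc(3) in auto)
    have "Y \<subseteq> carrier C" using openin_subset[OF Y(1)] top by simp
    then show "\<exists>Y. openin (mtop (mfd C)) Y \<and> Y \<noteq> {} \<and> Y \<subseteq> \<beta> ` P"
      using Y Kc(5) surj by (intro exI[of _ Y]) blast
  qed (rule that)
  obtain c0 where c0: "c0 \<in> T" using s(2) by blast
  then have c0C: "c0 \<in> carrier C" using openin_subset[OF s(1)] top by blast
  obtain g where g: "g \<in> carrier B" "\<beta> g = c \<otimes>\<^bsub>C\<^esub> inv\<^bsub>C\<^esub> c0" using surj c c0C by (metis C.inv_closed C.m_closed imageE)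
  define d where "d = inv\<^bsub>C\<^esub> (\<beta> g)"
  have dC: "d \<in> carrier C" unfolding d_def by (intro C.inv_closed h.hom_closed g(1))
  define X where "X = {y \<in> carrier C. d \<otimes>\<^bsub>C\<^esub> y \<in> T}"
  have X: "openin (mtop (mfd C)) X" unfolding X_def by (rule lie_translate_open[OF C dC s(1)])
  show ?thesis
  proof (rule that[OF X, of "\<lambda>y. g \<otimes>\<^bsub>B\<^esub> s (d \<otimes>\<^bsub>C\<^esub> y)"])
    show "c \<in> X" using c c0 c0C by (simp add: X_def d_def g C.inv_mult_group C.m_assoc)
    have "smooth_on (mfd C) X (mfd B) (\<lambda>y. s (d \<otimes>\<^bsub>C\<^esub> y))"
    proof (rule smooth_on_comp[OF lie_groupD(3)[OF C] lie_groupD(3)[OF C] lie_groupD(3)[OF B] X s(1) _ s(3)])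
      show "smooth_on (mfd C) X (mfd C) (\<lambda>y. d \<otimes>\<^bsub>C\<^esub> y)"
        by (rule smooth_on_subset[OF lie_translate_smooth[OF C dC] openin_topspace X]) (use openin_subset[OF X] in auto)
      show "(\<lambda>y. d \<otimes>\<^bsub>C\<^esub> y) ` X \<subseteq> T" by (auto simp: X_def)
    qed
    then show "smooth_on (mfd C) X (mfd B) (\<lambda>y. g \<otimes>\<^bsub>B\<^esub> s (d \<otimes>\<^bsub>C\<^esub> y))"
      by (rule lie_mult_smooth[OF B lie_groupD(3)[OF C] X lie_const_smooth[OF B X g(1)]])
    fix y assume y: "y \<in> X"
    then have "d \<otimes>\<^bsub>C\<^esub> y \<in> T" "y \<in> carrier C" by (auto simp: X_def)
    moreover from this have "s (d \<otimes>\<^bsub>C\<^esub> y) \<in> carrier B" using smooth_on_cont(1)[OF s(3,1)] top by blast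
    ultimately show "\<beta> (g \<otimes>\<^bsub>B\<^esub> s (d \<otimes>\<^bsub>C\<^esub> y)) = y"
      using g(1) s(4) by (simp add: d_def C.m_assoc[symmetric])
  qed
qed

text \<open>
  The inverse of \<open>\<alpha>\<close> is continuous on the image. For a compact neighbourhood Kc of 1 with \<open>k\<^sup>-\<^sup>1k' \<in> A1\<close> for
  all \<open>k, k' \<in> Kc\<close>, the image of Kc contains an open subset of \<open>\<alpha>(A)\<close>, and translating a point of this
  subset to 1 gives B1.
\<close>

lemma injective_hom_inverse_continuous:
  assumes A: "lie_group A" and B: "lie_group B" and a: "\<alpha> \<in> hom A B" "smooth_map (mfd A) (mfd B) \<alpha>"
    and inj: "inj_on \<alpha> (carrier A)" and cl: "closedin (mtop (mfd B)) (\<alpha> ` carrier A)"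
    and A1: "openin (mtop (mfd A)) A1" "\<one>\<^bsub>A\<^esub> \<in> A1"
  obtains B1 where "openin (mtop (mfd B)) B1" "\<one>\<^bsub>B\<^esub> \<in> B1" "\<And>x. x \<in> carrier A \<Longrightarrow> \<alpha> x \<in> B1 \<Longrightarrow> x \<in> A1"
proof -
  interpret A: group A using lie_groupD(1)[OF A] .
  interpret B: group B using lie_groupD(1)[OF B] .
  interpret h: group_hom A B \<alpha> using a(1) by unfold_locales
  have top: "topspace (mtop (mfd A)) = carrier A" "topspace (mtop (mfd B)) = carrier B" using lie_groupD(5) B A by auto
  let ?AA = "mprod (mfd A) (mfd A)"
  have AA: "charted ?AA" by (rule charted_mprod[OF lie_groupD(3,3)[OF A]])
  have sm: "smooth_map ?AA (mfd A) (\<lambda>p. inv\<^bsub>A\<^esub> (fst p) \<otimes>\<^bsub>A\<^esub> snd p)"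
    by (intro lie_mult_smooth[OF A AA openin_topspace] lie_inv_smooth[OF A AA openin_topspace]
        smooth_on_fst smooth_on_snd lie_groupD[OF A] openin_topspace)
  define R where "R = {p \<in> topspace (mtop ?AA). inv\<^bsub>A\<^esub> (fst p) \<otimes>\<^bsub>A\<^esub> snd p \<in> A1}"
  have "openin (mtop ?AA) R"
    unfolding R_def by (rule smooth_on_cont(2)[OF sm openin_topspace A1(1)])
  then have "openin (prod_topology (mtop (mfd A)) (mtop (mfd A))) R" by simp
  moreover have "(\<one>\<^bsub>A\<^esub>, \<one>\<^bsub>A\<^esub>) \<in> R"
    using A1(2) top by (simp add: R_def)
  ultimately have "\<exists>U V. openin (mtop (mfd A)) U \<and> openin (mtop (mfd A)) V \<and> \<one>\<^bsub>A\<^esub> \<in> U \<and> \<one>\<^bsub>A\<^esub> \<in> V \<and> U \<times> V \<subseteq> R"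
    by (rule iffD1[OF openin_prod_topology_alt, rule_format])
  then obtain P1 P2 where P12: "openin (mtop (mfd A)) P1" "openin (mtop (mfd A)) P2"
    "\<one>\<^bsub>A\<^esub> \<in> P1" "\<one>\<^bsub>A\<^esub> \<in> P2" "P1 \<times> P2 \<subseteq> R"
    by blast
  have P: "openin (mtop (mfd A)) (P1 \<inter> P2)" "\<one>\<^bsub>A\<^esub> \<in> P1 \<inter> P2" using P12 by auto
  obtain Kc P' where Kc: "compactin (mtop (mfd A)) Kc" "openin (mtop (mfd A)) P'" "\<one>\<^bsub>A\<^esub> \<in> P'" "P' \<subseteq> Kc" "Kc \<subseteq> P1 \<inter> P2"
    by (rule charted_compact_nbhd[OF lie_groupD(3)[OF A] P])
  have P'ne: "P' \<noteq> {}" using Kc(3) by blast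
  obtain Y where Y: "openin (mtop (mfd B)) Y" "Y \<inter> \<alpha> ` carrier A \<noteq> {}" "Y \<inter> \<alpha> ` carrier A \<subseteq> \<alpha> ` Kc"
    by (rule hom_image_compact_interior[OF A B a(1) smooth_map_continuous[OF a(2)] cl Kc(2) P'ne Kc(4,1)])
  obtain y where y: "y \<in> Y" "y \<in> \<alpha> ` carrier A" using Y(2) by auto
  then obtain k0 where k0: "k0 \<in> Kc" "\<alpha> k0 \<in> Y" using subsetD[OF Y(3) IntI[OF y]] by auto
  have KA: "Kc \<subseteq> carrier A" using compactin_subset_topspace[OF Kc(1)] top by simp
  have k0A: "k0 \<in> carrier A" using k0 KA by blast
  show ?thesis
  proof (rule that[of "{b \<in> carrier B. \<alpha> k0 \<otimes>\<^bsub>B\<^esub> b \<in> Y}"])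
    show "openin (mtop (mfd B)) {b \<in> carrier B. \<alpha> k0 \<otimes>\<^bsub>B\<^esub> b \<in> Y}"
      by (rule lie_translate_open[OF B _ Y(1)]) (simp add: k0A)
    show "\<one>\<^bsub>B\<^esub> \<in> {b \<in> carrier B. \<alpha> k0 \<otimes>\<^bsub>B\<^esub> b \<in> Y}" using k0 k0A by simp
    fix x assume x: "x \<in> carrier A" "\<alpha> x \<in> {b \<in> carrier B. \<alpha> k0 \<otimes>\<^bsub>B\<^esub> b \<in> Y}"
    have "\<alpha> (k0 \<otimes>\<^bsub>A\<^esub> x) \<in> Y" using x k0A by simp
    moreover have "\<alpha> (k0 \<otimes>\<^bsub>A\<^esub> x) \<in> \<alpha> ` carrier A" using x(1) k0A by (intro imageI A.m_closed)
    ultimately have "\<alpha> (k0 \<otimes>\<^bsub>A\<^esub> x) \<in> \<alpha> ` Kc" by (intro subsetD[OF Y(3)] IntI)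
    then obtain k where k: "k \<in> Kc" "\<alpha> (k0 \<otimes>\<^bsub>A\<^esub> x) = \<alpha> k" by (rule imageE) (rule that, simp_all)
    have "k0 \<otimes>\<^bsub>A\<^esub> x = k"
      by (rule inj_onD[OF inj k(2)]) (use k0A x(1) KA k(1) in auto)
    then have "(k0, k0 \<otimes>\<^bsub>A\<^esub> x) \<in> P1 \<times> P2" using k k0 Kc(5) by auto
    then have "inv\<^bsub>A\<^esub> k0 \<otimes>\<^bsub>A\<^esub> (k0 \<otimes>\<^bsub>A\<^esub> x) \<in> A1" using P12(5) by (auto simp: R_def)
    then show "x \<in> A1" using k0A x(1) by (simp add: A.m_assoc[symmetric])
  qed
qed

text \<open>
  Translations on both sides carry f, near any given point of W, into the domain of a smooth left
  inverse of \<open>\<alpha>\<close>. Continuity of the inverse of \<open>\<alpha>\<close> ensures that the left inverse there returns the right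
  element of A.
\<close>

lemma injective_hom_lift_smooth:
  assumes A: "lie_group A" and B: "lie_group B" and a: "\<alpha> \<in> hom A B" "smooth_map (mfd A) (mfd B) \<alpha>"
    and inj: "inj_on \<alpha> (carrier A)" and cl: "closedin (mtop (mfd B)) (\<alpha> ` carrier A)"
    and M: "charted M" and W: "openin (mtop M) W" and f: "smooth_on M W (mfd B) f" and im: "f ` W \<subseteq> \<alpha> ` carrier A"
  shows "smooth_on M W (mfd A) (\<lambda>x. inv_into (carrier A) \<alpha> (f x))"
proof (rule smooth_on_local[OF M lie_groupD(3)[OF A] W])
  interpret A: group A using lie_groupD(1)[OF A] .
  interpret B: group B using lie_groupD(1)[OF B] .
  interpret h: group_hom A B \<alpha> using a(1) by unfold_locales
  have top: "topspace (mtop (mfd A)) = carrier A" "topspace (mtop (mfd B)) = carrier B" using lie_groupD(5) B A by auto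
  fix w assume w: "w \<in> W"
  then obtain a0 where a0: "a0 \<in> carrier A" "f w = \<alpha> a0" using im by blast
  have ne: "topspace (mtop (mfd A)) \<noteq> {}" "inj_on \<alpha> (topspace (mtop (mfd A)))" using top A.one_closed inj by auto
  obtain X T l where l: "openin (mtop (mfd A)) X" "X \<noteq> {}" "openin (mtop (mfd B)) T" "smooth_on (mfd B) T (mfd A) l"
    "\<And>x. x \<in> X \<Longrightarrow> \<alpha> x \<in> T \<and> l (\<alpha> x) = x"
    by (rule injective_smooth_left_inverse[OF lie_groupD(2)[OF A] lie_groupD(2)[OF B] a(2) ne], rule that)
  obtain x0 where x0: "x0 \<in> X" using l(2) by blast
  then have x0A: "x0 \<in> carrier A" using openin_subset[OF l(1)] top by blast
  define A1 where "A1 = {x \<in> carrier A. x0 \<otimes>\<^bsub>A\<^esub> x \<in> X}"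
  have A1: "openin (mtop (mfd A)) A1" "\<one>\<^bsub>A\<^esub> \<in> A1"
    unfolding A1_def using lie_translate_open[OF A x0A l(1)] x0 x0A by auto
  obtain B1 where B1: "openin (mtop (mfd B)) B1" "\<one>\<^bsub>B\<^esub> \<in> B1" "\<And>x. x \<in> carrier A \<Longrightarrow> \<alpha> x \<in> B1 \<Longrightarrow> x \<in> A1"
    by (rule injective_hom_inverse_continuous[OF A B a inj cl A1], rule that)
  define c where "c = \<alpha> (x0 \<otimes>\<^bsub>A\<^esub> inv\<^bsub>A\<^esub> a0)"
  have cB: "c \<in> carrier B" using x0A a0 by (simp add: c_def)
  have i0: "inv\<^bsub>B\<^esub> (\<alpha> a0) \<in> carrier B" using a0 by simp
  define W' where "W' = {x \<in> W. inv\<^bsub>B\<^esub> (\<alpha> a0) \<otimes>\<^bsub>B\<^esub> f x \<in> B1}"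
  have W': "openin (mtop M) W'"
    unfolding W'_def
    by (rule smooth_on_cont(2)[OF lie_mult_smooth[OF B M W lie_const_smooth[OF B W i0] f] W B1(1)])
  have W'W: "W' \<subseteq> W" by (auto simp: W'_def)
  have key: "c \<otimes>\<^bsub>B\<^esub> f x \<in> T \<and> a0 \<otimes>\<^bsub>A\<^esub> inv\<^bsub>A\<^esub> x0 \<otimes>\<^bsub>A\<^esub> l (c \<otimes>\<^bsub>B\<^esub> f x) = inv_into (carrier A) \<alpha> (f x)" if x: "x \<in> W'" for x
  proof -
    obtain y where y: "y \<in> carrier A" "f x = \<alpha> y" using im x W'W by blast
    have "\<alpha> (inv\<^bsub>A\<^esub> a0 \<otimes>\<^bsub>A\<^esub> y) \<in> B1" using x y a0(1) by (simp add: W'_def)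
    then have "inv\<^bsub>A\<^esub> a0 \<otimes>\<^bsub>A\<^esub> y \<in> A1" using B1(3) y(1) a0(1) by simp
    then have "x0 \<otimes>\<^bsub>A\<^esub> (inv\<^bsub>A\<^esub> a0 \<otimes>\<^bsub>A\<^esub> y) \<in> X" by (simp add: A1_def)
    from l(5)[OF this] have 1: "\<alpha> (x0 \<otimes>\<^bsub>A\<^esub> (inv\<^bsub>A\<^esub> a0 \<otimes>\<^bsub>A\<^esub> y)) \<in> T"
      "l (\<alpha> (x0 \<otimes>\<^bsub>A\<^esub> (inv\<^bsub>A\<^esub> a0 \<otimes>\<^bsub>A\<^esub> y))) = x0 \<otimes>\<^bsub>A\<^esub> (inv\<^bsub>A\<^esub> a0 \<otimes>\<^bsub>A\<^esub> y)" by auto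
    have 2: "c \<otimes>\<^bsub>B\<^esub> f x = \<alpha> (x0 \<otimes>\<^bsub>A\<^esub> (inv\<^bsub>A\<^esub> a0 \<otimes>\<^bsub>A\<^esub> y))"
      using x0A a0(1) y by (simp add: c_def B.m_assoc)
    have "a0 \<otimes>\<^bsub>A\<^esub> inv\<^bsub>A\<^esub> x0 \<otimes>\<^bsub>A\<^esub> (x0 \<otimes>\<^bsub>A\<^esub> (inv\<^bsub>A\<^esub> a0 \<otimes>\<^bsub>A\<^esub> y)) = y"
    proof -
      have "a0 \<otimes>\<^bsub>A\<^esub> inv\<^bsub>A\<^esub> x0 \<otimes>\<^bsub>A\<^esub> (x0 \<otimes>\<^bsub>A\<^esub> (inv\<^bsub>A\<^esub> a0 \<otimes>\<^bsub>A\<^esub> y))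
          = a0 \<otimes>\<^bsub>A\<^esub> ((inv\<^bsub>A\<^esub> x0 \<otimes>\<^bsub>A\<^esub> x0) \<otimes>\<^bsub>A\<^esub> (inv\<^bsub>A\<^esub> a0 \<otimes>\<^bsub>A\<^esub> y))"
        using x0A a0(1) y(1) by (simp only: A.m_assoc A.m_closed A.inv_closed)
      also have "\<dots> = (a0 \<otimes>\<^bsub>A\<^esub> inv\<^bsub>A\<^esub> a0) \<otimes>\<^bsub>A\<^esub> y" using x0A a0(1) y(1) by (simp add: A.m_assoc[symmetric])
      finally show ?thesis using a0(1) y(1) by simp
    qed
    moreover have "inv_into (carrier A) \<alpha> (f x) = y" using y inj by (simp add: inv_into_f_f)
    ultimately show ?thesis using 1 2 by simp
  qed
  have "smooth_on M W' (mfd A) (\<lambda>x. l (c \<otimes>\<^bsub>B\<^esub> f x))"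
  proof (rule smooth_on_comp[OF M lie_groupD(3)[OF B] lie_groupD(3)[OF A] W' l(3) _ l(4)])
    show "smooth_on M W' (mfd B) (\<lambda>x. c \<otimes>\<^bsub>B\<^esub> f x)"
      by (rule lie_mult_smooth[OF B M W' lie_const_smooth[OF B W' cB] smooth_on_subset[OF f W W' W'W]])
    show "(\<lambda>x. c \<otimes>\<^bsub>B\<^esub> f x) ` W' \<subseteq> T" using key by blast
  qed
  then have "smooth_on M W' (mfd A) (\<lambda>x. a0 \<otimes>\<^bsub>A\<^esub> inv\<^bsub>A\<^esub> x0 \<otimes>\<^bsub>A\<^esub> l (c \<otimes>\<^bsub>B\<^esub> f x))"
    using a0(1) x0A by (intro lie_mult_smooth[OF A M W'] lie_const_smooth[OF A W']) auto
  then have "smooth_on M W' (mfd A) (\<lambda>x. inv_into (carrier A) \<alpha> (f x))"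
    by (rule smooth_on_cong[OF _ M W' lie_groupD(3)[OF A]]) (use key in blast)
  moreover have "w \<in> W'" using w a0 B1(2) by (simp add: W'_def)
  ultimately show "\<exists>W'. openin (mtop M) W' \<and> w \<in> W' \<and> W' \<subseteq> W \<and> smooth_on M W' (mfd A) (\<lambda>x. inv_into (carrier A) \<alpha> (f x))"
    using W' W'W by blast
qed

section \<open>Cochain groups\<close>

subsection \<open>Smooth maps into and out of the spaces \<open>X\<^sup>p\<close>\<close>

lemma compatI:
  assumes M: "charted M" and id: "smooth_map M M (\<lambda>x. x)"
  shows "compat M"
  unfolding compat_def
proof (intro ballI, clarify)
  fix U \<phi> V \<psi> assume c: "(U, \<phi>) \<in> atlas M" "(V, \<psi>) \<in> atlas M"
  have "{x \<in> U \<inter> topspace (mtop M). x \<in> V} = U \<inter> V" using charted_sub[OF M c(1)] by auto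
  then show "smooth_Rn (mdim M) (mdim M) (\<phi> ` (U \<inter> V)) (\<psi> \<circ> inv_into U \<phi>)"
    using smooth_on_rep[OF id c] by (simp add: comp_def)
qed

lemma compat_mpow:
  assumes "charted M" "compat M"
  shows "compat (mpow p M)"
proof (rule compatI[OF charted_mpow[OF assms(1)]])
  show "smooth_map (mpow p M) (mpow p M) (\<lambda>x. x)"
    by (rule smooth_on_mpow_tuple[OF charted_mpow[OF assms(1)] assms(1) openin_topspace smooth_on_mpow_proj[OF assms _ openin_topspace]])
      (auto simp: PiE_iff)
qed

lemma smooth_on_empty: "smooth_on M {} N f"
proof (rule smooth_onI)
  fix U \<phi> V \<psi>
  have "Ck (mdim M) k {} g" for k g by (rule Ck_cong[OF openin_empty _ Ck_const]) auto
  then show "smooth_Rn (mdim M) (mdim N) (\<phi> ` {x \<in> U \<inter> {}. f x \<in> V}) (\<lambda>p. \<psi> (f (inv_into U \<phi> p)))"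
    by (simp add: smooth_Rn_def)
qed auto

locale gspace =
  fixes S :: "('g, 'x) gspace"
  assumes space: "smooth_gspace S"
begin

abbreviation "Gam \<equiv> Grp S"
abbreviation "X \<equiv> topspace (mtop (Spc S))"
abbreviation gam_mult (infixl "\<cdot>" 70) where "g \<cdot> h \<equiv> g \<otimes>\<^bsub>Gam\<^esub> h"

lemma Gam: "lie_group Gam" and Spc: "smooth_manifold (Spc S)" "charted (Spc S)" "compat (Spc S)"
  and Gact: "group_action Gam X (act S)"
  and act_smooth: "smooth_map (mprod (mfd Gam) (Spc S)) (Spc S) (\<lambda>(\<gamma>,x). act S \<gamma> x)"
  using space smooth_manifoldD(1,2) by (auto simp: smooth_gspace_def)

sublocale Gam: group Gam using lie_groupD(1)[OF Gam] .

lemma act_closed [simp]: "g \<in> carrier Gam \<Longrightarrow> x \<in> X \<Longrightarrow> act S g x \<in> X"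
  using group_action.element_image[OF Gact] by blast

lemma act_one [simp]: "x \<in> X \<Longrightarrow> act S \<one>\<^bsub>Gam\<^esub> x = x"
  using group_action.id_eq_one[OF Gact] by (metis restrict_apply')

lemma act_mult: "g \<in> carrier Gam \<Longrightarrow> h \<in> carrier Gam \<Longrightarrow> x \<in> X \<Longrightarrow> act S (g \<cdot> h) x = act S g (act S h x)"
  using group_action.composition_rule[OF Gact] by blast

lemma Xp_simps: "topspace (mtop (Xp S p)) = ({1..p} \<rightarrow>\<^sub>E carrier Gam) \<times> X"
  by (simp add: Xp_def lie_groupD(5)[OF Gam])

lemma charted_Xp: "charted (Xp S p)"
  unfolding Xp_def by (intro charted_mprod charted_mpow lie_groupD(3)[OF Gam] Spc)

lemma Xp_proj_smooth: "i \<in> {1..p} \<Longrightarrow> smooth_map (Xp S p) (mfd Gam) (\<lambda>xp. fst xp i)"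
proof -
  assume i: "i \<in> {1..p}"
  note G = lie_groupD(3,4)[OF Gam]
  have "smooth_map (Xp S p) (mpow p (mfd Gam)) fst"
    unfolding Xp_def by (rule smooth_on_fst[OF charted_mpow[OF G(1)] compat_mpow[OF G] Spc(2) openin_topspace])
  from smooth_on_postcomp[OF charted_Xp charted_mpow[OF G(1)] G(1) openin_topspace this smooth_on_mpow_proj[OF G i openin_topspace]]
  show ?thesis .
qed

lemma Xp_snd_smooth: "smooth_map (Xp S p) (Spc S) snd"
  unfolding Xp_def by (rule smooth_on_snd[OF charted_mpow[OF lie_groupD(3)[OF Gam]] Spc(2,3) openin_topspace])

lemma smooth_into_Xp:
  assumes M: "charted M" and W: "openin (mtop M) W"
    and F: "\<And>i. i \<in> {1..p} \<Longrightarrow> smooth_on M W (mfd Gam) (\<lambda>w. F w i)" "\<And>w. w \<in> W \<Longrightarrow> F w \<in> extensional {1..p}"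
    and f: "smooth_on M W (Spc S) f"
  shows "smooth_on M W (Xp S p) (\<lambda>w. (F w, f w))"
  unfolding Xp_def
  by (rule smooth_on_pair[OF M charted_mpow[OF lie_groupD(3)[OF Gam]] Spc(2) W
        smooth_on_mpow_tuple[OF M lie_groupD(3)[OF Gam] W F] f])

lemma smooth_act:
  assumes "charted M" "openin (mtop M) W" "smooth_on M W (mfd Gam) g" "smooth_on M W (Spc S) f"
  shows "smooth_on M W (Spc S) (\<lambda>w. act S (g w) (f w))"
  by (rule smooth_on_compose2[OF assms(1) lie_groupD(3)[OF Gam] Spc(2,2) assms(2-4) act_smooth])

lemma vertex_smooth:
  "set js \<subseteq> {1..p} \<Longrightarrow> smooth_map (Xp S p) (Spc S) (\<lambda>xp. foldr (\<lambda>j. act S (fst xp j)) js (snd xp))"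
proof (induction js)
  case Nil then show ?case using Xp_snd_smooth by simp
next
  case (Cons j js)
  have "smooth_map (Xp S p) (Spc S) (\<lambda>xp. act S (fst xp j) (foldr (\<lambda>j. act S (fst xp j)) js (snd xp)))"
    by (rule smooth_act[OF charted_Xp openin_topspace Xp_proj_smooth]) (use Cons in auto)
  then show ?case by simp
qed

lemma coverD:
  assumes "U \<in> covers S"
  shows "a \<in> Idx U \<Longrightarrow> openin (mtop (Spc S)) (Mem U a)" "a \<in> Idx U \<Longrightarrow> x \<in> Mem U a \<Longrightarrow> x \<in> X"
    "x \<in> X \<Longrightarrow> \<exists>a\<in>Idx U. x \<in> Mem U a"
  using assms openin_subset unfolding covers_def by blast+

lemma Uset_open:
  assumes U: "U \<in> covers S" and a: "a \<in> multi_idx U p"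
  shows "openin (mtop (Xp S p)) (Uset S U p a)"
proof -
  have "openin (mtop (Xp S p)) {xp \<in> topspace (mtop (Xp S p)). foldr (\<lambda>j. act S (fst xp j)) [i+1..<p+1] (snd xp) \<in> Mem U (a i)}"
    if "i \<le> p" for i
    using that a by (intro smooth_on_cont(2)[OF vertex_smooth openin_topspace coverD(1)[OF U]]) auto
  then have "openin (mtop (Xp S p)) (topspace (mtop (Xp S p)) \<inter>
     (\<Inter>i\<in>{..p}. {xp \<in> topspace (mtop (Xp S p)). foldr (\<lambda>j. act S (fst xp j)) [i+1..<p+1] (snd xp) \<in> Mem U (a i)}))"
    by (intro openin_Int_Inter) auto
  moreover have "Uset S U p a = topspace (mtop (Xp S p)) \<inter>
     (\<Inter>i\<in>{..p}. {xp \<in> topspace (mtop (Xp S p)). foldr (\<lambda>j. act S (fst xp j)) [i+1..<p+1] (snd xp) \<in> Mem U (a i)})"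
    by (auto simp: Uset_def)
  ultimately show ?thesis by simp
qed

subsection \<open>Simplices as lists\<close>

(* lengths of lists are computed as successors *)
declare One_nat_def [simp]

text \<open>
  A point \<open>(g\<^sub>1,...,g\<^sub>p,x)\<close> of the set \<open>U\<^bsub>a\<^esub>\<close> with \<open>a = (a\<^sub>0,...,a\<^sub>p)\<close> is written by two lists and an element of
  X. Faces of lists of fixed length can be computed by simplification, and cochains are equal as soon
  as their values on such simplices are.
\<close>

definition pt :: "'g list \<Rightarrow> 'x \<Rightarrow> ('g, 'x) pt" where
  "pt gs x = ((\<lambda>j\<in>{1..length gs}. gs ! (j - 1)), x)"

definition ix :: "'x set list \<Rightarrow> nat \<Rightarrow> 'x set" where
  "ix as = (\<lambda>j\<in>{..length as - 1}. as ! j)"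

definition splx :: "'x cover \<Rightarrow> 'x set list \<Rightarrow> 'g list \<Rightarrow> 'x \<Rightarrow> bool" where
  "splx U as gs x \<longleftrightarrow> length as = Suc (length gs) \<and> set as \<subseteq> Idx U \<and> set gs \<subseteq> carrier Gam \<and> x \<in> X \<and>
     (\<forall>i\<le>length gs. foldr (act S) (drop i gs) x \<in> Mem U (as ! i))"

definition val :: "('g, 'x, 'a) cochain \<Rightarrow> 'x set list \<Rightarrow> 'g list \<Rightarrow> 'x \<Rightarrow> 'a" where
  "val \<phi> as gs x = \<phi> (ix as) (pt gs x)"

lemma pt_in_Xp: "set gs \<subseteq> carrier Gam \<Longrightarrow> x \<in> X \<Longrightarrow> length gs = p \<Longrightarrow> pt gs x \<in> topspace (mtop (Xp S p))"
  unfolding Xp_simps pt_def by (auto simp: subset_iff)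

lemma ix_in: "set as \<subseteq> Idx U \<Longrightarrow> length as = Suc p \<Longrightarrow> ix as \<in> multi_idx U p"
  by (auto simp: ix_def subset_iff)

lemma foldr_pt:
  assumes "length gs = p"
  shows "foldr (\<lambda>j. act S (fst (pt gs x) j)) [i+1..<p+1] (snd (pt gs x)) = foldr (act S) (drop i gs) x"
proof -
  have "map (fst (pt gs x)) [i+1..<p+1] = drop i gs"
    by (rule nth_equalityI) (use assms in \<open>auto simp: pt_def nth_upt simp del: upt_Suc\<close>)
  moreover have "foldr (\<lambda>j. act S (fst (pt gs x) j)) js y = foldr (act S) (map (fst (pt gs x)) js) y" for js y
    by (induction js) auto
  ultimately show ?thesis by (simp add: pt_def)
qed

lemma splx_mem:
  assumes "splx U as gs x" "length gs = p"
  shows "ix as \<in> multi_idx U p" "pt gs x \<in> Uset S U p (ix as)"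
proof -
  show "ix as \<in> multi_idx U p" using assms by (intro ix_in) (auto simp: splx_def)
  have "pt gs x \<in> topspace (mtop (Xp S p))" using assms by (intro pt_in_Xp) (auto simp: splx_def)
  moreover have "foldr (\<lambda>j. act S (fst (pt gs x) j)) [i+1..<p+1] (snd (pt gs x)) \<in> Mem U (ix as i)" if "i \<le> p" for i
    unfolding foldr_pt[OF assms(2)] using assms that by (simp add: splx_def ix_def)
  ultimately show "pt gs x \<in> Uset S U p (ix as)" unfolding Uset_def by (auto simp: case_prod_beta)
qed

lemma splx_exhaust:
  assumes "a \<in> multi_idx U p" "xp \<in> Uset S U p a"
  obtains as gs x where "length gs = p" "splx U as gs x" "a = ix as" "xp = pt gs x"
proof -
  define as where "as = map a [0..<Suc p]"
  define gs where "gs = map (fst xp) [1..<p+1]"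
  have xp: "fst xp \<in> {1..p} \<rightarrow>\<^sub>E carrier Gam" "snd xp \<in> X"
    using assms(2) unfolding Uset_def Xp_simps by auto
  have len: "length gs = p" "length as = Suc p" by (simp_all add: gs_def as_def)
  have a: "a = ix as"
  proof
    fix j show "a j = ix as j"
      using PiE_arb[OF assms(1), of j] by (cases "j \<le> p") (simp_all add: ix_def as_def nth_map del: upt_Suc)
  qed
  have x: "xp = pt gs (snd xp)"
  proof (rule prod_eqI)
    show "fst xp = fst (pt gs (snd xp))"
    proof
      fix j show "fst xp j = fst (pt gs (snd xp)) j"
        using PiE_arb[OF xp(1), of j] by (auto simp: pt_def gs_def nth_upt simp del: upt_Suc)
    qed
  qed (simp add: pt_def)
  have "set as \<subseteq> Idx U" using assms(1) by (auto simp: as_def simp del: upt_Suc)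
  moreover have "set gs \<subseteq> carrier Gam" using xp(1) by (auto simp: gs_def)
  moreover have "foldr (act S) (drop i gs) (snd xp) \<in> Mem U (as ! i)" if "i \<le> length gs" for i
  proof -
    have "foldr (\<lambda>j. act S (fst xp j)) [i+1..<p+1] (snd xp) \<in> Mem U (a i)"
      using assms(2) that len unfolding Uset_def by (auto simp: case_prod_beta)
    moreover have "foldr (\<lambda>j. act S (fst xp j)) [i+1..<p+1] (snd xp) = foldr (act S) (drop i gs) (snd xp)"
      using foldr_pt[OF len(1), of "snd xp" i] unfolding x[symmetric] .
    moreover have "a i = as ! i" using that len a by (simp add: ix_def)
    ultimately show ?thesis by simp
  qed
  ultimately have "splx U as gs (snd xp)" using len xp by (simp add: splx_def)
  then show ?thesis using that len(1) a x by blast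
qed

lemma splx0: "U \<in> covers S \<Longrightarrow> splx U [a] [] x \<longleftrightarrow> a \<in> Idx U \<and> x \<in> Mem U a"
  using coverD(2) by (auto simp: splx_def)

lemma splx1: "U \<in> covers S \<Longrightarrow> splx U [a,b] [g] x \<longleftrightarrow>
    a \<in> Idx U \<and> b \<in> Idx U \<and> g \<in> carrier Gam \<and> act S g x \<in> Mem U a \<and> x \<in> Mem U b"
  using coverD(2) by (auto simp: splx_def le_Suc_eq)

lemma splx2: "U \<in> covers S \<Longrightarrow> splx U [a,b,c] [g,h] x \<longleftrightarrow>
    a \<in> Idx U \<and> b \<in> Idx U \<and> c \<in> Idx U \<and> g \<in> carrier Gam \<and> h \<in> carrier Gam \<and>
    act S g (act S h x) \<in> Mem U a \<and> act S h x \<in> Mem U b \<and> x \<in> Mem U c"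
  using coverD(2) by (auto simp: splx_def le_Suc_eq)

lemma splx3: "U \<in> covers S \<Longrightarrow> splx U [a,b,c,d] [g,h,k] x \<longleftrightarrow>
    a \<in> Idx U \<and> b \<in> Idx U \<and> c \<in> Idx U \<and> d \<in> Idx U \<and> g \<in> carrier Gam \<and> h \<in> carrier Gam \<and> k \<in> carrier Gam \<and>
    act S g (act S h (act S k x)) \<in> Mem U a \<and> act S h (act S k x) \<in> Mem U b \<and> act S k x \<in> Mem U c \<and> x \<in> Mem U d"
  using coverD(2) by (auto simp: splx_def le_Suc_eq)

lemma splx_cases0:
  assumes "splx U as gs x" "length gs = 0"
  obtains a where "as = [a]" "gs = []"
  using assms by (auto simp: splx_def length_Suc_conv)

lemma splx_cases1:
  assumes "splx U as gs x" "length gs = 1"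
  obtains a b g where "as = [a,b]" "gs = [g]"
  using assms by (auto simp: splx_def length_Suc_conv One_nat_def)

lemma splx_cases2:
  assumes "splx U as gs x" "length gs = 2"
  obtains a b c g h where "as = [a,b,c]" "gs = [g,h]"
  using assms by (auto simp: splx_def length_Suc_conv numeral_2_eq_2)

lemma splx_cases3:
  assumes "splx U as gs x" "length gs = 3"
  obtains a b c d g h k where "as = [a,b,c,d]" "gs = [g,h,k]"
  using assms by (auto simp: splx_def length_Suc_conv numeral_3_eq_3)

subsection \<open>The groups of cochains\<close>

abbreviation "Coch p U G \<equiv> carrier (K S p U G)"

lemma K_carrier: "Coch p U G = (\<Pi>\<^sub>E a\<in>multi_idx U p. Cinf (Xp S p) (Uset S U p a) (mfd G))"
  by (simp add: K_def)

lemma K_smooth: "\<phi> \<in> Coch p U G \<Longrightarrow> a \<in> multi_idx U p \<Longrightarrow> smooth_on (Xp S p) (Uset S U p a) (mfd G) (\<phi> a)"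
  unfolding K_carrier by (drule PiE_mem) (auto simp: Cinf_def)

lemma K_carrierI:
  assumes U: "U \<in> covers S" and G: "lie_group G"
    and f: "\<And>a. a \<in> multi_idx U p \<Longrightarrow> smooth_on (Xp S p) (Uset S U p a) (mfd G) (f a)"
  shows "(\<lambda>a\<in>multi_idx U p. \<lambda>xp\<in>Uset S U p a. f a xp) \<in> Coch p U G"
  unfolding K_carrier
proof (intro restrict_PiE_iff[THEN iffD2] ballI)
  fix a assume a: "a \<in> multi_idx U p"
  have "smooth_on (Xp S p) (Uset S U p a) (mfd G) (\<lambda>xp\<in>Uset S U p a. f a xp)"
    by (rule smooth_on_cong[OF f[OF a] charted_Xp Uset_open[OF U a] lie_groupD(3)[OF G]]) simp
  then show "(\<lambda>xp\<in>Uset S U p a. f a xp) \<in> Cinf (Xp S p) (Uset S U p a) (mfd G)"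
    by (simp add: Cinf_def)
qed

lemma K_ext:
  assumes "\<phi> \<in> Coch p U G" "\<psi> \<in> Coch p U G'"
    "\<And>as gs x. splx U as gs x \<Longrightarrow> length gs = p \<Longrightarrow> val \<phi> as gs x = val \<psi> as gs x"
  shows "\<phi> = \<psi>"
proof (rule extensionalityI[where A="multi_idx U p"])
  show "\<phi> \<in> extensional (multi_idx U p)" "\<psi> \<in> extensional (multi_idx U p)"
    using assms(1,2) unfolding K_carrier PiE_iff by blast+
  fix a assume a: "a \<in> multi_idx U p"
  have "\<phi> a \<in> extensional (Uset S U p a)" "\<psi> a \<in> extensional (Uset S U p a)"
    using PiE_mem[OF assms(1)[unfolded K_carrier] a] PiE_mem[OF assms(2)[unfolded K_carrier] a] by (auto simp: Cinf_def)
  then show "\<phi> a = \<psi> a"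
  proof (rule extensionalityI)
    fix xp assume "xp \<in> Uset S U p a"
    then obtain as gs x where "length gs = p" "splx U as gs x" "a = ix as" "xp = pt gs x"
      using splx_exhaust[OF a] by blast
    then show "\<phi> a xp = \<psi> a xp" using assms(3) by (auto simp: val_def)
  qed
qed

lemma val_closed:
  assumes \<phi>: "\<phi> \<in> Coch p U G" and s: "splx U as gs x" "length gs = p"
    and U: "U \<in> covers S" and G: "lie_group G"
  shows "val \<phi> as gs x \<in> carrier G"
  using smooth_on_cont(1)[OF K_smooth[OF \<phi> splx_mem(1)[OF s]] Uset_open[OF U splx_mem(1)[OF s]]] splx_mem(2)[OF s]
  unfolding val_def lie_groupD(5)[OF G] by blast

lemma val_restrict:
  assumes s: "splx U as gs x" "length gs = p"
  shows "val (\<lambda>a\<in>multi_idx U p. \<lambda>xp\<in>Uset S U p a. f a xp) as gs x = f (ix as) (pt gs x)"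
  using splx_mem[OF s] by (simp add: val_def)

lemma val_mult: "splx U as gs x \<Longrightarrow> length gs = p \<Longrightarrow>
    val (\<phi> \<otimes>\<^bsub>K S p U G\<^esub> \<psi>) as gs x = val \<phi> as gs x \<otimes>\<^bsub>G\<^esub> val \<psi> as gs x"
  by (simp add: K_def val_restrict) (simp add: val_def)

lemma val_one: "splx U as gs x \<Longrightarrow> length gs = p \<Longrightarrow> val \<one>\<^bsub>K S p U G\<^esub> as gs x = \<one>\<^bsub>G\<^esub>"
  by (simp add: K_def val_restrict)

lemma K_mult_closed:
  assumes "U \<in> covers S" "lie_group G" "\<phi> \<in> Coch p U G" "\<psi> \<in> Coch p U G"
  shows "\<phi> \<otimes>\<^bsub>K S p U G\<^esub> \<psi> \<in> Coch p U G"
proof -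
  have "(\<lambda>a\<in>multi_idx U p. \<lambda>xp\<in>Uset S U p a. \<phi> a xp \<otimes>\<^bsub>G\<^esub> \<psi> a xp) \<in> Coch p U G"
    by (intro K_carrierI[OF assms(1,2)] lie_mult_smooth[OF assms(2) charted_Xp] Uset_open[OF assms(1)]
        K_smooth[OF assms(3)] K_smooth[OF assms(4)])
  then show ?thesis by (simp add: K_def)
qed

definition Kinv where "Kinv p U G \<phi> = (\<lambda>a\<in>multi_idx U p. \<lambda>xp\<in>Uset S U p a. inv\<^bsub>G\<^esub> (\<phi> a xp))"

lemma K_group:
  assumes U: "U \<in> covers S" and G: "lie_group G"
  shows "group (K S p U G)"
    and K_inv: "\<phi> \<in> Coch p U G \<Longrightarrow> inv\<^bsub>K S p U G\<^esub> \<phi> = Kinv p U G \<phi>"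
    and Kinv_closed: "\<phi> \<in> Coch p U G \<Longrightarrow> Kinv p U G \<phi> \<in> Coch p U G"
proof -
  interpret G: group G using lie_groupD(1)[OF G] .
  have one: "\<one>\<^bsub>K S p U G\<^esub> \<in> Coch p U G"
  proof -
    have "(\<lambda>a\<in>multi_idx U p. \<lambda>xp\<in>Uset S U p a. \<one>\<^bsub>G\<^esub>) \<in> Coch p U G"
      by (intro K_carrierI[OF U G] lie_const_smooth[OF G] Uset_open[OF U]) auto
    then show ?thesis by (simp add: K_def)
  qed
  have inv: "Kinv p U G \<phi> \<in> Coch p U G" if "\<phi> \<in> Coch p U G" for \<phi>
    unfolding Kinv_def
    by (intro K_carrierI[OF U G] lie_inv_smooth[OF G charted_Xp] Uset_open[OF U] K_smooth[OF that])
  note cl = val_closed[OF _ _ _ U G]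
  have linv: "Kinv p U G \<phi> \<otimes>\<^bsub>K S p U G\<^esub> \<phi> = \<one>\<^bsub>K S p U G\<^esub>" if \<phi>: "\<phi> \<in> Coch p U G" for \<phi>
  proof (rule K_ext[OF K_mult_closed[OF U G inv[OF \<phi>] \<phi>] one])
    fix as gs x assume s: "splx U as gs x" "length gs = p"
    show "val (Kinv p U G \<phi> \<otimes>\<^bsub>K S p U G\<^esub> \<phi>) as gs x = val \<one>\<^bsub>K S p U G\<^esub> as gs x"
      using cl[OF \<phi> s] by (simp add: val_mult[OF s] val_one[OF s] Kinv_def val_restrict[OF s]) (simp add: val_def)
  qed
  show g: "group (K S p U G)"
  proof (rule groupI)
    fix x y z assume "x \<in> Coch p U G" "y \<in> Coch p U G" "z \<in> Coch p U G"
    then show "x \<otimes>\<^bsub>K S p U G\<^esub> y \<otimes>\<^bsub>K S p U G\<^esub> z = x \<otimes>\<^bsub>K S p U G\<^esub> (y \<otimes>\<^bsub>K S p U G\<^esub> z)"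
      by (intro K_ext[of _ p U G _ G] K_mult_closed[OF U G]) (auto simp: val_mult G.m_assoc cl)
  next
    fix x assume x: "x \<in> Coch p U G"
    then show "\<one>\<^bsub>K S p U G\<^esub> \<otimes>\<^bsub>K S p U G\<^esub> x = x"
      by (intro K_ext[of _ p U G _ G] K_mult_closed[OF U G] one) (auto simp: val_mult val_one cl)
    show "\<exists>y\<in>Coch p U G. y \<otimes>\<^bsub>K S p U G\<^esub> x = \<one>\<^bsub>K S p U G\<^esub>"
      using inv[OF x] linv[OF x] by blast
  qed (use one K_mult_closed[OF U G] in auto)
  show "Kinv p U G \<phi> \<in> Coch p U G" if "\<phi> \<in> Coch p U G" using inv that .
  show "inv\<^bsub>K S p U G\<^esub> \<phi> = Kinv p U G \<phi>" if "\<phi> \<in> Coch p U G"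
    using group.inv_equality[OF g linv[OF that] that inv[OF that]] .
qed

lemma val_inv:
  assumes "U \<in> covers S" "lie_group G" "\<phi> \<in> Coch p U G" "splx U as gs x" "length gs = p"
  shows "val (inv\<^bsub>K S p U G\<^esub> \<phi>) as gs x = inv\<^bsub>G\<^esub> (val \<phi> as gs x)"
  unfolding K_inv[OF assms(1,2,3)] Kinv_def val_restrict[OF assms(4,5)] by (simp add: val_def)

lemma K_inv_closed:
  assumes "U \<in> covers S" "lie_group G" "\<phi> \<in> Coch p U G"
  shows "inv\<^bsub>K S p U G\<^esub> \<phi> \<in> Coch p U G"
  using Kinv_closed[OF assms] K_inv[OF assms] by simp

lemma K_one_closed: "U \<in> covers S \<Longrightarrow> lie_group G \<Longrightarrow> \<one>\<^bsub>K S p U G\<^esub> \<in> Coch p U G"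
  using monoid.one_closed[OF group.is_monoid[OF K_group(1)]] .

subsection \<open>Functoriality in the coefficients and in the cover\<close>

lemma post_closed:
  assumes "U \<in> covers S" "lie_group G" "lie_group G'" "smooth_map (mfd G) (mfd G') f" "\<phi> \<in> Coch p U G"
  shows "post S p U f \<phi> \<in> Coch p U G'"
  unfolding post_def
  by (intro K_carrierI[OF assms(1,3)] smooth_on_postcomp[OF charted_Xp lie_groupD(3)[OF assms(2)] lie_groupD(3)[OF assms(3)] _ _ assms(4)]
      Uset_open[OF assms(1)] K_smooth[OF assms(5)])

lemma val_post: "splx U as gs x \<Longrightarrow> length gs = p \<Longrightarrow> val (post S p U f \<phi>) as gs x = f (val \<phi> as gs x)"
  unfolding post_def by (simp add: val_restrict) (simp add: val_def)

lemma refinesD: "refines V U r \<Longrightarrow> b \<in> Idx V \<Longrightarrow> r b \<in> Idx U \<and> Mem V b \<subseteq> Mem U (r b)"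
  by (simp add: refines_def)

lemma splx_refine:
  assumes r: "refines V U r" and s: "splx V as gs x"
  shows "splx U (map r as) gs x"
proof -
  have "foldr (act S) (drop i gs) x \<in> Mem U (map r as ! i)" if "i \<le> length gs" for i
  proof -
    have "as ! i \<in> Idx V" using s that by (auto simp: splx_def subset_iff)
    from refinesD[OF r this] have "Mem V (as ! i) \<subseteq> Mem U (r (as ! i))" by blast
    moreover have "foldr (act S) (drop i gs) x \<in> Mem V (as ! i)" "i < length as" using s that by (auto simp: splx_def)
    ultimately show ?thesis by auto
  qed
  then show ?thesis using s refinesD[OF r] by (auto simp: splx_def)
qed

lemma refine_ix:
  assumes "as \<noteq> []"
  shows "(\<lambda>i\<in>{..length as - 1}. r (ix as i)) = ix (map r as)"
proof -
  have "j < length as" if "j \<le> length as - 1" for j using assms that by (cases as) auto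
  then show ?thesis by (auto simp: ix_def restrict_def fun_eq_iff)
qed

lemma val_restr:
  assumes s: "splx V as gs x" "length gs = p"
  shows "val (restr S p V r \<phi>) as gs x = val \<phi> (map r as) gs x"
proof -
  have l: "length as = Suc p" using s by (simp add: splx_def)
  then have "as \<noteq> []" "length as - 1 = p" by auto
  then have "(\<lambda>i\<in>{..p}. r (ix as i)) = ix (map r as)" using refine_ix[of as r] by simp
  then show ?thesis unfolding restr_def val_restrict[OF s] by (simp add: val_def)
qed

lemma restr_closed:
  assumes U: "U \<in> covers S" "V \<in> covers S" and G: "lie_group G" and r: "refines V U r" and \<phi>: "\<phi> \<in> Coch p U G"
  shows "restr S p V r \<phi> \<in> Coch p V G"
  unfolding restr_def
proof (intro K_carrierI[OF U(2) G])
  fix b assume b: "b \<in> multi_idx V p"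
  have a: "(\<lambda>i\<in>{..p}. r (b i)) \<in> multi_idx U p" using b refinesD[OF r] by auto
  have bi: "b i \<in> Idx V" if "i \<le> p" for i using b that by auto
  have "Uset S V p b \<subseteq> Uset S U p (\<lambda>i\<in>{..p}. r (b i))"
  proof clarify
    fix g x assume gx: "(g, x) \<in> Uset S V p b"
    then have "foldr (\<lambda>j. act S (g j)) [i+1..<p+1] x \<in> Mem U (r (b i))" if "i \<le> p" for i
      using refinesD[OF r bi[OF that]] that unfolding Uset_def by blast
    then show "(g, x) \<in> Uset S U p (\<lambda>i\<in>{..p}. r (b i))" using gx by (simp add: Uset_def del: upt_Suc)
  qed
  then show "smooth_on (Xp S p) (Uset S V p b) (mfd G) (\<phi> (\<lambda>i\<in>{..p}. r (b i)))"
    by (rule smooth_on_subset[OF K_smooth[OF \<phi> a] Uset_open[OF U(1) a] Uset_open[OF U(2) b]])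
qed

subsection \<open>Twisted pullbacks\<close>

lemma theta_hom:
  assumes G: "gamma_group Gam G" and g: "g \<in> carrier Gam"
  shows "group_hom G G (theta G g)"
proof -
  have "theta G g \<in> carrier (AutoGroup G)" using G g by (auto simp: gamma_group_def hom_def Pi_iff)
  then have "theta G g \<in> hom G G" by (simp add: AutoGroup_def auto_def)
  moreover have "group G" using G lie_groupD(1) by (auto simp: gamma_group_def)
  ultimately show ?thesis by (simp add: group_hom_def group_hom_axioms_def)
qed

lemma theta_mult:
  assumes G: "gamma_group Gam G" and g: "g \<in> carrier Gam" "h \<in> carrier Gam" and x: "x \<in> carrier G"
  shows "theta G (g \<cdot> h) x = theta G g (theta G h x)"
proof -
  have h: "theta G \<in> hom Gam (AutoGroup G)" using G by (simp add: gamma_group_def)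
  have c: "theta G g \<in> Bij (carrier G)" "theta G h \<in> Bij (carrier G)"
    using hom_in_carrier[OF h g(1)] hom_in_carrier[OF h g(2)] by (auto simp: AutoGroup_def auto_def)
  have "theta G (g \<cdot> h) = theta G g \<otimes>\<^bsub>AutoGroup G\<^esub> theta G h"
    using h g by (simp add: hom_mult)
  also have "\<dots> = compose (carrier G) (theta G g) (theta G h)" using c by (simp add: AutoGroup_def BijGroup_def)
  finally show ?thesis using x by (simp add: compose_def)
qed

lemma theta_one:
  assumes G: "gamma_group Gam G" and x: "x \<in> carrier G"
  shows "theta G \<one>\<^bsub>Gam\<^esub> x = x"
proof -
  have gG: "group G" using G lie_groupD(1) by (auto simp: gamma_group_def)
  interpret group_hom G G "theta G \<one>\<^bsub>Gam\<^esub>" using theta_hom[OF G] by simp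
  have "group_hom Gam (AutoGroup G) (theta G)"
    using G group.AutoGroup[OF gG] Gam.is_group by (simp add: gamma_group_def group_hom_def group_hom_axioms_def)
  then have "theta G \<one>\<^bsub>Gam\<^esub> = \<one>\<^bsub>AutoGroup G\<^esub>" by (rule group_hom.hom_one)
  then show ?thesis using x by (simp add: AutoGroup_def BijGroup_def)
qed

lemma gamma_groupD:
  assumes "gamma_group Gam G"
  shows "lie_group G" "smooth_map (mprod (mfd Gam) (mfd G)) (mfd G) (\<lambda>(\<gamma>,g). theta G \<gamma> g)" "group G"
  using assms lie_groupD(1) by (auto simp: gamma_group_def)

lemma theta_closed: "gamma_group Gam G \<Longrightarrow> g \<in> carrier Gam \<Longrightarrow> x \<in> carrier G \<Longrightarrow> theta G g x \<in> carrier G"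
  using group_hom.hom_closed[OF theta_hom] .

lemma face_smooth:
  assumes "i \<le> Suc p"
  shows "smooth_map (Xp S (Suc p)) (Xp S p) (face S (Suc p) i)"
proof -
  note sm = smooth_into_Xp[OF charted_Xp openin_topspace] and pr = Xp_proj_smooth and c = charted_Xp
  consider "i = 0" | "0 < i" "i < Suc p" | "i = Suc p" "i \<noteq> 0" using assms by linarith
  then show ?thesis
  proof cases
    case 1
    have "face S (Suc p) i = (\<lambda>xp. ((\<lambda>j\<in>{1..p}. fst xp (j+1)), snd xp))"
      using 1 by (auto simp: face_def fun_eq_iff)
    moreover have "smooth_map (Xp S (Suc p)) (Xp S p) (\<lambda>xp. ((\<lambda>j\<in>{1..p}. fst xp (j+1)), snd xp))"
      by (rule sm) (auto intro: Xp_snd_smooth intro!: pr)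
    ultimately show ?thesis by simp
  next
    case 2
    let ?F = "\<lambda>xp. (\<lambda>j\<in>{1..p}. if j < i then fst xp j else if j = i then fst xp i \<cdot> fst xp (i+1) else fst xp (j+1))"
    have "face S (Suc p) i = (\<lambda>xp. (?F xp, snd xp))"
      using 2 by (auto simp: face_def fun_eq_iff)
    moreover have "smooth_map (Xp S (Suc p)) (Xp S p) (\<lambda>xp. (?F xp, snd xp))"
    proof (rule sm)
      fix j assume j: "j \<in> {1..p}"
      consider "j < i" | "j = i" | "j > i" by linarith
      then show "smooth_map (Xp S (Suc p)) (mfd Gam) (\<lambda>xp. ?F xp j)"
      proof cases
        case 1
        then show ?thesis using j pr[of j "Suc p"] by simp
      next
        case eq: 2
        have "smooth_map (Xp S (Suc p)) (mfd Gam) (\<lambda>xp. fst xp i \<cdot> fst xp (i+1))"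
          by (rule lie_mult_smooth[OF Gam c openin_topspace pr pr]) (use 2 in auto)
        then show ?thesis using eq j by simp
      next
        case 3
        then show ?thesis using j pr[of "j+1" "Suc p"] by simp
      qed
    qed (auto intro: Xp_snd_smooth)
    ultimately show ?thesis by simp
  next
    case 3
    have "face S (Suc p) i = (\<lambda>xp. ((\<lambda>j\<in>{1..p}. fst xp j), act S (fst xp (Suc p)) (snd xp)))"
      using 3 by (auto simp: face_def fun_eq_iff)
    moreover have "smooth_map (Xp S (Suc p)) (Xp S p) (\<lambda>xp. ((\<lambda>j\<in>{1..p}. fst xp j), act S (fst xp (Suc p)) (snd xp)))"
      by (rule sm) (auto intro!: pr smooth_act[OF c openin_topspace _ Xp_snd_smooth])
    ultimately show ?thesis by simp
  qed
qed

definition lface :: "nat \<Rightarrow> 'g list \<Rightarrow> 'x \<Rightarrow> 'g list \<times> 'x" where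
  "lface i gs x = (if i = 0 then (tl gs, x) else if i < length gs then (take (i-1) gs @ (gs ! (i-1) \<cdot> gs ! i) # drop (i+1) gs, x)
     else (butlast gs, act S (last gs) x))"

lemma face_pt:
  assumes "length gs = Suc p" "i \<le> Suc p"
  shows "face S (Suc p) i (pt gs x) = (case lface i gs x of (gs', x') \<Rightarrow> pt gs' x')"
proof -
  consider "i = 0" | "0 < i" "i < Suc p" | "i = Suc p" "i \<noteq> 0" using assms by linarith
  then show ?thesis
  proof cases
    case 1
    then show ?thesis using assms by (auto simp: face_def pt_def lface_def fun_eq_iff nth_tl restrict_def)
  next
    case 2
    have e1: "face S (Suc p) i (pt gs x) = ((\<lambda>j\<in>{1..p}. if j < i then gs ! (j - 1) else if j = i then gs ! (i - 1) \<cdot> gs ! i else gs ! j), x)"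
      using 2 assms by (auto simp: face_def pt_def intro!: restrict_ext)
    have e2: "(case lface i gs x of (gs', x') \<Rightarrow> pt gs' x') = ((\<lambda>j\<in>{1..p}. (take (i-1) gs @ (gs ! (i-1) \<cdot> gs ! i) # drop (i+1) gs) ! (j - 1)), x)"
      using 2 assms by (simp add: lface_def pt_def min_def)
    show ?thesis unfolding e1 e2
      using 2 assms by (intro arg_cong2[where f=Pair] restrict_ext refl) (auto simp: nth_append nth_Cons' min_def)
  next
    case 3
    then have "gs \<noteq> []" using assms by auto
    then show ?thesis using 3 assms by (auto simp: face_def pt_def lface_def fun_eq_iff nth_butlast last_conv_nth restrict_def)
  qed
qed

lemma idx_face_ix:
  assumes "length as = Suc (Suc p)" "i \<le> Suc p"
  shows "idx_face (Suc p) i (ix as) = ix (take i as @ drop (Suc i) as)"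
  using assms by (auto simp: idx_face_def ix_def fun_eq_iff restrict_def nth_append min_def)

lemma lface_vertices:
  assumes "set gs \<subseteq> carrier Gam" "x \<in> X" "length gs = Suc p" "i \<le> Suc p" "k \<le> p" "lface i gs x = (gs', x')"
  shows "foldr (act S) (drop k gs') x' = foldr (act S) (drop (if k < i then k else Suc k) gs) x"
proof -
  have fX: "foldr (act S) hs x \<in> X" if "set hs \<subseteq> carrier Gam" for hs
    using that assms(2) by (induction hs) auto
  consider "i = 0" | "0 < i" "i < Suc p" | "i = Suc p" "i \<noteq> 0" using assms by linarith
  then show ?thesis
  proof cases
    case 1
    then show ?thesis using assms by (auto simp: lface_def drop_Suc)
  next
    case 2
    define i' where "i' = i - 1"
    have i: "i = Suc i'" "Suc i' < length gs" using 2 assms by (auto simp: i'_def)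
    have gs: "gs = take i' gs @ gs ! i' # gs ! Suc i' # drop (Suc (Suc i')) gs"
      using i by (metis Cons_nth_drop_Suc Suc_lessD append_take_drop_id)
    have el: "gs ! i' \<in> carrier Gam" "gs ! Suc i' \<in> carrier Gam" "set (drop (Suc (Suc i')) gs) \<subseteq> carrier Gam"
      using assms(1) i by (auto dest: in_set_dropD)
    have gs': "gs' = take i' gs @ (gs ! i' \<cdot> gs ! Suc i') # drop (Suc (Suc i')) gs" "x' = x"
      using assms(6) i 2 assms(3) by (auto simp: lface_def)
    show ?thesis
    proof (cases "k < i")
      case True
      then have "k \<le> i'" using i by simp
      then have "drop k gs' = drop k (take i' gs) @ (gs ! i' \<cdot> gs ! Suc i') # drop (Suc (Suc i')) gs"
        "drop k gs = drop k (take i' gs) @ gs ! i' # gs ! Suc i' # drop (Suc (Suc i')) gs"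
        using i gs' by simp (subst gs, use i \<open>k \<le> i'\<close> in simp)
      then show ?thesis using True el fX gs' by (simp add: act_mult)
    next
      case False
      then have "drop k gs' = drop (k - i' - 1) (drop (Suc (Suc i')) gs)" using i gs' by (simp add: drop_Cons' min_def)
      also have "\<dots> = drop (Suc k) gs" using False i by simp
      finally show ?thesis using False gs' by simp
    qed
  next
    case 3
    obtain bl l where gs: "gs = bl @ [l]" "length bl = p" using assms(3) by (cases gs rule: rev_exhaust) auto
    then have "gs' = bl" "x' = act S l x" using 3 assms(6) by (auto simp: lface_def)
    then show ?thesis using 3 assms(5) gs by simp
  qed
qed

lemma splx_face:
  assumes s: "splx U as gs x" "length gs = Suc p" and i: "i \<le> Suc p" and l: "lface i gs x = (gs', x')"
  shows "splx U (take i as @ drop (Suc i) as) gs' x'" "length gs' = p"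
proof -
  have s': "length as = Suc (Suc p)" "set as \<subseteq> Idx U" "set gs \<subseteq> carrier Gam" "x \<in> X"
     "\<And>k. k \<le> Suc p \<Longrightarrow> foldr (act S) (drop k gs) x \<in> Mem U (as ! k)"
    using s by (auto simp: splx_def)
  show len: "length gs' = p" using l s(2) i by (auto simp: lface_def split: if_splits)
  have mem: "gs ! k \<in> carrier Gam" if "k < Suc p" for k using s' s(2) that nth_mem by (metis subsetD)
  have "set gs' \<subseteq> carrier Gam \<and> x' \<in> X"
  proof -
    consider "i = 0" | "0 < i" "i < Suc p" | "i = Suc p" "i \<noteq> 0" using i by linarith
    then show ?thesis
    proof cases
      case 1
      then show ?thesis using l s' s(2) by (cases gs) (auto simp: lface_def)
    next
      case 2
      then show ?thesis using l s' s(2) mem[of "i-1"] mem[of i] by (auto simp: lface_def dest!: in_set_takeD in_set_dropD)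
    next
      case 3
      have "gs \<noteq> []" using s(2) by auto
      moreover have "last gs \<in> carrier Gam" using s'(3) \<open>gs \<noteq> []\<close> by (auto dest: subsetD)
      ultimately show ?thesis using l s' s(2) 3 by (auto simp: lface_def dest!: in_set_butlastD)
    qed
  qed
  moreover have "foldr (act S) (drop k gs') x' \<in> Mem U ((take i as @ drop (Suc i) as) ! k)" if "k \<le> p" for k
  proof -
    have "(take i as @ drop (Suc i) as) ! k = as ! (if k < i then k else Suc k)"
      using that i s'(1) by (auto simp: nth_append min_def)
    then show ?thesis using lface_vertices[OF s'(3,4) s(2) i that l] s'(5)[of "if k < i then k else Suc k"] that by auto
  qed
  ultimately show "splx U (take i as @ drop (Suc i) as) gs' x'"
    using len s' i by (auto simp: splx_def dest!: in_set_takeD in_set_dropD)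
qed

lemma face_Uset:
  assumes a: "a \<in> multi_idx U (Suc p)" and i: "i \<le> Suc p" and xp: "xp \<in> Uset S U (Suc p) a"
  shows "idx_face (Suc p) i a \<in> multi_idx U p" "face S (Suc p) i xp \<in> Uset S U p (idx_face (Suc p) i a)"
proof -
  obtain as gs x where *: "length gs = Suc p" "splx U as gs x" "a = ix as" "xp = pt gs x"
    by (rule splx_exhaust[OF a xp])
  obtain gs' x' where l: "lface i gs x = (gs', x')" by fastforce
  note sf = splx_face[OF *(2,1) i l]
  have len: "length as = Suc (Suc p)" using * by (simp add: splx_def)
  show "idx_face (Suc p) i a \<in> multi_idx U p" "face S (Suc p) i xp \<in> Uset S U p (idx_face (Suc p) i a)"
    using splx_mem[OF sf] by (simp_all add: *(3,4) face_pt[OF *(1) i] idx_face_ix[OF len i] l)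
qed

lemma val_delta:
  assumes s: "splx U as gs x" "length gs = Suc p" and i: "i \<le> Suc p" and l: "lface i gs x = (gs', x')"
  shows "val (delta S p U G i \<phi>) as gs x =
     (if i = 0 then theta G (hd gs) else id) (val \<phi> (take i as @ drop (Suc i) as) gs' x')"
proof -
  have len: "length as = Suc (Suc p)" using s by (simp add: splx_def)
  have "fst (pt gs x) 1 = hd gs" using s(2) by (cases gs) (auto simp: pt_def)
  then show ?thesis
    unfolding delta_def add.commute[of p 1] plus_1_eq_Suc val_restrict[OF s] twist_def face_pt[OF s(2) i] idx_face_ix[OF len i] l
    by (simp add: val_def)
qed

lemma delta_closed:
  assumes U: "U \<in> covers S" and G: "gamma_group Gam G" and i: "i \<le> Suc p" and \<phi>: "\<phi> \<in> Coch p U G"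
  shows "delta S p U G i \<phi> \<in> Coch (Suc p) U G"
  unfolding delta_def add.commute[of p 1] plus_1_eq_Suc
proof (rule K_carrierI[OF U gamma_groupD(1)[OF G]])
  note L = lie_groupD(3)[OF gamma_groupD(1)[OF G]]
  fix a assume a: "a \<in> multi_idx U (Suc p)"
  let ?W = "Uset S U (Suc p) a"
  have W: "openin (mtop (Xp S (Suc p))) ?W" by (rule Uset_open[OF U a])
  have Wsub: "?W \<subseteq> topspace (mtop (Xp S (Suc p)))" by (rule openin_subset[OF W])
  have f: "smooth_on (Xp S (Suc p)) ?W (mfd G) (\<lambda>xp. \<phi> (idx_face (Suc p) i a) (face S (Suc p) i xp))"
  proof (cases "?W = {}")
    case True
    show ?thesis unfolding True by (rule smooth_on_empty)
  next
    case False
    then obtain xp where "xp \<in> ?W" by blast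
    then have ia: "idx_face (Suc p) i a \<in> multi_idx U p" using face_Uset(1)[OF a i] by blast
    show ?thesis
      by (rule smooth_on_comp[OF charted_Xp charted_Xp L W Uset_open[OF U ia]
            smooth_on_subset[OF face_smooth[OF i] openin_topspace W Wsub] K_smooth[OF \<phi> ia]])
        (use face_Uset(2)[OF a i] in auto)
  qed
  show "smooth_on (Xp S (Suc p)) ?W (mfd G) (\<lambda>xp. twist G i xp (\<phi> (idx_face (Suc p) i a) (face S (Suc p) i xp)))"
  proof (cases "i = 0")
    case True
    have "smooth_on (Xp S (Suc p)) ?W (mfd G) (\<lambda>xp. theta G (fst xp 1) (\<phi> (idx_face (Suc p) i a) (face S (Suc p) i xp)))"
      by (rule smooth_on_compose2[OF charted_Xp lie_groupD(3)[OF Gam] L L W _ f gamma_groupD(2)[OF G]])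
        (rule smooth_on_subset[OF Xp_proj_smooth openin_topspace W Wsub], simp)
    then show ?thesis using True by (simp add: twist_def)
  qed (use f in \<open>simp add: twist_def\<close>)
qed

end

section \<open>Cocycles in low degrees\<close>

lemma (in group) cancel_l [simp]: "x \<in> carrier G \<Longrightarrow> y \<in> carrier G \<Longrightarrow> x \<otimes> (inv x \<otimes> y) = y"
  and cancel_r [simp]: "x \<in> carrier G \<Longrightarrow> y \<in> carrier G \<Longrightarrow> inv x \<otimes> (x \<otimes> y) = y"
  by (simp_all add: m_assoc[symmetric])

lemma (in group) inv_mult_eq_one:
  assumes "x \<in> carrier G" "y \<in> carrier G"
  shows "inv x \<otimes> y = \<one> \<longleftrightarrow> x = y"
proof
  assume "inv x \<otimes> y = \<one>"
  then have "x \<otimes> (inv x \<otimes> y) = x" using assms by simp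
  then show "x = y" using assms by simp
qed (use assms in simp)

lemma gamma_homD:
  assumes "f \<in> gamma_hom \<Gamma> G G'"
  shows "f \<in> hom G G'" "smooth_map (mfd G) (mfd G') f"
    "\<gamma> \<in> carrier \<Gamma> \<Longrightarrow> g \<in> carrier G \<Longrightarrow> f (theta G \<gamma> g) = theta G' \<gamma> (f g)"
  using assms by (auto simp: gamma_hom_def)

context gspace
begin

lemma common_refinement:
  assumes U: "U \<in> covers S" and V: "V \<in> covers S"
  obtains W r s where "W \<in> covers S" "refines W U r" "refines W V s"
proof -
  \<comment> \<open>indexed by its members, as indices are sets of points\<close>
  define W where "W = \<lparr>Idx = {Mem U a \<inter> Mem V b | a b. a \<in> Idx U \<and> b \<in> Idx V}, Mem = (\<lambda>w. w)\<rparr>"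
  have "\<forall>w\<in>Idx W. \<exists>a b. a \<in> Idx U \<and> b \<in> Idx V \<and> w = Mem U a \<inter> Mem V b" by (auto simp: W_def)
  then obtain r s where rs: "\<And>w. w \<in> Idx W \<Longrightarrow> r w \<in> Idx U \<and> s w \<in> Idx V \<and> w = Mem U (r w) \<inter> Mem V (s w)"
    by metis
  have "W \<in> covers S"
    unfolding covers_def
  proof (intro CollectI conjI ballI)
    show "openin (mtop (Spc S)) (Mem W w)" if "w \<in> Idx W" for w
    proof -
      have "openin (mtop (Spc S)) (Mem U (r w) \<inter> Mem V (s w))"
        using rs[OF that] by (intro openin_Int coverD(1)[OF U] coverD(1)[OF V]) auto
      then show ?thesis using rs[OF that] by (simp add: W_def)
    qed
    show "(\<Union>w\<in>Idx W. Mem W w) = X"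
    proof
      show "(\<Union>w\<in>Idx W. Mem W w) \<subseteq> X" using coverD(2)[OF U] by (auto simp: W_def)
      show "X \<subseteq> (\<Union>w\<in>Idx W. Mem W w)"
      proof
        fix x assume "x \<in> X"
        then obtain a b where "a \<in> Idx U" "x \<in> Mem U a" "b \<in> Idx V" "x \<in> Mem V b"
          using coverD(3)[OF U, of x] coverD(3)[OF V, of x] by auto
        then show "x \<in> (\<Union>w\<in>Idx W. Mem W w)" by (auto simp: W_def)
      qed
    qed
  qed
  moreover have "refines W U r" "refines W V s"
    using rs by (auto simp: refines_def W_def)
  ultimately show ?thesis using that by blast
qed

lemma triv_cover: "triv_cover S \<in> covers S" and refines_triv: "V \<in> covers S \<Longrightarrow> refines V (triv_cover S) (\<lambda>_. X)"
  using coverD(2) by (auto simp: triv_cover_def covers_def refines_def)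

lemma refines_comp: "refines V U r \<Longrightarrow> refines W V s \<Longrightarrow> refines W U (\<lambda>b. r (s b))"
  unfolding refines_def by blast

lemma refines_id: "refines U U (\<lambda>a. a)"
  by (simp add: refines_def)

lemma restr_restr:
  assumes "U \<in> covers S" "V \<in> covers S" "W \<in> covers S" "lie_group G" "\<phi> \<in> Coch p U G"
    "refines V U r" "refines W V s"
  shows "restr S p W s (restr S p V r \<phi>) = restr S p W (\<lambda>b. r (s b)) \<phi>"
proof (rule K_ext)
  show "restr S p W s (restr S p V r \<phi>) \<in> Coch p W G"
    by (intro restr_closed[of V W] restr_closed[of U V] assms)
  show "restr S p W (\<lambda>b. r (s b)) \<phi> \<in> Coch p W G"
    by (intro restr_closed[of U W] refines_comp[OF assms(6,7)] assms)
  fix as gs x assume s: "splx W as gs x" "length gs = p"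
  show "val (restr S p W s (restr S p V r \<phi>)) as gs x = val (restr S p W (\<lambda>b. r (s b)) \<phi>) as gs x"
    by (simp add: val_restr[OF s] val_restr[OF splx_refine[OF assms(7) s(1)] s(2)] comp_def)
qed

lemma restr_id:
  assumes "U \<in> covers S" "lie_group G" "\<phi> \<in> Coch p U G"
  shows "restr S p U (\<lambda>a. a) \<phi> = \<phi>"
  by (rule K_ext[OF restr_closed[OF assms(1,1,2) refines_id assms(3)] assms(3)]) (simp add: val_restr)

lemma restr_one:
  assumes "U \<in> covers S" "V \<in> covers S" "lie_group G" "refines V U r"
  shows "restr S p V r \<one>\<^bsub>K S p U G\<^esub> = \<one>\<^bsub>K S p V G\<^esub>"
  by (rule K_ext[OF restr_closed[OF assms(1-4) K_one_closed[OF assms(1,3)]] K_one_closed[OF assms(2,3)]])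
    (simp add: val_restr val_one splx_refine[OF assms(4)])

lemma restr_post:
  assumes "U \<in> covers S" "V \<in> covers S" "lie_group G" "lie_group G'" "refines V U r"
    "\<phi> \<in> Coch p U G" "post S p U f \<phi> \<in> Coch p U G'" "post S p V f (restr S p V r \<phi>) \<in> Coch p V G'"
  shows "restr S p V r (post S p U f \<phi>) = post S p V f (restr S p V r \<phi>)"
  by (rule K_ext[OF restr_closed[OF assms(1,2,4,5,7)] assms(8)])
    (simp add: val_restr val_post splx_refine[OF assms(5)])

lemma snd_pt: "snd (pt gs x) = x"
  by (simp add: pt_def)

text \<open>
  The cochain homotopies below are built from pullbacks along a smooth map of the spaces \<open>X\<^sup>p\<close>
  that is compatible with the covers.
\<close>

lemma K_pullback:
  assumes U: "U \<in> covers S" "V \<in> covers S" and G: "lie_group G" and \<phi>: "\<phi> \<in> Coch q U G"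
    and d: "smooth_map (Xp S p) (Xp S q) d"
    and kd: "\<And>as gs x. splx V as gs x \<Longrightarrow> length gs = p \<Longrightarrow>
      \<exists>as' gs' x'. length gs' = q \<and> splx U as' gs' x' \<and> k (ix as) = ix as' \<and> d (pt gs x) = pt gs' x'"
  shows "(\<lambda>b\<in>multi_idx V p. \<lambda>xp\<in>Uset S V p b. \<phi> (k b) (d xp)) \<in> Coch p V G"
proof (rule K_carrierI[OF U(2) G])
  fix b assume b: "b \<in> multi_idx V p"
  have kd': "k b \<in> multi_idx U q \<and> d xp \<in> Uset S U q (k b)" if xp: "xp \<in> Uset S V p b" for xp
  proof -
    obtain as gs x where *: "length gs = p" "splx V as gs x" "b = ix as" "xp = pt gs x"
      by (rule splx_exhaust[OF b xp])
    then obtain as' gs' x' where "length gs' = q" "splx U as' gs' x'" "k (ix as) = ix as'" "d (pt gs x) = pt gs' x'"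
      using kd by blast
    then show ?thesis using splx_mem[of U as' gs' x' q] * by simp
  qed
  note W = Uset_open[OF U(2) b]
  show "smooth_on (Xp S p) (Uset S V p b) (mfd G) (\<lambda>xp. \<phi> (k b) (d xp))"
  proof (cases "Uset S V p b = {}")
    case True
    show ?thesis unfolding True by (rule smooth_on_empty)
  next
    case False
    then have kb: "k b \<in> multi_idx U q" using kd' by blast
    show ?thesis
      by (rule smooth_on_comp[OF charted_Xp charted_Xp lie_groupD(3)[OF G] W Uset_open[OF U(1) kb]
          smooth_on_subset[OF d openin_topspace W openin_subset[OF W]] K_smooth[OF \<phi> kb]])
        (use kd' in auto)
  qed
qed

lemma smooth_pt_map:
  assumes "\<And>t. t \<in> set ts \<Longrightarrow> smooth_map (Xp S p) (mfd Gam) t"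
  shows "smooth_map (Xp S p) (Xp S (length ts)) (\<lambda>xp. pt (map (\<lambda>t. t xp) ts) (snd xp))"
  unfolding pt_def
proof (rule smooth_into_Xp[OF charted_Xp openin_topspace _ _ Xp_snd_smooth])
  fix i assume i: "i \<in> {1..length ts}"
  then have "ts ! (i - 1) \<in> set ts" by (intro nth_mem) auto
  moreover have "(\<lambda>j\<in>{1..length (map (\<lambda>t. t w) ts)}. map (\<lambda>t. t w) ts ! (j - 1)) i = (ts ! (i - 1)) w" for w
    using i by auto
  ultimately show "smooth_map (Xp S p) (mfd Gam) (\<lambda>w. (\<lambda>j\<in>{1..length (map (\<lambda>t. t w) ts)}. map (\<lambda>t. t w) ts ! (j - 1)) i)"
    using assms by simp
qed auto

subsection \<open>Explicit formulas in low degrees\<close>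

lemma K_ext0: "\<phi> \<in> Coch 0 U G \<Longrightarrow> \<psi> \<in> Coch 0 U G \<Longrightarrow>
    (\<And>a x. splx U [a] [] x \<Longrightarrow> val \<phi> [a] [] x = val \<psi> [a] [] x) \<Longrightarrow> \<phi> = \<psi>"
  by (erule (1) K_ext) (metis splx_cases0)

lemma K_ext1: "\<phi> \<in> Coch 1 U G \<Longrightarrow> \<psi> \<in> Coch 1 U G \<Longrightarrow>
    (\<And>a b g x. splx U [a,b] [g] x \<Longrightarrow> val \<phi> [a,b] [g] x = val \<psi> [a,b] [g] x) \<Longrightarrow> \<phi> = \<psi>"
  by (erule (1) K_ext) (metis splx_cases1)

lemma K_ext2: "\<phi> \<in> Coch 2 U G \<Longrightarrow> \<psi> \<in> Coch 2 U G \<Longrightarrow>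
    (\<And>a b c g h x. splx U [a,b,c] [g,h] x \<Longrightarrow> val \<phi> [a,b,c] [g,h] x = val \<psi> [a,b,c] [g,h] x) \<Longrightarrow> \<phi> = \<psi>"
  by (erule (1) K_ext) (metis splx_cases2)

lemma K_ext3: "\<phi> \<in> Coch 3 U G \<Longrightarrow> \<psi> \<in> Coch 3 U G \<Longrightarrow>
    (\<And>a b c d g h k x. splx U [a,b,c,d] [g,h,k] x \<Longrightarrow> val \<phi> [a,b,c,d] [g,h,k] x = val \<psi> [a,b,c,d] [g,h,k] x) \<Longrightarrow> \<phi> = \<psi>"
  by (erule (1) K_ext) (metis splx_cases3)

lemma faces1:
  assumes "U \<in> covers S" "splx U [a,b] [g] x"
  shows "splx U [b] [] x" "splx U [a] [] (act S g x)" "g \<in> carrier Gam" "x \<in> X"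
  using assms coverD(2) by (auto simp: splx0 splx1)

lemma faces2:
  assumes "U \<in> covers S" "splx U [a,b,c] [g,h] x"
  shows "splx U [b,c] [h] x" "splx U [a,c] [g \<cdot> h] x" "splx U [a,b] [g] (act S h x)"
    "g \<in> carrier Gam" "h \<in> carrier Gam" "x \<in> X"
  using assms coverD(2) by (auto simp: splx1 splx2 act_mult)

lemma faces3:
  assumes "U \<in> covers S" "splx U [a,b,c,d] [g,h,k] x"
  shows "splx U [b,c,d] [h,k] x" "splx U [a,c,d] [g \<cdot> h, k] x" "splx U [a,b,d] [g, h \<cdot> k] x"
    "splx U [a,b,c] [g,h] (act S k x)" "g \<in> carrier Gam" "h \<in> carrier Gam" "k \<in> carrier Gam" "x \<in> X"
  using assms coverD(2) by (auto simp: splx2 splx3 act_mult)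

lemma val_delta':
  assumes s: "splx U as gs x" "length gs = Suc p" and i: "i \<le> Suc p"
  shows "val (delta S p U G i \<phi>) as gs x =
     (if i = 0 then theta G (hd gs) else id) (val \<phi> (take i as @ drop (Suc i) as) (fst (lface i gs x)) (snd (lface i gs x)))"
  by (rule val_delta[OF s i prod.collapse[symmetric]])

lemma val_delta0:
  assumes "splx U [a,b] [g] x"
  shows "val (delta S 0 U G 0 \<mu>) [a,b] [g] x = theta G g (val \<mu> [b] [] x)"
    "val (delta S 0 U G 1 \<mu>) [a,b] [g] x = val \<mu> [a] [] (act S g x)"
  using val_delta'[OF assms, of 0 0] val_delta'[OF assms, of 0 1] by (simp_all add: lface_def)

lemma val_delta1:
  assumes "splx U [a,b,c] [g,h] x"
  shows "val (delta S 1 U G 0 \<phi>) [a,b,c] [g,h] x = theta G g (val \<phi> [b,c] [h] x)"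
    "val (delta S 1 U G 1 \<phi>) [a,b,c] [g,h] x = val \<phi> [a,c] [g \<cdot> h] x"
    "val (delta S 1 U G 2 \<phi>) [a,b,c] [g,h] x = val \<phi> [a,b] [g] (act S h x)"
  using val_delta'[OF assms, of 1 0] val_delta'[OF assms, of 1 1] val_delta'[OF assms, of 1 2]
  by (simp_all add: lface_def numeral_2_eq_2)

lemma val_delta2:
  assumes "splx U [a,b,c,d] [g,h,k] x"
  shows "val (delta S 2 U G 0 \<phi>) [a,b,c,d] [g,h,k] x = theta G g (val \<phi> [b,c,d] [h,k] x)"
    "val (delta S 2 U G 1 \<phi>) [a,b,c,d] [g,h,k] x = val \<phi> [a,c,d] [g \<cdot> h, k] x"
    "val (delta S 2 U G 2 \<phi>) [a,b,c,d] [g,h,k] x = val \<phi> [a,b,d] [g, h \<cdot> k] x"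
    "val (delta S 2 U G 3 \<phi>) [a,b,c,d] [g,h,k] x = val \<phi> [a,b,c] [g,h] (act S k x)"
  using val_delta'[OF assms, of 2 0] val_delta'[OF assms, of 2 1] val_delta'[OF assms, of 2 2] val_delta'[OF assms, of 2 3]
  by (simp_all add: lface_def numeral_2_eq_2 numeral_3_eq_3)

lemma delta0_closed: "U \<in> covers S \<Longrightarrow> gamma_group Gam G \<Longrightarrow> i \<le> 1 \<Longrightarrow> \<phi> \<in> Coch 0 U G \<Longrightarrow> delta S 0 U G i \<phi> \<in> Coch 1 U G"
  using delta_closed[of U G i 0 \<phi>] by simp

lemma delta1_closed: "U \<in> covers S \<Longrightarrow> gamma_group Gam G \<Longrightarrow> i \<le> 2 \<Longrightarrow> \<phi> \<in> Coch 1 U G \<Longrightarrow> delta S 1 U G i \<phi> \<in> Coch 2 U G"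
  using delta_closed[of U G i 1 \<phi>] by (simp add: numeral_2_eq_2)

lemma delta2_closed: "U \<in> covers S \<Longrightarrow> gamma_group Gam G \<Longrightarrow> i \<le> 3 \<Longrightarrow> \<phi> \<in> Coch 2 U G \<Longrightarrow> delta S 2 U G i \<phi> \<in> Coch 3 U G"
  using delta_closed[of U G i 2 \<phi>] by (simp add: numeral_3_eq_3 numeral_2_eq_2)

context
  fixes U :: "'x cover" and G :: "('g, 'a) ggroup" (structure)
  assumes U: "U \<in> covers S" and G: "gamma_group Gam G"
begin

interpretation G: group G using gamma_groupD(3)[OF G] .

lemmas LG = gamma_groupD(1)[OF G]

lemma val0_closed: "\<mu> \<in> Coch 0 U G \<Longrightarrow> splx U [a] [] x \<Longrightarrow> val \<mu> [a] [] x \<in> carrier G"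
  by (rule val_closed[OF _ _ _ U LG]) auto

lemma val1_closed: "\<phi> \<in> Coch 1 U G \<Longrightarrow> splx U [a,b] [g] x \<Longrightarrow> val \<phi> [a,b] [g] x \<in> carrier G"
  by (rule val_closed[OF _ _ _ U LG]) auto

lemma val2_closed: "\<phi> \<in> Coch 2 U G \<Longrightarrow> splx U [a,b,c] [g,h] x \<Longrightarrow> val \<phi> [a,b,c] [g,h] x \<in> carrier G"
  by (rule val_closed[where p=2, OF _ _ _ U LG]) auto

lemma ob0_closed: "\<mu> \<in> Coch 0 U G \<Longrightarrow> ob0 S G U \<mu> \<in> Coch 1 U G"
  unfolding ob0_def by (intro K_mult_closed[OF U LG] K_inv_closed[OF U LG] delta0_closed[OF U G]) auto

lemma val_ob0:
  assumes "\<mu> \<in> Coch 0 U G" "splx U [a,b] [g] x"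
  shows "val (ob0 S G U \<mu>) [a,b] [g] x = inv (val \<mu> [a] [] (act S g x)) \<otimes> theta G g (val \<mu> [b] [] x)"
proof -
  have l: "length [g] = 1" by simp
  show ?thesis unfolding ob0_def val_mult[OF assms(2) l]
      val_inv[OF U LG delta0_closed[OF U G order_refl assms(1)] assms(2) l] val_delta0[OF assms(2)] ..
qed

lemma ob1_closed: "\<phi> \<in> Coch 1 U G \<Longrightarrow> ob1 S G U \<phi> \<in> Coch 2 U G"
  unfolding ob1_def by (intro K_mult_closed[OF U LG] K_inv_closed[OF U LG] delta1_closed[OF U G]) auto

lemma val_ob1:
  assumes "\<phi> \<in> Coch 1 U G" "splx U [a,b,c] [g,h] x"
  shows "val (ob1 S G U \<phi>) [a,b,c] [g,h] x = inv (val \<phi> [a,c] [g \<cdot> h] x)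
     \<otimes> val \<phi> [a,b] [g] (act S h x) \<otimes> theta G g (val \<phi> [b,c] [h] x)"
proof -
  have l: "length [g,h] = 2" by simp
  have 1: "(1::nat) \<le> 2" by simp
  show ?thesis unfolding ob1_def val_mult[OF assms(2) l]
      val_inv[OF U LG delta1_closed[OF U G 1 assms(1)] assms(2) l] val_delta1[OF assms(2)] ..
qed

lemma TC0coc_iff: "\<mu> \<in> TC0coc S G U \<longleftrightarrow> \<mu> \<in> Coch 0 U G \<and>
    (\<forall>a b g x. splx U [a,b] [g] x \<longrightarrow> val \<mu> [a] [] (act S g x) = theta G g (val \<mu> [b] [] x))"
proof -
  have "ob0 S G U \<mu> = \<one>\<^bsub>K S 1 U G\<^esub> \<longleftrightarrow> (\<forall>a b g x. splx U [a,b] [g] x \<longrightarrow> val \<mu> [a] [] (act S g x) = theta G g (val \<mu> [b] [] x))"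
    if \<mu>: "\<mu> \<in> Coch 0 U G"
  proof -
    have eq: "val (ob0 S G U \<mu>) [a,b] [g] x = \<one> \<longleftrightarrow> val \<mu> [a] [] (act S g x) = theta G g (val \<mu> [b] [] x)"
      if s: "splx U [a,b] [g] x" for a b g x
      unfolding val_ob0[OF \<mu> s]
      by (intro G.inv_mult_eq_one val0_closed[OF \<mu>] theta_closed[OF G] faces1[OF U s])
    show ?thesis
    proof
      assume "ob0 S G U \<mu> = \<one>\<^bsub>K S 1 U G\<^esub>"
      then show "\<forall>a b g x. splx U [a,b] [g] x \<longrightarrow> val \<mu> [a] [] (act S g x) = theta G g (val \<mu> [b] [] x)"
        using eq by (simp add: val_one)
    next
      assume "\<forall>a b g x. splx U [a,b] [g] x \<longrightarrow> val \<mu> [a] [] (act S g x) = theta G g (val \<mu> [b] [] x)"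
      then show "ob0 S G U \<mu> = \<one>\<^bsub>K S 1 U G\<^esub>"
        by (intro K_ext1[OF ob0_closed[OF \<mu>] K_one_closed[OF U LG]]) (simp add: val_one eq)
    qed
  qed
  then show ?thesis unfolding TC0coc_def by blast
qed

lemma TC1coc_iff: "\<phi> \<in> TC1coc S G U \<longleftrightarrow> \<phi> \<in> Coch 1 U G \<and>
    (\<forall>a b c g h x. splx U [a,b,c] [g,h] x \<longrightarrow>
       val \<phi> [a,c] [g \<cdot> h] x = val \<phi> [a,b] [g] (act S h x) \<otimes> theta G g (val \<phi> [b,c] [h] x))"
proof -
  have "ob1 S G U \<phi> = \<one>\<^bsub>K S 2 U G\<^esub> \<longleftrightarrow> (\<forall>a b c g h x. splx U [a,b,c] [g,h] x \<longrightarrow>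
       val \<phi> [a,c] [g \<cdot> h] x = val \<phi> [a,b] [g] (act S h x) \<otimes> theta G g (val \<phi> [b,c] [h] x))"
    if \<phi>: "\<phi> \<in> Coch 1 U G"
  proof -
    have eq: "val (ob1 S G U \<phi>) [a,b,c] [g,h] x = \<one> \<longleftrightarrow>
         val \<phi> [a,c] [g \<cdot> h] x = val \<phi> [a,b] [g] (act S h x) \<otimes> theta G g (val \<phi> [b,c] [h] x)"
      if s: "splx U [a,b,c] [g,h] x" for a b c g h x
    proof -
      note f = faces2[OF U s]
      have c: "val \<phi> [a,c] [g \<cdot> h] x \<in> carrier G" "val \<phi> [a,b] [g] (act S h x) \<in> carrier G"
        "theta G g (val \<phi> [b,c] [h] x) \<in> carrier G"
        using val1_closed[OF \<phi>] f theta_closed[OF G f(4)] by auto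
      then show ?thesis
        unfolding val_ob1[OF \<phi> s] by (simp add: G.m_assoc G.inv_mult_eq_one)
    qed
    show ?thesis
    proof
      assume "ob1 S G U \<phi> = \<one>\<^bsub>K S 2 U G\<^esub>"
      then show "\<forall>a b c g h x. splx U [a,b,c] [g,h] x \<longrightarrow>
         val \<phi> [a,c] [g \<cdot> h] x = val \<phi> [a,b] [g] (act S h x) \<otimes> theta G g (val \<phi> [b,c] [h] x)"
        using eq by (simp add: val_one)
    next
      assume "\<forall>a b c g h x. splx U [a,b,c] [g,h] x \<longrightarrow>
         val \<phi> [a,c] [g \<cdot> h] x = val \<phi> [a,b] [g] (act S h x) \<otimes> theta G g (val \<phi> [b,c] [h] x)"
      then show "ob1 S G U \<phi> = \<one>\<^bsub>K S 2 U G\<^esub>"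
        by (intro K_ext2[OF ob1_closed[OF \<phi>] K_one_closed[OF U LG]]) (simp add: val_one eq)
    qed
  qed
  then show ?thesis unfolding TC1coc_def by blast
qed

lemma TC1rel_iff: "(\<phi>, \<phi>') \<in> TC1rel S G U \<longleftrightarrow> \<phi> \<in> TC1coc S G U \<and> \<phi>' \<in> TC1coc S G U \<and>
    (\<exists>\<mu>\<in>Coch 0 U G. \<forall>a b g x. splx U [a,b] [g] x \<longrightarrow>
      val \<mu> [a] [] (act S g x) \<otimes> val \<phi> [a,b] [g] x = val \<phi>' [a,b] [g] x \<otimes> theta G g (val \<mu> [b] [] x))"
proof -
  have "delta S 0 U G 1 \<mu> \<otimes>\<^bsub>K S 1 U G\<^esub> \<phi> = \<phi>' \<otimes>\<^bsub>K S 1 U G\<^esub> delta S 0 U G 0 \<mu> \<longleftrightarrow>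
     (\<forall>a b g x. splx U [a,b] [g] x \<longrightarrow>
      val \<mu> [a] [] (act S g x) \<otimes> val \<phi> [a,b] [g] x = val \<phi>' [a,b] [g] x \<otimes> theta G g (val \<mu> [b] [] x))"
    if c: "\<phi> \<in> Coch 1 U G" "\<phi>' \<in> Coch 1 U G" "\<mu> \<in> Coch 0 U G" for \<mu>
  proof -
    have l: "length [g] = 1" for g :: 'g by simp
    have eq: "val (delta S 0 U G 1 \<mu> \<otimes>\<^bsub>K S 1 U G\<^esub> \<phi>) [a,b] [g] x = val \<mu> [a] [] (act S g x) \<otimes> val \<phi> [a,b] [g] x"
      "val (\<phi>' \<otimes>\<^bsub>K S 1 U G\<^esub> delta S 0 U G 0 \<mu>) [a,b] [g] x = val \<phi>' [a,b] [g] x \<otimes> theta G g (val \<mu> [b] [] x)"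
      if s: "splx U [a,b] [g] x" for a b g x
      by (simp_all only: val_mult[OF s l] val_delta0[OF s])
    have k: "delta S 0 U G 1 \<mu> \<otimes>\<^bsub>K S 1 U G\<^esub> \<phi> \<in> Coch 1 U G"
      "\<phi>' \<otimes>\<^bsub>K S 1 U G\<^esub> delta S 0 U G 0 \<mu> \<in> Coch 1 U G"
      using K_mult_closed[OF U LG delta0_closed[OF U G order_refl c(3)] c(1)]
        K_mult_closed[OF U LG c(2) delta0_closed[OF U G zero_le c(3)]] .
    show ?thesis using K_ext1[OF k] eq by metis
  qed
  then show ?thesis unfolding TC1rel_def TC1coc_def by blast
qed

end

subsection \<open>Independence of the refinement map\<close>

lemma TC0coc_restr:
  assumes U: "U \<in> covers S" "V \<in> covers S" and G: "gamma_group Gam G" and r: "refines V U r" and \<mu>: "\<mu> \<in> TC0coc S G U"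
  shows "restr S 0 V r \<mu> \<in> TC0coc S G V"
proof -
  note m = \<mu>[unfolded TC0coc_iff[OF U(1) G]]
  show ?thesis unfolding TC0coc_iff[OF U(2) G]
  proof (intro conjI allI impI)
    show "restr S 0 V r \<mu> \<in> Coch 0 V G" by (rule restr_closed[OF U gamma_groupD(1)[OF G] r]) (use m in blast)
    fix a b g x assume s: "splx V [a,b] [g] x"
    note f = faces1[OF U(2) s]
    have "splx U [r a, r b] [g] x" using splx_refine[OF r s] by simp
    then show "val (restr S 0 V r \<mu>) [a] [] (act S g x) = theta G g (val (restr S 0 V r \<mu>) [b] [] x)"
      using m by (simp add: val_restr[OF f(1)] val_restr[OF f(2)])
  qed
qed

text \<open>
  The cocycle identity for the group element 1 says that the functions on two members of the cover
  agree on their intersection.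
\<close>

lemma TC0coc_homotopy:
  assumes U: "U \<in> covers S" "V \<in> covers S" and G: "gamma_group Gam G" and r: "refines V U r" "refines V U s" and \<mu>: "\<mu> \<in> TC0coc S G U"
  shows "restr S 0 V r \<mu> = restr S 0 V s \<mu>"
proof -
  note m = \<mu>[unfolded TC0coc_iff[OF U(1) G]]
  have mK: "\<mu> \<in> Coch 0 U G" using m by blast
  show ?thesis
  proof (rule K_ext0[OF restr_closed[OF U gamma_groupD(1)[OF G] r(1) mK] restr_closed[OF U gamma_groupD(1)[OF G] r(2) mK]])
    fix a x assume sx: "splx V [a] [] x"
    have x: "x \<in> X" using sx by (simp add: splx_def)
    have "splx U [r a, s a] [\<one>\<^bsub>Gam\<^esub>] x"
      using sx refinesD[OF r(1), of a] refinesD[OF r(2), of a] x by (auto simp: splx0[OF U(2)] splx1[OF U(1)])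
    then have "val \<mu> [r a] [] (act S \<one>\<^bsub>Gam\<^esub> x) = theta G \<one>\<^bsub>Gam\<^esub> (val \<mu> [s a] [] x)" "splx U [s a] [] x"
      using m faces1(1)[OF U(1)] by blast+
    then show "val (restr S 0 V r \<mu>) [a] [] x = val (restr S 0 V s \<mu>) [a] [] x"
      using x theta_one[OF G val0_closed[OF U(1) G mK]] by (simp add: val_restr[OF sx])
  qed
qed

lemma TC1coc_restr:
  assumes U: "U \<in> covers S" "V \<in> covers S" and G: "gamma_group Gam G" and r: "refines V U r" and \<phi>: "\<phi> \<in> TC1coc S G U"
  shows "restr S 1 V r \<phi> \<in> TC1coc S G V"
proof -
  note m = \<phi>[unfolded TC1coc_iff[OF U(1) G]]
  show ?thesis unfolding TC1coc_iff[OF U(2) G]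
  proof (intro conjI allI impI)
    show "restr S 1 V r \<phi> \<in> Coch 1 V G" by (rule restr_closed[OF U gamma_groupD(1)[OF G] r]) (use m in blast)
    fix a b c g h x assume s: "splx V [a,b,c] [g,h] x"
    note f = faces2[OF U(2) s]
    have "splx U [r a, r b, r c] [g,h] x" using splx_refine[OF r s] by simp
    then show "val (restr S 1 V r \<phi>) [a,c] [g \<cdot> h] x = val (restr S 1 V r \<phi>) [a,b] [g] (act S h x)
        \<otimes>\<^bsub>G\<^esub> theta G g (val (restr S 1 V r \<phi>) [b,c] [h] x)"
      using m by (simp add: val_restr[OF f(1)] val_restr[OF f(2)] val_restr[OF f(3)])
  qed
qed

lemma TC1rel_restr:
  assumes U: "U \<in> covers S" "V \<in> covers S" and G: "gamma_group Gam G" and r: "refines V U r" and R: "(\<phi>, \<psi>) \<in> TC1rel S G U"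
  shows "(restr S 1 V r \<phi>, restr S 1 V r \<psi>) \<in> TC1rel S G V"
proof -
  note m = R[unfolded TC1rel_iff[OF U(1) G]]
  then obtain \<mu> where \<mu>: "\<mu> \<in> Coch 0 U G" "\<And>a b g x. splx U [a,b] [g] x \<Longrightarrow>
      val \<mu> [a] [] (act S g x) \<otimes>\<^bsub>G\<^esub> val \<phi> [a,b] [g] x = val \<psi> [a,b] [g] x \<otimes>\<^bsub>G\<^esub> theta G g (val \<mu> [b] [] x)" by blast
  show ?thesis unfolding TC1rel_iff[OF U(2) G]
  proof (intro conjI bexI allI impI)
    show "restr S 1 V r \<phi> \<in> TC1coc S G V" "restr S 1 V r \<psi> \<in> TC1coc S G V"
      using TC1coc_restr[OF U G r] m by blast+
    show "restr S 0 V r \<mu> \<in> Coch 0 V G" by (rule restr_closed[OF U gamma_groupD(1)[OF G] r \<mu>(1)])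
    fix a b g x assume s: "splx V [a,b] [g] x"
    note f = faces1[OF U(2) s]
    have "splx U [r a, r b] [g] x" using splx_refine[OF r s] by simp
    from \<mu>(2)[OF this]
    show "val (restr S 0 V r \<mu>) [a] [] (act S g x) \<otimes>\<^bsub>G\<^esub> val (restr S 1 V r \<phi>) [a,b] [g] x
       = val (restr S 1 V r \<psi>) [a,b] [g] x \<otimes>\<^bsub>G\<^esub> theta G g (val (restr S 0 V r \<mu>) [b] [] x)"
      by (simp add: val_restr[OF f(1)] val_restr[OF f(2)] val_restr[OF s])
  qed
qed

text \<open>
  The two restrictions are related by the 0-cochain with value \<open>\<phi>[s a, r a](1, x)\<close>. It satisfies the
  relation by the cocycle identity on the triangles into which the square on the edges [r a, r b] and
  [s a, s b] is cut.
\<close>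

lemma TC1coc_homotopy:
  assumes U: "U \<in> covers S" "V \<in> covers S" and G: "gamma_group Gam G" and r: "refines V U r" "refines V U s" and \<phi>: "\<phi> \<in> TC1coc S G U"
  shows "(restr S 1 V r \<phi>, restr S 1 V s \<phi>) \<in> TC1rel S G V"
proof -
  note m = \<phi>[unfolded TC1coc_iff[OF U(1) G]]
  have mK: "\<phi> \<in> Coch 1 U G" using m by blast
  let ?e = "\<one>\<^bsub>Gam\<^esub>"
  define \<mu> where "\<mu> = (\<lambda>b\<in>multi_idx V 0. \<lambda>xp\<in>Uset S V 0 b. \<phi> (ix [s (b 0), r (b 0)]) (pt [?e] (snd xp)))"
  have sp: "splx U [s a, r a] [?e] x" if "splx V [a] [] x" for a x
  proof -
    have "x \<in> X" using that by (simp add: splx_def)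
    then show ?thesis
      using that refinesD[OF r(1), of a] refinesD[OF r(2), of a] by (auto simp: splx0[OF U(2)] splx1[OF U(1)])
  qed
  have ix0: "ix [a] 0 = a" for a by (simp add: ix_def)
  have \<mu>K: "\<mu> \<in> Coch 0 V G"
    unfolding \<mu>_def
  proof (rule K_pullback[OF U gamma_groupD(1)[OF G] mK])
    show "smooth_map (Xp S 0) (Xp S 1) (\<lambda>xp. pt [?e] (snd xp))"
    proof -
      have "smooth_map (Xp S 0) (mfd Gam) (\<lambda>_. ?e)"
        by (rule lie_const_smooth[OF Gam openin_topspace Gam.one_closed])
      then show ?thesis using smooth_pt_map[of "[\<lambda>_. ?e]" 0] by simp
    qed
    fix as gs x assume s0: "splx V as gs x" "length gs = 0"
    then obtain a where a: "as = [a]" "gs = []" by (rule splx_cases0)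
    show "\<exists>as' gs' x'. length gs' = 1 \<and> splx U as' gs' x' \<and> ix [s (ix as 0), r (ix as 0)] = ix as' \<and>
       pt [?e] (snd (pt gs x)) = pt gs' x'"
      using sp[of a x] s0 by (intro exI[of _ "[s a, r a]"] exI[of _ "[?e]"] exI[of _ x]) (auto simp: a ix0 pt_def)
  qed
  have v\<mu>: "val \<mu> [a] [] x = val \<phi> [s a, r a] [?e] x" if "splx V [a] [] x" for a x
  proof -
    have "val \<mu> [a] [] x = \<phi> (ix [s (ix [a] 0), r (ix [a] 0)]) (pt [?e] (snd (pt [] x)))"
      unfolding \<mu>_def by (rule val_restrict[OF that]) simp
    then show ?thesis unfolding ix0 snd_pt val_def .
  qed
  show ?thesis unfolding TC1rel_iff[OF U(2) G]
  proof (intro conjI bexI[OF _ \<mu>K] allI impI)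
    show "restr S 1 V r \<phi> \<in> TC1coc S G V" "restr S 1 V s \<phi> \<in> TC1coc S G V"
      using TC1coc_restr[OF U G _ \<phi>] r by blast+
    fix a b g x assume sx: "splx V [a,b] [g] x"
    note f = faces1[OF U(2) sx]
    have ab: "a \<in> Idx V" "b \<in> Idx V" "act S g x \<in> Mem V a" "x \<in> Mem V b" using sx by (auto simp: splx1[OF U(2)])
    have 1: "splx U [s a, r a, r b] [?e, g] x" "splx U [s a, s b, r b] [g, ?e] x"
      using ab f(3,4) refinesD[OF r(1)] refinesD[OF r(2)] by (auto simp: splx2[OF U(1)])
    have "val \<phi> [s a, r b] [?e \<cdot> g] x = val \<phi> [s a, r a] [?e] (act S g x) \<otimes>\<^bsub>G\<^esub> theta G ?e (val \<phi> [r a, r b] [g] x)"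
      "val \<phi> [s a, r b] [g \<cdot> ?e] x = val \<phi> [s a, s b] [g] (act S ?e x) \<otimes>\<^bsub>G\<^esub> theta G g (val \<phi> [s b, r b] [?e] x)"
      using m 1 by blast+
    moreover have "theta G ?e (val \<phi> [r a, r b] [g] x) = val \<phi> [r a, r b] [g] x"
      using faces2(1)[OF U(1) 1(1)] by (intro theta_one[OF G] val1_closed[OF U(1) G mK])
    ultimately show "val \<mu> [a] [] (act S g x) \<otimes>\<^bsub>G\<^esub> val (restr S 1 V r \<phi>) [a,b] [g] x
       = val (restr S 1 V s \<phi>) [a,b] [g] x \<otimes>\<^bsub>G\<^esub> theta G g (val \<mu> [b] [] x)"
      using f(3,4) by (simp add: v\<mu>[OF f(1)] v\<mu>[OF f(2)] val_restr[OF sx])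
  qed
qed

end

section \<open>Direct limits over refinements\<close>

text \<open>
  Independence of the refinement map up to R is what makes the relation \<^const>\<open>lim_rel\<close> transitive: the
  middle cocycle is restricted to the common refinement along two different maps.
\<close>

locale limsys = gspace S for S :: "('g, 'x) gspace" +
  fixes G :: "('g, 'a) ggroup" and p :: nat
    and Z :: "'x cover \<Rightarrow> ('g, 'x, 'a) cochain set" and R :: "'x cover \<Rightarrow> ('g, 'x, 'a) cochain rel"
  assumes G: "gamma_group Gam G"
    and Z_closed: "U \<in> covers S \<Longrightarrow> \<phi> \<in> Z U \<Longrightarrow> \<phi> \<in> Coch p U G"
    and Z_one: "U \<in> covers S \<Longrightarrow> \<one>\<^bsub>K S p U G\<^esub> \<in> Z U"
    and Z_restr: "U \<in> covers S \<Longrightarrow> V \<in> covers S \<Longrightarrow> refines V U r \<Longrightarrow> \<phi> \<in> Z U \<Longrightarrow> restr S p V r \<phi> \<in> Z V"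
    and R_refl: "U \<in> covers S \<Longrightarrow> \<phi> \<in> Z U \<Longrightarrow> (\<phi>, \<phi>) \<in> R U"
    and R_sym: "U \<in> covers S \<Longrightarrow> (\<phi>, \<psi>) \<in> R U \<Longrightarrow> (\<psi>, \<phi>) \<in> R U"
    and R_trans: "U \<in> covers S \<Longrightarrow> (\<phi>, \<psi>) \<in> R U \<Longrightarrow> (\<psi>, \<zeta>) \<in> R U \<Longrightarrow> (\<phi>, \<zeta>) \<in> R U"
    and R_restr: "U \<in> covers S \<Longrightarrow> V \<in> covers S \<Longrightarrow> refines V U r \<Longrightarrow> (\<phi>, \<psi>) \<in> R U \<Longrightarrow> \<phi> \<in> Z U \<Longrightarrow> \<psi> \<in> Z U \<Longrightarrow>
       (restr S p V r \<phi>, restr S p V r \<psi>) \<in> R V"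
    and homotopy: "U \<in> covers S \<Longrightarrow> V \<in> covers S \<Longrightarrow> refines V U r \<Longrightarrow> refines V U s \<Longrightarrow> \<phi> \<in> Z U \<Longrightarrow>
       (restr S p V r \<phi>, restr S p V s \<phi>) \<in> R V"
begin

abbreviation "L \<equiv> lim_rel S p Z R"
abbreviation "Q \<equiv> (SIGMA U:covers S. Z U) // L"
definition "cls U \<phi> = L `` {(U, \<phi>)}"

lemmas LG = gamma_groupD(1)[OF G]

lemma L_iff: "((U, \<phi>), (V, \<psi>)) \<in> L \<longleftrightarrow> U \<in> covers S \<and> V \<in> covers S \<and> \<phi> \<in> Z U \<and> \<psi> \<in> Z V \<and>
     (\<exists>W\<in>covers S. \<exists>r s. refines W U r \<and> refines W V s \<and> (restr S p W r \<phi>, restr S p W s \<psi>) \<in> R W)"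
  by (simp add: lim_rel_def)

lemma restr2:
  assumes "U \<in> covers S" "V \<in> covers S" "W \<in> covers S" "\<phi> \<in> Z U" "refines V U r" "refines W V s"
  shows "restr S p W s (restr S p V r \<phi>) = restr S p W (\<lambda>b. r (s b)) \<phi>"
  by (rule restr_restr[OF assms(1-3) LG Z_closed[OF assms(1,4)] assms(5,6)])

lemma L_trans:
  assumes "((U, \<phi>), (V, \<psi>)) \<in> L" "((V, \<psi>), (T, \<zeta>)) \<in> L"
  shows "((U, \<phi>), (T, \<zeta>)) \<in> L"
proof -
  obtain W1 r1 s1 where 1: "U \<in> covers S" "V \<in> covers S" "\<phi> \<in> Z U" "\<psi> \<in> Z V" "W1 \<in> covers S"
    "refines W1 U r1" "refines W1 V s1" "(restr S p W1 r1 \<phi>, restr S p W1 s1 \<psi>) \<in> R W1"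
    using assms(1)[unfolded L_iff] by blast
  obtain W2 r2 s2 where 2: "T \<in> covers S" "\<zeta> \<in> Z T" "W2 \<in> covers S"
    "refines W2 V r2" "refines W2 T s2" "(restr S p W2 r2 \<psi>, restr S p W2 s2 \<zeta>) \<in> R W2"
    using assms(2)[unfolded L_iff] by blast
  obtain W t u where W: "W \<in> covers S" "refines W W1 t" "refines W W2 u"
    by (rule common_refinement[OF 1(5) 2(3)])
  have a: "(restr S p W (\<lambda>b. r1 (t b)) \<phi>, restr S p W (\<lambda>b. s1 (t b)) \<psi>) \<in> R W"
    using R_restr[OF 1(5) W(1,2) 1(8)] Z_restr[OF 1(1,5,6,3)] Z_restr[OF 1(2,5,7,4)]
    unfolding restr2[OF 1(1,5) W(1) 1(3,6) W(2)] restr2[OF 1(2,5) W(1) 1(4,7) W(2)] by blast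
  have b: "(restr S p W (\<lambda>b. r2 (u b)) \<psi>, restr S p W (\<lambda>b. s2 (u b)) \<zeta>) \<in> R W"
    using R_restr[OF 2(3) W(1,3) 2(6)] Z_restr[OF 1(2) 2(3,4) 1(4)] Z_restr[OF 2(1,3,5,2)]
    unfolding restr2[OF 1(2) 2(3) W(1) 1(4) 2(4) W(3)] restr2[OF 2(1,3) W(1) 2(2,5) W(3)] by blast
  have c: "(restr S p W (\<lambda>b. s1 (t b)) \<psi>, restr S p W (\<lambda>b. r2 (u b)) \<psi>) \<in> R W"
    by (rule homotopy[OF 1(2) W(1) refines_comp[OF 1(7) W(2)] refines_comp[OF 2(4) W(3)] 1(4)])
  have "(restr S p W (\<lambda>b. r1 (t b)) \<phi>, restr S p W (\<lambda>b. s2 (u b)) \<zeta>) \<in> R W"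
    by (rule R_trans[OF W(1) a R_trans[OF W(1) c b]])
  then show ?thesis
    unfolding L_iff using 1 2 W refines_comp[OF 1(6) W(2)] refines_comp[OF 2(5) W(3)] by blast
qed

lemma L_sym: "((U, \<phi>), (V, \<psi>)) \<in> L \<Longrightarrow> ((V, \<psi>), (U, \<phi>)) \<in> L"
  unfolding L_iff using R_sym by blast

lemma L_restr:
  assumes "U \<in> covers S" "V \<in> covers S" "refines V U r" "\<phi> \<in> Z U"
  shows "((V, restr S p V r \<phi>), (U, \<phi>)) \<in> L"
  unfolding L_iff
proof (intro conjI bexI exI)
  show "restr S p V r \<phi> \<in> Z V" by (rule Z_restr[OF assms])
  show "(restr S p V (\<lambda>a. a) (restr S p V r \<phi>), restr S p V r \<phi>) \<in> R V"
    unfolding restr_id[OF assms(2) LG Z_closed[OF assms(2) Z_restr[OF assms]]]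
    by (rule R_refl[OF assms(2) Z_restr[OF assms]])
qed (use assms refines_id in auto)

lemma L_refl: "U \<in> covers S \<Longrightarrow> \<phi> \<in> Z U \<Longrightarrow> ((U, \<phi>), (U, \<phi>)) \<in> L"
  using L_restr[OF _ _ refines_id, of U \<phi>] restr_id[OF _ LG Z_closed] by simp

lemma L_equiv: "equiv (SIGMA U:covers S. Z U) L"
proof (rule equivI)
  show "L \<subseteq> (SIGMA U:covers S. Z U) \<times> (SIGMA U:covers S. Z U)" by (auto simp: lim_rel_def)
  show "refl_on (SIGMA U:covers S. Z U) L" unfolding refl_on_def using L_refl by (auto simp: lim_rel_def)
  show "sym L" by (rule symI) (metis L_sym surj_pair)
  show "trans L" by (rule transI) (metis L_trans surj_pair)
qed

lemma cls_eq_iff: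
  assumes "U \<in> covers S" "\<phi> \<in> Z U" "V \<in> covers S" "\<psi> \<in> Z V"
  shows "cls U \<phi> = cls V \<psi> \<longleftrightarrow> ((U, \<phi>), (V, \<psi>)) \<in> L"
  unfolding cls_def by (rule eq_equiv_class_iff[OF L_equiv]) (use assms in auto)

lemma cls_restr: "U \<in> covers S \<Longrightarrow> V \<in> covers S \<Longrightarrow> refines V U r \<Longrightarrow> \<phi> \<in> Z U \<Longrightarrow> cls V (restr S p V r \<phi>) = cls U \<phi>"
  using L_restr cls_eq_iff Z_restr by simp

lemma cls_R:
  assumes "U \<in> covers S" "\<phi> \<in> Z U" "\<psi> \<in> Z U" "(\<phi>, \<psi>) \<in> R U"
  shows "cls U \<phi> = cls U \<psi>"
  unfolding cls_eq_iff[OF assms(1,2,1,3)] L_iff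
  using assms refines_id restr_id[OF assms(1) LG Z_closed[OF assms(1)]] by metis

lemma cls_one: "U \<in> covers S \<Longrightarrow> cls U \<one>\<^bsub>K S p U G\<^esub> = cls (triv_cover S) \<one>\<^bsub>K S p (triv_cover S) G\<^esub>"
  using cls_restr[OF triv_cover _ refines_triv Z_one[OF triv_cover]] restr_one[OF triv_cover _ LG refines_triv] by simp

lemma cls_eq_one:
  assumes "U \<in> covers S" "\<phi> \<in> Z U"
  shows "cls U \<phi> = cls (triv_cover S) \<one>\<^bsub>K S p (triv_cover S) G\<^esub> \<longleftrightarrow>
    (\<exists>V\<in>covers S. \<exists>r. refines V U r \<and> (restr S p V r \<phi>, \<one>\<^bsub>K S p V G\<^esub>) \<in> R V)"
proof
  assume "cls U \<phi> = cls (triv_cover S) \<one>\<^bsub>K S p (triv_cover S) G\<^esub>"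
  then obtain V r s where "V \<in> covers S" "refines V U r" "refines V (triv_cover S) s"
    "(restr S p V r \<phi>, restr S p V s \<one>\<^bsub>K S p (triv_cover S) G\<^esub>) \<in> R V"
    unfolding cls_eq_iff[OF assms triv_cover Z_one[OF triv_cover]] L_iff by blast
  then show "\<exists>V\<in>covers S. \<exists>r. refines V U r \<and> (restr S p V r \<phi>, \<one>\<^bsub>K S p V G\<^esub>) \<in> R V"
    using restr_one[OF triv_cover _ LG] by metis
next
  assume "\<exists>V\<in>covers S. \<exists>r. refines V U r \<and> (restr S p V r \<phi>, \<one>\<^bsub>K S p V G\<^esub>) \<in> R V"
  then obtain V r where V: "V \<in> covers S" "refines V U r" "(restr S p V r \<phi>, \<one>\<^bsub>K S p V G\<^esub>) \<in> R V" by blast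
  have "cls V (restr S p V r \<phi>) = cls V \<one>\<^bsub>K S p V G\<^esub>"
    by (rule cls_R[OF V(1) Z_restr[OF assms(1) V(1,2) assms(2)] Z_one[OF V(1)] V(3)])
  then show "cls U \<phi> = cls (triv_cover S) \<one>\<^bsub>K S p (triv_cover S) G\<^esub>"
    using cls_restr[OF assms(1) V(1,2) assms(2)] cls_one[OF V(1)] by simp
qed

lemma Q_iff: "c \<in> Q \<longleftrightarrow> (\<exists>U \<phi>. U \<in> covers S \<and> \<phi> \<in> Z U \<and> c = cls U \<phi>)"
  unfolding quotient_def cls_def by auto

end

text \<open>
  The connecting maps involve the choice of a lift, so a map between limits is given by a relation F between
  cocycles. Equivalent cocycles need only have images that are equivalent after refinement, because
  the gauge transformation between them can only be lifted there.
\<close>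

locale limmap = src: limsys S G p Z R + tgt: limsys S G' p' Z' R'
  for S :: "('g, 'x) gspace" and G :: "('g, 'a) ggroup" and p Z R and G' :: "('g, 'b) ggroup" and p' Z' R' +
  fixes F :: "'x cover \<Rightarrow> (('g, 'x, 'a) cochain \<times> ('g, 'x, 'b) cochain) set"
  assumes F_sub: "U \<in> covers S \<Longrightarrow> F U \<subseteq> Z U \<times> Z' U"
    and F_restr: "U \<in> covers S \<Longrightarrow> V \<in> covers S \<Longrightarrow> refines V U r \<Longrightarrow> (\<phi>, \<psi>) \<in> F U \<Longrightarrow>
       (restr S p V r \<phi>, restr S p' V r \<psi>) \<in> F V"
    and F_R: "U \<in> covers S \<Longrightarrow> (\<phi>, \<psi>) \<in> F U \<Longrightarrow> (\<phi>', \<psi>') \<in> F U \<Longrightarrow> (\<phi>, \<phi>') \<in> R U \<Longrightarrow>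
       \<exists>V\<in>covers S. \<exists>r. refines V U r \<and> (restr S p' V r \<psi>, restr S p' V r \<psi>') \<in> R' V"
    and F_one: "U \<in> covers S \<Longrightarrow> (\<one>\<^bsub>K S p U G\<^esub>, \<one>\<^bsub>K S p' U G'\<^esub>) \<in> F U"
begin

definition "graph = {(src.cls U \<phi>, tgt.cls U \<psi>) | U \<phi> \<psi>. U \<in> covers S \<and> (\<phi>, \<psi>) \<in> F U}"

lemma graph_partial:
  "pointed_partial_map src.Q (src.cls (triv_cover S) \<one>\<^bsub>K S p (triv_cover S) G\<^esub>)
     tgt.Q (tgt.cls (triv_cover S) \<one>\<^bsub>K S p' (triv_cover S) G'\<^esub>) graph"
  unfolding pointed_partial_map_def
proof (intro conjI)
  show "graph \<subseteq> src.Q \<times> tgt.Q"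
  proof
    fix z assume "z \<in> graph"
    then obtain U \<phi> \<psi> where "z = (src.cls U \<phi>, tgt.cls U \<psi>)" "U \<in> covers S" "(\<phi>, \<psi>) \<in> F U"
      unfolding graph_def by blast
    moreover from this have "\<phi> \<in> Z U" "\<psi> \<in> Z' U" using F_sub by blast+
    ultimately show "z \<in> src.Q \<times> tgt.Q" unfolding mem_Times_iff src.Q_iff tgt.Q_iff by auto
  qed
  show "(src.cls (triv_cover S) \<one>\<^bsub>K S p (triv_cover S) G\<^esub>, tgt.cls (triv_cover S) \<one>\<^bsub>K S p' (triv_cover S) G'\<^esub>) \<in> graph"
    unfolding graph_def using src.triv_cover F_one by blast
  show "single_valued graph"
  proof (rule single_valuedI)
    fix x y z assume "(x, y) \<in> graph" "(x, z) \<in> graph"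
    then obtain U \<phi> \<psi> V \<phi>' \<psi>' where 1: "x = src.cls U \<phi>" "y = tgt.cls U \<psi>" "U \<in> covers S" "(\<phi>, \<psi>) \<in> F U"
      and 2: "x = src.cls V \<phi>'" "z = tgt.cls V \<psi>'" "V \<in> covers S" "(\<phi>', \<psi>') \<in> F V"
      unfolding graph_def by blast
    have Z1: "\<phi> \<in> Z U" "\<psi> \<in> Z' U" and Z2: "\<phi>' \<in> Z V" "\<psi>' \<in> Z' V" using F_sub 1(3,4) 2(3,4) by blast+
    have "src.cls U \<phi> = src.cls V \<phi>'" using 1 2 by simp
    then obtain W r s where W: "W \<in> covers S" "refines W U r" "refines W V s" "(restr S p W r \<phi>, restr S p W s \<phi>') \<in> R W"
      unfolding src.cls_eq_iff[OF 1(3) Z1(1) 2(3) Z2(1)] src.L_iff by blast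
    obtain W' t where W': "W' \<in> covers S" "refines W' W t"
       "(restr S p' W' t (restr S p' W r \<psi>), restr S p' W' t (restr S p' W s \<psi>')) \<in> R' W'"
      using F_R[OF W(1) F_restr[OF 1(3) W(1,2) 1(4)] F_restr[OF 2(3) W(1,3) 2(4)] W(4)] by blast
    have z1: "restr S p' W r \<psi> \<in> Z' W" "restr S p' W s \<psi>' \<in> Z' W"
      using tgt.Z_restr 1(3) 2(3) W Z1 Z2 by blast+
    have "tgt.cls W (restr S p' W r \<psi>) = tgt.cls W (restr S p' W s \<psi>')"
      using tgt.cls_R[OF W'(1) _ _ W'(3)] tgt.Z_restr[OF W(1) W'(1,2)] z1 tgt.cls_restr[OF W(1) W'(1,2)] by metis
    then show "y = z"
      using tgt.cls_restr[OF 1(3) W(1,2) Z1(2)] tgt.cls_restr[OF 2(3) W(1,3) Z2(2)] 1(2) 2(2) by simp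
  qed
qed

lemma graph_total:
  assumes "\<And>U \<phi>. U \<in> covers S \<Longrightarrow> \<phi> \<in> Z U \<Longrightarrow> \<exists>V\<in>covers S. \<exists>r \<psi>. refines V U r \<and> (restr S p V r \<phi>, \<psi>) \<in> F V"
  shows "pointed_map src.Q (src.cls (triv_cover S) \<one>\<^bsub>K S p (triv_cover S) G\<^esub>)
     tgt.Q (tgt.cls (triv_cover S) \<one>\<^bsub>K S p' (triv_cover S) G'\<^esub>) graph"
proof -
  have "src.Q \<subseteq> Domain graph"
  proof
    fix c assume "c \<in> src.Q"
    then obtain U \<phi> where c: "U \<in> covers S" "\<phi> \<in> Z U" "c = src.cls U \<phi>" unfolding src.Q_iff by blast
    then obtain V r \<psi> where V: "V \<in> covers S" "refines V U r" "(restr S p V r \<phi>, \<psi>) \<in> F V" using assms by blast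
    then have "(src.cls V (restr S p V r \<phi>), tgt.cls V \<psi>) \<in> graph" unfolding graph_def by blast
    then show "c \<in> Domain graph" using src.cls_restr[OF c(1) V(1,2) c(2)] c(3) by (metis DomainI)
  qed
  then show ?thesis using graph_partial unfolding pointed_map_def pointed_partial_map_def by blast
qed

end

context gspace
begin

lemma TC0_limsys:
  fixes G :: "('g, 'a) ggroup" (structure)
  assumes G: "gamma_group Gam G"
  shows "limsys S G 0 (TC0coc S G) (\<lambda>_. Id)"
proof unfold_locales
  note iff = TC0coc_iff[OF _ G]
  fix U assume U: "U \<in> covers S"
  show "\<phi> \<in> TC0coc S G U \<Longrightarrow> \<phi> \<in> Coch 0 U G" for \<phi> using iff[OF U] by blast
  show "\<one>\<^bsub>K S 0 U G\<^esub> \<in> TC0coc S G U"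
    unfolding iff[OF U]
  proof (intro conjI allI impI)
    fix a b g x assume "splx U [a,b] [g] x"
    note f = faces1[OF U this]
    show "val \<one>\<^bsub>K S 0 U G\<^esub> [a] [] (act S g x) = theta G g (val \<one>\<^bsub>K S 0 U G\<^esub> [b] [] x)"
      using group_hom.hom_one[OF theta_hom[OF G f(3)]] by (simp add: val_one[OF f(1)] val_one[OF f(2)])
  qed (rule K_one_closed[OF U gamma_groupD(1)[OF G]])
  fix V assume V: "V \<in> covers S"
  show "refines V U r \<Longrightarrow> \<phi> \<in> TC0coc S G U \<Longrightarrow> restr S 0 V r \<phi> \<in> TC0coc S G V" for r \<phi>
    by (rule TC0coc_restr[OF U V G])
  show "(restr S 0 V r \<phi>, restr S 0 V s \<phi>) \<in> Id" if "refines V U r" "refines V U s" "\<phi> \<in> TC0coc S G U" for r s \<phi>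
    unfolding TC0coc_homotopy[OF U V G that] by (rule IdI)
qed (use G in auto)

lemma TC1_limsys:
  fixes G :: "('g, 'a) ggroup" (structure)
  assumes G: "gamma_group Gam G"
  shows "limsys S G 1 (TC1coc S G) (TC1rel S G)"
proof unfold_locales
  interpret G: group G using gamma_groupD(3)[OF G] .
  note iff = TC1coc_iff[OF _ G] and LG = gamma_groupD(1)[OF G]
  fix U assume U: "U \<in> covers S"
  note riff = TC1rel_iff[OF U G]
  show Zc: "\<phi> \<in> TC1coc S G U \<Longrightarrow> \<phi> \<in> Coch 1 U G" for \<phi> using iff[OF U] by blast
  show "\<one>\<^bsub>K S 1 U G\<^esub> \<in> TC1coc S G U"
    unfolding iff[OF U]
  proof (intro conjI allI impI)
    fix a b c g h x assume "splx U [a,b,c] [g,h] x"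
    note f = faces2[OF U this]
    show "val \<one>\<^bsub>K S 1 U G\<^esub> [a,c] [g \<cdot> h] x = val \<one>\<^bsub>K S 1 U G\<^esub> [a,b] [g] (act S h x) \<otimes> theta G g (val \<one>\<^bsub>K S 1 U G\<^esub> [b,c] [h] x)"
      using group_hom.hom_one[OF theta_hom[OF G f(4)]] by (simp add: val_one[OF f(1)] val_one[OF f(2)] val_one[OF f(3)])
  qed (rule K_one_closed[OF U LG])
  show "(\<phi>, \<phi>) \<in> TC1rel S G U" if \<phi>: "\<phi> \<in> TC1coc S G U" for \<phi>
    unfolding riff
  proof (intro conjI bexI[OF _ K_one_closed[OF U LG]] allI impI)
    fix a b g x assume s: "splx U [a,b] [g] x"
    note f = faces1[OF U s]
    show "val \<one>\<^bsub>K S 0 U G\<^esub> [a] [] (act S g x) \<otimes> val \<phi> [a, b] [g] x = val \<phi> [a, b] [g] x \<otimes> theta G g (val \<one>\<^bsub>K S 0 U G\<^esub> [b] [] x)"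
      using group_hom.hom_one[OF theta_hom[OF G f(3)]] val1_closed[OF U G Zc[OF \<phi>] s]
      by (simp add: val_one[OF f(1)] val_one[OF f(2)])
  qed (use \<phi> in auto)
  show "(\<psi>, \<phi>) \<in> TC1rel S G U" if R: "(\<phi>, \<psi>) \<in> TC1rel S G U" for \<phi> \<psi>
  proof -
    obtain \<mu> where c: "\<phi> \<in> TC1coc S G U" "\<psi> \<in> TC1coc S G U" and \<mu>: "\<mu> \<in> Coch 0 U G"
      "\<And>a b g x. splx U [a,b] [g] x \<Longrightarrow> val \<mu> [a] [] (act S g x) \<otimes> val \<phi> [a,b] [g] x = val \<psi> [a,b] [g] x \<otimes> theta G g (val \<mu> [b] [] x)"
      using R[unfolded riff] by blast
    show ?thesis unfolding riff
    proof (intro conjI bexI[OF _ K_inv_closed[OF U LG \<mu>(1)]] allI impI)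
      fix a b g x assume s: "splx U [a,b] [g] x"
      note f = faces1[OF U s]
      interpret t: group_hom G G "theta G g" by (rule theta_hom[OF G f(3)])
      have cl: "val \<mu> [a] [] (act S g x) \<in> carrier G" "val \<mu> [b] [] x \<in> carrier G" "val \<phi> [a,b] [g] x \<in> carrier G"
        "val \<psi> [a,b] [g] x \<in> carrier G"
        using val0_closed[OF U G \<mu>(1)] val1_closed[OF U G Zc s] f c by auto
      have "inv (val \<mu> [a] [] (act S g x)) \<otimes> (val \<mu> [a] [] (act S g x) \<otimes> val \<phi> [a,b] [g] x) \<otimes> inv (theta G g (val \<mu> [b] [] x))
        = inv (val \<mu> [a] [] (act S g x)) \<otimes> (val \<psi> [a,b] [g] x \<otimes> theta G g (val \<mu> [b] [] x)) \<otimes> inv (theta G g (val \<mu> [b] [] x))"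
        using \<mu>(2)[OF s] by simp
      then show "val (inv\<^bsub>K S 0 U G\<^esub> \<mu>) [a] [] (act S g x) \<otimes> val \<psi> [a, b] [g] x
          = val \<phi> [a, b] [g] x \<otimes> theta G g (val (inv\<^bsub>K S 0 U G\<^esub> \<mu>) [b] [] x)"
        using cl by (simp add: val_inv[OF U LG \<mu>(1) f(1)] val_inv[OF U LG \<mu>(1) f(2)] G.m_assoc)
    qed (use c in auto)
  qed
  show "(\<phi>, \<zeta>) \<in> TC1rel S G U" if R: "(\<phi>, \<psi>) \<in> TC1rel S G U" "(\<psi>, \<zeta>) \<in> TC1rel S G U" for \<phi> \<psi> \<zeta>
  proof -
    obtain \<mu> where c: "\<phi> \<in> TC1coc S G U" "\<psi> \<in> TC1coc S G U" and \<mu>: "\<mu> \<in> Coch 0 U G"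
      "\<And>a b g x. splx U [a,b] [g] x \<Longrightarrow> val \<mu> [a] [] (act S g x) \<otimes> val \<phi> [a,b] [g] x = val \<psi> [a,b] [g] x \<otimes> theta G g (val \<mu> [b] [] x)"
      using R(1)[unfolded riff] by blast
    obtain \<nu> where c': "\<zeta> \<in> TC1coc S G U" and \<nu>: "\<nu> \<in> Coch 0 U G"
      "\<And>a b g x. splx U [a,b] [g] x \<Longrightarrow> val \<nu> [a] [] (act S g x) \<otimes> val \<psi> [a,b] [g] x = val \<zeta> [a,b] [g] x \<otimes> theta G g (val \<nu> [b] [] x)"
      using R(2)[unfolded riff] by blast
    show ?thesis unfolding riff
    proof (intro conjI bexI[OF _ K_mult_closed[OF U LG \<nu>(1) \<mu>(1)]] allI impI)
      fix a b g x assume s: "splx U [a,b] [g] x"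
      note f = faces1[OF U s]
      interpret t: group_hom G G "theta G g" by (rule theta_hom[OF G f(3)])
      have cl: "val \<mu> [a] [] (act S g x) \<in> carrier G" "val \<mu> [b] [] x \<in> carrier G" "val \<phi> [a,b] [g] x \<in> carrier G"
        "val \<psi> [a,b] [g] x \<in> carrier G" "val \<zeta> [a,b] [g] x \<in> carrier G"
        "val \<nu> [a] [] (act S g x) \<in> carrier G" "val \<nu> [b] [] x \<in> carrier G"
        using val0_closed[OF U G \<mu>(1)] val0_closed[OF U G \<nu>(1)] val1_closed[OF U G Zc s] f c c' by auto
      have "val \<nu> [a] [] (act S g x) \<otimes> val \<mu> [a] [] (act S g x) \<otimes> val \<phi> [a,b] [g] x
          = val \<nu> [a] [] (act S g x) \<otimes> val \<psi> [a,b] [g] x \<otimes> theta G g (val \<mu> [b] [] x)"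
        using cl \<mu>(2)[OF s] by (simp add: G.m_assoc)
      also have "\<dots> = val \<zeta> [a,b] [g] x \<otimes> (theta G g (val \<nu> [b] [] x) \<otimes> theta G g (val \<mu> [b] [] x))"
        using cl \<nu>(2)[OF s] by (simp add: G.m_assoc)
      finally show "val (\<nu> \<otimes>\<^bsub>K S 0 U G\<^esub> \<mu>) [a] [] (act S g x) \<otimes> val \<phi> [a, b] [g] x
          = val \<zeta> [a, b] [g] x \<otimes> theta G g (val (\<nu> \<otimes>\<^bsub>K S 0 U G\<^esub> \<mu>) [b] [] x)"
        using cl by (simp add: val_mult[OF f(1)] val_mult[OF f(2)])
    qed (use c c' in auto)
  qed
  fix V assume V: "V \<in> covers S"
  show "refines V U r \<Longrightarrow> \<phi> \<in> TC1coc S G U \<Longrightarrow> restr S 1 V r \<phi> \<in> TC1coc S G V" for r \<phi>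
    by (rule TC1coc_restr[OF U V G])
  show "refines V U r \<Longrightarrow> refines V U s \<Longrightarrow> \<phi> \<in> TC1coc S G U \<Longrightarrow> (restr S 1 V r \<phi>, restr S 1 V s \<phi>) \<in> TC1rel S G V" for r s \<phi>
    by (rule TC1coc_homotopy[OF U V G])
  show "refines V U r \<Longrightarrow> (\<phi>, \<psi>) \<in> TC1rel S G U \<Longrightarrow> (restr S 1 V r \<phi>, restr S 1 V r \<psi>) \<in> TC1rel S G V" for r \<phi> \<psi>
    by (rule TC1rel_restr[OF U V G])
qed (use G in auto)

end

section \<open>Coboundaries and gauge transformations\<close>

text \<open>
  This identity makes the coboundaries multiplicative for central factors.
\<close>

lemma (in group) central_ob1:
  assumes "p \<in> carrier G" "q \<in> carrier G" "r \<in> carrier G" "p' \<in> carrier G" "q' \<in> carrier G" "r' \<in> carrier G"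
    and p': "\<And>b. b \<in> carrier G \<Longrightarrow> p' \<otimes> b = b \<otimes> p'" and q': "\<And>b. b \<in> carrier G \<Longrightarrow> q' \<otimes> b = b \<otimes> q'"
  shows "inv (p \<otimes> p') \<otimes> (q \<otimes> q') \<otimes> (r \<otimes> r') = (inv p \<otimes> q \<otimes> r) \<otimes> (inv p' \<otimes> q' \<otimes> r')"
proof -
  have ip: "inv p' \<otimes> b = b \<otimes> inv p'" if b: "b \<in> carrier G" for b
  proof -
    have "p' \<otimes> (b \<otimes> inv p') = b" using p'[of "b \<otimes> inv p'"] assms(4) b by (simp add: m_assoc)
    then have "inv p' \<otimes> (p' \<otimes> (b \<otimes> inv p')) = inv p' \<otimes> b" by simp
    then show ?thesis using assms(4) b by simp
  qed
  have "inv (p \<otimes> p') \<otimes> (q \<otimes> q') \<otimes> (r \<otimes> r') = inv p' \<otimes> (inv p \<otimes> (q \<otimes> ((q' \<otimes> r) \<otimes> r')))"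
    using assms(1-6) by (simp add: m_assoc inv_mult_group)
  also have "\<dots> = (inv p' \<otimes> (inv p \<otimes> q \<otimes> r)) \<otimes> (q' \<otimes> r')"
    unfolding q'[OF assms(3)] using assms(1-6) by (simp add: m_assoc)
  also have "\<dots> = (inv p \<otimes> q \<otimes> r) \<otimes> (inv p' \<otimes> q' \<otimes> r')"
    using ip[of "inv p \<otimes> q \<otimes> r"] assms(1-6) by (simp add: m_assoc)
  finally show ?thesis .
qed

lemma (in comm_group) four_term_iff:
  assumes "a \<in> carrier G" "b \<in> carrier G" "c \<in> carrier G" "d \<in> carrier G"
  shows "inv d \<otimes> (c \<otimes> (inv b \<otimes> a)) = \<one> \<longleftrightarrow> a \<otimes> c = b \<otimes> d"
proof -
  have "inv d \<otimes> (c \<otimes> (inv b \<otimes> a)) = inv (b \<otimes> d) \<otimes> (a \<otimes> c)"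
    using assms by (simp add: inv_mult m_ac)
  then show ?thesis using inv_mult_eq_one[of "b \<otimes> d" "a \<otimes> c"] assms by auto
qed

text \<open>
  The elimination behind \<open>Hcoc2_homotopy\<close>: the three equations are the cocycle identity on the three
  tetrahedra into which a prism is cut.
\<close>

lemma (in comm_group) homotopy_identity:
  assumes "r \<in> carrier G" "s \<in> carrier G" "u \<in> carrier G" "v \<in> carrier G"
    "a \<in> carrier G" "b \<in> carrier G" "c \<in> carrier G" "d \<in> carrier G" "e \<in> carrier G" "f \<in> carrier G"
    and 1: "s \<otimes> c = u \<otimes> e" and 2: "a \<otimes> v = u \<otimes> f" and 3: "b \<otimes> v = d \<otimes> r"
  shows "s = r \<otimes> (inv (c \<otimes> inv d) \<otimes> (e \<otimes> inv f) \<otimes> (a \<otimes> inv b))"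
proof -
  have "(s \<otimes> c) \<otimes> (b \<otimes> v) \<otimes> (u \<otimes> f) = (u \<otimes> e) \<otimes> (d \<otimes> r) \<otimes> (a \<otimes> v)" using 1 2 3 by simp
  then have "(u \<otimes> v) \<otimes> (s \<otimes> (c \<otimes> b \<otimes> f)) = (u \<otimes> v) \<otimes> (r \<otimes> (d \<otimes> e \<otimes> a))"
    using assms(1-10) by (simp add: m_ac)
  then have "s \<otimes> (c \<otimes> b \<otimes> f) = r \<otimes> (d \<otimes> e \<otimes> a)" using assms(1-10) by simp
  then have "s = r \<otimes> (d \<otimes> e \<otimes> a) \<otimes> inv (c \<otimes> b \<otimes> f)"
    using assms(1-10) by (simp add: inv_solve_right)
  then show ?thesis using assms(1-10) by (simp add: inv_mult m_ac)
qed

lemma (in comm_group) alternating_finprod: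
  fixes d :: "nat \<Rightarrow> 'a"
  defines "t \<equiv> \<lambda>i. d i [^] ((-1)^i :: int)"
  shows "(\<And>i. i \<le> 1 \<Longrightarrow> d i \<in> carrier G) \<Longrightarrow> finprod G t {..1} = inv (d 1) \<otimes> d 0"
    and "(\<And>i. i \<le> 2 \<Longrightarrow> d i \<in> carrier G) \<Longrightarrow> finprod G t {..2} = inv (d 1) \<otimes> d 2 \<otimes> d 0"
    and "(\<And>i. i \<le> 3 \<Longrightarrow> d i \<in> carrier G) \<Longrightarrow> finprod G t {..3} = inv (d 3) \<otimes> (d 2 \<otimes> (inv (d 1) \<otimes> d 0))"
proof -
  have tc: "t i \<in> carrier G" if "d i \<in> carrier G" for i using that by (simp add: t_def)
  have te: "t 0 = d 0" if "d 0 \<in> carrier G" using that by (simp add: t_def)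
  have t1: "t 1 = inv (d 1)" if "d 1 \<in> carrier G" using that by (simp add: t_def int_pow_neg)
  have t2: "t 2 = d 2" if "d 2 \<in> carrier G" using that by (simp add: t_def)
  have t3: "t 3 = inv (d 3)" if "d 3 \<in> carrier G" using that by (simp add: t_def int_pow_neg)
  have S: "finprod G t {..Suc n} = t (Suc n) \<otimes> finprod G t {..n}" if "\<And>i. i \<le> Suc n \<Longrightarrow> d i \<in> carrier G" for n
    by (rule finprod_Suc) (use that tc in blast)
  have z: "finprod G t {..0} = d 0" if c: "d 0 \<in> carrier G" using te[OF c] c by simp
  have n: "Suc 0 = 1" "Suc 1 = 2" "Suc 2 = 3" by auto
  have one: "finprod G t {..1} = inv (d 1) \<otimes> d 0" if c: "\<And>i. i \<le> 1 \<Longrightarrow> d i \<in> carrier G"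
  proof -
    have "finprod G t {..1} = t 1 \<otimes> finprod G t {..0}" by (rule S[of 0, unfolded n], rule c)
    then show ?thesis unfolding t1[OF c[OF order_refl]] z[OF c[OF zero_le]] .
  qed
  have two: "finprod G t {..2} = d 2 \<otimes> (inv (d 1) \<otimes> d 0)" if c: "\<And>i. i \<le> 2 \<Longrightarrow> d i \<in> carrier G"
  proof -
    have 1: "finprod G t {..1} = inv (d 1) \<otimes> d 0" by (rule one, rule c) linarith
    have "finprod G t {..2} = t 2 \<otimes> finprod G t {..1}" by (rule S[of 1, unfolded n], rule c)
    then show ?thesis unfolding t2[OF c[OF order_refl]] 1 .
  qed
  show "(\<And>i. i \<le> 1 \<Longrightarrow> d i \<in> carrier G) \<Longrightarrow> finprod G t {..1} = inv (d 1) \<otimes> d 0" by (rule one)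
  show "finprod G t {..2} = inv (d 1) \<otimes> d 2 \<otimes> d 0" if c: "\<And>i. i \<le> 2 \<Longrightarrow> d i \<in> carrier G"
  proof -
    have cl: "d 0 \<in> carrier G" "d 1 \<in> carrier G" "d 2 \<in> carrier G" by (rule c; linarith)+
    have "finprod G t {..2} = d 2 \<otimes> (inv (d 1) \<otimes> d 0)" by (rule two, rule c)
    also have "\<dots> = inv (d 1) \<otimes> (d 2 \<otimes> d 0)" by (rule m_lcomm[OF cl(3) inv_closed[OF cl(2)] cl(1)])
    finally show ?thesis unfolding m_assoc[OF inv_closed[OF cl(2)] cl(3) cl(1)] .
  qed
  show "finprod G t {..3} = inv (d 3) \<otimes> (d 2 \<otimes> (inv (d 1) \<otimes> d 0))" if c: "\<And>i. i \<le> 3 \<Longrightarrow> d i \<in> carrier G"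
  proof -
    have 2: "finprod G t {..2} = d 2 \<otimes> (inv (d 1) \<otimes> d 0)" by (rule two, rule c) linarith
    have "finprod G t {..3} = t 3 \<otimes> finprod G t {..2}" by (rule S[of 2, unfolded n], rule c)
    then show ?thesis unfolding t3[OF c[OF order_refl]] 2 .
  qed
qed

context gspace
begin

context
  fixes U :: "'x cover" and G :: "('g, 'a) ggroup" (structure)
  assumes U: "U \<in> covers S" and G: "gamma_group Gam G"
begin

interpretation G: group G using gamma_groupD(3)[OF G] .

lemma ob0_cocycle:
  assumes \<eta>: "\<eta> \<in> Coch 0 U G"
  shows "ob0 S G U \<eta> \<in> TC1coc S G U"
  unfolding TC1coc_iff[OF U G]
proof (intro conjI allI impI)
  show "ob0 S G U \<eta> \<in> Coch 1 U G" by (rule ob0_closed[OF U G \<eta>])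
  fix a b c g h x assume s: "splx U [a,b,c] [g,h] x"
  note f = faces2[OF U s]
  interpret t: group_hom G G "theta G g" by (rule theta_hom[OF G f(4)])
  note v = val0_closed[OF U G \<eta>] and tc = theta_closed[OF G]
  have hx: "act S h x \<in> X" using f by simp
  have am: "act S (g \<cdot> h) x = act S g (act S h x)" by (rule act_mult[OF f(4,5,6)])
  have cl: "val \<eta> [a] [] (act S g (act S h x)) \<in> carrier G" "val \<eta> [b] [] (act S h x) \<in> carrier G" "val \<eta> [c] [] x \<in> carrier G"
    using v faces1(2)[OF U f(3)] faces1(1)[OF U f(3)] faces1(1)[OF U f(1)] by auto
  show "val (ob0 S G U \<eta>) [a,c] [g \<cdot> h] x = val (ob0 S G U \<eta>) [a,b] [g] (act S h x) \<otimes> theta G g (val (ob0 S G U \<eta>) [b,c] [h] x)"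
    unfolding val_ob0[OF U G \<eta> f(1)] val_ob0[OF U G \<eta> f(2)] val_ob0[OF U G \<eta> f(3)] am theta_mult[OF G f(4,5) cl(3)]
    using cl tc[OF f(5) cl(3)] tc[OF f(4)] by (simp add: G.m_assoc)
qed

text \<open>
  The 0-cochain \<open>\<eta>\<close> itself is the required witness.
\<close>

lemma ob0_trivial:
  assumes \<eta>: "\<eta> \<in> Coch 0 U G"
  shows "(ob0 S G U \<eta>, \<one>\<^bsub>K S 1 U G\<^esub>) \<in> TC1rel S G U"
  unfolding TC1rel_iff[OF U G]
proof (intro conjI bexI[OF _ \<eta>] allI impI)
  show "ob0 S G U \<eta> \<in> TC1coc S G U" by (rule ob0_cocycle[OF \<eta>])
  show "\<one>\<^bsub>K S 1 U G\<^esub> \<in> TC1coc S G U" using limsys.Z_one[OF TC1_limsys[OF G] U] .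
  fix a b g x assume s: "splx U [a,b] [g] x"
  note f = faces1[OF U s]
  have "val \<eta> [a] [] (act S g x) \<in> carrier G" "theta G g (val \<eta> [b] [] x) \<in> carrier G"
    using val0_closed[OF U G \<eta>] f theta_closed[OF G f(3)] by auto
  then show "val \<eta> [a] [] (act S g x) \<otimes> val (ob0 S G U \<eta>) [a,b] [g] x = val \<one>\<^bsub>K S 1 U G\<^esub> [a,b] [g] x \<otimes> theta G g (val \<eta> [b] [] x)"
    by (simp add: val_ob0[OF U G \<eta> s] val_one[OF s])
qed

text \<open>
  The action of 0-cochains on 1-cochains whose orbits are the classes of \<^const>\<open>TC1rel\<close>.
\<close>

definition gauge where
  "gauge \<eta> \<psi> = delta S 0 U G 1 \<eta> \<otimes>\<^bsub>K S 1 U G\<^esub> \<psi> \<otimes>\<^bsub>K S 1 U G\<^esub> inv\<^bsub>K S 1 U G\<^esub> (delta S 0 U G 0 \<eta>)"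

lemma gauge_closed: "\<eta> \<in> Coch 0 U G \<Longrightarrow> \<psi> \<in> Coch 1 U G \<Longrightarrow> gauge \<eta> \<psi> \<in> Coch 1 U G"
  unfolding gauge_def
  by (intro K_mult_closed[OF U gamma_groupD(1)[OF G]] K_inv_closed[OF U gamma_groupD(1)[OF G]] delta0_closed[OF U G] order_refl zero_le)

lemma val_gauge:
  assumes \<eta>: "\<eta> \<in> Coch 0 U G" and s: "splx U [a,b] [g] x"
  shows "val (gauge \<eta> \<psi>) [a,b] [g] x = val \<eta> [a] [] (act S g x) \<otimes> val \<psi> [a,b] [g] x \<otimes> inv (theta G g (val \<eta> [b] [] x))"
proof -
  have l: "length [g] = 1" by simp
  show ?thesis unfolding gauge_def val_mult[OF s l]
    val_inv[OF U gamma_groupD(1)[OF G] delta0_closed[OF U G zero_le \<eta>] s l] val_delta0[OF s] ..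
qed

text \<open>
  All factors \<open>\<eta>\<close> cancel except those at the last vertex, so that \<open>ob1\<close> is conjugated.
\<close>

lemma val_ob1_gauge:
  assumes \<eta>: "\<eta> \<in> Coch 0 U G" and \<psi>: "\<psi> \<in> Coch 1 U G" and s: "splx U [a,b,c] [g,h] x"
  defines "t \<equiv> theta G (g \<cdot> h) (val \<eta> [c] [] x)"
  shows "val (ob1 S G U (gauge \<eta> \<psi>)) [a,b,c] [g,h] x = t \<otimes> val (ob1 S G U \<psi>) [a,b,c] [g,h] x \<otimes> inv t"
    and "t \<in> carrier G"
proof -
  note f = faces2[OF U s]
  interpret t: group_hom G G "theta G g" by (rule theta_hom[OF G f(4)])
  have am: "act S (g \<cdot> h) x = act S g (act S h x)" by (rule act_mult[OF f(4,5,6)])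
  have cl: "val \<eta> [a] [] (act S g (act S h x)) \<in> carrier G" "val \<eta> [b] [] (act S h x) \<in> carrier G" "val \<eta> [c] [] x \<in> carrier G"
    "val \<psi> [b,c] [h] x \<in> carrier G" "val \<psi> [a,b] [g] (act S h x) \<in> carrier G" "val \<psi> [a,c] [g \<cdot> h] x \<in> carrier G"
    using val0_closed[OF U G \<eta>] faces1(2)[OF U f(3)] faces1(1)[OF U f(3)] faces1(1)[OF U f(1)] val1_closed[OF U G \<psi>] f by auto
  have t: "t = theta G g (theta G h (val \<eta> [c] [] x))" unfolding t_def by (rule theta_mult[OF G f(4,5) cl(3)])
  have tc: "theta G h (val \<eta> [c] [] x) \<in> carrier G" by (rule theta_closed[OF G f(5) cl(3)])
  then show tG: "t \<in> carrier G" unfolding t by simp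
  show "val (ob1 S G U (gauge \<eta> \<psi>)) [a,b,c] [g,h] x = t \<otimes> val (ob1 S G U \<psi>) [a,b,c] [g,h] x \<otimes> inv t"
    unfolding val_ob1[OF U G gauge_closed[OF \<eta> \<psi>] s] val_ob1[OF U G \<psi> s] val_gauge[OF \<eta> f(1)] val_gauge[OF \<eta> f(2)] val_gauge[OF \<eta> f(3)]
      am t_def[symmetric]
    using cl tc tG by (simp add: G.m_assoc G.inv_mult_group t[symmetric])
qed

lemma gauge_rel:
  assumes \<eta>: "\<eta> \<in> Coch 0 U G" and \<psi>: "\<psi> \<in> TC1coc S G U"
  shows "(\<psi>, gauge \<eta> \<psi>) \<in> TC1rel S G U"
proof -
  have \<psi>K: "\<psi> \<in> Coch 1 U G" and ob: "ob1 S G U \<psi> = \<one>\<^bsub>K S 2 U G\<^esub>" using \<psi> by (auto simp: TC1coc_def)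
  have "ob1 S G U (gauge \<eta> \<psi>) = \<one>\<^bsub>K S 2 U G\<^esub>"
  proof (rule K_ext2[OF ob1_closed[OF U G gauge_closed[OF \<eta> \<psi>K]] K_one_closed[OF U gamma_groupD(1)[OF G]]])
    fix a b c g h x assume s: "splx U [a,b,c] [g,h] x"
    show "val (ob1 S G U (gauge \<eta> \<psi>)) [a,b,c] [g,h] x = val \<one>\<^bsub>K S 2 U G\<^esub> [a,b,c] [g,h] x"
      unfolding val_ob1_gauge(1)[OF \<eta> \<psi>K s] ob using val_ob1_gauge(2)[OF \<eta> \<psi>K s] by (simp add: val_one[OF s])
  qed
  then have "gauge \<eta> \<psi> \<in> TC1coc S G U" using gauge_closed[OF \<eta> \<psi>K] by (simp add: TC1coc_def)
  then show ?thesis unfolding TC1rel_iff[OF U G]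
  proof (intro conjI bexI[OF _ \<eta>] allI impI)
    fix a b g x assume s: "splx U [a,b] [g] x"
    note f = faces1[OF U s]
    have "val \<eta> [a] [] (act S g x) \<in> carrier G" "theta G g (val \<eta> [b] [] x) \<in> carrier G" "val \<psi> [a,b] [g] x \<in> carrier G"
      using val0_closed[OF U G \<eta>] f theta_closed[OF G f(3)] val1_closed[OF U G \<psi>K s] by auto
    then show "val \<eta> [a] [] (act S g x) \<otimes> val \<psi> [a,b] [g] x = val (gauge \<eta> \<psi>) [a,b] [g] x \<otimes> theta G g (val \<eta> [b] [] x)"
      by (simp add: val_gauge[OF \<eta> s] G.m_assoc)
  qed (use \<psi> in auto)
qed

lemma ob1_mult_central:
  assumes \<psi>: "\<psi> \<in> Coch 1 U G" and \<kappa>: "\<kappa> \<in> Coch 1 U G"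
    and central: "\<And>a b g x y. splx U [a,b] [g] x \<Longrightarrow> y \<in> carrier G \<Longrightarrow> val \<kappa> [a,b] [g] x \<otimes> y = y \<otimes> val \<kappa> [a,b] [g] x"
  shows "ob1 S G U (\<psi> \<otimes>\<^bsub>K S 1 U G\<^esub> \<kappa>) = ob1 S G U \<psi> \<otimes>\<^bsub>K S 2 U G\<^esub> ob1 S G U \<kappa>"
proof -
  note LG = gamma_groupD(1)[OF G]
  have pk: "\<psi> \<otimes>\<^bsub>K S 1 U G\<^esub> \<kappa> \<in> Coch 1 U G" by (rule K_mult_closed[OF U LG \<psi> \<kappa>])
  show ?thesis
  proof (rule K_ext2[OF ob1_closed[OF U G pk] K_mult_closed[OF U LG ob1_closed[OF U G \<psi>] ob1_closed[OF U G \<kappa>]]])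
    fix a b c g h x assume s: "splx U [a,b,c] [g,h] x"
    note f = faces2[OF U s]
    interpret t: group_hom G G "theta G g" by (rule theta_hom[OF G f(4)])
    have l: "length [g,h] = 2" "length [g] = 1" for g h :: 'g by auto
    note cl = val1_closed[OF U G \<psi>] val1_closed[OF U G \<kappa>]
    have v: "val (\<psi> \<otimes>\<^bsub>K S 1 U G\<^esub> \<kappa>) [a,b] [g] x = val \<psi> [a,b] [g] x \<otimes> val \<kappa> [a,b] [g] x" if "splx U [a,b] [g] x" for a b g x
      by (rule val_mult[OF that l(2)])
    show "val (ob1 S G U (\<psi> \<otimes>\<^bsub>K S 1 U G\<^esub> \<kappa>)) [a,b,c] [g,h] x = val (ob1 S G U \<psi> \<otimes>\<^bsub>K S 2 U G\<^esub> ob1 S G U \<kappa>) [a,b,c] [g,h] x"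
      unfolding val_mult[OF s l(1)] val_ob1[OF U G pk s] val_ob1[OF U G \<psi> s] val_ob1[OF U G \<kappa> s] v[OF f(1)] v[OF f(2)] v[OF f(3)]
        t.hom_mult[OF cl(1)[OF f(1)] cl(2)[OF f(1)]]
      by (rule G.central_ob1) (use cl f central in auto)
  qed
qed

end

subsection \<open>Coefficient homomorphisms\<close>

context
  fixes U :: "'x cover" and G :: "('g, 'a) ggroup" and G' :: "('g, 'b) ggroup" and f
  assumes U: "U \<in> covers S" and G: "gamma_group Gam G" and G': "gamma_group Gam G'" and f: "f \<in> gamma_hom Gam G G'"
begin

interpretation f: group_hom G G' f
  using gamma_groupD(3)[OF G] gamma_groupD(3)[OF G'] gamma_homD(1)[OF f] by (simp add: group_hom_def group_hom_axioms_def)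

lemma post_hom_closed: "\<phi> \<in> Coch p U G \<Longrightarrow> post S p U f \<phi> \<in> Coch p U G'"
  by (rule post_closed[OF U gamma_groupD(1)[OF G] gamma_groupD(1)[OF G'] gamma_homD(2)[OF f]])

lemma post_one: "post S p U f \<one>\<^bsub>K S p U G\<^esub> = \<one>\<^bsub>K S p U G'\<^esub>"
  by (rule K_ext[OF post_hom_closed[OF K_one_closed[OF U gamma_groupD(1)[OF G]]] K_one_closed[OF U gamma_groupD(1)[OF G']]])
    (simp add: val_post val_one)

lemma post_ob0:
  assumes \<mu>: "\<mu> \<in> Coch 0 U G"
  shows "post S 1 U f (ob0 S G U \<mu>) = ob0 S G' U (post S 0 U f \<mu>)"
proof (rule K_ext1[OF post_hom_closed[OF ob0_closed[OF U G \<mu>]] ob0_closed[OF U G' post_hom_closed[OF \<mu>]]])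
  fix a b g x assume s: "splx U [a,b] [g] x"
  note fc = faces1[OF U s]
  have l: "length [g] = 1" by simp
  show "val (post S 1 U f (ob0 S G U \<mu>)) [a,b] [g] x = val (ob0 S G' U (post S 0 U f \<mu>)) [a,b] [g] x"
    unfolding val_post[OF s l] val_ob0[OF U G \<mu> s] val_ob0[OF U G' post_hom_closed[OF \<mu>] s]
    using val0_closed[OF U G \<mu>] fc theta_closed[OF G fc(3)]
    by (simp add: val_post[OF fc(1)] val_post[OF fc(2)] gamma_homD(3)[OF f])
qed

lemma post_ob1:
  assumes \<phi>: "\<phi> \<in> Coch 1 U G"
  shows "post S 2 U f (ob1 S G U \<phi>) = ob1 S G' U (post S 1 U f \<phi>)"
proof (rule K_ext2[OF post_hom_closed[OF ob1_closed[OF U G \<phi>]] ob1_closed[OF U G' post_hom_closed[OF \<phi>]]])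
  fix a b c g h x assume s: "splx U [a,b,c] [g,h] x"
  note fc = faces2[OF U s]
  have l: "length [g,h] = 2" "length [g] = 1" for g h :: 'g by auto
  have vp: "val (post S 1 U f \<phi>) as [g] x = f (val \<phi> as [g] x)" if "splx U as [g] x" for as g x
    by (rule val_post[OF that l(2)])
  show "val (post S 2 U f (ob1 S G U \<phi>)) [a,b,c] [g,h] x = val (ob1 S G' U (post S 1 U f \<phi>)) [a,b,c] [g,h] x"
    unfolding val_post[OF s l(1)] val_ob1[OF U G \<phi> s] val_ob1[OF U G' post_hom_closed[OF \<phi>] s] vp[OF fc(1)] vp[OF fc(2)] vp[OF fc(3)]
    using val1_closed[OF U G \<phi>] fc theta_closed[OF G fc(4)]
    by (simp add: gamma_homD(3)[OF f])
qed

lemma post_TC0: "\<mu> \<in> TC0coc S G U \<Longrightarrow> post S 0 U f \<mu> \<in> TC0coc S G' U"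
  unfolding TC0coc_def using post_ob0[of \<mu>] post_hom_closed[of \<mu> 0] post_one[of 1] by auto

lemma post_TC1: "\<phi> \<in> TC1coc S G U \<Longrightarrow> post S 1 U f \<phi> \<in> TC1coc S G' U"
  unfolding TC1coc_def using post_ob1[of \<phi>] post_hom_closed[of \<phi> 1] post_one[of 2] by auto

lemma post_TC1rel:
  assumes "(\<phi>, \<psi>) \<in> TC1rel S G U"
  shows "(post S 1 U f \<phi>, post S 1 U f \<psi>) \<in> TC1rel S G' U"
proof -
  obtain \<mu> where c: "\<phi> \<in> TC1coc S G U" "\<psi> \<in> TC1coc S G U" and \<mu>: "\<mu> \<in> Coch 0 U G"
    "\<And>a b g x. splx U [a,b] [g] x \<Longrightarrow> val \<mu> [a] [] (act S g x) \<otimes>\<^bsub>G\<^esub> val \<phi> [a,b] [g] x = val \<psi> [a,b] [g] x \<otimes>\<^bsub>G\<^esub> theta G g (val \<mu> [b] [] x)"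
    using assms[unfolded TC1rel_iff[OF U G]] by blast
  have k: "\<phi> \<in> Coch 1 U G" "\<psi> \<in> Coch 1 U G" using c by (auto simp: TC1coc_def)
  show ?thesis unfolding TC1rel_iff[OF U G']
  proof (intro conjI bexI[OF _ post_hom_closed[OF \<mu>(1)]] allI impI)
    fix a b g x assume s: "splx U [a,b] [g] x"
    note fc = faces1[OF U s]
    have l: "length [g] = 1" by simp
    have cl: "val \<mu> [a] [] (act S g x) \<in> carrier G" "val \<mu> [b] [] x \<in> carrier G" "val \<phi> [a,b] [g] x \<in> carrier G" "val \<psi> [a,b] [g] x \<in> carrier G"
      using val0_closed[OF U G \<mu>(1)] val1_closed[OF U G _ s] fc k by auto
    have "f (val \<mu> [a] [] (act S g x) \<otimes>\<^bsub>G\<^esub> val \<phi> [a,b] [g] x) = f (val \<psi> [a,b] [g] x \<otimes>\<^bsub>G\<^esub> theta G g (val \<mu> [b] [] x))"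
      using \<mu>(2)[OF s] by simp
    then show "val (post S 0 U f \<mu>) [a] [] (act S g x) \<otimes>\<^bsub>G'\<^esub> val (post S 1 U f \<phi>) [a,b] [g] x
      = val (post S 1 U f \<psi>) [a,b] [g] x \<otimes>\<^bsub>G'\<^esub> theta G' g (val (post S 0 U f \<mu>) [b] [] x)"
      unfolding val_post[OF s l] using cl theta_closed[OF G fc(3)]
      by (simp add: val_post[OF fc(1)] val_post[OF fc(2)] gamma_homD(3)[OF f fc(3), symmetric])
  qed (use c post_TC1 in auto)
qed

end

lemma restr_post_hom:
  assumes "U \<in> covers S" "V \<in> covers S" "gamma_group Gam G" "gamma_group Gam G'" "f \<in> gamma_hom Gam G G'" "refines V U r"
    "\<phi> \<in> Coch p U G"
  shows "restr S p V r (post S p U f \<phi>) = post S p V f (restr S p V r \<phi>)"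
  by (rule restr_post[OF assms(1,2) gamma_groupD(1)[OF assms(3)] gamma_groupD(1)[OF assms(4)] assms(6,7)
      post_hom_closed[OF assms(1,3-5,7)] post_hom_closed[OF assms(2,3-5) restr_closed[OF assms(1,2) gamma_groupD(1)[OF assms(3)] assms(6,7)]]])

lemma TC0cls_eq: "gamma_group Gam G \<Longrightarrow> TC0cls S G U \<mu> = limsys.cls S 0 (TC0coc S G) (\<lambda>_. Id) U \<mu>"
  unfolding TC0cls_def limsys.cls_def[OF TC0_limsys] ..

lemma TC1cls_eq: "gamma_group Gam G \<Longrightarrow> TC1cls S G U \<mu> = limsys.cls S 1 (TC1coc S G) (TC1rel S G) U \<mu>"
  unfolding TC1cls_def limsys.cls_def[OF TC1_limsys] ..

lemma beta0_map:
  assumes G: "gamma_group Gam G" and G': "gamma_group Gam G'" and f: "f \<in> gamma_hom Gam G G'"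
  shows "pointed_map (TC0 S G) (TC0pt S G) (TC0 S G') (TC0pt S G') (beta0 S G G' f)"
proof -
  interpret src: limsys S G 0 "TC0coc S G" "\<lambda>_. Id" by (rule TC0_limsys[OF G])
  interpret tgt: limsys S G' 0 "TC0coc S G'" "\<lambda>_. Id" by (rule TC0_limsys[OF G'])
  interpret m: limmap S G 0 "TC0coc S G" "\<lambda>_. Id" G' 0 "TC0coc S G'" "\<lambda>_. Id" "\<lambda>U. {(\<mu>, post S 0 U f \<mu>) | \<mu>. \<mu> \<in> TC0coc S G U}"
  proof unfold_locales
    fix U assume U: "U \<in> covers S"
    show "{(\<mu>, post S 0 U f \<mu>) | \<mu>. \<mu> \<in> TC0coc S G U} \<subseteq> TC0coc S G U \<times> TC0coc S G' U"
      using post_TC0[OF U G G' f] by blast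
    show "(\<one>\<^bsub>K S 0 U G\<^esub>, \<one>\<^bsub>K S 0 U G'\<^esub>) \<in> {(\<mu>, post S 0 U f \<mu>) | \<mu>. \<mu> \<in> TC0coc S G U}"
      using src.Z_one[OF U] post_one[OF U G G' f, of 0] by force
    show "\<exists>V\<in>covers S. \<exists>r. refines V U r \<and> (restr S 0 V r \<psi>, restr S 0 V r \<psi>') \<in> Id"
      if "(\<phi>, \<psi>) \<in> {(\<mu>, post S 0 U f \<mu>) | \<mu>. \<mu> \<in> TC0coc S G U}" "(\<phi>', \<psi>') \<in> {(\<mu>, post S 0 U f \<mu>) | \<mu>. \<mu> \<in> TC0coc S G U}" "(\<phi>, \<phi>') \<in> Id" for \<phi> \<psi> \<phi>' \<psi>'
      using that U refines_id by auto
    fix V r \<phi> \<psi> assume V: "V \<in> covers S" "refines V U r" "(\<phi>, \<psi>) \<in> {(\<mu>, post S 0 U f \<mu>) | \<mu>. \<mu> \<in> TC0coc S G U}"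
    then have "\<phi> \<in> TC0coc S G U" "\<psi> = post S 0 U f \<phi>" by auto
    then show "(restr S 0 V r \<phi>, restr S 0 V r \<psi>) \<in> {(\<mu>, post S 0 V f \<mu>) | \<mu>. \<mu> \<in> TC0coc S G V}"
      using restr_post_hom[OF U V(1) G G' f V(2) src.Z_closed[OF U]] src.Z_restr[OF U V(1,2)] by auto
  qed
  have "beta0 S G G' f = m.graph"
    unfolding beta0_def m.graph_def TC0cls_eq[OF G] TC0cls_eq[OF G'] by blast
  moreover have "pointed_map src.Q (src.cls (triv_cover S) \<one>\<^bsub>K S 0 (triv_cover S) G\<^esub>)
     tgt.Q (tgt.cls (triv_cover S) \<one>\<^bsub>K S 0 (triv_cover S) G'\<^esub>) m.graph"
    by (rule m.graph_total) (use src.Z_restr refines_id in blast)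
  ultimately show ?thesis unfolding TC0_def TC0pt_def TC0cls_eq[OF G] TC0cls_eq[OF G'] by simp
qed

lemma beta1_map:
  assumes G: "gamma_group Gam G" and G': "gamma_group Gam G'" and f: "f \<in> gamma_hom Gam G G'"
  shows "pointed_map (TC1 S G) (TC1pt S G) (TC1 S G') (TC1pt S G') (beta1 S G G' f)"
proof -
  interpret src: limsys S G 1 "TC1coc S G" "TC1rel S G" by (rule TC1_limsys[OF G])
  interpret tgt: limsys S G' 1 "TC1coc S G'" "TC1rel S G'" by (rule TC1_limsys[OF G'])
  interpret m: limmap S G 1 "TC1coc S G" "TC1rel S G" G' 1 "TC1coc S G'" "TC1rel S G'" "\<lambda>U. {(\<mu>, post S 1 U f \<mu>) | \<mu>. \<mu> \<in> TC1coc S G U}"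
  proof unfold_locales
    fix U assume U: "U \<in> covers S"
    show "{(\<mu>, post S 1 U f \<mu>) | \<mu>. \<mu> \<in> TC1coc S G U} \<subseteq> TC1coc S G U \<times> TC1coc S G' U"
      using post_TC1[OF U G G' f] by blast
    show "(\<one>\<^bsub>K S 1 U G\<^esub>, \<one>\<^bsub>K S 1 U G'\<^esub>) \<in> {(\<mu>, post S 1 U f \<mu>) | \<mu>. \<mu> \<in> TC1coc S G U}"
      using src.Z_one[OF U] post_one[OF U G G' f, of 1] by force
    show "\<exists>V\<in>covers S. \<exists>r. refines V U r \<and> (restr S 1 V r \<psi>, restr S 1 V r \<psi>') \<in> TC1rel S G' V"
      if "(\<phi>, \<psi>) \<in> {(\<mu>, post S 1 U f \<mu>) | \<mu>. \<mu> \<in> TC1coc S G U}" "(\<phi>', \<psi>') \<in> {(\<mu>, post S 1 U f \<mu>) | \<mu>. \<mu> \<in> TC1coc S G U}" "(\<phi>, \<phi>') \<in> TC1rel S G U" for \<phi> \<psi> \<phi>' \<psi>'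
    proof -
      have p: "\<psi> = post S 1 U f \<phi>" "\<psi>' = post S 1 U f \<phi>'" "\<phi> \<in> TC1coc S G U" "\<phi>' \<in> TC1coc S G U" using that by auto
      have "(restr S 1 U (\<lambda>a. a) \<psi>, restr S 1 U (\<lambda>a. a) \<psi>') \<in> TC1rel S G' U"
        unfolding p by (rule tgt.R_restr[OF U U refines_id post_TC1rel[OF U G G' f that(3)]]) (use p post_TC1[OF U G G' f] in auto)
      then show ?thesis using U refines_id by blast
    qed
    fix V r \<phi> \<psi> assume V: "V \<in> covers S" "refines V U r" "(\<phi>, \<psi>) \<in> {(\<mu>, post S 1 U f \<mu>) | \<mu>. \<mu> \<in> TC1coc S G U}"
    then have "\<phi> \<in> TC1coc S G U" "\<psi> = post S 1 U f \<phi>" by auto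
    then show "(restr S 1 V r \<phi>, restr S 1 V r \<psi>) \<in> {(\<mu>, post S 1 V f \<mu>) | \<mu>. \<mu> \<in> TC1coc S G V}"
      using restr_post_hom[OF U V(1) G G' f V(2) src.Z_closed[OF U]] src.Z_restr[OF U V(1,2)] by auto
  qed
  have "beta1 S G G' f = m.graph"
    unfolding beta1_def m.graph_def TC1cls_eq[OF G] TC1cls_eq[OF G'] by blast
  moreover have "pointed_map src.Q (src.cls (triv_cover S) \<one>\<^bsub>K S 1 (triv_cover S) G\<^esub>)
     tgt.Q (tgt.cls (triv_cover S) \<one>\<^bsub>K S 1 (triv_cover S) G'\<^esub>) m.graph"
    by (rule m.graph_total) (use src.Z_restr refines_id in blast)
  ultimately show ?thesis unfolding TC1_def TC1pt_def TC1cls_eq[OF G] TC1cls_eq[OF G'] by simp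
qed

lemma restr_ob1:
  fixes B :: "('g, 'b) ggroup"
  assumes U: "U \<in> covers S" "V \<in> covers S" and B: "gamma_group Gam B" and r: "refines V U r" and \<nu>: "\<nu> \<in> Coch 1 U B"
  shows "restr S 2 V r (ob1 S B U \<nu>) = ob1 S B V (restr S 1 V r \<nu>)"
proof -
  note LB = gamma_groupD(1)[OF B]
  note \<nu>V = restr_closed[OF U LB r \<nu>]
  show ?thesis
  proof (rule K_ext2[OF restr_closed[OF U LB r ob1_closed[OF U(1) B \<nu>]] ob1_closed[OF U(2) B \<nu>V]])
    fix a b c g h x assume s: "splx V [a,b,c] [g,h] x"
    note f = faces2[OF U(2) s]
    have l: "length [g,h] = 2" "length [g] = 1" for g h :: 'g by auto
    have s': "splx U [r a, r b, r c] [g,h] x" using splx_refine[OF r s] by simp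
    show "val (restr S 2 V r (ob1 S B U \<nu>)) [a,b,c] [g,h] x = val (ob1 S B V (restr S 1 V r \<nu>)) [a,b,c] [g,h] x"
      unfolding val_restr[OF s l(1)] val_ob1[OF U(2) B \<nu>V s] val_restr[OF f(1) l(2)] val_restr[OF f(2) l(2)] val_restr[OF f(3) l(2)]
      using val_ob1[OF U(1) B \<nu> s'] by simp
  qed
qed

lemma restr_mult:
  assumes U: "U \<in> covers S" "V \<in> covers S" and B: "lie_group B" and r: "refines V U r"
    and c: "\<phi> \<in> Coch p U B" "\<psi> \<in> Coch p U B"
  shows "restr S p V r (\<phi> \<otimes>\<^bsub>K S p U B\<^esub> \<psi>) = restr S p V r \<phi> \<otimes>\<^bsub>K S p V B\<^esub> restr S p V r \<psi>"
  by (rule K_ext[OF restr_closed[OF U B r K_mult_closed[OF U(1) B c]] K_mult_closed[OF U(2) B restr_closed[OF U B r c(1)] restr_closed[OF U B r c(2)]]])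
    (simp add: val_restr val_mult splx_refine[OF r])

subsection \<open>Abelian coefficients\<close>

context
  fixes A :: "('g, 'a) ggroup" (structure)
  assumes A: "gamma_group Gam A" and comm: "comm_group A"
begin

interpretation A: comm_group A by (rule comm)

lemmas LA = gamma_groupD(1)[OF A]

lemma K_comm:
  assumes U: "U \<in> covers S"
  shows "comm_group (K S p U A)"
proof (rule group.group_comm_groupI[OF K_group(1)[OF U LA]])
  fix x y assume xy: "x \<in> Coch p U A" "y \<in> Coch p U A"
  show "x \<otimes>\<^bsub>K S p U A\<^esub> y = y \<otimes>\<^bsub>K S p U A\<^esub> x"
  proof (rule K_ext[OF K_mult_closed[OF U LA xy] K_mult_closed[OF U LA xy(2,1)]])
    fix as gs z assume s: "splx U as gs z" "length gs = p"
    show "val (x \<otimes>\<^bsub>K S p U A\<^esub> y) as gs z = val (y \<otimes>\<^bsub>K S p U A\<^esub> x) as gs z"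
      unfolding val_mult[OF s] by (rule A.m_comm[OF val_closed[OF xy(1) s U LA] val_closed[OF xy(2) s U LA]])
  qed
qed

lemma cobd0_eq:
  assumes U: "U \<in> covers S" and \<mu>: "\<mu> \<in> Coch 0 U A"
  shows "cobd S 0 U A \<mu> = ob0 S A U \<mu>"
  unfolding cobd_def ob0_def add_0
  by (rule comm_group.alternating_finprod(1)[OF K_comm[OF U] delta0_closed[OF U A _ \<mu>]])

lemma cobd1_eq:
  assumes U: "U \<in> covers S" and \<mu>: "\<mu> \<in> Coch 1 U A"
  shows "cobd S 1 U A \<mu> = ob1 S A U \<mu>"
  unfolding cobd_def ob1_def one_add_one
  by (rule comm_group.alternating_finprod(2)[OF K_comm[OF U] delta1_closed[OF U A _ \<mu>]])

lemma cobd2_eq: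
  assumes U: "U \<in> covers S" and \<mu>: "\<mu> \<in> Coch 2 U A"
  shows "cobd S 2 U A \<mu> = inv\<^bsub>K S 3 U A\<^esub> (delta S 2 U A 3 \<mu>) \<otimes>\<^bsub>K S 3 U A\<^esub> (delta S 2 U A 2 \<mu> \<otimes>\<^bsub>K S 3 U A\<^esub>
    (inv\<^bsub>K S 3 U A\<^esub> (delta S 2 U A 1 \<mu>) \<otimes>\<^bsub>K S 3 U A\<^esub> delta S 2 U A 0 \<mu>))"
proof -
  have "2 + (1::nat) = 3" by simp
  then show ?thesis unfolding cobd_def
    by (simp only:) (rule comm_group.alternating_finprod(3)[OF K_comm[OF U] delta2_closed[OF U A _ \<mu>]])
qed

lemma Hcoc0: "U \<in> covers S \<Longrightarrow> Hcoc S A 0 U = TC0coc S A U"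
  unfolding Hcoc_def TC0coc_def using cobd0_eq by auto

lemma Hcoc1: "U \<in> covers S \<Longrightarrow> Hcoc S A 1 U = TC1coc S A U"
  unfolding Hcoc_def TC1coc_def one_add_one using cobd1_eq by auto

text \<open>
  In degrees 0 and 1 the abelian theory is the case of abelian coefficients of the non-abelian one, so
  that all that is known about \<open>TC\<^sup>0\<close> and \<open>TC\<^sup>1\<close> applies to the cohomology groups.
\<close>

lemma Hrel1:
  assumes U: "U \<in> covers S"
  shows "Hrel S A 1 U = TC1rel S A U"
proof -
  interpret Kc: comm_group "K S 1 U A" by (rule K_comm[OF U])
  have eqv: "\<phi> = \<phi>' \<otimes>\<^bsub>K S 1 U A\<^esub> cobd S 0 U A \<mu> \<longleftrightarrow>
      delta S 0 U A 1 \<mu> \<otimes>\<^bsub>K S 1 U A\<^esub> \<phi> = \<phi>' \<otimes>\<^bsub>K S 1 U A\<^esub> delta S 0 U A 0 \<mu>"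
    if c: "\<phi> \<in> Coch 1 U A" "\<phi>' \<in> Coch 1 U A" "\<mu> \<in> Coch 0 U A" for \<phi> \<phi>' \<mu>
  proof -
    have d: "delta S 0 U A 1 \<mu> \<in> Coch 1 U A" "delta S 0 U A 0 \<mu> \<in> Coch 1 U A"
      by (rule delta0_closed[OF U A order_refl c(3)], rule delta0_closed[OF U A zero_le c(3)])
    have "\<phi>' \<otimes>\<^bsub>K S 1 U A\<^esub> cobd S 0 U A \<mu> = inv\<^bsub>K S 1 U A\<^esub> (delta S 0 U A 1 \<mu>) \<otimes>\<^bsub>K S 1 U A\<^esub> (\<phi>' \<otimes>\<^bsub>K S 1 U A\<^esub> delta S 0 U A 0 \<mu>)"
      unfolding cobd0_eq[OF U c(3)] ob0_def by (rule Kc.m_lcomm[OF c(2) Kc.inv_closed[OF d(1)] d(2)])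
    then show ?thesis using Kc.inv_solve_left[OF c(1) d(1) Kc.m_closed[OF c(2) d(2)]] by metis
  qed
  have hr: "(\<phi>, \<phi>') \<in> Hrel S A 1 U \<longleftrightarrow> \<phi> \<in> TC1coc S A U \<and> \<phi>' \<in> TC1coc S A U \<and>
     (\<exists>\<mu>\<in>Coch 0 U A. \<phi> = \<phi>' \<otimes>\<^bsub>K S 1 U A\<^esub> cobd S 0 U A \<mu>)" for \<phi> \<phi>'
    unfolding Hrel_def Hcoc1[OF U] by simp
  have tr: "(\<phi>, \<phi>') \<in> TC1rel S A U \<longleftrightarrow> \<phi> \<in> TC1coc S A U \<and> \<phi>' \<in> TC1coc S A U \<and>
     (\<exists>\<mu>\<in>Coch 0 U A. delta S 0 U A 1 \<mu> \<otimes>\<^bsub>K S 1 U A\<^esub> \<phi> = \<phi>' \<otimes>\<^bsub>K S 1 U A\<^esub> delta S 0 U A 0 \<mu>)" for \<phi> \<phi>'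
    unfolding TC1rel_def by (simp only: mem_Collect_eq case_prod_conv)
  have Zc: "\<phi> \<in> TC1coc S A U \<Longrightarrow> \<phi> \<in> Coch 1 U A" for \<phi> by (simp add: TC1coc_def)
  have "(\<phi>, \<phi>') \<in> Hrel S A 1 U \<longleftrightarrow> (\<phi>, \<phi>') \<in> TC1rel S A U" for \<phi> \<phi>'
    unfolding hr tr by (intro conj_cong bex_cong refl eqv Zc)
  then show ?thesis by auto
qed

lemma lim_rel_H0: "lim_rel S 0 (Hcoc S A 0) (Hrel S A 0) = lim_rel S 0 (TC0coc S A) (\<lambda>_. Id)"
proof -
  have "(restr S 0 W r \<phi>, restr S 0 W s \<psi>) \<in> Hrel S A 0 W \<longleftrightarrow> (restr S 0 W r \<phi>, restr S 0 W s \<psi>) \<in> Id"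
    if "U \<in> covers S" "V \<in> covers S" "W \<in> covers S" "refines W U r" "refines W V s" "\<phi> \<in> TC0coc S A U" "\<psi> \<in> TC0coc S A V" for U V W r s \<phi> \<psi>
    using TC0coc_restr[OF that(1,3) A that(4,6)] TC0coc_restr[OF that(2,3) A that(5,7)] by (auto simp: Hrel_def Hcoc0[OF that(3)])
  then show ?thesis unfolding lim_rel_def using Hcoc0 by (intro Collect_cong) blast
qed

lemma lim_rel_H1: "lim_rel S 1 (Hcoc S A 1) (Hrel S A 1) = lim_rel S 1 (TC1coc S A) (TC1rel S A)"
  unfolding lim_rel_def using Hcoc1 Hrel1 by (intro Collect_cong) blast

lemma Sigma_Hcoc0: "(SIGMA U:covers S. Hcoc S A 0 U) = (SIGMA U:covers S. TC0coc S A U)"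
  using Hcoc0 by (intro Sigma_cong refl) auto

lemma Sigma_Hcoc1: "(SIGMA U:covers S. Hcoc S A 1 U) = (SIGMA U:covers S. TC1coc S A U)"
  using Hcoc1 by (intro Sigma_cong refl) auto

lemma H0_eq: "H S A 0 = TC0 S A" "Hcls S A 0 U \<mu> = TC0cls S A U \<mu>" "Hpt S A 0 = TC0pt S A"
  unfolding H_def TC0_def Hcls_def TC0cls_def Hpt_def TC0pt_def lim_rel_H0 Sigma_Hcoc0 by simp_all

lemma H1_eq: "H S A 1 = TC1 S A" "Hcls S A 1 U \<mu> = TC1cls S A U \<mu>" "Hpt S A 1 = TC1pt S A"
  unfolding H_def TC1_def Hcls_def TC1cls_def Hpt_def TC1pt_def lim_rel_H1 Sigma_Hcoc1 by simp_all

lemma Hcoc2_iff: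
  assumes U: "U \<in> covers S"
  shows "\<omega> \<in> Hcoc S A 2 U \<longleftrightarrow> \<omega> \<in> Coch 2 U A \<and>
    (\<forall>a b c d g h k x. splx U [a,b,c,d] [g,h,k] x \<longrightarrow>
       theta A g (val \<omega> [b,c,d] [h,k] x) \<otimes> val \<omega> [a,b,d] [g, h \<cdot> k] x =
       val \<omega> [a,c,d] [g \<cdot> h, k] x \<otimes> val \<omega> [a,b,c] [g,h] (act S k x))"
proof -
  have "cobd S 2 U A \<omega> = \<one>\<^bsub>K S 3 U A\<^esub> \<longleftrightarrow> (\<forall>a b c d g h k x. splx U [a,b,c,d] [g,h,k] x \<longrightarrow>
       theta A g (val \<omega> [b,c,d] [h,k] x) \<otimes> val \<omega> [a,b,d] [g, h \<cdot> k] x =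
       val \<omega> [a,c,d] [g \<cdot> h, k] x \<otimes> val \<omega> [a,b,c] [g,h] (act S k x))"
    if \<omega>: "\<omega> \<in> Coch 2 U A"
  proof -
    have dc: "delta S 2 U A i \<omega> \<in> Coch 3 U A" if "i \<le> 3" for i by (rule delta2_closed[OF U A that \<omega>])
    have d: "delta S 2 U A 0 \<omega> \<in> Coch 3 U A" "delta S 2 U A 1 \<omega> \<in> Coch 3 U A"
      "delta S 2 U A 2 \<omega> \<in> Coch 3 U A" "delta S 2 U A 3 \<omega> \<in> Coch 3 U A"
      by (rule dc; simp)+
    have eq: "val (cobd S 2 U A \<omega>) [a,b,c,d] [g,h,k] x = \<one> \<longleftrightarrow>
       theta A g (val \<omega> [b,c,d] [h,k] x) \<otimes> val \<omega> [a,b,d] [g, h \<cdot> k] x =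
       val \<omega> [a,c,d] [g \<cdot> h, k] x \<otimes> val \<omega> [a,b,c] [g,h] (act S k x)"
      if s: "splx U [a,b,c,d] [g,h,k] x" for a b c d g h k x
    proof -
      note f = faces3[OF U s]
      have l: "length [g,h,k] = 3" by simp
      show ?thesis
        unfolding cobd2_eq[OF U \<omega>] val_mult[OF s l] val_inv[OF U LA d(4) s l] val_inv[OF U LA d(2) s l] val_delta2[OF s]
        by (rule A.four_term_iff) (use val2_closed[OF U A \<omega>] f theta_closed[OF A f(5)] in auto)
    qed
    have cc: "cobd S 2 U A \<omega> \<in> Coch 3 U A"
      unfolding cobd2_eq[OF U \<omega>] using d by (intro K_mult_closed[OF U LA] K_inv_closed[OF U LA])
    have l: "length [g,h,k] = 3" for g h k :: 'g by simp
    show ?thesis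
    proof
      assume c1: "cobd S 2 U A \<omega> = \<one>\<^bsub>K S 3 U A\<^esub>"
      show "\<forall>a b c d g h k x. splx U [a,b,c,d] [g,h,k] x \<longrightarrow>
       theta A g (val \<omega> [b,c,d] [h,k] x) \<otimes> val \<omega> [a,b,d] [g, h \<cdot> k] x =
       val \<omega> [a,c,d] [g \<cdot> h, k] x \<otimes> val \<omega> [a,b,c] [g,h] (act S k x)"
        using eq val_one[OF _ l] unfolding c1 by blast
    next
      assume r: "\<forall>a b c d g h k x. splx U [a,b,c,d] [g,h,k] x \<longrightarrow>
       theta A g (val \<omega> [b,c,d] [h,k] x) \<otimes> val \<omega> [a,b,d] [g, h \<cdot> k] x =
       val \<omega> [a,c,d] [g \<cdot> h, k] x \<otimes> val \<omega> [a,b,c] [g,h] (act S k x)"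
      show "cobd S 2 U A \<omega> = \<one>\<^bsub>K S 3 U A\<^esub>"
      proof (rule K_ext3[OF cc K_one_closed[OF U LA]])
        fix a b c d g h k x assume s: "splx U [a,b,c,d] [g,h,k] x"
        show "val (cobd S 2 U A \<omega>) [a,b,c,d] [g,h,k] x = val \<one>\<^bsub>K S 3 U A\<^esub> [a,b,c,d] [g,h,k] x"
          unfolding val_one[OF s l] eq[OF s] using r s by blast
      qed
    qed
  qed
  moreover have "2 + (1::nat) = 3" by simp
  ultimately show ?thesis unfolding Hcoc_def by auto
qed

lemma Hrel2_iff:
  assumes U: "U \<in> covers S"
  shows "(\<phi>, \<phi>') \<in> Hrel S A 2 U \<longleftrightarrow> \<phi> \<in> Hcoc S A 2 U \<and> \<phi>' \<in> Hcoc S A 2 U \<and>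
    (\<exists>\<nu>\<in>Coch 1 U A. \<phi> = \<phi>' \<otimes>\<^bsub>K S 2 U A\<^esub> ob1 S A U \<nu>)"
proof -
  have "(case 2 of 0 \<Rightarrow> \<phi> = \<phi>' | Suc q \<Rightarrow> \<exists>\<mu>\<in>Coch q U A. \<phi> = \<phi>' \<otimes>\<^bsub>K S 2 U A\<^esub> cobd S q U A \<mu>)
      \<longleftrightarrow> (\<exists>\<mu>\<in>Coch 1 U A. \<phi> = \<phi>' \<otimes>\<^bsub>K S 2 U A\<^esub> cobd S 1 U A \<mu>)"
    by (simp add: numeral_2_eq_2)
  then show ?thesis unfolding Hrel_def using cobd1_eq[OF U] by auto
qed

lemma ob1_mult_abelian:
  assumes "U \<in> covers S" "\<psi> \<in> Coch 1 U A" "\<kappa> \<in> Coch 1 U A"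
  shows "ob1 S A U (\<psi> \<otimes>\<^bsub>K S 1 U A\<^esub> \<kappa>) = ob1 S A U \<psi> \<otimes>\<^bsub>K S 2 U A\<^esub> ob1 S A U \<kappa>"
  by (rule ob1_mult_central[OF assms(1) A assms(2,3)]) (use val1_closed[OF assms(1) A assms(3)] A.m_comm in auto)

lemma ob1_one: "U \<in> covers S \<Longrightarrow> ob1 S A U \<one>\<^bsub>K S 1 U A\<^esub> = \<one>\<^bsub>K S 2 U A\<^esub>"
  using limsys.Z_one[OF TC1_limsys[OF A]] by (simp add: TC1coc_def)

lemma Hcoc2_restr:
  assumes U: "U \<in> covers S" "V \<in> covers S" and r: "refines V U r" and \<omega>: "\<omega> \<in> Hcoc S A 2 U"
  shows "restr S 2 V r \<omega> \<in> Hcoc S A 2 V"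
proof -
  note m = \<omega>[unfolded Hcoc2_iff[OF U(1)]]
  show ?thesis unfolding Hcoc2_iff[OF U(2)]
  proof (intro conjI allI impI)
    show "restr S 2 V r \<omega> \<in> Coch 2 V A" by (rule restr_closed[OF U LA r]) (use m in blast)
    fix a b c d g h k x assume s: "splx V [a,b,c,d] [g,h,k] x"
    note f = faces3[OF U(2) s]
    have l: "length [g,h] = 2" for g h :: 'g by simp
    have "splx U [r a, r b, r c, r d] [g,h,k] x" using splx_refine[OF r s] by simp
    then have "theta A g (val \<omega> [r b,r c,r d] [h,k] x) \<otimes> val \<omega> [r a,r b,r d] [g, h \<cdot> k] x =
       val \<omega> [r a,r c,r d] [g \<cdot> h, k] x \<otimes> val \<omega> [r a,r b,r c] [g,h] (act S k x)" using m by blast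
    then show "theta A g (val (restr S 2 V r \<omega>) [b,c,d] [h,k] x) \<otimes> val (restr S 2 V r \<omega>) [a,b,d] [g, h \<cdot> k] x =
       val (restr S 2 V r \<omega>) [a,c,d] [g \<cdot> h, k] x \<otimes> val (restr S 2 V r \<omega>) [a,b,c] [g,h] (act S k x)"
      by (simp add: val_restr[OF f(1) l] val_restr[OF f(2) l] val_restr[OF f(3) l] val_restr[OF f(4) l])
  qed
qed

text \<open>
  The prism on the triangles [r a, r b, r c] and [s a, s b, s c], with the neutral element of \<open>\<Gamma>\<close> on the
  edges from r to s, consists of three tetrahedra. The 1-cochain \<open>\<nu>\<close> takes the quotient of \<open>\<omega>\<close> on
  the two triangles of each of the lateral squares.
\<close>

lemma Hcoc2_homotopy:
  assumes U: "U \<in> covers S" "V \<in> covers S" and r: "refines V U r" "refines V U s" and \<omega>: "\<omega> \<in> Hcoc S A 2 U"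
  shows "(restr S 2 V s \<omega>, restr S 2 V r \<omega>) \<in> Hrel S A 2 V"
proof -
  note m = \<omega>[unfolded Hcoc2_iff[OF U(1)]]
  have mK: "\<omega> \<in> Coch 2 U A" using m by blast
  let ?e = "\<one>\<^bsub>Gam\<^esub>"
  define \<nu>1 where "\<nu>1 = (\<lambda>b\<in>multi_idx V 1. \<lambda>xp\<in>Uset S V 1 b. \<omega> (ix [r (b 0), s (b 0), s (b 1)]) (pt [?e, fst xp 1] (snd xp)))"
  define \<nu>2 where "\<nu>2 = (\<lambda>b\<in>multi_idx V 1. \<lambda>xp\<in>Uset S V 1 b. \<omega> (ix [r (b 0), r (b 1), s (b 1)]) (pt [fst xp 1, ?e] (snd xp)))"
  have l: "length [g,h] = 2" "length [g] = 1" for g h :: 'g by auto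
  have sp: "splx U [r a, s a, s b] [?e, g] x" "splx U [r a, r b, s b] [g, ?e] x" if "splx V [a,b] [g] x" for a b g x
  proof -
    have *: "a \<in> Idx V" "b \<in> Idx V" "g \<in> carrier Gam" "act S g x \<in> Mem V a" "x \<in> Mem V b" "x \<in> X"
      using that faces1[OF U(2) that] by (auto simp: splx1[OF U(2)])
    then show "splx U [r a, s a, s b] [?e, g] x" "splx U [r a, r b, s b] [g, ?e] x"
      using refinesD[OF r(1)] refinesD[OF r(2)] by (auto simp: splx2[OF U(1)])
  qed
  have ix1: "ix [a,b] 0 = a" "ix [a,b] 1 = b" for a b :: "'x set" by (simp_all add: ix_def)
  have pt1: "fst (pt [g] x) 1 = g" for g x by (simp add: pt_def)
  have G1: "smooth_map (Xp S 1) (mfd Gam) (\<lambda>_. ?e)" by (rule lie_const_smooth[OF Gam openin_topspace Gam.one_closed])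
  have G2: "smooth_map (Xp S 1) (mfd Gam) (\<lambda>xp. fst xp 1)" by (rule Xp_proj_smooth) simp
  have \<nu>1K: "\<nu>1 \<in> Coch 1 V A"
    unfolding \<nu>1_def
  proof (rule K_pullback[OF U LA mK])
    show "smooth_map (Xp S 1) (Xp S 2) (\<lambda>xp. pt [?e, fst xp 1] (snd xp))"
      using smooth_pt_map[of "[\<lambda>_. ?e, \<lambda>xp. fst xp 1]" 1] G1 G2 by (auto simp: numeral_2_eq_2)
    fix as gs x assume s0: "splx V as gs x" "length gs = 1"
    then obtain a b g where a: "as = [a,b]" "gs = [g]" by (rule splx_cases1)
    show "\<exists>as' gs' x'. length gs' = 2 \<and> splx U as' gs' x' \<and> ix [r (ix as 0), s (ix as 0), s (ix as 1)] = ix as' \<and>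
       pt [?e, fst (pt gs x) 1] (snd (pt gs x)) = pt gs' x'"
      unfolding a ix1 pt1 snd_pt using sp(1)[of a b g x] s0(1)[unfolded a] l(1) by blast
  qed
  have \<nu>2K: "\<nu>2 \<in> Coch 1 V A"
    unfolding \<nu>2_def
  proof (rule K_pullback[OF U LA mK])
    show "smooth_map (Xp S 1) (Xp S 2) (\<lambda>xp. pt [fst xp 1, ?e] (snd xp))"
      using smooth_pt_map[of "[\<lambda>xp. fst xp 1, \<lambda>_. ?e]" 1] G1 G2 by (auto simp: numeral_2_eq_2)
    fix as gs x assume s0: "splx V as gs x" "length gs = 1"
    then obtain a b g where a: "as = [a,b]" "gs = [g]" by (rule splx_cases1)
    show "\<exists>as' gs' x'. length gs' = 2 \<and> splx U as' gs' x' \<and> ix [r (ix as 0), r (ix as 1), s (ix as 1)] = ix as' \<and>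
       pt [fst (pt gs x) 1, ?e] (snd (pt gs x)) = pt gs' x'"
      unfolding a ix1 pt1 snd_pt using sp(2)[of a b g x] s0(1)[unfolded a] l(1) by blast
  qed
  have v1: "val \<nu>1 [a,b] [g] x = val \<omega> [r a, s a, s b] [?e, g] x" if "splx V [a,b] [g] x" for a b g x
  proof -
    have "val \<nu>1 [a,b] [g] x = \<omega> (ix [r (ix [a,b] 0), s (ix [a,b] 0), s (ix [a,b] 1)]) (pt [?e, fst (pt [g] x) 1] (snd (pt [g] x)))"
      unfolding \<nu>1_def by (rule val_restrict[OF that l(2)])
    then show ?thesis unfolding ix1 snd_pt pt1 val_def .
  qed
  have v2: "val \<nu>2 [a,b] [g] x = val \<omega> [r a, r b, s b] [g, ?e] x" if "splx V [a,b] [g] x" for a b g x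
  proof -
    have "val \<nu>2 [a,b] [g] x = \<omega> (ix [r (ix [a,b] 0), r (ix [a,b] 1), s (ix [a,b] 1)]) (pt [fst (pt [g] x) 1, ?e] (snd (pt [g] x)))"
      unfolding \<nu>2_def by (rule val_restrict[OF that l(2)])
    then show ?thesis unfolding ix1 snd_pt pt1 val_def .
  qed
  define \<nu> where "\<nu> = \<nu>1 \<otimes>\<^bsub>K S 1 V A\<^esub> inv\<^bsub>K S 1 V A\<^esub> \<nu>2"
  have \<nu>K: "\<nu> \<in> Coch 1 V A" unfolding \<nu>_def by (intro K_mult_closed[OF U(2) LA] K_inv_closed[OF U(2) LA] \<nu>1K \<nu>2K)
  have v: "val \<nu> [a,b] [g] x = val \<omega> [r a, s a, s b] [?e, g] x \<otimes> inv (val \<omega> [r a, r b, s b] [g, ?e] x)"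
    if "splx V [a,b] [g] x" for a b g x
    unfolding \<nu>_def val_mult[OF that l(2)] val_inv[OF U(2) LA \<nu>2K that l(2)] v1[OF that] v2[OF that] ..
  have rK: "restr S 2 V r \<omega> \<in> Coch 2 V A" "restr S 2 V s \<omega> \<in> Coch 2 V A"
    using restr_closed[OF U LA _ mK] r by blast+
  have "restr S 2 V s \<omega> = restr S 2 V r \<omega> \<otimes>\<^bsub>K S 2 V A\<^esub> ob1 S A V \<nu>"
  proof (rule K_ext2[OF rK(2) K_mult_closed[OF U(2) LA rK(1) ob1_closed[OF U(2) A \<nu>K]]])
    fix a b c g h x assume sx: "splx V [a,b,c] [g,h] x"
    note f = faces2[OF U(2) sx]
    interpret t: group_hom A A "theta A g" by (rule theta_hom[OF A f(4)])
    have *: "a \<in> Idx V" "b \<in> Idx V" "c \<in> Idx V" "act S g (act S h x) \<in> Mem V a" "act S h x \<in> Mem V b" "x \<in> Mem V c"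
      using sx by (auto simp: splx2[OF U(2)])
    have ss: "splx U [r a, s a, s b, s c] [?e, g, h] x" "splx U [r a, r b, s b, s c] [g, ?e, h] x" "splx U [r a, r b, r c, s c] [g, h, ?e] x"
      using * f(4-6) refinesD[OF r(1)] refinesD[OF r(2)] by (auto simp: splx3[OF U(1)])
    note lifts1 = faces3[OF U(1) ss(1)] and F2 = faces3[OF U(1) ss(2)] and F3 = faces3[OF U(1) ss(3)]
    have coc: "theta A g (val \<omega> [b,c,d] [h,k] x) \<otimes> val \<omega> [a,b,d] [g, h \<cdot> k] x =
       val \<omega> [a,c,d] [g \<cdot> h, k] x \<otimes> val \<omega> [a,b,c] [g,h] (act S k x)" if "splx U [a,b,c,d] [g,h,k] x" for a b c d g h k x
      using m that by blast
    note cl = val2_closed[OF U(1) A mK]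
    have e: "?e \<cdot> g = g" "g \<cdot> ?e = g" "?e \<cdot> h = h" "h \<cdot> ?e = h" "act S ?e x = x" using f(4-6) by auto
    have te: "theta A ?e (val \<omega> [s a, s b, s c] [g, h] x) = val \<omega> [s a, s b, s c] [g, h] x"
      by (rule theta_one[OF A cl[OF lifts1(1)]])
    note c1 = coc[OF ss(1), unfolded te e] and c2 = coc[OF ss(2), unfolded e] and c3 = coc[OF ss(3), unfolded e]
    have vv: "val \<nu> [b,c] [h] x \<in> carrier A" by (rule val1_closed[OF U(2) A \<nu>K f(1)])
    have tv: "theta A g (val \<nu> [b,c] [h] x) = theta A g (val \<omega> [r b, s b, s c] [?e, h] x) \<otimes> inv (theta A g (val \<omega> [r b, r c, s c] [h, ?e] x))"
      unfolding v[OF f(1)] using cl[OF F2(1)] cl[OF F3(1)] by simp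
    show "val (restr S 2 V s \<omega>) [a,b,c] [g,h] x = val (restr S 2 V r \<omega> \<otimes>\<^bsub>K S 2 V A\<^esub> ob1 S A V \<nu>) [a,b,c] [g,h] x"
      unfolding val_mult[OF sx l(1)] val_ob1[OF U(2) A \<nu>K sx] tv v[OF f(2)] v[OF f(3)] val_restr[OF sx l(1)] list.map
      by (rule A.homotopy_identity[where u="val \<omega> [r a, s b, s c] [g, h] x" and v="val \<omega> [r a, r b, s c] [g, h] x"])
        (use c1 c2 c3 cl lifts1 F2 F3 theta_closed[OF A f(4)] e in \<open>auto simp: A.m_comm\<close>)
  qed
  then show ?thesis unfolding Hrel2_iff[OF U(2)] using Hcoc2_restr[OF U _ \<omega>] r \<nu>K by blast
qed

lemma H2_limsys: "limsys S A 2 (Hcoc S A 2) (Hrel S A 2)"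
proof unfold_locales
  fix U assume U: "U \<in> covers S"
  interpret K1: comm_group "K S 1 U A" by (rule K_comm[OF U])
  interpret K2: comm_group "K S 2 U A" by (rule K_comm[OF U])
  note riff = Hrel2_iff[OF U]
  show Zc: "\<phi> \<in> Hcoc S A 2 U \<Longrightarrow> \<phi> \<in> Coch 2 U A" for \<phi> by (simp add: Hcoc_def)
  have ob: "\<nu> \<in> Coch 1 U A \<Longrightarrow> ob1 S A U \<nu> \<in> Coch 2 U A" for \<nu> by (rule ob1_closed[OF U A])
  show "\<one>\<^bsub>K S 2 U A\<^esub> \<in> Hcoc S A 2 U"
    unfolding Hcoc2_iff[OF U]
  proof (intro conjI allI impI)
    fix a b c d g h k x assume "splx U [a,b,c,d] [g,h,k] x"
    note f = faces3[OF U this]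
    have l: "length [g,h] = 2" for g h :: 'g by simp
    show "theta A g (val \<one>\<^bsub>K S 2 U A\<^esub> [b,c,d] [h,k] x) \<otimes> val \<one>\<^bsub>K S 2 U A\<^esub> [a,b,d] [g, h \<cdot> k] x =
       val \<one>\<^bsub>K S 2 U A\<^esub> [a,c,d] [g \<cdot> h, k] x \<otimes> val \<one>\<^bsub>K S 2 U A\<^esub> [a,b,c] [g,h] (act S k x)"
      using group_hom.hom_one[OF theta_hom[OF A f(5)]]
      by (simp add: val_one[OF f(1) l] val_one[OF f(2) l] val_one[OF f(3) l] val_one[OF f(4) l])
  qed (rule K_one_closed[OF U LA])
  show "(\<phi>, \<phi>) \<in> Hrel S A 2 U" if "\<phi> \<in> Hcoc S A 2 U" for \<phi>
    unfolding riff using that Zc[OF that] ob1_one[OF U] K1.one_closed by (metis K2.r_one)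
  show "(\<psi>, \<phi>) \<in> Hrel S A 2 U" if R: "(\<phi>, \<psi>) \<in> Hrel S A 2 U" for \<phi> \<psi>
  proof -
    obtain \<nu> where n: "\<phi> \<in> Hcoc S A 2 U" "\<psi> \<in> Hcoc S A 2 U" "\<nu> \<in> Coch 1 U A" "\<phi> = \<psi> \<otimes>\<^bsub>K S 2 U A\<^esub> ob1 S A U \<nu>"
      using R unfolding riff by blast
    have "ob1 S A U \<nu> \<otimes>\<^bsub>K S 2 U A\<^esub> ob1 S A U (inv\<^bsub>K S 1 U A\<^esub> \<nu>) = \<one>\<^bsub>K S 2 U A\<^esub>"
      using ob1_mult_abelian[OF U n(3) K1.inv_closed[OF n(3)]] unfolding K1.r_inv[OF n(3)] ob1_one[OF U] by (rule sym)
    then have "\<psi> = \<phi> \<otimes>\<^bsub>K S 2 U A\<^esub> ob1 S A U (inv\<^bsub>K S 1 U A\<^esub> \<nu>)"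
      unfolding n(4) K2.m_assoc[OF Zc[OF n(2)] ob[OF n(3)] ob[OF K1.inv_closed[OF n(3)]]] using Zc[OF n(2)] by simp
    then show ?thesis unfolding riff using n K1.inv_closed by blast
  qed
  show "(\<phi>, \<zeta>) \<in> Hrel S A 2 U" if R: "(\<phi>, \<psi>) \<in> Hrel S A 2 U" "(\<psi>, \<zeta>) \<in> Hrel S A 2 U" for \<phi> \<psi> \<zeta>
  proof -
    obtain \<nu> where n: "\<phi> \<in> Hcoc S A 2 U" "\<psi> \<in> Hcoc S A 2 U" "\<nu> \<in> Coch 1 U A" "\<phi> = \<psi> \<otimes>\<^bsub>K S 2 U A\<^esub> ob1 S A U \<nu>"
      using R(1) unfolding riff by blast
    obtain \<kappa> where k: "\<zeta> \<in> Hcoc S A 2 U" "\<kappa> \<in> Coch 1 U A" "\<psi> = \<zeta> \<otimes>\<^bsub>K S 2 U A\<^esub> ob1 S A U \<kappa>"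
      using R(2) unfolding riff by blast
    have "\<phi> = \<zeta> \<otimes>\<^bsub>K S 2 U A\<^esub> ob1 S A U (\<kappa> \<otimes>\<^bsub>K S 1 U A\<^esub> \<nu>)"
      unfolding n(4) k(3) ob1_mult_abelian[OF U k(2) n(3)] by (rule K2.m_assoc[OF Zc[OF k(1)] ob[OF k(2)] ob[OF n(3)]])
    then show ?thesis unfolding riff using n k K1.m_closed by blast
  qed
  fix V assume V: "V \<in> covers S"
  show Zr: "restr S 2 V r \<phi> \<in> Hcoc S A 2 V" if "refines V U r" "\<phi> \<in> Hcoc S A 2 U" for r \<phi>
    by (rule Hcoc2_restr[OF U V that])
  show "(restr S 2 V r \<phi>, restr S 2 V s \<phi>) \<in> Hrel S A 2 V" if "refines V U r" "refines V U s" "\<phi> \<in> Hcoc S A 2 U" for r s \<phi>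
    by (rule Hcoc2_homotopy[OF U V that(2,1,3)])
  show "(restr S 2 V r \<phi>, restr S 2 V r \<psi>) \<in> Hrel S A 2 V" if r: "refines V U r" and R: "(\<phi>, \<psi>) \<in> Hrel S A 2 U" for r \<phi> \<psi>
  proof -
    obtain \<nu> where n: "\<phi> \<in> Hcoc S A 2 U" "\<psi> \<in> Hcoc S A 2 U" "\<nu> \<in> Coch 1 U A" "\<phi> = \<psi> \<otimes>\<^bsub>K S 2 U A\<^esub> ob1 S A U \<nu>"
      using R unfolding riff by blast
    have "restr S 2 V r \<phi> = restr S 2 V r \<psi> \<otimes>\<^bsub>K S 2 V A\<^esub> ob1 S A V (restr S 1 V r \<nu>)"
      unfolding n(4) restr_mult[OF U V LA r Zc[OF n(2)] ob[OF n(3)]] restr_ob1[OF U V A r n(3)] ..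
    then show ?thesis unfolding Hrel2_iff[OF V] using Zr[OF r] n(1,2) restr_closed[OF U V LA r n(3)] by blast
  qed
qed (use A in auto)

end

end

section \<open>Coboundaries with central values\<close>

(* the degree 1 of cochain groups stays a numeral *)
declare One_nat_def [simp del]

text \<open>
  The values of a 1-cochain on the edges of a tetrahedron multiply to the same element along two ways
  of filling it by triangles. The elements w and t are the defects on the four faces.
\<close>

lemma (in group) central_cocycle:
  assumes G: "pab \<in> carrier G" "qbc \<in> carrier G" "r \<in> carrier G" "pac \<in> carrier G" "qbd \<in> carrier G" "pad \<in> carrier G"
      "t \<in> carrier G" "w1 \<in> carrier G" "w3 \<in> carrier G" "w4 \<in> carrier G"
    and w1: "inv pac \<otimes> pab \<otimes> qbc = w1" and t: "inv qbd \<otimes> qbc \<otimes> r = t"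
    and w3: "inv pad \<otimes> pac \<otimes> r = w3" and w4: "inv pad \<otimes> pab \<otimes> qbd = w4"
    and c1: "w1 \<otimes> r = r \<otimes> w1" and c4: "t \<otimes> w4 = w4 \<otimes> t"
  shows "t \<otimes> w4 = w3 \<otimes> w1"
proof -
  have e1: "pab \<otimes> qbc = pac \<otimes> w1" unfolding w1[symmetric] using G(1-6) by (simp add: m_assoc)
  have e3: "pac \<otimes> r = pad \<otimes> w3" unfolding w3[symmetric] using G(1-6) by (simp add: m_assoc)
  have "t \<otimes> w4 = w4 \<otimes> t" by (rule c4)
  also have "\<dots> = inv pad \<otimes> ((pab \<otimes> qbc) \<otimes> r)" unfolding w4[symmetric] t[symmetric] using G(1-6) by (simp add: m_assoc)
  also have "\<dots> = inv pad \<otimes> (pac \<otimes> (r \<otimes> w1))" unfolding e1 c1[symmetric] using G by (simp add: m_assoc)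
  also have "\<dots> = inv pad \<otimes> ((pac \<otimes> r) \<otimes> w1)" using G by (simp add: m_assoc)
  also have "\<dots> = w3 \<otimes> w1" unfolding e3 using G by (simp add: m_assoc)
  finally show ?thesis .
qed

context gspace
begin

lemma post_group_hom:
  assumes U: "U \<in> covers S" and G: "gamma_group Gam G" and G': "gamma_group Gam G'" and f: "f \<in> gamma_hom Gam G G'"
  shows "group_hom (K S p U G) (K S p U G') (post S p U f)"
proof -
  interpret f: group_hom G G' f
    using gamma_groupD(3)[OF G] gamma_groupD(3)[OF G'] gamma_homD(1)[OF f] by (simp add: group_hom_def group_hom_axioms_def)
  note LG = gamma_groupD(1)[OF G] and LG' = gamma_groupD(1)[OF G'] and pc = post_hom_closed[OF U G G' f]
  have "post S p U f \<in> hom (K S p U G) (K S p U G')"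
  proof (rule homI)
    fix x y assume xy: "x \<in> Coch p U G" "y \<in> Coch p U G"
    show "post S p U f (x \<otimes>\<^bsub>K S p U G\<^esub> y) = post S p U f x \<otimes>\<^bsub>K S p U G'\<^esub> post S p U f y"
    proof (rule K_ext[OF pc[OF K_mult_closed[OF U LG xy]] K_mult_closed[OF U LG' pc[OF xy(1)] pc[OF xy(2)]]])
      fix as gs z assume s: "splx U as gs z" "length gs = p"
      show "val (post S p U f (x \<otimes>\<^bsub>K S p U G\<^esub> y)) as gs z = val (post S p U f x \<otimes>\<^bsub>K S p U G'\<^esub> post S p U f y) as gs z"
        unfolding val_post[OF s] val_mult[OF s] by (rule f.hom_mult[OF val_closed[OF xy(1) s U LG] val_closed[OF xy(2) s U LG]])
    qed
  qed (rule pc)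
  then show ?thesis using K_group(1)[OF U LG] K_group(1)[OF U LG'] by (simp add: group_hom_def group_hom_axioms_def)
qed

lemma ob0_mult_central:
  fixes G :: "('g, 'a) ggroup" (structure)
  assumes U: "U \<in> covers S" and G: "gamma_group Gam G" and \<psi>: "\<psi> \<in> Coch 0 U G" and \<kappa>: "\<kappa> \<in> Coch 0 U G"
    and central: "\<And>a x y. splx U [a] [] x \<Longrightarrow> y \<in> carrier G \<Longrightarrow> val \<kappa> [a] [] x \<otimes> y = y \<otimes> val \<kappa> [a] [] x"
  shows "ob0 S G U (\<psi> \<otimes>\<^bsub>K S 0 U G\<^esub> \<kappa>) = ob0 S G U \<psi> \<otimes>\<^bsub>K S 1 U G\<^esub> ob0 S G U \<kappa>"
proof -
  interpret G: group G using gamma_groupD(3)[OF G] .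
  note LG = gamma_groupD(1)[OF G]
  have pk: "\<psi> \<otimes>\<^bsub>K S 0 U G\<^esub> \<kappa> \<in> Coch 0 U G" by (rule K_mult_closed[OF U LG \<psi> \<kappa>])
  show ?thesis
  proof (rule K_ext1[OF ob0_closed[OF U G pk] K_mult_closed[OF U LG ob0_closed[OF U G \<psi>] ob0_closed[OF U G \<kappa>]]])
    fix a b g x assume s: "splx U [a,b] [g] x"
    note f = faces1[OF U s]
    interpret t: group_hom G G "theta G g" by (rule theta_hom[OF G f(3)])
    have l: "length [g] = 1" "length ([] :: 'g list) = 0" by auto
    note cl = val0_closed[OF U G \<psi>] val0_closed[OF U G \<kappa>]
    note v = val_mult[OF f(1) l(2)] val_mult[OF f(2) l(2)]
    have "inv (val \<psi> [a] [] (act S g x) \<otimes> val \<kappa> [a] [] (act S g x)) \<otimes> (\<one> \<otimes> \<one>) \<otimes>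
        (theta G g (val \<psi> [b] [] x) \<otimes> theta G g (val \<kappa> [b] [] x))
      = (inv (val \<psi> [a] [] (act S g x)) \<otimes> \<one> \<otimes> theta G g (val \<psi> [b] [] x)) \<otimes>
        (inv (val \<kappa> [a] [] (act S g x)) \<otimes> \<one> \<otimes> theta G g (val \<kappa> [b] [] x))"
      by (rule G.central_ob1) (use cl f central in auto)
    then show "val (ob0 S G U (\<psi> \<otimes>\<^bsub>K S 0 U G\<^esub> \<kappa>)) [a,b] [g] x = val (ob0 S G U \<psi> \<otimes>\<^bsub>K S 1 U G\<^esub> ob0 S G U \<kappa>) [a,b] [g] x"
      unfolding val_mult[OF s l(1)] val_ob0[OF U G pk s] val_ob0[OF U G \<psi> s] val_ob0[OF U G \<kappa> s] v
        t.hom_mult[OF cl(1)[OF f(1)] cl(2)[OF f(1)]]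
      using cl[OF f(2)] by simp
  qed
qed

text \<open>
  Centrality of the values is what allows the defects of the four faces to be moved past the edges.
\<close>

lemma ob1_cocycle:
  fixes G :: "('g, 'a) ggroup" (structure)
  assumes U: "U \<in> covers S" and G: "gamma_group Gam G" and \<psi>: "\<psi> \<in> Coch 1 U G"
    and central: "\<And>a b c g h x y. splx U [a,b,c] [g,h] x \<Longrightarrow> y \<in> carrier G \<Longrightarrow>
      val (ob1 S G U \<psi>) [a,b,c] [g,h] x \<otimes> y = y \<otimes> val (ob1 S G U \<psi>) [a,b,c] [g,h] x"
    and s: "splx U [a,b,c,d] [g,h,k] x"
  shows "theta G g (val (ob1 S G U \<psi>) [b,c,d] [h,k] x) \<otimes> val (ob1 S G U \<psi>) [a,b,d] [g, h \<cdot> k] x =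
       val (ob1 S G U \<psi>) [a,c,d] [g \<cdot> h, k] x \<otimes> val (ob1 S G U \<psi>) [a,b,c] [g,h] (act S k x)"
proof -
  interpret G: group G using gamma_groupD(3)[OF G] .
  note f = faces3[OF U s]
  interpret t: group_hom G G "theta G g" by (rule theta_hom[OF G f(5)])
  note e1 = faces2[OF U f(1)] and e2 = faces2[OF U f(2)] and e3 = faces2[OF U f(3)] and e4 = faces2[OF U f(4)]
  note v = val_ob1[OF U G \<psi>] and c1 = val1_closed[OF U G \<psi>] and c2 = val2_closed[OF U G ob1_closed[OF U G \<psi>]]
  have tt: "theta G (g \<cdot> h) (val \<psi> [c,d] [k] x) = theta G g (theta G h (val \<psi> [c,d] [k] x))"
    by (rule theta_mult[OF G f(5,6) c1[OF e1(1)]])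
  have tc: "theta G h (val \<psi> [c,d] [k] x) \<in> carrier G" by (rule theta_closed[OF G f(6) c1[OF e1(1)]])
  have as: "g \<cdot> (h \<cdot> k) = g \<cdot> h \<cdot> k" using f(5-7) by (simp add: Gam.m_assoc)
  have am: "act S (h \<cdot> k) x = act S h (act S k x)" by (rule act_mult[OF f(6,7,8)])
  show ?thesis
  proof (rule G.central_cocycle)
    show "inv (val \<psi> [a,c] [g \<cdot> h] (act S k x)) \<otimes> val \<psi> [a,b] [g] (act S h (act S k x)) \<otimes> theta G g (val \<psi> [b,c] [h] (act S k x))
      = val (ob1 S G U \<psi>) [a,b,c] [g,h] (act S k x)" unfolding v[OF f(4)] ..
    show "inv (theta G g (val \<psi> [b,d] [h \<cdot> k] x)) \<otimes> theta G g (val \<psi> [b,c] [h] (act S k x)) \<otimes> theta G (g \<cdot> h) (val \<psi> [c,d] [k] x)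
      = theta G g (val (ob1 S G U \<psi>) [b,c,d] [h,k] x)"
      unfolding v[OF f(1)] tt using c1[OF e1(1)] c1[OF e1(2)] c1[OF e1(3)] tc by simp
    show "inv (val \<psi> [a,d] [g \<cdot> h \<cdot> k] x) \<otimes> val \<psi> [a,c] [g \<cdot> h] (act S k x) \<otimes> theta G (g \<cdot> h) (val \<psi> [c,d] [k] x)
      = val (ob1 S G U \<psi>) [a,c,d] [g \<cdot> h, k] x" unfolding v[OF f(2)] ..
    show "inv (val \<psi> [a,d] [g \<cdot> h \<cdot> k] x) \<otimes> val \<psi> [a,b] [g] (act S h (act S k x)) \<otimes> theta G g (val \<psi> [b,d] [h \<cdot> k] x)
      = val (ob1 S G U \<psi>) [a,b,d] [g, h \<cdot> k] x" unfolding v[OF f(3)] as am ..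
    have tgc: "theta G (g \<cdot> h) (val \<psi> [c,d] [k] x) \<in> carrier G" unfolding tt using tc by simp
    show "val (ob1 S G U \<psi>) [a,b,c] [g,h] (act S k x) \<otimes> theta G (g \<cdot> h) (val \<psi> [c,d] [k] x)
       = theta G (g \<cdot> h) (val \<psi> [c,d] [k] x) \<otimes> val (ob1 S G U \<psi>) [a,b,c] [g,h] (act S k x)"
      by (rule central[OF f(4) tgc])
    have tw: "theta G g (val (ob1 S G U \<psi>) [b,c,d] [h,k] x) \<in> carrier G" by (rule t.hom_closed[OF c2[OF f(1)]])
    show "theta G g (val (ob1 S G U \<psi>) [b,c,d] [h,k] x) \<otimes> val (ob1 S G U \<psi>) [a,b,d] [g, h \<cdot> k] x
      = val (ob1 S G U \<psi>) [a,b,d] [g, h \<cdot> k] x \<otimes> theta G g (val (ob1 S G U \<psi>) [b,c,d] [h,k] x)"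
      by (rule central[OF f(3) tw, symmetric])
    show "val \<psi> [a,b] [g] (act S h (act S k x)) \<in> carrier G" by (rule c1[OF e4(3)])
    show "theta G g (val \<psi> [b,c] [h] (act S k x)) \<in> carrier G" by (rule t.hom_closed[OF c1[OF e4(1)]])
    show "theta G (g \<cdot> h) (val \<psi> [c,d] [k] x) \<in> carrier G" by (rule tgc)
    show "val \<psi> [a,c] [g \<cdot> h] (act S k x) \<in> carrier G" by (rule c1[OF e4(2)])
    show "theta G g (val \<psi> [b,d] [h \<cdot> k] x) \<in> carrier G" by (rule t.hom_closed[OF c1[OF e1(2)]])
    show "val \<psi> [a,d] [g \<cdot> h \<cdot> k] x \<in> carrier G" by (rule c1[OF e2(2)])
    show "theta G g (val (ob1 S G U \<psi>) [b,c,d] [h,k] x) \<in> carrier G" by (rule tw)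
  qed (rule c2[OF f(4)], rule c2[OF f(2)], rule c2[OF f(3)])
qed

lemma restr_ob0:
  assumes U: "U \<in> covers S" "V \<in> covers S" and G: "gamma_group Gam G" and r: "refines V U r" and \<nu>: "\<nu> \<in> Coch 0 U G"
  shows "restr S 1 V r (ob0 S G U \<nu>) = ob0 S G V (restr S 0 V r \<nu>)"
proof -
  note LG = gamma_groupD(1)[OF G]
  note \<nu>V = restr_closed[OF U LG r \<nu>]
  show ?thesis
  proof (rule K_ext1[OF restr_closed[OF U LG r ob0_closed[OF U(1) G \<nu>]] ob0_closed[OF U(2) G \<nu>V]])
    fix a b g x assume s: "splx V [a,b] [g] x"
    note f = faces1[OF U(2) s]
    have l: "length [g] = 1" "length ([] :: 'g list) = 0" by auto
    have s': "splx U [r a, r b] [g] x" using splx_refine[OF r s] by simp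
    show "val (restr S 1 V r (ob0 S G U \<nu>)) [a,b] [g] x = val (ob0 S G V (restr S 0 V r \<nu>)) [a,b] [g] x"
      unfolding val_restr[OF s l(1)] val_ob0[OF U(2) G \<nu>V s] val_restr[OF f(1) l(2)] val_restr[OF f(2) l(2)]
      using val_ob0[OF U(1) G \<nu> s'] by simp
  qed
qed

lemma restr_gauge:
  assumes U: "U \<in> covers S" "V \<in> covers S" and G: "gamma_group Gam G" and r: "refines V U r"
    and \<eta>: "\<eta> \<in> Coch 0 U G" and \<psi>: "\<psi> \<in> Coch 1 U G"
  shows "restr S 1 V r (gauge U G \<eta> \<psi>) = gauge V G (restr S 0 V r \<eta>) (restr S 1 V r \<psi>)"
proof -
  note LG = gamma_groupD(1)[OF G]
  note \<eta>V = restr_closed[OF U LG r \<eta>] and \<psi>V = restr_closed[OF U LG r \<psi>]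
  show ?thesis
  proof (rule K_ext1[OF restr_closed[OF U LG r gauge_closed[OF U(1) G \<eta> \<psi>]] gauge_closed[OF U(2) G \<eta>V \<psi>V]])
    fix a b g x assume s: "splx V [a,b] [g] x"
    note f = faces1[OF U(2) s]
    have l: "length [g] = 1" "length ([] :: 'g list) = 0" by auto
    have s': "splx U [r a, r b] [g] x" using splx_refine[OF r s] by simp
    show "val (restr S 1 V r (gauge U G \<eta> \<psi>)) [a,b] [g] x = val (gauge V G (restr S 0 V r \<eta>) (restr S 1 V r \<psi>)) [a,b] [g] x"
      unfolding val_restr[OF s l(1)] val_gauge[OF U(2) G \<eta>V s] val_restr[OF f(1) l(2)] val_restr[OF f(2) l(2)]
      using val_gauge[OF U(1) G \<eta> s'] by simp
  qed
qed

lemma post_gauge: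
  assumes U: "U \<in> covers S" and G: "gamma_group Gam G" and G': "gamma_group Gam G'" and f: "f \<in> gamma_hom Gam G G'"
    and \<eta>: "\<eta> \<in> Coch 0 U G" and \<psi>: "\<psi> \<in> Coch 1 U G"
  shows "post S 1 U f (gauge U G \<eta> \<psi>) = gauge U G' (post S 0 U f \<eta>) (post S 1 U f \<psi>)"
proof -
  interpret f: group_hom G G' f
    using gamma_groupD(3)[OF G] gamma_groupD(3)[OF G'] gamma_homD(1)[OF f] by (simp add: group_hom_def group_hom_axioms_def)
  note pc = post_hom_closed[OF U G G' f]
  show ?thesis
  proof (rule K_ext1[OF pc[OF gauge_closed[OF U G \<eta> \<psi>]] gauge_closed[OF U G' pc[OF \<eta>] pc[OF \<psi>]]])
    fix a b g x assume s: "splx U [a,b] [g] x"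
    note fc = faces1[OF U s]
    have l: "length [g] = 1" "length ([] :: 'g list) = 0" by auto
    have "val \<eta> [a] [] (act S g x) \<in> carrier G" "val \<eta> [b] [] x \<in> carrier G" "val \<psi> [a,b] [g] x \<in> carrier G"
      "theta G g (val \<eta> [b] [] x) \<in> carrier G"
      using val0_closed[OF U G \<eta>] val1_closed[OF U G \<psi> s] fc theta_closed[OF G fc(3)] by auto
    then show "val (post S 1 U f (gauge U G \<eta> \<psi>)) [a,b] [g] x = val (gauge U G' (post S 0 U f \<eta>) (post S 1 U f \<psi>)) [a,b] [g] x"
      unfolding val_post[OF s l(1)] val_gauge[OF U G \<eta> s] val_gauge[OF U G' pc[OF \<eta>] s] val_post[OF fc(1) l(2)] val_post[OF fc(2) l(2)]
      by (simp add: gamma_homD(3)[OF f fc(3)])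
  qed
qed

lemma TC1rel_gauge:
  assumes U: "U \<in> covers S" and G: "gamma_group Gam G"
  shows "(\<phi>, \<phi>') \<in> TC1rel S G U \<longleftrightarrow> \<phi> \<in> TC1coc S G U \<and> \<phi>' \<in> TC1coc S G U \<and> (\<exists>\<mu>\<in>Coch 0 U G. \<phi>' = gauge U G \<mu> \<phi>)"
proof -
  interpret K: group "K S 1 U G" by (rule K_group(1)[OF U gamma_groupD(1)[OF G]])
  have eq: "delta S 0 U G 1 \<mu> \<otimes>\<^bsub>K S 1 U G\<^esub> \<phi> = \<phi>' \<otimes>\<^bsub>K S 1 U G\<^esub> delta S 0 U G 0 \<mu> \<longleftrightarrow> \<phi>' = gauge U G \<mu> \<phi>"
    if c: "\<phi> \<in> Coch 1 U G" "\<phi>' \<in> Coch 1 U G" "\<mu> \<in> Coch 0 U G" for \<phi> \<phi>' \<mu>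
  proof -
    have d: "delta S 0 U G 1 \<mu> \<in> Coch 1 U G" "delta S 0 U G 0 \<mu> \<in> Coch 1 U G"
      by (rule delta0_closed[OF U G order_refl c(3)], rule delta0_closed[OF U G zero_le c(3)])
    show ?thesis unfolding gauge_def[OF U G] using K.inv_solve_right[OF c(2) K.m_closed[OF d(1) c(1)] d(2)] by blast
  qed
  have Zc: "\<phi> \<in> TC1coc S G U \<Longrightarrow> \<phi> \<in> Coch 1 U G" for \<phi> by (simp add: TC1coc_def)
  show ?thesis
    unfolding TC1rel_def mem_Collect_eq case_prod_conv by (intro conj_cong bex_cong refl eq Zc)
qed

end

section \<open>Cochains of a central extension\<close>

locale central_ext = gspace S for S :: "('g, 'x) gspace" +
  fixes A :: "('g, 'a) ggroup" and B :: "('g, 'b) ggroup" and C :: "('g, 'c) ggroup"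
    and \<alpha> :: "'a \<Rightarrow> 'b" and \<beta> :: "'b \<Rightarrow> 'c"
  assumes exact: "gamma_short_exact (Grp S) A B C \<alpha> \<beta>"
    and central: "\<forall>a\<in>carrier A. \<forall>b\<in>carrier B. \<alpha> a \<otimes>\<^bsub>B\<^esub> b = b \<otimes>\<^bsub>B\<^esub> \<alpha> a"
begin

lemma gg: "gamma_group Gam A" "gamma_group Gam B" "gamma_group Gam C"
  and gh: "\<alpha> \<in> gamma_hom Gam A B" "\<beta> \<in> gamma_hom Gam B C"
  and inj: "inj_on \<alpha> (carrier A)" and ker: "\<alpha> ` carrier A = kernel B C \<beta>" and surj: "\<beta> ` carrier B = carrier C"
  using exact by (auto simp: gamma_short_exact_def)

lemmas lg = gg[THEN gamma_groupD(1)]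

lemma group_A: "group A" and group_B: "group B" and group_C: "group C"
  using gg gamma_groupD(3) by auto

lemma hom_\<alpha>: "group_hom A B \<alpha>" and hom_\<beta>: "group_hom B C \<beta>"
  using group_A group_B group_C gamma_homD(1)[OF gh(1)] gamma_homD(1)[OF gh(2)] by (simp_all add: group_hom_def group_hom_axioms_def)

lemma \<beta>\<alpha>: "a \<in> carrier A \<Longrightarrow> \<beta> (\<alpha> a) = \<one>\<^bsub>C\<^esub>"
  using ker by (auto simp: kernel_def)

text \<open>
  \<open>\<alpha>\<close> embeds A in the centre of B.
\<close>

lemma comm_A: "comm_group A"
proof (rule group.group_comm_groupI[OF group_A])
  interpret A: group A by (rule group_A)
  interpret h: group_hom A B \<alpha> by (rule hom_\<alpha>)
  fix x y assume xy: "x \<in> carrier A" "y \<in> carrier A"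
  have "\<alpha> x \<otimes>\<^bsub>B\<^esub> \<alpha> y = \<alpha> y \<otimes>\<^bsub>B\<^esub> \<alpha> x" using central xy(1) h.hom_closed[OF xy(2)] by blast
  then have "\<alpha> (x \<otimes>\<^bsub>A\<^esub> y) = \<alpha> (y \<otimes>\<^bsub>A\<^esub> x)" unfolding h.hom_mult[OF xy] h.hom_mult[OF xy(2,1)] .
  then show "x \<otimes>\<^bsub>A\<^esub> y = y \<otimes>\<^bsub>A\<^esub> x" by (rule inj_onD[OF inj _ A.m_closed[OF xy] A.m_closed[OF xy(2,1)]])
qed

lemma closed_image: "closedin (mtop (mfd B)) (\<alpha> ` carrier A)"
proof -
  have top: "topspace (mtop (mfd B)) = carrier B" "topspace (mtop (mfd C)) = carrier C" using lie_groupD(5) lg by auto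
  have "closedin (mtop (mfd C)) {\<one>\<^bsub>C\<^esub>}"
    by (rule closedin_Hausdorff_singleton[OF smooth_manifoldD(3)[OF lie_groupD(2)[OF lg(3)]]])
      (use group.is_monoid[OF group_C] top in \<open>simp add: monoid.one_closed\<close>)
  then have "closedin (mtop (mfd B)) {b \<in> topspace (mtop (mfd B)). \<beta> b \<in> {\<one>\<^bsub>C\<^esub>}}"
    by (rule closedin_continuous_map_preimage[OF smooth_map_continuous[OF gamma_homD(2)[OF gh(2)]]])
  then show ?thesis by (simp add: ker kernel_def top)
qed

abbreviation "corestr p U \<equiv> post S p U (inv_into (carrier A) \<alpha>)"

context
  fixes U :: "'x cover"
  assumes U: "U \<in> covers S"
begin

lemma hom_post_\<alpha>: "group_hom (K S p U A) (K S p U B) (post S p U \<alpha>)"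
  and hom_post_\<beta>: "group_hom (K S p U B) (K S p U C) (post S p U \<beta>)"
  by (rule post_group_hom[OF U gg(1,2) gh(1)], rule post_group_hom[OF U gg(2,3) gh(2)])

lemma post_\<alpha>_inj:
  assumes c: "\<phi> \<in> Coch p U A" "\<phi>' \<in> Coch p U A" and eq: "post S p U \<alpha> \<phi> = post S p U \<alpha> \<phi>'"
  shows "\<phi> = \<phi>'"
proof (rule K_ext[OF c])
  fix as gs z assume s: "splx U as gs z" "length gs = p"
  have v: "val (post S p U \<alpha> \<phi>) as gs z = \<alpha> (val \<phi> as gs z)" for \<phi> by (rule val_post[OF s])
  have "\<alpha> (val \<phi> as gs z) = \<alpha> (val \<phi>' as gs z)" using arg_cong[OF eq, of "\<lambda>\<phi>. val \<phi> as gs z"] unfolding v .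
  then show "val \<phi> as gs z = val \<phi>' as gs z"
    by (rule inj_onD[OF inj _ val_closed[OF c(1) s U lg(1)] val_closed[OF c(2) s U lg(1)]])
qed

lemma post_\<beta>\<alpha>:
  assumes c: "\<phi> \<in> Coch p U A"
  shows "post S p U \<beta> (post S p U \<alpha> \<phi>) = \<one>\<^bsub>K S p U C\<^esub>"
proof (rule K_ext[OF post_hom_closed[OF U gg(2,3) gh(2) post_hom_closed[OF U gg(1,2) gh(1) c]] K_one_closed[OF U lg(3)]])
  fix as gs z assume s: "splx U as gs z" "length gs = p"
  show "val (post S p U \<beta> (post S p U \<alpha> \<phi>)) as gs z = val \<one>\<^bsub>K S p U C\<^esub> as gs z"
    unfolding val_post[OF s] val_one[OF s] by (rule \<beta>\<alpha>[OF val_closed[OF c s U lg(1)]])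
qed

text \<open>
  Exactness of the cochain groups at \<open>K\<^sup>p(B)\<close>.
\<close>

lemma corestrict:
  assumes c: "\<phi> \<in> Coch p U B" and 1: "post S p U \<beta> \<phi> = \<one>\<^bsub>K S p U C\<^esub>"
  shows "corestr p U \<phi> \<in> Coch p U A" "post S p U \<alpha> (corestr p U \<phi>) = \<phi>"
proof -
  have mem: "val \<phi> as gs z \<in> \<alpha> ` carrier A" if s: "splx U as gs z" "length gs = p" for as gs z
  proof -
    have "val (post S p U \<beta> \<phi>) as gs z = \<beta> (val \<phi> as gs z)" by (rule val_post[OF s])
    then have "\<beta> (val \<phi> as gs z) = \<one>\<^bsub>C\<^esub>" unfolding 1 val_one[OF s] by (rule sym)
    then show ?thesis using val_closed[OF c s U lg(2)] unfolding ker kernel_def by simp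
  qed
  show *: "corestr p U \<phi> \<in> Coch p U A"
    unfolding post_def
  proof (rule K_carrierI[OF U lg(1)])
    fix a assume a: "a \<in> multi_idx U p"
    show "smooth_on (Xp S p) (Uset S U p a) (mfd A) (\<lambda>xp. inv_into (carrier A) \<alpha> (\<phi> a xp))"
    proof (rule injective_hom_lift_smooth[OF lg(1,2) gamma_homD(1,2)[OF gh(1)] inj closed_image charted_Xp Uset_open[OF U a] K_smooth[OF c a]])
      show "\<phi> a ` Uset S U p a \<subseteq> \<alpha> ` carrier A"
      proof
        fix y assume "y \<in> \<phi> a ` Uset S U p a"
        then obtain xp where y: "y = \<phi> a xp" "xp \<in> Uset S U p a" by blast
        obtain as gs z where *: "length gs = p" "splx U as gs z" "a = ix as" "xp = pt gs z" by (rule splx_exhaust[OF a y(2)])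
        show "y \<in> \<alpha> ` carrier A" using mem[OF *(2,1)] unfolding y *(3,4) val_def .
      qed
    qed
  qed
  show "post S p U \<alpha> (corestr p U \<phi>) = \<phi>"
  proof (rule K_ext[OF post_hom_closed[OF U gg(1,2) gh(1) *] c])
    fix as gs z assume s: "splx U as gs z" "length gs = p"
    show "val (post S p U \<alpha> (corestr p U \<phi>)) as gs z = val \<phi> as gs z"
      unfolding val_post[OF s] by (rule f_inv_into_f[OF mem[OF s]])
  qed
qed

lemma corestrict_ex:
  assumes "\<phi> \<in> Coch p U B" "post S p U \<beta> \<phi> = \<one>\<^bsub>K S p U C\<^esub>"
  obtains \<kappa> where "\<kappa> \<in> Coch p U A" "post S p U \<alpha> \<kappa> = \<phi>"
  using corestrict[OF assms] by (rule that)

text \<open>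
  Two lifts of the same cochain of C differ by a cochain of A.
\<close>

lemma lift_ratio:
  assumes c: "\<phi> \<in> Coch p U B" "\<phi>' \<in> Coch p U B" and eq: "post S p U \<beta> \<phi> = post S p U \<beta> \<phi>'"
  obtains \<kappa> where "\<kappa> \<in> Coch p U A" "\<phi> = \<phi>' \<otimes>\<^bsub>K S p U B\<^esub> post S p U \<alpha> \<kappa>"
proof -
  interpret b: group_hom "K S p U B" "K S p U C" "post S p U \<beta>" by (rule hom_post_\<beta>)
  have q: "inv\<^bsub>K S p U B\<^esub> \<phi>' \<otimes>\<^bsub>K S p U B\<^esub> \<phi> \<in> Coch p U B" using c by simp
  have "post S p U \<beta> (inv\<^bsub>K S p U B\<^esub> \<phi>' \<otimes>\<^bsub>K S p U B\<^esub> \<phi>) = \<one>\<^bsub>K S p U C\<^esub>"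
    using c eq by simp
  then obtain \<kappa> where k: "\<kappa> \<in> Coch p U A" "post S p U \<alpha> \<kappa> = inv\<^bsub>K S p U B\<^esub> \<phi>' \<otimes>\<^bsub>K S p U B\<^esub> \<phi>"
    by (rule corestrict_ex[OF q])
  show ?thesis by (rule that[OF k(1)]) (use c in \<open>simp add: k(2)\<close>)
qed

lemma val_\<alpha>_central:
  assumes \<kappa>: "\<kappa> \<in> Coch p U A" and s: "splx U as gs x" "length gs = p" and y: "y \<in> carrier B"
  shows "val (post S p U \<alpha> \<kappa>) as gs x \<otimes>\<^bsub>B\<^esub> y = y \<otimes>\<^bsub>B\<^esub> val (post S p U \<alpha> \<kappa>) as gs x"
  unfolding val_post[OF s] using central val_closed[OF \<kappa> s U lg(1)] y by blast

lemma ob0_mult_\<alpha>: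
  assumes \<psi>: "\<psi> \<in> Coch 0 U B" and \<kappa>: "\<kappa> \<in> Coch 0 U A"
  shows "ob0 S B U (\<psi> \<otimes>\<^bsub>K S 0 U B\<^esub> post S 0 U \<alpha> \<kappa>) = ob0 S B U \<psi> \<otimes>\<^bsub>K S 1 U B\<^esub> post S 1 U \<alpha> (ob0 S A U \<kappa>)"
  unfolding post_ob0[OF U gg(1,2) gh(1) \<kappa>]
  by (rule ob0_mult_central[OF U gg(2) \<psi> post_hom_closed[OF U gg(1,2) gh(1) \<kappa>]]) (rule val_\<alpha>_central[OF \<kappa>], auto)

lemma ob1_mult_\<alpha>:
  assumes \<psi>: "\<psi> \<in> Coch 1 U B" and \<kappa>: "\<kappa> \<in> Coch 1 U A"
  shows "ob1 S B U (\<psi> \<otimes>\<^bsub>K S 1 U B\<^esub> post S 1 U \<alpha> \<kappa>) = ob1 S B U \<psi> \<otimes>\<^bsub>K S 2 U B\<^esub> post S 2 U \<alpha> (ob1 S A U \<kappa>)"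
  unfolding post_ob1[OF U gg(1,2) gh(1) \<kappa>]
  by (rule ob1_mult_central[OF U gg(2) \<psi> post_hom_closed[OF U gg(1,2) gh(1) \<kappa>]]) (rule val_\<alpha>_central[OF \<kappa>], auto simp: One_nat_def)

lemma reflect_TC0:
  assumes "\<kappa> \<in> Coch 0 U A" "post S 0 U \<alpha> \<kappa> \<in> TC0coc S B U"
  shows "\<kappa> \<in> TC0coc S A U"
proof -
  have "post S 1 U \<alpha> (ob0 S A U \<kappa>) = post S 1 U \<alpha> \<one>\<^bsub>K S 1 U A\<^esub>"
    using assms(2) unfolding post_ob0[OF U gg(1,2) gh(1) assms(1)] post_one[OF U gg(1,2) gh(1)] TC0coc_def by blast
  from post_\<alpha>_inj[OF ob0_closed[OF U gg(1) assms(1)] K_one_closed[OF U lg(1)] this] show ?thesis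
    using assms(1) by (simp add: TC0coc_def)
qed

lemma reflect_TC1:
  assumes "\<kappa> \<in> Coch 1 U A" "post S 1 U \<alpha> \<kappa> \<in> TC1coc S B U"
  shows "\<kappa> \<in> TC1coc S A U"
proof -
  have "post S 2 U \<alpha> (ob1 S A U \<kappa>) = post S 2 U \<alpha> \<one>\<^bsub>K S 2 U A\<^esub>"
    using assms(2) unfolding post_ob1[OF U gg(1,2) gh(1) assms(1)] post_one[OF U gg(1,2) gh(1)] TC1coc_def by blast
  from post_\<alpha>_inj[OF ob1_closed[OF U gg(1) assms(1)] K_one_closed[OF U lg(1)] this] show ?thesis
    using assms(1) by (simp add: TC1coc_def)
qed

lemma corestr_ob0:
  assumes \<eta>: "\<eta> \<in> Coch 0 U B" and c: "post S 0 U \<beta> \<eta> \<in> TC0coc S C U"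
  shows "corestr 1 U (ob0 S B U \<eta>) \<in> Coch 1 U A" "post S 1 U \<alpha> (corestr 1 U (ob0 S B U \<eta>)) = ob0 S B U \<eta>"
    "corestr 1 U (ob0 S B U \<eta>) \<in> TC1coc S A U"
proof -
  have 1: "post S 1 U \<beta> (ob0 S B U \<eta>) = \<one>\<^bsub>K S 1 U C\<^esub>"
    using c unfolding post_ob0[OF U gg(2,3) gh(2) \<eta>] TC0coc_def by blast
  note * = corestrict[OF ob0_closed[OF U gg(2) \<eta>] 1]
  show "corestr 1 U (ob0 S B U \<eta>) \<in> Coch 1 U A" "post S 1 U \<alpha> (corestr 1 U (ob0 S B U \<eta>)) = ob0 S B U \<eta>" by (rule *)+
  show "corestr 1 U (ob0 S B U \<eta>) \<in> TC1coc S A U"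
    by (rule reflect_TC1[OF *(1)]) (unfold *(2), rule ob0_cocycle[OF U gg(2) \<eta>])
qed

lemma corestr_ob0_eqI:
  assumes \<eta>: "\<eta> \<in> Coch 0 U B" and c: "post S 0 U \<beta> \<eta> \<in> TC0coc S C U"
    and \<omega>: "\<omega> \<in> Coch 1 U A" "post S 1 U \<alpha> \<omega> = ob0 S B U \<eta>"
  shows "corestr 1 U (ob0 S B U \<eta>) = \<omega>"
  by (rule post_\<alpha>_inj[OF corestr_ob0(1)[OF \<eta> c] \<omega>(1)]) (simp only: corestr_ob0(2)[OF \<eta> c] \<omega>(2))

text \<open>
  The coboundary of a lift of a cocycle comes from a 2-cocycle of A. The cocycle identity is verified in
  B, where \<open>ob1 \<psi>\<close> has central values, and carried back by injectivity of \<open>\<alpha>\<close>.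
\<close>

lemma corestr_ob1:
  assumes \<psi>: "\<psi> \<in> Coch 1 U B" and c: "post S 1 U \<beta> \<psi> \<in> TC1coc S C U"
  shows "corestr 2 U (ob1 S B U \<psi>) \<in> Coch 2 U A" "post S 2 U \<alpha> (corestr 2 U (ob1 S B U \<psi>)) = ob1 S B U \<psi>"
    "corestr 2 U (ob1 S B U \<psi>) \<in> Hcoc S A 2 U"
proof -
  interpret A: group A by (rule group_A)
  interpret a: group_hom A B \<alpha> by (rule hom_\<alpha>)
  have 1: "post S 2 U \<beta> (ob1 S B U \<psi>) = \<one>\<^bsub>K S 2 U C\<^esub>"
    using c unfolding post_ob1[OF U gg(2,3) gh(2) \<psi>] TC1coc_def by blast
  note * = corestrict[OF ob1_closed[OF U gg(2) \<psi>] 1]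
  show "corestr 2 U (ob1 S B U \<psi>) \<in> Coch 2 U A" "post S 2 U \<alpha> (corestr 2 U (ob1 S B U \<psi>)) = ob1 S B U \<psi>" by (rule *)+
  define \<omega> where "\<omega> = corestr 2 U (ob1 S B U \<psi>)"
  have \<omega>: "\<omega> \<in> Coch 2 U A" "post S 2 U \<alpha> \<omega> = ob1 S B U \<psi>" unfolding \<omega>_def by (rule *)+
  have l: "length [g,h] = 2" for g h :: 'g by simp
  have v: "val (ob1 S B U \<psi>) as [g,h] x = \<alpha> (val \<omega> as [g,h] x)" if "splx U as [g,h] x" for as g h x
    unfolding \<omega>(2)[symmetric] by (rule val_post[OF that l])
  have "\<omega> \<in> Hcoc S A 2 U"
    unfolding Hcoc2_iff[OF gg(1) comm_A U]
  proof (intro conjI allI impI \<omega>(1))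
    fix a b c d g h k x assume s: "splx U [a,b,c,d] [g,h,k] x"
    note f = faces3[OF U s]
    note wc = val2_closed[OF U gg(1) \<omega>(1)]
    have cen: "val (ob1 S B U \<psi>) [a,b,c] [g,h] x \<otimes>\<^bsub>B\<^esub> y = y \<otimes>\<^bsub>B\<^esub> val (ob1 S B U \<psi>) [a,b,c] [g,h] x"
      if "splx U [a,b,c] [g,h] x" "y \<in> carrier B" for a b c g h x y
      using val_\<alpha>_central[OF \<omega>(1) that(1) l that(2)] unfolding \<omega>(2) .
    have "\<alpha> (theta A g (val \<omega> [b,c,d] [h,k] x) \<otimes>\<^bsub>A\<^esub> val \<omega> [a,b,d] [g, h \<cdot> k] x) =
       \<alpha> (val \<omega> [a,c,d] [g \<cdot> h, k] x \<otimes>\<^bsub>A\<^esub> val \<omega> [a,b,c] [g,h] (act S k x))"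
      using ob1_cocycle[OF U gg(2) \<psi> cen s] wc f theta_closed[OF gg(1) f(5)]
      by (simp add: v[OF f(1)] v[OF f(2)] v[OF f(3)] v[OF f(4)] gamma_homD(3)[OF gh(1) f(5)])
    then show "theta A g (val \<omega> [b,c,d] [h,k] x) \<otimes>\<^bsub>A\<^esub> val \<omega> [a,b,d] [g, h \<cdot> k] x =
       val \<omega> [a,c,d] [g \<cdot> h, k] x \<otimes>\<^bsub>A\<^esub> val \<omega> [a,b,c] [g,h] (act S k x)"
      by (rule inj_onD[OF inj]) (use wc f theta_closed[OF gg(1) f(5)] in auto)
  qed
  then show "corestr 2 U (ob1 S B U \<psi>) \<in> Hcoc S A 2 U" unfolding \<omega>_def .
qed

lemma corestr_ob1_eqI:
  assumes \<psi>: "\<psi> \<in> Coch 1 U B" and c: "post S 1 U \<beta> \<psi> \<in> TC1coc S C U"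
    and \<omega>: "\<omega> \<in> Coch 2 U A" "post S 2 U \<alpha> \<omega> = ob1 S B U \<psi>"
  shows "corestr 2 U (ob1 S B U \<psi>) = \<omega>"
  by (rule post_\<alpha>_inj[OF corestr_ob1(1)[OF \<psi> c] \<omega>(1)]) (simp only: corestr_ob1(2)[OF \<psi> c] \<omega>(2))

text \<open>
  The coboundary is conjugated by the gauge transformation, and it is central.
\<close>

lemma ob1_gauge:
  assumes \<eta>: "\<eta> \<in> Coch 0 U B" and \<psi>: "\<psi> \<in> Coch 1 U B" and c: "post S 1 U \<beta> \<psi> \<in> TC1coc S C U"
  shows "ob1 S B U (gauge U B \<eta> \<psi>) = ob1 S B U \<psi>"
proof (rule K_ext2[OF ob1_closed[OF U gg(2) gauge_closed[OF U gg(2) \<eta> \<psi>]] ob1_closed[OF U gg(2) \<psi>]])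
  fix a b c g h x assume s: "splx U [a,b,c] [g,h] x"
  interpret B: group B by (rule group_B)
  let ?t = "theta B (g \<cdot> h) (val \<eta> [c] [] x)" and ?w = "val (ob1 S B U \<psi>) [a,b,c] [g,h] x"
  have l: "length [g,h] = 2" by simp
  have t: "?t \<in> carrier B" by (rule val_ob1_gauge(2)[OF U gg(2) \<eta> \<psi> s])
  have w: "?w \<in> carrier B" by (rule val2_closed[OF U gg(2) ob1_closed[OF U gg(2) \<psi>] s])
  have "?w \<otimes>\<^bsub>B\<^esub> ?t = ?t \<otimes>\<^bsub>B\<^esub> ?w"
    using val_\<alpha>_central[OF corestr_ob1(1)[OF \<psi> c] s l t] unfolding corestr_ob1(2)[OF \<psi> c] .
  then have "?t \<otimes>\<^bsub>B\<^esub> ?w \<otimes>\<^bsub>B\<^esub> inv\<^bsub>B\<^esub> ?t = ?w \<otimes>\<^bsub>B\<^esub> ?t \<otimes>\<^bsub>B\<^esub> inv\<^bsub>B\<^esub> ?t" by simp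
  also have "\<dots> = ?w" using t w by (simp add: B.m_assoc)
  finally show "val (ob1 S B U (gauge U B \<eta> \<psi>)) [a,b,c] [g,h] x = ?w"
    unfolding val_ob1_gauge(1)[OF U gg(2) \<eta> \<psi> s] .
qed

text \<open>
  Local sections of \<open>\<beta>\<close> lift the functions \<open>\<nu>\<^sub>a\<close> on small open sets. The refinement consists of all open
  sets on which one of these functions has a lift, each indexed by itself.
\<close>

lemma local_lift:
  assumes \<nu>: "\<nu> \<in> Coch 0 U C"
  obtains V r \<eta> where "V \<in> covers S" "refines V U r" "\<eta> \<in> Coch 0 V B" "post S 0 V \<beta> \<eta> = restr S 0 V r \<nu>"
proof -
  define good where "good Q a f \<longleftrightarrow> openin (mtop (Spc S)) Q \<and> a \<in> Idx U \<and> Q \<subseteq> Mem U a \<and> smooth_on (Spc S) Q (mfd B) f \<and>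
    (\<forall>y\<in>Q. \<beta> (f y) = val \<nu> [a] [] y)" for Q a f
  define V where "V = \<lparr>Idx = {Q. \<exists>a f. good Q a f}, Mem = (\<lambda>Q. Q)\<rparr>"
  have top: "topspace (mtop (mfd B)) = carrier B" "topspace (mtop (mfd C)) = carrier C" using lie_groupD(5) lg by auto
  have ex: "\<exists>Q a f. good Q a f \<and> x \<in> Q" if x: "x \<in> X" for x
  proof -
    obtain a where a: "a \<in> Idx U" "x \<in> Mem U a" using coverD(3)[OF U x] by blast
    have ix: "ix [a] \<in> multi_idx U 0" using a by (intro ix_in) auto
    note Ma = coverD(1)[OF U a(1)]
    have "smooth_on (Spc S) (Mem U a) (Xp S 0) (\<lambda>y. pt [] y)"
      unfolding pt_def by (rule smooth_into_Xp[OF Spc(2) Ma _ _ smooth_on_id[OF Spc(3) Ma]]) auto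
    moreover have "(\<lambda>y. pt [] y) ` Mem U a \<subseteq> Uset S U 0 (ix [a])"
    proof
      fix q assume "q \<in> (\<lambda>y. pt [] y) ` Mem U a"
      then obtain y where y: "q = pt [] y" "y \<in> Mem U a" by blast
      have "splx U [a] [] y" using splx0[OF U] a y by simp
      from splx_mem(2)[OF this, of 0] show "q \<in> Uset S U 0 (ix [a])" using y by simp
    qed
    ultimately have "smooth_on (Spc S) (Mem U a) (mfd C) (\<lambda>y. \<nu> (ix [a]) (pt [] y))"
      using smooth_on_comp[OF Spc(2) charted_Xp lie_groupD(3)[OF lg(3)] Ma Uset_open[OF U ix] _ K_smooth[OF \<nu> ix]] by blast
    then have sm: "smooth_on (Spc S) (Mem U a) (mfd C) (\<lambda>y. val \<nu> [a] [] y)" unfolding val_def .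
    have c: "val \<nu> [a] [] x \<in> carrier C" using smooth_on_cont(1)[OF sm Ma] a(2) top by blast
    obtain Y s where Y: "openin (mtop (mfd C)) Y" "val \<nu> [a] [] x \<in> Y" "smooth_on (mfd C) Y (mfd B) s" "\<And>y. y \<in> Y \<Longrightarrow> \<beta> (s y) = y"
      by (rule surjective_hom_local_section[OF lg(2,3) gamma_homD(1,2)[OF gh(2)] surj c]) (rule that)
    define Q where "Q = {y \<in> Mem U a. val \<nu> [a] [] y \<in> Y}"
    have Q: "openin (mtop (Spc S)) Q" unfolding Q_def by (rule smooth_on_cont(2)[OF sm Ma Y(1)])
    have QM: "Q \<subseteq> Mem U a" unfolding Q_def by blast
    have "smooth_on (Spc S) Q (mfd B) (\<lambda>y. s (val \<nu> [a] [] y))"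
      by (rule smooth_on_comp[OF Spc(2) lie_groupD(3)[OF lg(3)] lie_groupD(3)[OF lg(2)] Q Y(1) smooth_on_subset[OF sm Ma Q QM] Y(3)])
        (auto simp: Q_def)
    moreover have "\<forall>y\<in>Q. \<beta> (s (val \<nu> [a] [] y)) = val \<nu> [a] [] y" using Y(4) by (simp add: Q_def)
    ultimately have "good Q a (\<lambda>y. s (val \<nu> [a] [] y))" unfolding good_def using Q QM a(1) by blast
    moreover have "x \<in> Q" using a(2) Y(2) by (simp add: Q_def)
    ultimately show ?thesis by blast
  qed
  have "\<forall>Q\<in>Idx V. \<exists>a f. good Q a f" by (simp add: V_def)
  then obtain r f where rf: "\<And>Q. Q \<in> Idx V \<Longrightarrow> good Q (r Q) (f Q)" by metis
  have M: "Mem V Q = Q" for Q by (simp add: V_def)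
  have Vo: "openin (mtop (Spc S)) Q" if "Q \<in> Idx V" for Q using rf[OF that] by (simp add: good_def)
  have V: "V \<in> covers S"
    unfolding covers_def
  proof (intro CollectI conjI ballI)
    show "openin (mtop (Spc S)) (Mem V Q)" if "Q \<in> Idx V" for Q unfolding M by (rule Vo[OF that])
    show "(\<Union>Q\<in>Idx V. Mem V Q) = X"
    proof
      show "(\<Union>Q\<in>Idx V. Mem V Q) \<subseteq> X" unfolding M using openin_subset[OF Vo] by blast
      show "X \<subseteq> (\<Union>Q\<in>Idx V. Mem V Q)"
      proof
        fix x assume "x \<in> X"
        then obtain Q a f where "good Q a f" "x \<in> Q" using ex by blast
        then show "x \<in> (\<Union>Q\<in>Idx V. Mem V Q)" by (auto simp: V_def)
      qed
    qed
  qed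
  have r: "refines V U r" unfolding refines_def M using rf by (simp add: good_def)
  define \<eta> where "\<eta> = (\<lambda>a\<in>multi_idx V 0. \<lambda>xp\<in>Uset S V 0 a. f (a 0) (snd xp))"
  have \<eta>: "\<eta> \<in> Coch 0 V B"
    unfolding \<eta>_def
  proof (rule K_carrierI[OF V lg(2)])
    fix a assume a: "a \<in> multi_idx V 0"
    then have a0: "a 0 \<in> Idx V" by auto
    note W = Uset_open[OF V a]
    have "smooth_on (Spc S) (a 0) (mfd B) (f (a 0))" using rf[OF a0] by (simp add: good_def)
    moreover have "snd ` Uset S V 0 a \<subseteq> a 0" unfolding Uset_def M by auto
    ultimately show "smooth_on (Xp S 0) (Uset S V 0 a) (mfd B) (\<lambda>xp. f (a 0) (snd xp))"
      using smooth_on_comp[OF charted_Xp Spc(2) lie_groupD(3)[OF lg(2)] W Vo[OF a0] smooth_on_subset[OF Xp_snd_smooth openin_topspace W openin_subset[OF W]]]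
      by blast
  qed
  have "post S 0 V \<beta> \<eta> = restr S 0 V r \<nu>"
  proof (rule K_ext0[OF post_hom_closed[OF V gg(2,3) gh(2) \<eta>] restr_closed[OF U V lg(3) r \<nu>]])
    fix Q x assume s: "splx V [Q] [] x"
    have l: "length ([] :: 'g list) = 0" by simp
    have Q: "Q \<in> Idx V" "x \<in> Q" using s unfolding splx0[OF V] M by auto
    have "val \<eta> [Q] [] x = f (ix [Q] 0) (snd (pt [] x))" unfolding \<eta>_def by (rule val_restrict[OF s l])
    then have "val \<eta> [Q] [] x = f Q x" by (simp add: ix_def snd_pt)
    then show "val (post S 0 V \<beta> \<eta>) [Q] [] x = val (restr S 0 V r \<nu>) [Q] [] x"
      unfolding val_post[OF s l] val_restr[OF s l] using rf[OF Q(1)] Q(2) by (simp add: good_def)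
  qed
  then show ?thesis by (rule that[OF V r \<eta>])
qed

end

end

section \<open>The exact sequence\<close>

lemma exact_atI:
  assumes "\<And>c d. (c, d) \<in> f \<Longrightarrow> (d, u) \<in> g" "\<And>d. (d, u) \<in> g \<Longrightarrow> \<exists>c. (c, d) \<in> f"
  shows "exact_at f g u"
  unfolding exact_at_def using assms by blast

context central_ext
begin

interpretation A0: limsys S A 0 "TC0coc S A" "\<lambda>_. Id" by (rule TC0_limsys[OF gg(1)])
interpretation B0: limsys S B 0 "TC0coc S B" "\<lambda>_. Id" by (rule TC0_limsys[OF gg(2)])
interpretation C0: limsys S C 0 "TC0coc S C" "\<lambda>_. Id" by (rule TC0_limsys[OF gg(3)])
interpretation A1: limsys S A 1 "TC1coc S A" "TC1rel S A" by (rule TC1_limsys[OF gg(1)])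
interpretation B1: limsys S B 1 "TC1coc S B" "TC1rel S B" by (rule TC1_limsys[OF gg(2)])
interpretation C1: limsys S C 1 "TC1coc S C" "TC1rel S C" by (rule TC1_limsys[OF gg(3)])
interpretation A2: limsys S A 2 "Hcoc S A 2" "Hrel S A 2" by (rule H2_limsys[OF gg(1) comm_A])

lemma cls0: "TC0cls S A U \<mu> = A0.cls U \<mu>" "TC0cls S B U \<mu>' = B0.cls U \<mu>'" "TC0cls S C U \<mu>'' = C0.cls U \<mu>''"
  by (rule TC0cls_eq[OF gg(1)], rule TC0cls_eq[OF gg(2)], rule TC0cls_eq[OF gg(3)])

lemma cls1: "TC1cls S A U \<mu> = A1.cls U \<mu>" "TC1cls S B U \<mu>' = B1.cls U \<mu>'" "TC1cls S C U \<mu>'' = C1.cls U \<mu>''"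
  by (rule TC1cls_eq[OF gg(1)], rule TC1cls_eq[OF gg(2)], rule TC1cls_eq[OF gg(3)])

lemma clsH: "Hcls S A 0 U \<mu> = A0.cls U \<mu>" "Hcls S A 1 U \<mu> = A1.cls U \<mu>" "Hcls S A 2 U \<mu> = A2.cls U \<mu>"
  unfolding H0_eq(2)[OF gg(1) comm_A] H1_eq(2)[OF gg(1) comm_A] cls0 cls1 by (simp_all add: Hcls_def A2.cls_def)

lemma alpha0_eq: "alpha0 S A B \<alpha> = beta0 S A B \<alpha>"
  unfolding alpha0_def beta0_def H0_eq(2)[OF gg(1) comm_A] using Hcoc0[OF gg(1) comm_A] by blast

lemma alpha1_eq: "alpha1 S A B \<alpha> = beta1 S A B \<alpha>"
  unfolding alpha1_def beta1_def H1_eq(2)[OF gg(1) comm_A] using Hcoc1[OF gg(1) comm_A] by blast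

lemma alpha0_iff: "(c, d) \<in> alpha0 S A B \<alpha> \<longleftrightarrow>
    (\<exists>U \<mu>. U \<in> covers S \<and> \<mu> \<in> TC0coc S A U \<and> c = A0.cls U \<mu> \<and> d = B0.cls U (post S 0 U \<alpha> \<mu>))"
  unfolding alpha0_eq beta0_def cls0 by blast

lemma alpha1_iff: "(c, d) \<in> alpha1 S A B \<alpha> \<longleftrightarrow>
    (\<exists>U \<mu>. U \<in> covers S \<and> \<mu> \<in> TC1coc S A U \<and> c = A1.cls U \<mu> \<and> d = B1.cls U (post S 1 U \<alpha> \<mu>))"
  unfolding alpha1_eq beta1_def cls1 by blast

lemma beta0_iff: "(c, d) \<in> beta0 S B C \<beta> \<longleftrightarrow>
    (\<exists>U \<mu>. U \<in> covers S \<and> \<mu> \<in> TC0coc S B U \<and> c = B0.cls U \<mu> \<and> d = C0.cls U (post S 0 U \<beta> \<mu>))"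
  unfolding beta0_def cls0 by blast

lemma beta1_iff: "(c, d) \<in> beta1 S B C \<beta> \<longleftrightarrow>
    (\<exists>U \<mu>. U \<in> covers S \<and> \<mu> \<in> TC1coc S B U \<and> c = B1.cls U \<mu> \<and> d = C1.cls U (post S 1 U \<beta> \<mu>))"
  unfolding beta1_def cls1 by blast

lemma Delta0_iff: "(c, d) \<in> Delta0 S A B C \<alpha> \<beta> \<longleftrightarrow>
    (\<exists>U \<eta>. U \<in> covers S \<and> \<eta> \<in> Coch 0 U B \<and> post S 0 U \<beta> \<eta> \<in> TC0coc S C U \<and>
       c = C0.cls U (post S 0 U \<beta> \<eta>) \<and> d = A1.cls U (corestr 1 U (ob0 S B U \<eta>)))"
  unfolding Delta0_def cls0 clsH by blast

lemma Delta1_iff: "(c, d) \<in> Delta1 S A B C \<alpha> \<beta> \<longleftrightarrow>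
    (\<exists>U \<psi>. U \<in> covers S \<and> \<psi> \<in> Coch 1 U B \<and> post S 1 U \<beta> \<psi> \<in> TC1coc S C U \<and>
       c = C1.cls U (post S 1 U \<beta> \<psi>) \<and> d = A2.cls U (corestr 2 U (ob1 S B U \<psi>)))"
  unfolding Delta1_def cls1 clsH by blast

lemmas rph = restr_post_hom[OF _ _ gg(1,2) gh(1)] restr_post_hom[OF _ _ gg(2,3) gh(2)]

lemma restr_corestr_ob0:
  assumes U: "U \<in> covers S" "V \<in> covers S" and r: "refines V U r"
    and \<eta>: "\<eta> \<in> Coch 0 U B" and c: "post S 0 U \<beta> \<eta> \<in> TC0coc S C U"
  shows "restr S 0 V r \<eta> \<in> Coch 0 V B" "post S 0 V \<beta> (restr S 0 V r \<eta>) = restr S 0 V r (post S 0 U \<beta> \<eta>)"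
    "post S 0 V \<beta> (restr S 0 V r \<eta>) \<in> TC0coc S C V"
    "restr S 1 V r (corestr 1 U (ob0 S B U \<eta>)) = corestr 1 V (ob0 S B V (restr S 0 V r \<eta>))"
proof -
  show \<eta>V: "restr S 0 V r \<eta> \<in> Coch 0 V B" by (rule restr_closed[OF U lg(2) r \<eta>])
  show e: "post S 0 V \<beta> (restr S 0 V r \<eta>) = restr S 0 V r (post S 0 U \<beta> \<eta>)" by (rule rph(2)[OF U r \<eta>, symmetric])
  show cV: "post S 0 V \<beta> (restr S 0 V r \<eta>) \<in> TC0coc S C V" unfolding e by (rule C0.Z_restr[OF U r c])
  note d = corestr_ob0[OF U(1) \<eta> c]
  have "post S 1 V \<alpha> (restr S 1 V r (corestr 1 U (ob0 S B U \<eta>))) = ob0 S B V (restr S 0 V r \<eta>)"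
    unfolding rph(1)[OF U r d(1), symmetric] d(2) by (rule restr_ob0[OF U gg(2) r \<eta>])
  from corestr_ob0_eqI[OF U(2) \<eta>V cV restr_closed[OF U lg(1) r d(1)] this]
  show "restr S 1 V r (corestr 1 U (ob0 S B U \<eta>)) = corestr 1 V (ob0 S B V (restr S 0 V r \<eta>))" by (rule sym)
qed

lemma restr_corestr_ob1:
  assumes U: "U \<in> covers S" "V \<in> covers S" and r: "refines V U r"
    and \<psi>: "\<psi> \<in> Coch 1 U B" and c: "post S 1 U \<beta> \<psi> \<in> TC1coc S C U"
  shows "restr S 1 V r \<psi> \<in> Coch 1 V B" "post S 1 V \<beta> (restr S 1 V r \<psi>) = restr S 1 V r (post S 1 U \<beta> \<psi>)"
    "post S 1 V \<beta> (restr S 1 V r \<psi>) \<in> TC1coc S C V"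
    "restr S 2 V r (corestr 2 U (ob1 S B U \<psi>)) = corestr 2 V (ob1 S B V (restr S 1 V r \<psi>))"
proof -
  show \<psi>V: "restr S 1 V r \<psi> \<in> Coch 1 V B" by (rule restr_closed[OF U lg(2) r \<psi>])
  show e: "post S 1 V \<beta> (restr S 1 V r \<psi>) = restr S 1 V r (post S 1 U \<beta> \<psi>)" by (rule rph(2)[OF U r \<psi>, symmetric])
  show cV: "post S 1 V \<beta> (restr S 1 V r \<psi>) \<in> TC1coc S C V" unfolding e by (rule C1.Z_restr[OF U r c])
  note d = corestr_ob1[OF U(1) \<psi> c]
  have "post S 2 V \<alpha> (restr S 2 V r (corestr 2 U (ob1 S B U \<psi>))) = ob1 S B V (restr S 1 V r \<psi>)"
    unfolding rph(1)[OF U r d(1), symmetric] d(2) by (rule restr_ob1[OF U gg(2) r \<psi>])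
  from corestr_ob1_eqI[OF U(2) \<psi>V cV restr_closed[OF U lg(1) r d(1)] this]
  show "restr S 2 V r (corestr 2 U (ob1 S B U \<psi>)) = corestr 2 V (ob1 S B V (restr S 1 V r \<psi>))" by (rule sym)
qed

context
  fixes U :: "'x cover"
  assumes U: "U \<in> covers S"
begin

lemma corestr_ob0_cocycle: "\<mu> \<in> TC0coc S B U \<Longrightarrow> corestr 1 U (ob0 S B U \<mu>) = \<one>\<^bsub>K S 1 U A\<^esub>"
proof (rule corestr_ob0_eqI[OF U])
  assume c: "\<mu> \<in> TC0coc S B U"
  show "\<mu> \<in> Coch 0 U B" by (rule B0.Z_closed[OF U c])
  show "post S 0 U \<beta> \<mu> \<in> TC0coc S C U" by (rule post_TC0[OF U gg(2,3) gh(2) c])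
  show "\<one>\<^bsub>K S 1 U A\<^esub> \<in> Coch 1 U A" by (rule K_one_closed[OF U lg(1)])
  show "post S 1 U \<alpha> \<one>\<^bsub>K S 1 U A\<^esub> = ob0 S B U \<mu>" unfolding post_one[OF U gg(1,2) gh(1)] using c by (simp add: TC0coc_def)
qed

lemma corestr_ob1_cocycle: "\<phi> \<in> TC1coc S B U \<Longrightarrow> corestr 2 U (ob1 S B U \<phi>) = \<one>\<^bsub>K S 2 U A\<^esub>"
proof (rule corestr_ob1_eqI[OF U])
  assume c: "\<phi> \<in> TC1coc S B U"
  show "\<phi> \<in> Coch 1 U B" by (rule B1.Z_closed[OF U c])
  show "post S 1 U \<beta> \<phi> \<in> TC1coc S C U" by (rule post_TC1[OF U gg(2,3) gh(2) c])
  show "\<one>\<^bsub>K S 2 U A\<^esub> \<in> Coch 2 U A" by (rule K_one_closed[OF U lg(1)])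
  show "post S 2 U \<alpha> \<one>\<^bsub>K S 2 U A\<^esub> = ob1 S B U \<phi>" unfolding post_one[OF U gg(1,2) gh(1)] using c by (simp add: TC1coc_def)
qed

lemma corestr_ob0_mult:
  assumes \<eta>: "\<eta> \<in> Coch 0 U B" and c: "post S 0 U \<beta> \<eta> \<in> TC0coc S C U" and \<kappa>: "\<kappa> \<in> Coch 0 U A"
  defines "\<eta>' \<equiv> \<eta> \<otimes>\<^bsub>K S 0 U B\<^esub> post S 0 U \<alpha> \<kappa>"
  shows "\<eta>' \<in> Coch 0 U B" "post S 0 U \<beta> \<eta>' = post S 0 U \<beta> \<eta>"
    "corestr 1 U (ob0 S B U \<eta>') = corestr 1 U (ob0 S B U \<eta>) \<otimes>\<^bsub>K S 1 U A\<^esub> ob0 S A U \<kappa>"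
proof -
  interpret b: group_hom "K S 0 U B" "K S 0 U C" "post S 0 U \<beta>" by (rule hom_post_\<beta>[OF U])
  interpret a: group_hom "K S 1 U A" "K S 1 U B" "post S 1 U \<alpha>" by (rule hom_post_\<alpha>[OF U])
  note \<alpha>\<kappa> = post_hom_closed[OF U gg(1,2) gh(1) \<kappa>] and ob = ob0_closed[OF U gg(1) \<kappa>]
  show \<eta>': "\<eta>' \<in> Coch 0 U B" unfolding \<eta>'_def by (rule K_mult_closed[OF U lg(2) \<eta> \<alpha>\<kappa>])
  show e: "post S 0 U \<beta> \<eta>' = post S 0 U \<beta> \<eta>"
    unfolding \<eta>'_def b.hom_mult[OF \<eta> \<alpha>\<kappa>] post_\<beta>\<alpha>[OF U \<kappa>] by (rule b.H.r_one[OF b.hom_closed[OF \<eta>]])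
  note d = corestr_ob0[OF U \<eta> c]
  have "post S 1 U \<alpha> (corestr 1 U (ob0 S B U \<eta>) \<otimes>\<^bsub>K S 1 U A\<^esub> ob0 S A U \<kappa>) = ob0 S B U \<eta>'"
    unfolding a.hom_mult[OF d(1) ob] d(2) \<eta>'_def by (rule ob0_mult_\<alpha>[OF U \<eta> \<kappa>, symmetric])
  from corestr_ob0_eqI[OF U \<eta>' _ K_mult_closed[OF U lg(1) d(1) ob] this]
  show "corestr 1 U (ob0 S B U \<eta>') = corestr 1 U (ob0 S B U \<eta>) \<otimes>\<^bsub>K S 1 U A\<^esub> ob0 S A U \<kappa>" using c unfolding e by blast
qed

lemma corestr_ob1_mult:
  assumes \<psi>: "\<psi> \<in> Coch 1 U B" and c: "post S 1 U \<beta> \<psi> \<in> TC1coc S C U" and \<kappa>: "\<kappa> \<in> Coch 1 U A"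
  defines "\<psi>' \<equiv> \<psi> \<otimes>\<^bsub>K S 1 U B\<^esub> post S 1 U \<alpha> \<kappa>"
  shows "\<psi>' \<in> Coch 1 U B" "post S 1 U \<beta> \<psi>' = post S 1 U \<beta> \<psi>"
    "corestr 2 U (ob1 S B U \<psi>') = corestr 2 U (ob1 S B U \<psi>) \<otimes>\<^bsub>K S 2 U A\<^esub> ob1 S A U \<kappa>"
proof -
  interpret b: group_hom "K S 1 U B" "K S 1 U C" "post S 1 U \<beta>" by (rule hom_post_\<beta>[OF U])
  interpret a: group_hom "K S 2 U A" "K S 2 U B" "post S 2 U \<alpha>" by (rule hom_post_\<alpha>[OF U])
  note \<alpha>\<kappa> = post_hom_closed[OF U gg(1,2) gh(1) \<kappa>] and ob = ob1_closed[OF U gg(1) \<kappa>]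
  show \<psi>': "\<psi>' \<in> Coch 1 U B" unfolding \<psi>'_def by (rule K_mult_closed[OF U lg(2) \<psi> \<alpha>\<kappa>])
  show e: "post S 1 U \<beta> \<psi>' = post S 1 U \<beta> \<psi>"
    unfolding \<psi>'_def b.hom_mult[OF \<psi> \<alpha>\<kappa>] post_\<beta>\<alpha>[OF U \<kappa>] by (rule b.H.r_one[OF b.hom_closed[OF \<psi>]])
  note d = corestr_ob1[OF U \<psi> c]
  have "post S 2 U \<alpha> (corestr 2 U (ob1 S B U \<psi>) \<otimes>\<^bsub>K S 2 U A\<^esub> ob1 S A U \<kappa>) = ob1 S B U \<psi>'"
    unfolding a.hom_mult[OF d(1) ob] d(2) \<psi>'_def by (rule ob1_mult_\<alpha>[OF U \<psi> \<kappa>, symmetric])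
  from corestr_ob1_eqI[OF U \<psi>' _ K_mult_closed[OF U lg(1) d(1) ob] this]
  show "corestr 2 U (ob1 S B U \<psi>') = corestr 2 U (ob1 S B U \<psi>) \<otimes>\<^bsub>K S 2 U A\<^esub> ob1 S A U \<kappa>" using c unfolding e by blast
qed

lemma TC1rel_A_iff: "(\<phi>, \<phi>') \<in> TC1rel S A U \<longleftrightarrow> \<phi> \<in> TC1coc S A U \<and> \<phi>' \<in> TC1coc S A U \<and>
    (\<exists>\<mu>\<in>Coch 0 U A. \<phi> = \<phi>' \<otimes>\<^bsub>K S 1 U A\<^esub> ob0 S A U \<mu>)"
proof -
  have "(\<phi>, \<phi>') \<in> Hrel S A 1 U \<longleftrightarrow> \<phi> \<in> TC1coc S A U \<and> \<phi>' \<in> TC1coc S A U \<and>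
     (\<exists>\<mu>\<in>Coch 0 U A. \<phi> = \<phi>' \<otimes>\<^bsub>K S 1 U A\<^esub> cobd S 0 U A \<mu>)"
    unfolding Hrel_def Hcoc1[OF gg(1) comm_A U] by (simp add: One_nat_def)
  then show ?thesis unfolding Hrel1[OF gg(1) comm_A U] using cobd0_eq[OF gg(1) comm_A U] by simp
qed

lemma corestr_ob0_unique:
  assumes \<eta>: "\<eta> \<in> Coch 0 U B" "\<eta>' \<in> Coch 0 U B" and c: "post S 0 U \<beta> \<eta> \<in> TC0coc S C U"
    and eq: "post S 0 U \<beta> \<eta>' = post S 0 U \<beta> \<eta>"
  shows "(corestr 1 U (ob0 S B U \<eta>'), corestr 1 U (ob0 S B U \<eta>)) \<in> TC1rel S A U"
proof -
  obtain \<kappa> where \<kappa>: "\<kappa> \<in> Coch 0 U A" "\<eta>' = \<eta> \<otimes>\<^bsub>K S 0 U B\<^esub> post S 0 U \<alpha> \<kappa>"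
    by (rule lift_ratio[OF U \<eta>(2,1) eq])
  have c': "post S 0 U \<beta> \<eta>' \<in> TC0coc S C U" unfolding eq by (rule c)
  show ?thesis unfolding TC1rel_A_iff
    using corestr_ob0(3)[OF U \<eta>(2) c'] corestr_ob0(3)[OF U \<eta>(1) c] corestr_ob0_mult(3)[OF \<eta>(1) c \<kappa>(1)] \<kappa> by blast
qed

text \<open>
  The gauge transformation \<open>\<eta>\<close> of \<open>\<psi>\<close> and the cochain \<open>\<psi>'\<close> lift the same cochain of C, so they differ by a
  cochain of A; and \<open>\<eta>\<close> does not change the coboundary.
\<close>

lemma corestr_ob1_unique:
  assumes \<psi>: "\<psi> \<in> Coch 1 U B" "\<psi>' \<in> Coch 1 U B" and \<eta>: "\<eta> \<in> Coch 0 U B"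
    and c: "post S 1 U \<beta> \<psi> \<in> TC1coc S C U" "post S 1 U \<beta> \<psi>' \<in> TC1coc S C U"
    and eq: "post S 1 U \<beta> \<psi>' = gauge U C (post S 0 U \<beta> \<eta>) (post S 1 U \<beta> \<psi>)"
  shows "(corestr 2 U (ob1 S B U \<psi>), corestr 2 U (ob1 S B U \<psi>')) \<in> Hrel S A 2 U"
proof -
  have eq': "post S 1 U \<beta> (gauge U B \<eta> \<psi>) = post S 1 U \<beta> \<psi>'"
    unfolding eq by (rule post_gauge[OF U gg(2,3) gh(2) \<eta> \<psi>(1)])
  obtain \<kappa> where \<kappa>: "\<kappa> \<in> Coch 1 U A" "gauge U B \<eta> \<psi> = \<psi>' \<otimes>\<^bsub>K S 1 U B\<^esub> post S 1 U \<alpha> \<kappa>"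
    by (rule lift_ratio[OF U gauge_closed[OF U gg(2) \<eta> \<psi>(1)] \<psi>(2) eq'])
  have "corestr 2 U (ob1 S B U \<psi>) = corestr 2 U (ob1 S B U \<psi>') \<otimes>\<^bsub>K S 2 U A\<^esub> ob1 S A U \<kappa>"
    using corestr_ob1_mult(3)[OF \<psi>(2) c(2) \<kappa>(1)] unfolding \<kappa>(2)[symmetric] ob1_gauge[OF U \<eta> \<psi>(1) c(1)] .
  then show ?thesis unfolding Hrel2_iff[OF gg(1) comm_A U]
    using corestr_ob1(3)[OF U \<psi>(1) c(1)] corestr_ob1(3)[OF U \<psi>(2) c(2)] \<kappa>(1) by blast
qed

end

lemma alpha0_map: "pointed_map (H S A 0) (Hpt S A 0) (TC0 S B) (TC0pt S B) (alpha0 S A B \<alpha>)"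
  unfolding alpha0_eq H0_eq[OF gg(1) comm_A] by (rule beta0_map[OF gg(1,2) gh(1)])

lemma alpha1_map: "pointed_map (H S A 1) (Hpt S A 1) (TC1 S B) (TC1pt S B) (alpha1 S A B \<alpha>)"
  unfolding alpha1_eq H1_eq[OF gg(1) comm_A] by (rule beta1_map[OF gg(1,2) gh(1)])

text \<open>
  The graphs of the connecting maps on the level of cocycles, over a fixed cover.
\<close>

definition "lifts0 U = {(post S 0 U \<beta> \<eta>, corestr 1 U (ob0 S B U \<eta>)) | \<eta>. \<eta> \<in> Coch 0 U B \<and> post S 0 U \<beta> \<eta> \<in> TC0coc S C U}"
definition "lifts1 U = {(post S 1 U \<beta> \<psi>, corestr 2 U (ob1 S B U \<psi>)) | \<psi>. \<psi> \<in> Coch 1 U B \<and> post S 1 U \<beta> \<psi> \<in> TC1coc S C U}"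

lemma lifts0_iff: "(\<mu>, \<omega>) \<in> lifts0 U \<longleftrightarrow> (\<exists>\<eta>. \<eta> \<in> Coch 0 U B \<and> post S 0 U \<beta> \<eta> \<in> TC0coc S C U \<and>
    \<mu> = post S 0 U \<beta> \<eta> \<and> \<omega> = corestr 1 U (ob0 S B U \<eta>))"
  unfolding lifts0_def by blast

lemma lifts1_iff: "(\<mu>, \<omega>) \<in> lifts1 U \<longleftrightarrow> (\<exists>\<psi>. \<psi> \<in> Coch 1 U B \<and> post S 1 U \<beta> \<psi> \<in> TC1coc S C U \<and>
    \<mu> = post S 1 U \<beta> \<psi> \<and> \<omega> = corestr 2 U (ob1 S B U \<psi>))"
  unfolding lifts1_def by blast

interpretation D0: limmap S C 0 "TC0coc S C" "\<lambda>_. Id" A 1 "TC1coc S A" "TC1rel S A" lifts0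
proof unfold_locales
  fix U assume U: "U \<in> covers S"
  show "lifts0 U \<subseteq> TC0coc S C U \<times> TC1coc S A U"
    using corestr_ob0(3)[OF U] by (auto simp: lifts0_def)
  show "(\<one>\<^bsub>K S 0 U C\<^esub>, \<one>\<^bsub>K S 1 U A\<^esub>) \<in> lifts0 U"
    unfolding lifts0_iff
  proof (intro exI conjI)
    show "\<one>\<^bsub>K S 0 U B\<^esub> \<in> Coch 0 U B" by (rule K_one_closed[OF U lg(2)])
    show "post S 0 U \<beta> \<one>\<^bsub>K S 0 U B\<^esub> \<in> TC0coc S C U" by (rule post_TC0[OF U gg(2,3) gh(2) B0.Z_one[OF U]])
    show "\<one>\<^bsub>K S 0 U C\<^esub> = post S 0 U \<beta> \<one>\<^bsub>K S 0 U B\<^esub>" by (rule post_one[OF U gg(2,3) gh(2), symmetric])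
    show "\<one>\<^bsub>K S 1 U A\<^esub> = corestr 1 U (ob0 S B U \<one>\<^bsub>K S 0 U B\<^esub>)" by (rule corestr_ob0_cocycle[OF U B0.Z_one[OF U], symmetric])
  qed
  show "\<exists>V\<in>covers S. \<exists>r. refines V U r \<and> (restr S 1 V r \<psi>, restr S 1 V r \<psi>') \<in> TC1rel S A V"
    if F: "(\<phi>, \<psi>) \<in> lifts0 U" "(\<phi>', \<psi>') \<in> lifts0 U" and eq: "(\<phi>, \<phi>') \<in> Id" for \<phi> \<psi> \<phi>' \<psi>'
  proof -
    obtain \<eta> where 1: "\<eta> \<in> Coch 0 U B" "post S 0 U \<beta> \<eta> \<in> TC0coc S C U" "\<phi> = post S 0 U \<beta> \<eta>" "\<psi> = corestr 1 U (ob0 S B U \<eta>)"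
      using F(1) unfolding lifts0_iff by blast
    obtain \<eta>' where 2: "\<eta>' \<in> Coch 0 U B" "post S 0 U \<beta> \<eta>' \<in> TC0coc S C U" "\<phi>' = post S 0 U \<beta> \<eta>'" "\<psi>' = corestr 1 U (ob0 S B U \<eta>')"
      using F(2) unfolding lifts0_iff by blast
    have e: "post S 0 U \<beta> \<eta> = post S 0 U \<beta> \<eta>'" using eq 1(3) 2(3) by simp
    have "(\<psi>, \<psi>') \<in> TC1rel S A U" unfolding 1(4) 2(4) by (rule corestr_ob0_unique[OF U 2(1) 1(1) 2(2) e])
    moreover have "restr S 1 U (\<lambda>a. a) \<psi> = \<psi>" "restr S 1 U (\<lambda>a. a) \<psi>' = \<psi>'"
      unfolding 1(4) 2(4) by (rule restr_id[OF U lg(1) corestr_ob0(1)[OF U 1(1,2)]], rule restr_id[OF U lg(1) corestr_ob0(1)[OF U 2(1,2)]])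
    ultimately show ?thesis using U refines_id by metis
  qed
  fix V r \<phi> \<psi> assume V: "V \<in> covers S" "refines V U r" and F: "(\<phi>, \<psi>) \<in> lifts0 U"
  obtain \<eta> where 1: "\<eta> \<in> Coch 0 U B" "post S 0 U \<beta> \<eta> \<in> TC0coc S C U" "\<phi> = post S 0 U \<beta> \<eta>" "\<psi> = corestr 1 U (ob0 S B U \<eta>)"
    using F unfolding lifts0_iff by blast
  show "(restr S 0 V r \<phi>, restr S 1 V r \<psi>) \<in> lifts0 V"
    unfolding lifts0_iff 1(3,4) using restr_corestr_ob0[OF U V 1(1,2)] by metis
qed

interpretation D1: limmap S C 1 "TC1coc S C" "TC1rel S C" A 2 "Hcoc S A 2" "Hrel S A 2" lifts1
proof unfold_locales
  fix U assume U: "U \<in> covers S"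
  show "lifts1 U \<subseteq> TC1coc S C U \<times> Hcoc S A 2 U"
    using corestr_ob1(3)[OF U] by (auto simp: lifts1_def)
  show "(\<one>\<^bsub>K S 1 U C\<^esub>, \<one>\<^bsub>K S 2 U A\<^esub>) \<in> lifts1 U"
    unfolding lifts1_iff
  proof (intro exI conjI)
    show "\<one>\<^bsub>K S 1 U B\<^esub> \<in> Coch 1 U B" by (rule K_one_closed[OF U lg(2)])
    show "post S 1 U \<beta> \<one>\<^bsub>K S 1 U B\<^esub> \<in> TC1coc S C U" by (rule post_TC1[OF U gg(2,3) gh(2) B1.Z_one[OF U]])
    show "\<one>\<^bsub>K S 1 U C\<^esub> = post S 1 U \<beta> \<one>\<^bsub>K S 1 U B\<^esub>" by (rule post_one[OF U gg(2,3) gh(2), symmetric])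
    show "\<one>\<^bsub>K S 2 U A\<^esub> = corestr 2 U (ob1 S B U \<one>\<^bsub>K S 1 U B\<^esub>)" by (rule corestr_ob1_cocycle[OF U B1.Z_one[OF U], symmetric])
  qed
  show "\<exists>V\<in>covers S. \<exists>r. refines V U r \<and> (restr S 2 V r \<omega>, restr S 2 V r \<omega>') \<in> Hrel S A 2 V"
    if F: "(\<phi>, \<omega>) \<in> lifts1 U" "(\<phi>', \<omega>') \<in> lifts1 U" and R: "(\<phi>, \<phi>') \<in> TC1rel S C U" for \<phi> \<omega> \<phi>' \<omega>'
  proof -
    obtain \<psi> where 1: "\<psi> \<in> Coch 1 U B" "post S 1 U \<beta> \<psi> \<in> TC1coc S C U" "\<phi> = post S 1 U \<beta> \<psi>" "\<omega> = corestr 2 U (ob1 S B U \<psi>)"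
      using F(1) unfolding lifts1_iff by blast
    obtain \<psi>' where 2: "\<psi>' \<in> Coch 1 U B" "post S 1 U \<beta> \<psi>' \<in> TC1coc S C U" "\<phi>' = post S 1 U \<beta> \<psi>'" "\<omega>' = corestr 2 U (ob1 S B U \<psi>')"
      using F(2) unfolding lifts1_iff by blast
    obtain \<nu> where \<nu>: "\<nu> \<in> Coch 0 U C" "\<phi>' = gauge U C \<nu> \<phi>"
      using R unfolding TC1rel_gauge[OF U gg(3)] by blast
    obtain V r \<eta> where V: "V \<in> covers S" "refines V U r" and \<eta>: "\<eta> \<in> Coch 0 V B" "post S 0 V \<beta> \<eta> = restr S 0 V r \<nu>"
      by (rule local_lift[OF U \<nu>(1)])
    note r1 = restr_corestr_ob1[OF U V 1(1,2)] and r2 = restr_corestr_ob1[OF U V 2(1,2)]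
    have "post S 1 V \<beta> (restr S 1 V r \<psi>') = gauge V C (post S 0 V \<beta> \<eta>) (post S 1 V \<beta> (restr S 1 V r \<psi>))"
      unfolding r1(2) r2(2) 2(3)[symmetric] 1(3)[symmetric] \<eta>(2) \<nu>(2)
      by (rule restr_gauge[OF U V(1) gg(3) V(2) \<nu>(1)]) (unfold 1(3), rule C1.Z_closed[OF U 1(2)])
    from corestr_ob1_unique[OF V(1) r1(1) r2(1) \<eta>(1) r1(3) r2(3) this]
    have "(restr S 2 V r \<omega>, restr S 2 V r \<omega>') \<in> Hrel S A 2 V" unfolding 1(4) 2(4) r1(4) r2(4) .
    then show ?thesis using V by blast
  qed
  fix V r \<phi> \<psi> assume V: "V \<in> covers S" "refines V U r" and F: "(\<phi>, \<psi>) \<in> lifts1 U"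
  obtain \<psi>' where 1: "\<psi>' \<in> Coch 1 U B" "post S 1 U \<beta> \<psi>' \<in> TC1coc S C U" "\<phi> = post S 1 U \<beta> \<psi>'" "\<psi> = corestr 2 U (ob1 S B U \<psi>')"
    using F unfolding lifts1_iff by blast
  show "(restr S 1 V r \<phi>, restr S 2 V r \<psi>) \<in> lifts1 V"
    unfolding lifts1_iff 1(3,4) using restr_corestr_ob1[OF U V 1(1,2)] by metis
qed

lemma Delta0_graph: "Delta0 S A B C \<alpha> \<beta> = D0.graph"
proof -
  have "(c, d) \<in> Delta0 S A B C \<alpha> \<beta> \<longleftrightarrow> (c, d) \<in> D0.graph" for c d
    unfolding Delta0_iff D0.graph_def lifts0_def by blast
  then show ?thesis by auto
qed

lemma Delta1_graph: "Delta1 S A B C \<alpha> \<beta> = D1.graph"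
proof -
  have "(c, d) \<in> Delta1 S A B C \<alpha> \<beta> \<longleftrightarrow> (c, d) \<in> D1.graph" for c d
    unfolding Delta1_iff D1.graph_def lifts1_def by blast
  then show ?thesis by auto
qed

lemma Delta0_map: "pointed_map (TC0 S C) (TC0pt S C) (H S A 1) (Hpt S A 1) (Delta0 S A B C \<alpha> \<beta>)"
  unfolding Delta0_graph H1_eq[OF gg(1) comm_A] TC0_def TC0pt_def TC1_def TC1pt_def cls0 cls1
proof (rule D0.graph_total)
  fix U \<mu> assume U: "U \<in> covers S" and \<mu>: "\<mu> \<in> TC0coc S C U"
  obtain V r \<eta> where V: "V \<in> covers S" "refines V U r" and \<eta>: "\<eta> \<in> Coch 0 V B" "post S 0 V \<beta> \<eta> = restr S 0 V r \<mu>"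
    by (rule local_lift[OF U C0.Z_closed[OF U \<mu>]])
  have "(restr S 0 V r \<mu>, corestr 1 V (ob0 S B V \<eta>)) \<in> lifts0 V"
    unfolding lifts0_iff using \<eta> C0.Z_restr[OF U V \<mu>] by metis
  then show "\<exists>V\<in>covers S. \<exists>r \<psi>. refines V U r \<and> (restr S 0 V r \<mu>, \<psi>) \<in> lifts0 V" using V by blast
qed

lemma Delta1_partial_map: "pointed_partial_map (TC1 S C) (TC1pt S C) (H S A 2) (Hpt S A 2) (Delta1 S A B C \<alpha> \<beta>)"
  unfolding Delta1_graph H_def Hpt_def TC1_def TC1pt_def cls1 clsH by (rule D1.graph_partial)

lemma Delta1_map:
  assumes l: "lifts_exist S B C \<beta>"
  shows "pointed_map (TC1 S C) (TC1pt S C) (H S A 2) (Hpt S A 2) (Delta1 S A B C \<alpha> \<beta>)"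
  unfolding Delta1_graph H_def Hpt_def TC1_def TC1pt_def cls1 clsH
proof (rule D1.graph_total)
  fix U \<phi> assume U: "U \<in> covers S" and \<phi>: "\<phi> \<in> TC1coc S C U"
  obtain V r \<psi> where V: "V \<in> covers S" "refines V U r" and \<psi>: "\<psi> \<in> Coch 1 V B" "post S 1 V \<beta> \<psi> = restr S 1 V r \<phi>"
    using l U \<phi> unfolding lifts_exist_def by blast
  have "(restr S 1 V r \<phi>, corestr 2 V (ob1 S B V \<psi>)) \<in> lifts1 V"
    unfolding lifts1_iff using \<psi> C1.Z_restr[OF U V \<phi>] by metis
  then show "\<exists>V\<in>covers S. \<exists>r \<psi>. refines V U r \<and> (restr S 1 V r \<phi>, \<psi>) \<in> lifts1 V" using V by blast
qed

lemma exact_H0: "{Hpt S A 0} = (alpha0 S A B \<alpha>)\<inverse> `` {TC0pt S B}"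
proof -
  have "c = Hpt S A 0" if ac: "(c, TC0pt S B) \<in> alpha0 S A B \<alpha>" for c
  proof -
    obtain U \<mu> where U: "U \<in> covers S" and \<mu>: "\<mu> \<in> TC0coc S A U" "c = A0.cls U \<mu>" "B0.cls U (post S 0 U \<alpha> \<mu>) = TC0pt S B"
      using ac unfolding alpha0_iff by metis
    note \<mu>K = A0.Z_closed[OF U \<mu>(1)]
    obtain V r where V: "V \<in> covers S" "refines V U r" "restr S 0 V r (post S 0 U \<alpha> \<mu>) = \<one>\<^bsub>K S 0 V B\<^esub>"
      using \<mu>(3) unfolding TC0pt_def cls0 B0.cls_eq_one[OF U post_TC0[OF U gg(1,2) gh(1) \<mu>(1)]] by blast
    have "post S 0 V \<alpha> (restr S 0 V r \<mu>) = post S 0 V \<alpha> \<one>\<^bsub>K S 0 V A\<^esub>"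
      unfolding post_one[OF V(1) gg(1,2) gh(1)] V(3)[symmetric] by (rule rph(1)[OF U V(1,2) \<mu>K, symmetric])
    then have "restr S 0 V r \<mu> = \<one>\<^bsub>K S 0 V A\<^esub>"
      by (rule post_\<alpha>_inj[OF V(1) restr_closed[OF U V(1) lg(1) V(2) \<mu>K] K_one_closed[OF V(1) lg(1)]])
    then show ?thesis
      unfolding Hpt_def clsH \<mu>(2) A0.cls_restr[OF U V(1,2) \<mu>(1), symmetric] using A0.cls_one[OF V(1)] by simp
  qed
  moreover have "(Hpt S A 0, TC0pt S B) \<in> alpha0 S A B \<alpha>"
    using alpha0_map unfolding pointed_map_def pointed_partial_map_def by blast
  ultimately show ?thesis by blast
qed

lemma exact_TC0_B: "exact_at (alpha0 S A B \<alpha>) (beta0 S B C \<beta>) (TC0pt S C)"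
proof (rule exact_atI)
  fix c d assume "(c, d) \<in> alpha0 S A B \<alpha>"
  then obtain U \<mu> where U: "U \<in> covers S" and \<mu>: "\<mu> \<in> TC0coc S A U" "d = B0.cls U (post S 0 U \<alpha> \<mu>)"
    unfolding alpha0_iff by blast
  have "TC0pt S C = C0.cls U (post S 0 U \<beta> (post S 0 U \<alpha> \<mu>))"
    unfolding TC0pt_def cls0 post_\<beta>\<alpha>[OF U A0.Z_closed[OF U \<mu>(1)]] by (rule C0.cls_one[OF U, symmetric])
  then show "(d, TC0pt S C) \<in> beta0 S B C \<beta>"
    unfolding beta0_iff using U \<mu>(2) post_TC0[OF U gg(1,2) gh(1) \<mu>(1)] by blast
next
  fix d assume "(d, TC0pt S C) \<in> beta0 S B C \<beta>"
  then obtain U \<mu> where U: "U \<in> covers S" and \<mu>: "\<mu> \<in> TC0coc S B U" "d = B0.cls U \<mu>" "C0.cls U (post S 0 U \<beta> \<mu>) = TC0pt S C"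
    unfolding beta0_iff by metis
  note \<mu>K = B0.Z_closed[OF U \<mu>(1)]
  obtain V r where V: "V \<in> covers S" "refines V U r" "restr S 0 V r (post S 0 U \<beta> \<mu>) = \<one>\<^bsub>K S 0 V C\<^esub>"
    using \<mu>(3) unfolding TC0pt_def cls0 C0.cls_eq_one[OF U post_TC0[OF U gg(2,3) gh(2) \<mu>(1)]] by blast
  have "post S 0 V \<beta> (restr S 0 V r \<mu>) = \<one>\<^bsub>K S 0 V C\<^esub>"
    unfolding V(3)[symmetric] by (rule rph(2)[OF U V(1,2) \<mu>K, symmetric])
  then obtain \<kappa> where \<kappa>: "\<kappa> \<in> Coch 0 V A" "post S 0 V \<alpha> \<kappa> = restr S 0 V r \<mu>"
    by (rule corestrict_ex[OF V(1) restr_closed[OF U V(1) lg(2) V(2) \<mu>K]])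
  have "\<kappa> \<in> TC0coc S A V"
    by (rule reflect_TC0[OF V(1) \<kappa>(1)]) (unfold \<kappa>(2), rule B0.Z_restr[OF U V(1,2) \<mu>(1)])
  moreover have "d = B0.cls V (post S 0 V \<alpha> \<kappa>)" unfolding \<kappa>(2) \<mu>(2) by (rule B0.cls_restr[OF U V(1,2) \<mu>(1), symmetric])
  ultimately show "\<exists>c. (c, d) \<in> alpha0 S A B \<alpha>" unfolding alpha0_iff using V(1) by blast
qed

text \<open>
  If the coboundary of a lift \<open>\<eta>\<close> is trivial in the cohomology of A, it can be cancelled by multiplying
  \<open>\<eta>\<close> by a cochain of A. The result is a cocycle with the same image in C.
\<close>

lemma exact_TC0_C: "exact_at (beta0 S B C \<beta>) (Delta0 S A B C \<alpha> \<beta>) (Hpt S A 1)"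
proof (rule exact_atI)
  fix c d assume "(c, d) \<in> beta0 S B C \<beta>"
  then obtain U \<mu> where U: "U \<in> covers S" and \<mu>: "\<mu> \<in> TC0coc S B U" "d = C0.cls U (post S 0 U \<beta> \<mu>)"
    unfolding beta0_iff by blast
  have "Hpt S A 1 = A1.cls U (corestr 1 U (ob0 S B U \<mu>))"
    unfolding corestr_ob0_cocycle[OF U \<mu>(1)] Hpt_def clsH by (rule A1.cls_one[OF U, symmetric])
  then show "(d, Hpt S A 1) \<in> Delta0 S A B C \<alpha> \<beta>"
    unfolding Delta0_iff using U \<mu>(2) B0.Z_closed[OF U \<mu>(1)] post_TC0[OF U gg(2,3) gh(2) \<mu>(1)] by blast
next
  fix d assume "(d, Hpt S A 1) \<in> Delta0 S A B C \<alpha> \<beta>"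
  then obtain U \<eta> where U: "U \<in> covers S" and \<eta>: "\<eta> \<in> Coch 0 U B" "post S 0 U \<beta> \<eta> \<in> TC0coc S C U"
    "d = C0.cls U (post S 0 U \<beta> \<eta>)" "A1.cls U (corestr 1 U (ob0 S B U \<eta>)) = Hpt S A 1"
    unfolding Delta0_iff by metis
  obtain V r where V: "V \<in> covers S" "refines V U r" and R: "(restr S 1 V r (corestr 1 U (ob0 S B U \<eta>)), \<one>\<^bsub>K S 1 V A\<^esub>) \<in> TC1rel S A V"
    using \<eta>(4) unfolding Hpt_def clsH A1.cls_eq_one[OF U corestr_ob0(3)[OF U \<eta>(1,2)]] by blast
  note r = restr_corestr_ob0[OF U V \<eta>(1,2)]
  interpret a0: group "K S 0 V A" by (rule K_group(1)[OF V(1) lg(1)])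
  interpret a1: group "K S 1 V A" by (rule K_group(1)[OF V(1) lg(1)])
  have "(\<one>\<^bsub>K S 1 V A\<^esub>, corestr 1 V (ob0 S B V (restr S 0 V r \<eta>))) \<in> TC1rel S A V"
    using A1.R_sym[OF V(1) R] unfolding r(4) .
  then obtain \<kappa> where \<kappa>: "\<kappa> \<in> Coch 0 V A"
    "\<one>\<^bsub>K S 1 V A\<^esub> = corestr 1 V (ob0 S B V (restr S 0 V r \<eta>)) \<otimes>\<^bsub>K S 1 V A\<^esub> ob0 S A V \<kappa>"
    unfolding TC1rel_A_iff[OF V(1)] by blast
  define \<mu> where "\<mu> = restr S 0 V r \<eta> \<otimes>\<^bsub>K S 0 V B\<^esub> post S 0 V \<alpha> \<kappa>"
  note m = corestr_ob0_mult[OF V(1) r(1,3) \<kappa>(1), folded \<mu>_def]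
  have "corestr 1 V (ob0 S B V \<mu>) = \<one>\<^bsub>K S 1 V A\<^esub>" unfolding m(3) by (rule \<kappa>(2)[symmetric])
  then have "ob0 S B V \<mu> = \<one>\<^bsub>K S 1 V B\<^esub>"
    using corestr_ob0(2)[OF V(1) m(1)] r(3) unfolding m(2) by (simp add: post_one[OF V(1) gg(1,2) gh(1)])
  then have "\<mu> \<in> TC0coc S B V" using m(1) by (simp add: TC0coc_def)
  moreover have "d = C0.cls V (post S 0 V \<beta> \<mu>)"
    unfolding m(2) r(2) \<eta>(3) by (rule C0.cls_restr[OF U V \<eta>(2), symmetric])
  ultimately show "\<exists>c. (c, d) \<in> beta0 S B C \<beta>" unfolding beta0_iff using V(1) by blast
qed

text \<open>
  A cocycle of A that is trivial in B is the coboundary of some 0-cochain \<open>\<mu>\<close> of B, and then \<open>\<beta>\<mu>\<close> is a cocycle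
  for which \<open>\<mu>\<close> is a lift.
\<close>

lemma exact_H1: "exact_at (Delta0 S A B C \<alpha> \<beta>) (alpha1 S A B \<alpha>) (TC1pt S B)"
proof (rule exact_atI)
  fix c d assume "(c, d) \<in> Delta0 S A B C \<alpha> \<beta>"
  then obtain U \<eta> where U: "U \<in> covers S" and \<eta>: "\<eta> \<in> Coch 0 U B" "post S 0 U \<beta> \<eta> \<in> TC0coc S C U"
    "d = A1.cls U (corestr 1 U (ob0 S B U \<eta>))"
    unfolding Delta0_iff by blast
  have "B1.cls U (post S 1 U \<alpha> (corestr 1 U (ob0 S B U \<eta>))) = B1.cls U \<one>\<^bsub>K S 1 U B\<^esub>"
    unfolding corestr_ob0(2)[OF U \<eta>(1,2)]
    by (rule B1.cls_R[OF U ob0_cocycle[OF U gg(2) \<eta>(1)] B1.Z_one[OF U] ob0_trivial[OF U gg(2) \<eta>(1)]])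
  also have "\<dots> = TC1pt S B" unfolding TC1pt_def cls1 by (rule B1.cls_one[OF U])
  finally show "(d, TC1pt S B) \<in> alpha1 S A B \<alpha>"
    unfolding alpha1_iff using U \<eta>(3) corestr_ob0(3)[OF U \<eta>(1,2)] by metis
next
  fix d assume "(d, TC1pt S B) \<in> alpha1 S A B \<alpha>"
  then obtain U \<phi> where U: "U \<in> covers S" and \<phi>: "\<phi> \<in> TC1coc S A U" "d = A1.cls U \<phi>" "B1.cls U (post S 1 U \<alpha> \<phi>) = TC1pt S B"
    unfolding alpha1_iff by metis
  note \<phi>K = A1.Z_closed[OF U \<phi>(1)]
  obtain V r where V: "V \<in> covers S" "refines V U r" and R: "(restr S 1 V r (post S 1 U \<alpha> \<phi>), \<one>\<^bsub>K S 1 V B\<^esub>) \<in> TC1rel S B V"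
    using \<phi>(3) unfolding TC1pt_def cls1 B1.cls_eq_one[OF U post_TC1[OF U gg(1,2) gh(1) \<phi>(1)]] by blast
  note \<phi>V = restr_closed[OF U V(1) lg(1) V(2) \<phi>K]
  interpret b1: group "K S 1 V B" by (rule K_group(1)[OF V(1) lg(2)])
  have e: "restr S 1 V r (post S 1 U \<alpha> \<phi>) = post S 1 V \<alpha> (restr S 1 V r \<phi>)" by (rule rph(1)[OF U V \<phi>K])
  obtain \<mu> where \<mu>: "\<mu> \<in> Coch 0 V B"
    "delta S 0 V B 1 \<mu> \<otimes>\<^bsub>K S 1 V B\<^esub> post S 1 V \<alpha> (restr S 1 V r \<phi>) = \<one>\<^bsub>K S 1 V B\<^esub> \<otimes>\<^bsub>K S 1 V B\<^esub> delta S 0 V B 0 \<mu>"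
    using R unfolding e TC1rel_def by blast
  have dc: "delta S 0 V B 1 \<mu> \<in> Coch 1 V B" "delta S 0 V B 0 \<mu> \<in> Coch 1 V B"
    by (rule delta0_closed[OF V(1) gg(2) order_refl \<mu>(1)], rule delta0_closed[OF V(1) gg(2) zero_le \<mu>(1)])
  have ob: "post S 1 V \<alpha> (restr S 1 V r \<phi>) = ob0 S B V \<mu>"
    unfolding ob0_def b1.inv_solve_left[OF post_hom_closed[OF V(1) gg(1,2) gh(1) \<phi>V] dc] using \<mu>(2) b1.l_one[OF dc(2)] by simp
  have "ob0 S C V (post S 0 V \<beta> \<mu>) = \<one>\<^bsub>K S 1 V C\<^esub>"
    unfolding post_ob0[OF V(1) gg(2,3) gh(2) \<mu>(1), symmetric] ob[symmetric] by (rule post_\<beta>\<alpha>[OF V(1) \<phi>V])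
  then have c: "post S 0 V \<beta> \<mu> \<in> TC0coc S C V"
    using post_hom_closed[OF V(1) gg(2,3) gh(2) \<mu>(1)] by (simp add: TC0coc_def)
  have "d = A1.cls V (corestr 1 V (ob0 S B V \<mu>))"
    unfolding corestr_ob0_eqI[OF V(1) \<mu>(1) c \<phi>V ob] \<phi>(2) by (rule A1.cls_restr[OF U V \<phi>(1), symmetric])
  then show "\<exists>c. (c, d) \<in> Delta0 S A B C \<alpha> \<beta>" unfolding Delta0_iff using V(1) \<mu>(1) c by blast
qed

text \<open>
  The gauge transformation that makes \<open>\<beta>\<phi>\<close> trivial lifts to B after refinement; the transformed cocycle
  has values in \<open>\<alpha>(A)\<close>.
\<close>

lemma exact_TC1_B: "exact_at (alpha1 S A B \<alpha>) (beta1 S B C \<beta>) (TC1pt S C)"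
proof (rule exact_atI)
  fix c d assume "(c, d) \<in> alpha1 S A B \<alpha>"
  then obtain U \<phi> where U: "U \<in> covers S" and \<phi>: "\<phi> \<in> TC1coc S A U" "d = B1.cls U (post S 1 U \<alpha> \<phi>)"
    unfolding alpha1_iff by blast
  have "TC1pt S C = C1.cls U (post S 1 U \<beta> (post S 1 U \<alpha> \<phi>))"
    unfolding TC1pt_def cls1 post_\<beta>\<alpha>[OF U A1.Z_closed[OF U \<phi>(1)]] by (rule C1.cls_one[OF U, symmetric])
  then show "(d, TC1pt S C) \<in> beta1 S B C \<beta>"
    unfolding beta1_iff using U \<phi>(2) post_TC1[OF U gg(1,2) gh(1) \<phi>(1)] by blast
next
  fix d assume "(d, TC1pt S C) \<in> beta1 S B C \<beta>"
  then obtain U \<phi> where U: "U \<in> covers S" and \<phi>: "\<phi> \<in> TC1coc S B U" "d = B1.cls U \<phi>" "C1.cls U (post S 1 U \<beta> \<phi>) = TC1pt S C"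
    unfolding beta1_iff by metis
  note \<phi>c = post_TC1[OF U gg(2,3) gh(2) \<phi>(1)]
  obtain V r where V: "V \<in> covers S" "refines V U r" and R: "(restr S 1 V r (post S 1 U \<beta> \<phi>), \<one>\<^bsub>K S 1 V C\<^esub>) \<in> TC1rel S C V"
    using \<phi>(3) unfolding TC1pt_def cls1 C1.cls_eq_one[OF U \<phi>c] by blast
  note \<phi>V = B1.Z_restr[OF U V \<phi>(1)]
  note \<phi>VC = post_TC1[OF V(1) gg(2,3) gh(2) \<phi>V]
  have e: "restr S 1 V r (post S 1 U \<beta> \<phi>) = post S 1 V \<beta> (restr S 1 V r \<phi>)" by (rule rph(2)[OF U V B1.Z_closed[OF U \<phi>(1)]])
  obtain \<nu> where \<nu>: "\<nu> \<in> Coch 0 V C" "\<one>\<^bsub>K S 1 V C\<^esub> = gauge V C \<nu> (post S 1 V \<beta> (restr S 1 V r \<phi>))"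
    using R unfolding e TC1rel_gauge[OF V(1) gg(3)] by blast
  obtain W s \<eta> where W: "W \<in> covers S" "refines W V s" and \<eta>: "\<eta> \<in> Coch 0 W B" "post S 0 W \<beta> \<eta> = restr S 0 W s \<nu>"
    by (rule local_lift[OF V(1) \<nu>(1)])
  define \<phi>' where "\<phi>' = restr S 1 W s (restr S 1 V r \<phi>)"
  have \<phi>': "\<phi>' \<in> TC1coc S B W" unfolding \<phi>'_def by (rule B1.Z_restr[OF V(1) W \<phi>V])
  note \<phi>'K = B1.Z_closed[OF W(1) \<phi>']
  have p: "post S 1 W \<beta> \<phi>' = restr S 1 W s (post S 1 V \<beta> (restr S 1 V r \<phi>))"
    unfolding \<phi>'_def by (rule rph(2)[OF V(1) W B1.Z_closed[OF V(1) \<phi>V], symmetric])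
  have "post S 1 W \<beta> (gauge W B \<eta> \<phi>') = gauge W C (post S 0 W \<beta> \<eta>) (post S 1 W \<beta> \<phi>')"
    by (rule post_gauge[OF W(1) gg(2,3) gh(2) \<eta>(1) \<phi>'K])
  also have "\<dots> = restr S 1 W s (gauge V C \<nu> (post S 1 V \<beta> (restr S 1 V r \<phi>)))"
    unfolding \<eta>(2) p by (rule restr_gauge[OF V(1) W(1) gg(3) W(2) \<nu>(1) C1.Z_closed[OF V(1) \<phi>VC], symmetric])
  also have "\<dots> = \<one>\<^bsub>K S 1 W C\<^esub>" unfolding \<nu>(2)[symmetric] by (rule restr_one[OF V(1) W(1) lg(3) W(2)])
  finally obtain \<kappa> where \<kappa>: "\<kappa> \<in> Coch 1 W A" "post S 1 W \<alpha> \<kappa> = gauge W B \<eta> \<phi>'"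
    by (rule corestrict_ex[OF W(1) gauge_closed[OF W(1) gg(2) \<eta>(1) \<phi>'K]])
  have g: "(\<phi>', gauge W B \<eta> \<phi>') \<in> TC1rel S B W" by (rule gauge_rel[OF W(1) gg(2) \<eta>(1) \<phi>'])
  then have gc: "gauge W B \<eta> \<phi>' \<in> TC1coc S B W" by (simp add: TC1rel_def)
  have \<kappa>c: "\<kappa> \<in> TC1coc S A W" by (rule reflect_TC1[OF W(1) \<kappa>(1)]) (unfold \<kappa>(2), rule gc)
  have "d = B1.cls V (restr S 1 V r \<phi>)" unfolding \<phi>(2) by (rule B1.cls_restr[OF U V \<phi>(1), symmetric])
  also have "\<dots> = B1.cls W \<phi>'" unfolding \<phi>'_def by (rule B1.cls_restr[OF V(1) W \<phi>V, symmetric])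
  also have "\<dots> = B1.cls W (post S 1 W \<alpha> \<kappa>)" unfolding \<kappa>(2) by (rule B1.cls_R[OF W(1) \<phi>' gc g])
  finally show "\<exists>c. (c, d) \<in> alpha1 S A B \<alpha>" unfolding alpha1_iff using W(1) \<kappa>c by blast
qed

text \<open>
  As for \<open>exact_TC0_C\<close>, one degree higher: a lift whose coboundary is trivial in the cohomology of A is
  corrected by a cochain of A.
\<close>

lemma exact_TC1_C: "exact_at (beta1 S B C \<beta>) (Delta1 S A B C \<alpha> \<beta>) (Hpt S A 2)"
proof (rule exact_atI)
  fix c d assume "(c, d) \<in> beta1 S B C \<beta>"
  then obtain U \<phi> where U: "U \<in> covers S" and \<phi>: "\<phi> \<in> TC1coc S B U" "d = C1.cls U (post S 1 U \<beta> \<phi>)"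
    unfolding beta1_iff by blast
  have "Hpt S A 2 = A2.cls U (corestr 2 U (ob1 S B U \<phi>))"
    unfolding corestr_ob1_cocycle[OF U \<phi>(1)] Hpt_def clsH by (rule A2.cls_one[OF U, symmetric])
  then show "(d, Hpt S A 2) \<in> Delta1 S A B C \<alpha> \<beta>"
    unfolding Delta1_iff using U \<phi>(2) B1.Z_closed[OF U \<phi>(1)] post_TC1[OF U gg(2,3) gh(2) \<phi>(1)] by blast
next
  fix d assume "(d, Hpt S A 2) \<in> Delta1 S A B C \<alpha> \<beta>"
  then obtain U \<psi> where U: "U \<in> covers S" and \<psi>: "\<psi> \<in> Coch 1 U B" "post S 1 U \<beta> \<psi> \<in> TC1coc S C U"
    "d = C1.cls U (post S 1 U \<beta> \<psi>)" "A2.cls U (corestr 2 U (ob1 S B U \<psi>)) = Hpt S A 2"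
    unfolding Delta1_iff by metis
  obtain V r where V: "V \<in> covers S" "refines V U r" and R: "(restr S 2 V r (corestr 2 U (ob1 S B U \<psi>)), \<one>\<^bsub>K S 2 V A\<^esub>) \<in> Hrel S A 2 V"
    using \<psi>(4) unfolding Hpt_def clsH A2.cls_eq_one[OF U corestr_ob1(3)[OF U \<psi>(1,2)]] by blast
  note r = restr_corestr_ob1[OF U V \<psi>(1,2)]
  have "(\<one>\<^bsub>K S 2 V A\<^esub>, corestr 2 V (ob1 S B V (restr S 1 V r \<psi>))) \<in> Hrel S A 2 V"
    using A2.R_sym[OF V(1) R] unfolding r(4) .
  then obtain \<kappa> where \<kappa>: "\<kappa> \<in> Coch 1 V A"
    "\<one>\<^bsub>K S 2 V A\<^esub> = corestr 2 V (ob1 S B V (restr S 1 V r \<psi>)) \<otimes>\<^bsub>K S 2 V A\<^esub> ob1 S A V \<kappa>"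
    unfolding Hrel2_iff[OF gg(1) comm_A V(1)] by blast
  define \<phi> where "\<phi> = restr S 1 V r \<psi> \<otimes>\<^bsub>K S 1 V B\<^esub> post S 1 V \<alpha> \<kappa>"
  note m = corestr_ob1_mult[OF V(1) r(1,3) \<kappa>(1), folded \<phi>_def]
  have "corestr 2 V (ob1 S B V \<phi>) = \<one>\<^bsub>K S 2 V A\<^esub>" unfolding m(3) by (rule \<kappa>(2)[symmetric])
  then have "ob1 S B V \<phi> = \<one>\<^bsub>K S 2 V B\<^esub>"
    using corestr_ob1(2)[OF V(1) m(1)] r(3) unfolding m(2) by (simp add: post_one[OF V(1) gg(1,2) gh(1)])
  then have "\<phi> \<in> TC1coc S B V" using m(1) by (simp add: TC1coc_def)
  moreover have "d = C1.cls V (post S 1 V \<beta> \<phi>)"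
    unfolding m(2) r(2) \<psi>(3) by (rule C1.cls_restr[OF U V \<psi>(2), symmetric])
  ultimately show "\<exists>c. (c, d) \<in> beta1 S B C \<beta>" unfolding beta1_iff using V(1) by blast
qed

end

theorem mainTheorem2:
  fixes S :: "('g, 'x) gspace"
    and A :: "('g, 'a) ggroup" and B :: "('g, 'b) ggroup" and C :: "('g, 'c) ggroup"
    and \<alpha> :: "'a \<Rightarrow> 'b" and \<beta> :: "'b \<Rightarrow> 'c"
  assumes space: "smooth_gspace S"
    and exact: "gamma_short_exact (Grp S) A B C \<alpha> \<beta>"
    and central: "\<forall>a\<in>carrier A. \<forall>b\<in>carrier B. \<alpha> a \<otimes>\<^bsub>B\<^esub> b = b \<otimes>\<^bsub>B\<^esub> \<alpha> a"
  shows "pointed_map (H S A 0) (Hpt S A 0) (TC0 S B) (TC0pt S B) (alpha0 S A B \<alpha>)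
       \<and> pointed_map (TC0 S B) (TC0pt S B) (TC0 S C) (TC0pt S C) (beta0 S B C \<beta>)
       \<and> pointed_map (TC0 S C) (TC0pt S C) (H S A 1) (Hpt S A 1) (Delta0 S A B C \<alpha> \<beta>)
       \<and> pointed_map (H S A 1) (Hpt S A 1) (TC1 S B) (TC1pt S B) (alpha1 S A B \<alpha>)
       \<and> pointed_map (TC1 S B) (TC1pt S B) (TC1 S C) (TC1pt S C) (beta1 S B C \<beta>)
       \<and> pointed_partial_map (TC1 S C) (TC1pt S C) (H S A 2) (Hpt S A 2) (Delta1 S A B C \<alpha> \<beta>)
       \<and> (lifts_exist S B C \<beta> \<longrightarrow>
            pointed_map (TC1 S C) (TC1pt S C) (H S A 2) (Hpt S A 2) (Delta1 S A B C \<alpha> \<beta>))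
       \<and> {Hpt S A 0} = (alpha0 S A B \<alpha>)\<inverse> `` {TC0pt S B}
       \<and> exact_at (alpha0 S A B \<alpha>) (beta0 S B C \<beta>) (TC0pt S C)
       \<and> exact_at (beta0 S B C \<beta>) (Delta0 S A B C \<alpha> \<beta>) (Hpt S A 1)
       \<and> exact_at (Delta0 S A B C \<alpha> \<beta>) (alpha1 S A B \<alpha>) (TC1pt S B)
       \<and> exact_at (alpha1 S A B \<alpha>) (beta1 S B C \<beta>) (TC1pt S C)
       \<and> exact_at (beta1 S B C \<beta>) (Delta1 S A B C \<alpha> \<beta>) (Hpt S A 2)"
proof -
  interpret central_ext S A B C \<alpha> \<beta>
    by (unfold_locales) (rule space, rule exact, rule central)
  show ?thesis
    by (intro conjI impI alpha0_map beta0_map[OF gg(2,3) gh(2)] Delta0_map alpha1_map beta1_map[OF gg(2,3) gh(2)]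
        Delta1_partial_map Delta1_map exact_H0 exact_TC0_B exact_TC0_C exact_H1 exact_TC1_B exact_TC1_C)
qed

end
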